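(* Let $K$ be a $d$-dimensional simplicial complex. Then $\vartheta(K)\neq 0$ if and only if $\vartheta([3]*K)\neq 0$, where $\vartheta$ denotes the van Kampen obstruction class.
   Context: $[3]*K$ is the simplicial join of $K$ with a set $[3]$ of three points (vertices not in $K$); it has dimension $d+1$. Deleted product: for a simplicial complex $L$, $\Delta(L)=\{\sigma_1\times\sigma_2\in L\times L : \sigma_1\cap\sigma_2=\emptyset\}$ is the cell complex whose cells are products of vertex-disjoint (non-empty) simplices of $L$, oriented as products of fixed orientations of simplices of $L$. The involution $\tau(\sigma_1\times\sigma_2)=\sigma_2\times\sigma_1$ induces the chain map $\tau_\sharp(\sigma_1\times\sigma_2)=(-1)^{\dim\sigma_1\dim\sigma_2}\sigma_2\times\sigma_1$, with dual $\tau^\sharp$ on integer cochains. Let $C^i_\delta(\Delta(L))=\ker(1-\tau^\sharp)\subset C^i(\Delta(L))$ be the invariant integer cochains; $H^i_\delta(\Delta(L))$ is the cohomology of the cochain complex $C^*_\delta(\Delta(L))$. Van Kampen obstruction: for a $k$-dimensional simplicial complex $L$ and a piecewise linear map $f:L\to\mathbb{R}^{2k}$ in general position, define the cochain $\vartheta_f^{2k}(\sigma\times\sigma')=(-1)^{k}\,\mathcal{X}(f(\sigma),f(\sigma'))$ for disjoint $k$-simplices $\sigma,\sigma'$, where $\mathcal{X}$ is the algebraic intersection number in $\mathbb{R}^{2k}$. This is a cocycle in $C^{2k}_\delta(\Delta(L))$ whose class $\vartheta(L)=\vartheta^{2k}(L)=[\vartheta_f^{2k}]\in H^{2k}_\delta(\Delta(L))$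 does not depend on $f$; it is the van Kampen obstruction of $L$. Thus $\vartheta(K)=\vartheta^{2d}(K)$ and $\vartheta([3]*K)=\vartheta^{2d+2}([3]*K)$. Equivalently (a known theorem of Wu), $\vartheta(L)$ is the special Smith class $A^{2k}(\Delta(L),\tau)$, obtained as follows: with $C^i_s=\ker(1+\tau^\sharp)$ and $H^i_s$ its cohomology, let $\mu_\delta^i:H^{i-1}_\delta\to H^i_s$ be $[\phi]\mapsto[\delta\psi]$ with $(1+\tau^\sharp)\psi=\phi$, and $\mu_s^i:H^{i-1}_s\to H^i_\delta$ be $[\phi]\mapsto[\delta\psi]$ with $(1-\tau^\sharp)\psi=\phi$; then $A^{2k}=\mu_s^{2k}\mu_\delta^{2k-1}\cdots\mu_s^2\mu_\delta^1(\mathbf 1)$, where $\mathbf 1\in H^0_\delta$ is the class of the constant cocycle $1$.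
   Formalization: Proved for finite simplicial complexes of dimension d ≥ 1. For d = 0 the statement fails: if K is two points, then ϑ(K) is the class of the constant 1 and is nonzero, while [3]*K = K_{3,2} is planar, so ϑ([3]*K) = 0. *)

theory Defs
  imports
    "HOL-Analysis.Analysis"
    "HOL-Algebra.Coset"
    "Jordan_Normal_Form.Determinant"
begin

text \<open>
  The dollar sign denotes components of vectors in \<open>real ^ 'a\<close>; the target spaces, whose
  dimension is a term, are the sets \<open>carrier_vec n\<close> of the type \<open>real vec\<close>.
\<close>

no_notation vec_index (infixl "$" 100)


subsection \<open>Simplicial complexes and joins\<close>

text \<open>Simplices are nonempty finite vertex sets; the empty simplex is not a member.\<close>

definition abstract_complex :: "'a set set \<Rightarrow> bool" where
  "abstract_complex L \<longleftrightarrow> finite L \<and> (\<forall>\<sigma>\<in>L. finite \<sigma> \<and> \<sigma> \<noteq> {}) \<and>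
     (\<forall>\<sigma>\<in>L. \<forall>\<rho>. \<rho> \<noteq> {} \<and> \<rho> \<subseteq> \<sigma> \<longrightarrow> \<rho> \<in> L)"

definition simplex_dim :: "'a set \<Rightarrow> nat" where
  "simplex_dim \<sigma> = card \<sigma> - 1"

definition has_dimension :: "'a set set \<Rightarrow> nat \<Rightarrow> bool" where
  "has_dimension L k \<longleftrightarrow> (\<forall>\<sigma>\<in>L. simplex_dim \<sigma> \<le> k) \<and> (\<exists>\<sigma>\<in>L. simplex_dim \<sigma> = k)"

definition simplicial_join :: "'a set set \<Rightarrow> 'b set set \<Rightarrow> ('a + 'b) set set" where
  "simplicial_join L M = {A <+> B | A B. A \<in> insert {} L \<and> B \<in> insert {} M} - {{}}"

definition three_points :: "3 set set" where
  "three_points = range (\<lambda>i. {i})"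


subsection \<open>Orientations\<close>

text \<open>An orientation of a simplex is given by an ordering of its vertices.\<close>

definition orientation :: "'a set set \<Rightarrow> ('a set \<Rightarrow> 'a list) \<Rightarrow> bool" where
  "orientation L ori \<longleftrightarrow> (\<forall>\<sigma>\<in>L. distinct (ori \<sigma>) \<and> set (ori \<sigma>) = \<sigma>)"

definition reorder_sign :: "'a list \<Rightarrow> 'a list \<Rightarrow> int" where
  "reorder_sign xs ys = sign (THE p. p permutes set xs \<and> map p xs = ys)"

text \<open>
  The coefficient of the facet opposite to \<open>v\<close> in the boundary of \<open>\<sigma>\<close>. Moving the \<open>i\<close>-th vertex
  to the front costs \<open>(-1) ^ i\<close>, so this is the usual \<open>(-1) ^ i\<close> when the facet carries the
  ordering induced from \<open>\<sigma>\<close>.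
\<close>

definition incidence :: "('a set \<Rightarrow> 'a list) \<Rightarrow> 'a set \<Rightarrow> 'a \<Rightarrow> int" where
  "incidence ori \<sigma> v = reorder_sign (v # ori (\<sigma> - {v})) (ori \<sigma>)"


subsection \<open>Invariant cohomology of the deleted product\<close>

definition deleted_cells :: "'a set set \<Rightarrow> nat \<Rightarrow> ('a set \<times> 'a set) set" where
  "deleted_cells L i =
     {(\<sigma>, \<tau>). \<sigma> \<in> L \<and> \<tau> \<in> L \<and> \<sigma> \<inter> \<tau> = {} \<and> simplex_dim \<sigma> + simplex_dim \<tau> = i}"

type_synonym 'a cochain = "'a set \<times> 'a set \<Rightarrow> int"

definition cochains :: "'a set set \<Rightarrow> nat \<Rightarrow> 'a cochain set" where
  "cochains L i = {c. \<forall>e. e \<notin> deleted_cells L i \<longrightarrow> c e = 0}"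

text \<open>
  The coboundary of an \<open>i\<close>-cochain, dual to
  \<open>\<partial>(\<sigma> \<times> \<tau>) = \<partial>\<sigma> \<times> \<tau> + (-1) ^ dim \<sigma> (\<sigma> \<times> \<partial>\<tau>)\<close>.
  When \<open>\<sigma>\<close> or \<open>\<tau>\<close> is a vertex, the terms involving the empty set vanish, because cochains are
  zero outside the cells.
\<close>

definition coboundary ::
    "'a set set \<Rightarrow> ('a set \<Rightarrow> 'a list) \<Rightarrow> nat \<Rightarrow> 'a cochain \<Rightarrow> 'a cochain" where
  "coboundary L ori i c = (\<lambda>(\<sigma>, \<tau>). if (\<sigma>, \<tau>) \<in> deleted_cells L (Suc i) then
       (\<Sum>v\<in>\<sigma>. incidence ori \<sigma> v * c (\<sigma> - {v}, \<tau>))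
       + (- 1) ^ simplex_dim \<sigma> * (\<Sum>w\<in>\<tau>. incidence ori \<tau> w * c (\<sigma>, \<tau> - {w}))
     else 0)"

definition swap_cochain :: "'a cochain \<Rightarrow> 'a cochain" where
  "swap_cochain c = (\<lambda>(\<sigma>, \<tau>). (- 1) ^ (simplex_dim \<sigma> * simplex_dim \<tau>) * c (\<tau>, \<sigma>))"

definition invariant_cochains :: "'a set set \<Rightarrow> nat \<Rightarrow> 'a cochain set" where
  "invariant_cochains L i = {c \<in> cochains L i. swap_cochain c = c}"

definition invariant_cocycle_group ::
    "'a set set \<Rightarrow> ('a set \<Rightarrow> 'a list) \<Rightarrow> nat \<Rightarrow> 'a cochain monoid" where
  "invariant_cocycle_group L ori i =
     \<lparr>carrier = {c \<in> invariant_cochains L i. coboundary L ori i c = (\<lambda>e. 0)},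
      mult = (\<lambda>b c e. b e + c e), one = (\<lambda>e. 0)\<rparr>"

definition invariant_coboundaries ::
    "'a set set \<Rightarrow> ('a set \<Rightarrow> 'a list) \<Rightarrow> nat \<Rightarrow> 'a cochain set" where
  "invariant_coboundaries L ori i =
     (if i = 0 then {\<lambda>e. 0} else coboundary L ori (i - 1) ` invariant_cochains L (i - 1))"

definition invariant_cohomology ::
    "'a set set \<Rightarrow> ('a set \<Rightarrow> 'a list) \<Rightarrow> nat \<Rightarrow> 'a cochain set monoid" where
  "invariant_cohomology L ori i =
     invariant_cocycle_group L ori i Mod invariant_coboundaries L ori i"

definition cohomology_class ::
    "'a set set \<Rightarrow> ('a set \<Rightarrow> 'a list) \<Rightarrow> nat \<Rightarrow> 'a cochain \<Rightarrow> 'a cochain set" where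
  "cohomology_class L ori i c =
     invariant_coboundaries L ori i #>\<^bsub>invariant_cocycle_group L ori i\<^esub> c"


subsection \<open>Piecewise linear maps in general position\<close>

definition realization :: "'a::finite set \<Rightarrow> (real ^ 'a) set" where
  "realization \<sigma> = convex hull ((\<lambda>v. axis v 1) ` \<sigma>)"

definition polyhedron_of :: "'a::finite set set \<Rightarrow> (real ^ 'a) set" where
  "polyhedron_of L = (\<Union>\<sigma>\<in>L. realization \<sigma>)"

definition subdivision_of :: "(real ^ 'a::finite) set set \<Rightarrow> 'a set set \<Rightarrow> bool" where
  "subdivision_of T L \<longleftrightarrow> simplicial_complex T \<and> \<Union> T = polyhedron_of L \<and>
     (\<forall>\<alpha>\<in>T. \<exists>\<sigma>\<in>L. \<alpha> \<subseteq> realization \<sigma>)"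

definition affine_map_on :: "(real ^ 'a::finite) set \<Rightarrow> (real ^ 'a \<Rightarrow> real vec) \<Rightarrow> bool" where
  "affine_map_on \<alpha> f \<longleftrightarrow> (\<forall>x\<in>\<alpha>. \<forall>y\<in>\<alpha>. \<forall>t\<in>{0..1}.
     f ((1 - t) *\<^sub>R x + t *\<^sub>R y) = (1 - t) \<cdot>\<^sub>v f x + t \<cdot>\<^sub>v f y)"

definition simplex_vertices :: "(real ^ 'a::finite) set \<Rightarrow> (real ^ 'a) set" where
  "simplex_vertices \<alpha> = {x. x extreme_point_of \<alpha>}"

text \<open>
  The family of points \<open>f v\<close> in \<open>n\<close>-space, indexed by \<open>v \<in> V\<close>, is in general position: every
  subfamily of at most \<open>n + 1\<close> members is affinely independent (in particular \<open>f\<close> is injective on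
  \<open>V\<close> when \<open>n > 0\<close>).
\<close>

definition general_position :: "nat \<Rightarrow> 'p set \<Rightarrow> ('p \<Rightarrow> real vec) \<Rightarrow> bool" where
  "general_position n V f \<longleftrightarrow>
     (\<forall>S. finite S \<and> S \<subseteq> V \<and> card S \<le> n + 1 \<longrightarrow>
       (\<forall>c. (\<Sum>v\<in>S. c v) = 0 \<and> (\<forall>i<n. (\<Sum>v\<in>S. c v * vec_index (f v) i) = 0) \<longrightarrow>
          (\<forall>v\<in>S. c v = 0)))"

text \<open>
  A piecewise linear map of (the polyhedron of) \<open>L\<close> to \<open>n\<close>-space in general position: it is affine
  on the simplices of some subdivision \<open>T\<close> of \<open>L\<close> (kept as part of the data), whose vertices have
  images in general position.
\<close>

definition pl_general_position ::
    "nat \<Rightarrow> 'a::finite set set \<Rightarrow> (real ^ 'a) set set \<Rightarrow> (real ^ 'a \<Rightarrow> real vec) \<Rightarrow> bool" where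
  "pl_general_position n L T f \<longleftrightarrow>
     subdivision_of T L \<and> f ` polyhedron_of L \<subseteq> carrier_vec n \<and>
     (\<forall>\<alpha>\<in>T. affine_map_on \<alpha> f) \<and>
     general_position n (\<Union>\<alpha>\<in>T. simplex_vertices \<alpha>) f"


subsection \<open>Algebraic intersection numbers\<close>

text \<open>
  The list \<open>as\<close> enumerates the vertices of a simplex \<open>\<alpha>\<close> contained in the realization of the
  simplex ordered by \<open>vs\<close>, and defines the same orientation: the matrix of barycentric coordinates
  of the points \<open>as\<close> with respect to \<open>vs\<close> has positive determinant.
\<close>

definition positive_ordering ::
    "'a::finite list \<Rightarrow> (real ^ 'a) set \<Rightarrow> (real ^ 'a) list \<Rightarrow> bool" where
  "positive_ordering vs \<alpha> as \<longleftrightarrow>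
     distinct as \<and> set as = simplex_vertices \<alpha> \<and> length as = length vs \<and>
     Determinant.det (Matrix.mat (length vs) (length vs) (\<lambda>(i, j). (as ! i) $ (vs ! j))) > 0"

definition edge_vectors :: "(real ^ 'a::finite \<Rightarrow> real vec) \<Rightarrow> (real ^ 'a) list \<Rightarrow> real vec list" where
  "edge_vectors f as = map (\<lambda>a. f a - f (hd as)) (tl as)"

text \<open>
  The sign of the crossing of \<open>f \<alpha>\<close> and \<open>f \<beta>\<close>, for \<open>k\<close>-simplices \<open>\<alpha>\<close>, \<open>\<beta>\<close> of the subdivision that lie
  in the simplices \<open>\<sigma>\<close>, \<open>\<sigma>'\<close> of the complex: a positive frame of \<open>f \<alpha>\<close> followed by a positive frame
  of \<open>f \<beta>\<close> is compared with the standard orientation of \<open>2k\<close>-space.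
\<close>

definition crossing_sign ::
    "nat \<Rightarrow> ('a::finite set \<Rightarrow> 'a list) \<Rightarrow> (real ^ 'a \<Rightarrow> real vec) \<Rightarrow> 'a set \<Rightarrow> 'a set \<Rightarrow>
     (real ^ 'a) set \<Rightarrow> (real ^ 'a) set \<Rightarrow> real \<Rightarrow> bool" where
  "crossing_sign k ori f \<sigma> \<sigma>' \<alpha> \<beta> s \<longleftrightarrow>
     (\<exists>as bs. positive_ordering (ori \<sigma>) \<alpha> as \<and> positive_ordering (ori \<sigma>') \<beta> bs \<and>
        sgn (Determinant.det (mat_of_cols (2 * k) (edge_vectors f as @ edge_vectors f bs))) = s)"

text \<open>
  By general position, the images of the simplices of \<open>T\<close> in two disjoint \<open>k\<close>-simplices of \<open>L\<close> meet
  only when both have dimension \<open>k\<close>, and then in a single interior point. Hence the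
  intersection points of \<open>f \<sigma>\<close> and \<open>f \<sigma>'\<close> correspond to the crossing pairs below.
\<close>

definition crossings ::
    "nat \<Rightarrow> (real ^ 'a::finite) set set \<Rightarrow> (real ^ 'a \<Rightarrow> real vec) \<Rightarrow> 'a set \<Rightarrow> 'a set \<Rightarrow>
     ((real ^ 'a) set \<times> (real ^ 'a) set) set" where
  "crossings k T f \<sigma> \<sigma>' = {(\<alpha>, \<beta>). \<alpha> \<in> T \<and> \<beta> \<in> T \<and> int k simplex \<alpha> \<and> int k simplex \<beta> \<and>
     \<alpha> \<subseteq> realization \<sigma> \<and> \<beta> \<subseteq> realization \<sigma>' \<and> f ` \<alpha> \<inter> f ` \<beta> \<noteq> {}}"

definition intersection_number ::
    "nat \<Rightarrow> ('a::finite set \<Rightarrow> 'a list) \<Rightarrow> (real ^ 'a) set set \<Rightarrow> (real ^ 'a \<Rightarrow> real vec) \<Rightarrow>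
     'a set \<Rightarrow> 'a set \<Rightarrow> int" where
  "intersection_number k ori T f \<sigma> \<sigma>' =
     int (card {(\<alpha>, \<beta>) \<in> crossings k T f \<sigma> \<sigma>'. crossing_sign k ori f \<sigma> \<sigma>' \<alpha> \<beta> 1})
     - int (card {(\<alpha>, \<beta>) \<in> crossings k T f \<sigma> \<sigma>'. crossing_sign k ori f \<sigma> \<sigma>' \<alpha> \<beta> (- 1)})"


subsection \<open>The van Kampen obstruction\<close>

text \<open>Here \<open>k\<close> is the dimension of \<open>L\<close>, so that in a \<open>2k\<close>-cell both factors are \<open>k\<close>-simplices.\<close>

definition van_kampen_cochain ::
    "nat \<Rightarrow> 'a::finite set set \<Rightarrow> ('a set \<Rightarrow> 'a list) \<Rightarrow>
     (real ^ 'a) set set \<Rightarrow> (real ^ 'a \<Rightarrow> real vec) \<Rightarrow> 'a cochain" where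
  "van_kampen_cochain k L ori T f = (\<lambda>(\<sigma>, \<sigma>'). if (\<sigma>, \<sigma>') \<in> deleted_cells L (2 * k)
     then (- 1) ^ k * intersection_number k ori T f \<sigma> \<sigma>' else 0)"

definition van_kampen_obstruction ::
    "nat \<Rightarrow> 'a::finite set set \<Rightarrow> ('a set \<Rightarrow> 'a list) \<Rightarrow> 'a cochain set" where
  "van_kampen_obstruction k L ori =
     (THE c. \<exists>T f. pl_general_position (2 * k) L T f \<and>
        c = cohomology_class L ori (2 * k) (van_kampen_cochain k L ori T f))"

end

theory Submission
  imports Defs
begin

text \<open>
  Let \<open>f\<close> be a map to \<open>\<real>\<^sup>N\<close>, linear on the simplices of a subdivision. After a unitriangular
  change of coordinates, which does not affect the intersection numbers, the first \<open>j\<close> coordinates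
  of \<open>f\<close> are generic for every \<open>j\<close>. Let \<open>X\<^sub>j\<close> count with signs the pairs of points of two disjoint
  simplices whose first \<open>j\<close> coordinates agree, and let \<open>U\<^sub>j\<close> count only those pairs at which the next
  coordinate of the first point is on a given side of that of the second one. Then
  \<open>X\<^sub>j = U\<^sub>j \<plusminus> \<tau>\<^sup>\<sharp> U\<^sub>j\<close>, and \<open>\<delta> U\<^sub>j = X\<^sub>j\<^sub>+\<^sub>1\<close>, because the pairs counted by
  \<open>X\<^sub>j\<close> on a cell of dimension \<open>j + 1\<close> form segments, and \<open>X\<^sub>j\<^sub>+\<^sub>1\<close> counts the zeros of the next
  coordinate difference on them. Hence the sequence \<open>X\<close> represents the iterated Smith classes of the
  constant cocycle, and the van Kampen obstruction is the last one of these (Wu).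

  The Smith classes can also be computed by halving cochains along an order of the simplices. The
  deleted join of the three points is a hexagon, and integration over it commutes with the
  coboundary in high degrees, is onto, and shifts the Smith sequence of \<open>[3] * K\<close> down by two
  degrees to that of \<open>K\<close>. So if the obstruction of the join vanishes, so does that of \<open>K\<close>.
  Conversely, a cochain of top degree whose integral vanishes is a coboundary.
\<close>

section \<open>Signs of reorderings\<close>

text \<open>The Smith homomorphisms are never formed as maps of cohomology groups. They are handled
  as sequences of cochains, and one uniqueness statement, \<open>smith_sequence_unique\<close>,
  serves twice: it compares every geometric sequence with the one obtained by halving, which also
  shows that the class does not depend on the map, and it compares the integrated sequence of the
  join with that of \<open>K\<close>.

  As \<open>f\<close> is affine only on a subdivision, the geometric cochains are signed sums over
  pairs of top-dimensional simplices of the subdivision. Their coboundary formula needs the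
  contributions of interior facets to cancel in pairs; hence the study of subdivided simplices as
  pseudomanifolds.

  Integration over the hexagon sees only pairs of cones, so cells with one of the three points as a
  factor obstruct its commuting with the coboundary. Two facts remove them: the halving prefers the
  cell whose first factor has more vertices, which makes the Smith cochains vanish on such cells
  from degree two on, and for \<open>d \<ge> 1\<close> there are no such cells in degree
  \<open>2 * d + 1\<close>.\<close>

lemma reorder_perm_exists:
  assumes "distinct xs" "distinct ys" "set xs = set ys"
  shows "\<exists>p. p permutes set xs \<and> map p xs = ys"
proof -
  have len: "length xs = length ys" using assms by (metis distinct_card)
  define p where "p = (\<lambda>x. if x \<in> set xs then the (map_of (zip xs ys) x) else x)"
  have m: "map p xs = ys"
    by (rule nth_equalityI) (use assms len in \<open>auto simp: p_def map_of_zip_nth\<close>)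
  have "p ` set xs = set xs" using m assms(3) by (metis set_map)
  hence "bij_betw p (set xs) (set xs)" by (simp add: bij_betw_def eq_card_imp_inj_on)
  hence "p permutes set xs" by (rule bij_imp_permutes) (simp add: p_def)
  with m show ?thesis by blast
qed

lemma reorder_signI:
  assumes "distinct xs" "p permutes set xs" "map p xs = ys"
  shows "reorder_sign xs ys = sign p"
proof -
  have "(THE q. q permutes set xs \<and> map q xs = ys) = p"
  proof (rule the_equality)
    fix q assume q: "q permutes set xs \<and> map q xs = ys"
    show "q = p"
    proof
      fix x show "q x = p x"
        using q assms by (cases "x \<in> set xs") (auto simp: permutes_not_in)
    qed
  qed (use assms in auto)
  thus ?thesis by (simp add: reorder_sign_def)
qed

definition same_elems :: "'a list \<Rightarrow> 'a list \<Rightarrow> bool" where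
  "same_elems xs ys \<longleftrightarrow> distinct xs \<and> distinct ys \<and> set xs = set ys"

lemma same_elems_sym: "same_elems xs ys \<Longrightarrow> same_elems ys xs"
  by (auto simp: same_elems_def)

lemma reorder_signE:
  assumes "same_elems xs ys"
  obtains p where "p permutes set xs" "map p xs = ys" "reorder_sign xs ys = sign p"
  using assms reorder_perm_exists reorder_signI unfolding same_elems_def by metis

lemma reorder_sign_refl [simp]: "distinct xs \<Longrightarrow> reorder_sign xs xs = 1"
  using reorder_signI[of xs id xs] by (simp add: permutes_id)

lemma reorder_sign_trans:
  assumes "same_elems xs ys" "same_elems ys zs"
  shows "reorder_sign xs ys * reorder_sign ys zs = reorder_sign xs zs"
proof -
  obtain p where p: "p permutes set xs" "map p xs = ys" "reorder_sign xs ys = sign p"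
    using reorder_signE[OF assms(1)] .
  obtain q where q: "q permutes set ys" "map q ys = zs" "reorder_sign ys zs = sign q"
    using reorder_signE[OF assms(2)] .
  have q': "q permutes set xs" using q(1) assms by (simp add: same_elems_def)
  have "reorder_sign xs zs = sign (q \<circ> p)"
    using permutes_compose[OF p(1) q'] p q assms
    by (intro reorder_signI) (auto simp: same_elems_def simp flip: map_map)
  also have "\<dots> = sign q * sign p"
    using p(1) q' by (intro sign_compose) (auto intro: permutes_imp_permutation[of "set xs"])
  finally show ?thesis using p q by simp
qed

lemma reorder_sign_square:
  assumes "same_elems xs ys"
  shows "reorder_sign xs ys * reorder_sign xs ys = 1"
  using reorder_signE[OF assms] by (metis sign_idempotent)

lemma reorder_sign_cases:
  assumes "same_elems xs ys"
  shows "reorder_sign xs ys = 1 \<or> reorder_sign xs ys = - 1"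
  using reorder_signE[OF assms] by (metis sign_cases)

lemma reorder_sign_commute:
  assumes "same_elems xs ys"
  shows "reorder_sign ys xs = reorder_sign xs ys"
proof -
  have "reorder_sign xs ys * reorder_sign ys xs = 1"
    using reorder_sign_trans[OF assms same_elems_sym[OF assms]] assms
    by (simp add: same_elems_def)
  thus ?thesis using reorder_sign_cases[OF assms] by auto
qed

lemma reorder_sign_append:
  assumes "same_elems xs ys" "distinct (us @ xs @ ws)"
  shows "reorder_sign (us @ xs @ ws) (us @ ys @ ws) = reorder_sign xs ys"
proof -
  obtain p where p: "p permutes set xs" "map p xs = ys" "reorder_sign xs ys = sign p"
    using reorder_signE[OF assms(1)] .
  have "map p us = us" "map p ws = ws"
    by (rule map_idI; use assms(2) permutes_not_in[OF p(1)] in auto)+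
  moreover have "p permutes set (us @ xs @ ws)"
    using p(1) by (rule permutes_subset) auto
  ultimately have "reorder_sign (us @ xs @ ws) (us @ ys @ ws) = sign p"
    using p assms(2) by (intro reorder_signI) auto
  thus ?thesis using p by simp
qed

lemma reorder_sign_Cons:
  assumes "same_elems xs ys" "v \<notin> set xs"
  shows "reorder_sign (v # xs) (v # ys) = reorder_sign xs ys"
  using reorder_sign_append[of xs ys "[v]" "[]"] assms by (simp add: same_elems_def)

lemma reorder_sign_append2:
  assumes "same_elems xs ys" "same_elems xs' ys'" "set xs \<inter> set xs' = {}"
  shows "reorder_sign (xs @ xs') (ys @ ys') = reorder_sign xs ys * reorder_sign xs' ys'"
proof -
  have "reorder_sign (xs @ xs') (ys @ xs') = reorder_sign xs ys"
    using reorder_sign_append[of xs ys "[]" xs'] assms by (simp add: same_elems_def)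
  moreover have "reorder_sign (ys @ xs') (ys @ ys') = reorder_sign xs' ys'"
    using reorder_sign_append[of xs' ys' ys "[]"] assms by (simp add: same_elems_def)
  ultimately show ?thesis
    using reorder_sign_trans[of "xs @ xs'" "ys @ xs'" "ys @ ys'"] assms
    by (auto simp: same_elems_def)
qed

lemma reorder_sign_swap:
  assumes "distinct (v # w # xs)"
  shows "reorder_sign (v # w # xs) (w # v # xs) = - 1"
proof -
  have "map (Transposition.transpose v w) xs = xs"
    by (rule map_idI) (use assms in \<open>auto simp: Transposition.transpose_def\<close>)
  hence "map (Transposition.transpose v w) (v # w # xs) = w # v # xs"
    by simp
  moreover have "Transposition.transpose v w permutes set (v # w # xs)"
    by (rule permutes_swap_id) auto
  ultimately show ?thesis
    using reorder_signI[OF assms] assms by (simp add: sign_swap_id)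
qed

lemma reorder_sign_map:
  assumes "same_elems xs ys" "inj_on g (set xs)"
  shows "reorder_sign (map g xs) (map g ys) = reorder_sign xs ys"
proof -
  obtain p where p: "p permutes set xs" "map p xs = ys" "reorder_sign xs ys = sign p"
    using reorder_signE[OF assms(1)] .
  let ?q = "map_permutation (set xs) g p"
  have q: "?q permutes g ` set xs"
    using p(1) assms(2) by (intro map_permutation_permutes) (auto simp: bij_betw_def)
  have "map ?q (map g xs) = map g ys"
    using p(2) assms(2) by (auto simp: map_permutation_apply p(2)[symmetric])
  hence "reorder_sign (map g xs) (map g ys) = sign ?q"
    using q assms by (intro reorder_signI) (auto simp: same_elems_def distinct_map)
  also have "\<dots> = sign p"
    using p(1) assms(2) by (intro sign_map_permutation) auto
  finally show ?thesis using p by simp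
qed

lemma reorder_sign_to_front:
  assumes "distinct (v # xs @ ys)"
  shows "reorder_sign (v # xs @ ys) (xs @ v # ys) = (- 1) ^ length xs"
  using assms
proof (induction xs)
  case (Cons x xs)
  have "reorder_sign (v # x # xs @ ys) (x # v # xs @ ys) = - 1"
    using Cons.prems by (intro reorder_sign_swap) auto
  moreover have "reorder_sign (x # v # xs @ ys) (x # xs @ v # ys) = (- 1) ^ length xs"
    using Cons by (subst reorder_sign_Cons) (auto simp: same_elems_def)
  ultimately show ?case
    using reorder_sign_trans[of "v # x # xs @ ys" "x # v # xs @ ys" "x # xs @ v # ys"] Cons.prems
    by (auto simp: same_elems_def insert_commute)
qed auto

lemma reorder_sign_swap_append:
  assumes "distinct (xs @ ys)"
  shows "reorder_sign (xs @ ys) (ys @ xs) = (- 1) ^ (length xs * length ys)"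
  using assms
proof (induction xs)
  case (Cons x xs)
  have "reorder_sign (x # xs @ ys) (x # ys @ xs) = (- 1) ^ (length xs * length ys)"
    using Cons by (subst reorder_sign_Cons) (auto simp: same_elems_def)
  moreover have "reorder_sign (x # ys @ xs) (ys @ x # xs) = (- 1) ^ length ys"
    using Cons.prems by (intro reorder_sign_to_front) auto
  ultimately show ?case
    using reorder_sign_trans[of "x # xs @ ys" "x # ys @ xs" "ys @ x # xs"] Cons.prems
    by (auto simp: same_elems_def power_add mult.commute Int_commute Un_commute)
qed auto

section \<open>Determinants with columns indexed by lists\<close>

text \<open>Columns are labelled by points and rows are functions of the point. So deleting a point
  is deleting a list entry, reordering costs a \<open>reorder_sign\<close>, and one \<open>G\<close>
  serves all sizes, since \<open>n\<close> truncates it to its first \<open>n\<close> rows.\<close>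

definition col_det :: "nat \<Rightarrow> (nat \<Rightarrow> 'v \<Rightarrow> real) \<Rightarrow> 'v list \<Rightarrow> real" where
  "col_det n G xs = Determinant.det (Matrix.mat n n (\<lambda>(i, j). G i (xs ! j)))"

lemma col_det_swap:
  assumes "distinct xs" "length xs = n" "a \<in> set xs" "b \<in> set xs" "a \<noteq> b"
  shows "col_det n G (map (Transposition.transpose a b) xs) = - col_det n G xs"
proof -
  obtain k l where k: "k < n" "xs ! k = a" and l: "l < n" "xs ! l = b"
    using assms by (metis in_set_conv_nth)
  hence kl: "k \<noteq> l" using assms by auto
  let ?A = "Matrix.mat n n (\<lambda>(i, j). G i (xs ! j))"
  have "Matrix.mat n n (\<lambda>(i, j). G i (map (Transposition.transpose a b) xs ! j)) = swapcols k l ?A"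
    using k l assms
    by (intro eq_matI)
       (auto simp: Transposition.transpose_def nth_eq_iff_index_eq)
  thus ?thesis
    using det_swapcols[OF k(1) l(1) kl, of ?A] by (simp add: col_det_def)
qed

lemma col_det_reorder:
  assumes "same_elems xs ys" "length xs = n"
  shows "col_det n G ys = of_int (reorder_sign xs ys) * col_det n G xs"
proof -
  obtain p where p: "p permutes set xs" "map p xs = ys" "reorder_sign xs ys = sign p"
    using reorder_signE[OF assms(1)] .
  have "col_det n G (map p xs) = of_int (sign p) * col_det n G xs"
    using p(1) finite_set
  proof (induction rule: permutes_induct)
    case (swap a b q)
    have "distinct (map q xs)" using assms swap
      by (auto simp: distinct_map same_elems_def intro: permutes_inj_on)
    moreover have "set (map q xs) = set xs" using swap by (simp add: permutes_image)
    ultimately have "col_det n G (map (Transposition.transpose a b) (map q xs)) = - col_det n G (map q xs)"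
      using swap assms by (intro col_det_swap) auto
    moreover have "sign (Transposition.transpose a b \<circ> q) = - sign q"
      using swap by (subst sign_compose)
        (auto simp: sign_swap_id permutation_swap_id intro: permutes_imp_permutation[of "set xs"])
    ultimately show ?case using swap.IH by (simp only: map_map[symmetric])
  qed simp
  thus ?thesis using p by simp
qed

lemma col_det_expand_last_nth:
  assumes "length xs = Suc n"
  shows "col_det (Suc n) G xs =
    (\<Sum>j<Suc n. (- 1) ^ (n + j) * G n (xs ! j) * col_det n G (take j xs @ drop (Suc j) xs))"
proof -
  let ?A = "Matrix.mat (Suc n) (Suc n) (\<lambda>(i, j). G i (xs ! j))"
  have "mat_delete ?A n j = Matrix.mat n n (\<lambda>(i, j'). G i ((take j xs @ drop (Suc j) xs) ! j'))"
    if "j < Suc n" for j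
    using that assms by (intro eq_matI) (auto simp: mat_delete_def nth_append)
  hence "cofactor ?A n j = (- 1) ^ (n + j) * col_det n G (take j xs @ drop (Suc j) xs)"
    if "j < Suc n" for j
    using that by (simp add: Determinant.cofactor_def col_det_def)
  moreover have "col_det (Suc n) G xs = (\<Sum>j<Suc n. ?A $$ (n, j) * cofactor ?A n j)"
    unfolding col_det_def by (rule laplace_expansion_row) auto
  ultimately show ?thesis by (simp add: algebra_simps)
qed

text \<open>The orderings \<open>ys x\<close> of the remaining points are arbitrary: a change of one
  of them changes the minor and the \<open>reorder_sign\<close> in front of it by the same sign.
  This matches incidence numbers, where the facets are oriented arbitrarily as well.\<close>

lemma col_det_expand_last:
  assumes "distinct xs" "length xs = Suc n"
    and ys: "\<And>x. x \<in> set xs \<Longrightarrow> distinct (ys x) \<and> set (ys x) = set xs - {x}"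
  shows "(\<Sum>x\<in>set xs. G n x * (of_int (reorder_sign (x # ys x) xs) * col_det n G (ys x)))
     = (- 1) ^ n * col_det (Suc n) G xs"
proof -
  have "(\<Sum>x\<in>set xs. G n x * (of_int (reorder_sign (x # ys x) xs) * col_det n G (ys x)))
     = (\<Sum>j<Suc n. G n (xs ! j) * (of_int (reorder_sign (xs ! j # ys (xs ! j)) xs) * col_det n G (ys (xs ! j))))"
    using assms by (subst sum.reindex_bij_betw[OF bij_betw_nth, symmetric]) auto
  also have "\<dots> = (\<Sum>j<Suc n. (- 1) ^ j * G n (xs ! j) * col_det n G (take j xs @ drop (Suc j) xs))"
  proof (rule sum.cong[OF refl])
    fix j assume "j \<in> {..<Suc n}"
    hence j: "j < length xs" using assms by simp
    let ?x = "xs ! j" and ?zs = "take j xs @ drop (Suc j) xs"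
    have xs: "xs = take j xs @ ?x # drop (Suc j) xs" using j by (rule id_take_nth_drop)
    have d: "distinct (?x # ?zs)" using assms(1) by (subst (asm) xs) auto
    have s: "set xs = insert ?x (set ?zs)" by (subst xs) auto
    have e: "same_elems ?zs (ys ?x)" using d s ys[OF nth_mem[OF j]] by (auto simp: same_elems_def)
    have "reorder_sign (?x # ?zs) xs = (- 1) ^ j"
      using reorder_sign_to_front[of ?x "take j xs" "drop (Suc j) xs"] d xs j by simp
    moreover have "reorder_sign (?x # ys ?x) (?x # ?zs) = reorder_sign ?zs (ys ?x)"
      using reorder_sign_Cons[OF same_elems_sym[OF e], of ?x] ys[OF nth_mem[OF j]]
      by (simp add: reorder_sign_commute[OF e])
    ultimately have "reorder_sign (?x # ys ?x) xs = reorder_sign ?zs (ys ?x) * (- 1) ^ j"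
      using reorder_sign_trans[of "?x # ys ?x" "?x # ?zs" xs] e d s assms(1)
      unfolding same_elems_def by (metis distinct.simps(2) list.simps(15))
    moreover have "col_det n G (ys ?x) = of_int (reorder_sign ?zs (ys ?x)) * col_det n G ?zs"
      using e by (rule col_det_reorder) (use j assms in auto)
    moreover have "of_int (reorder_sign ?zs (ys ?x)) * of_int (reorder_sign ?zs (ys ?x)) = (1::real)"
      using reorder_sign_square[OF e] by (metis of_int_1 of_int_mult)
    ultimately show "G n ?x * (of_int (reorder_sign (?x # ys ?x) xs) * col_det n G (ys ?x))
       = (- 1) ^ j * G n ?x * col_det n G ?zs"
      by (simp add: algebra_simps)
  qed
  also have "\<dots> = (- 1) ^ n * col_det (Suc n) G xs"
    by (subst col_det_expand_last_nth)
       (use assms in \<open>auto simp: sum_distrib_left power_add algebra_simps simp flip: power_mult_distrib\<close>)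
  finally show ?thesis .
qed

lemma col_det_same_rows:
  assumes "r < s" "s < n" "\<And>x. x \<in> set xs \<Longrightarrow> G r x = G s x" "length xs = n"
  shows "col_det n G xs = 0"
  unfolding col_det_def
  by (rule det_identical_rows[of _ n r s]) (use assms in auto)

text \<open>Replacing row \<open>n\<close> by row \<open>r\<close> gives a determinant with two
  equal rows, whose expansion is this sum. The signed maximal minors of an \<open>n\<close> by
  \<open>n + 1\<close> matrix thus lie in its kernel; they will be the direction of a line of
  solutions.\<close>

lemma col_det_kernel:
  assumes "distinct xs" "length xs = Suc n" "r < n"
    and ys: "\<And>x. x \<in> set xs \<Longrightarrow> distinct (ys x) \<and> set (ys x) = set xs - {x}"
  shows "(\<Sum>x\<in>set xs. G r x * (of_int (reorder_sign (x # ys x) xs) * col_det n G (ys x))) = 0"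
proof -
  let ?H = "G(n := G r)"
  have "col_det n ?H (ys x) = col_det n G (ys x)" if "x \<in> set xs" for x
    unfolding col_det_def by (rule arg_cong[where f = Determinant.det], rule cong_mat) auto
  hence "(\<Sum>x\<in>set xs. G r x * (of_int (reorder_sign (x # ys x) xs) * col_det n G (ys x)))
    = (\<Sum>x\<in>set xs. ?H n x * (of_int (reorder_sign (x # ys x) xs) * col_det n ?H (ys x)))"
    by (intro sum.cong) auto
  also have "\<dots> = (- 1) ^ n * col_det (Suc n) ?H xs"
    by (rule col_det_expand_last) (use assms in auto)
  also have "\<dots> = 0"
    using assms by (subst col_det_same_rows[of r n]) auto
  finally show ?thesis .
qed

lemma col_det_nonzero_imp_independent:
  assumes "length xs = n" "distinct xs" "col_det n G xs \<noteq> 0"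
    and "\<And>i. i < n \<Longrightarrow> (\<Sum>x\<in>set xs. G i x * c x) = 0" "x \<in> set xs"
  shows "c x = 0"
proof (rule ccontr)
  assume cx: "c x \<noteq> 0"
  let ?A = "Matrix.mat n n (\<lambda>(i, j). G i (xs ! j))"
  let ?v = "Matrix.vec n (\<lambda>j. c (xs ! j))"
  have "?A *\<^sub>v ?v = 0\<^sub>v n"
  proof (rule eq_vecI)
    fix i assume i: "i < dim_vec (0\<^sub>v n :: real vec)"
    have "vec_index (?A *\<^sub>v ?v) i = (\<Sum>j<n. G i (xs ! j) * c (xs ! j))"
      using i by (simp add: scalar_prod_def lessThan_atLeast0)
    also have "\<dots> = (\<Sum>x\<in>set xs. G i x * c x)"
      using assms by (intro sum.reindex_bij_betw bij_betw_nth) auto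
    finally show "vec_index (?A *\<^sub>v ?v) i = vec_index (0\<^sub>v n) i" using i assms(4) by simp
  qed auto
  moreover have "?v \<noteq> 0\<^sub>v n"
  proof -
    obtain j where "j < n" "xs ! j = x" using assms by (metis in_set_conv_nth)
    thus ?thesis using cx by (metis index_vec index_zero_vec(1))
  qed
  ultimately have "Determinant.det ?A = 0"
    by (subst det_0_iff_vec_prod_zero[of _ n]) (auto intro!: exI[of _ ?v])
  with assms(3) show False by (simp add: col_det_def)
qed

lemma col_det_zero_imp_dependent:
  assumes "length xs = n" "distinct xs" "col_det n G xs = 0"
  obtains c where "\<And>i. i < n \<Longrightarrow> (\<Sum>x\<in>set xs. G i x * c x) = 0" "\<exists>x\<in>set xs. c x \<noteq> 0"
proof -
  let ?A = "Matrix.mat n n (\<lambda>(i, j). G i (xs ! j))"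
  obtain v where v: "v \<in> carrier_vec n" "v \<noteq> 0\<^sub>v n" "?A *\<^sub>v v = 0\<^sub>v n"
    using assms(3) unfolding col_det_def
    by (subst (asm) det_0_iff_vec_prod_zero[of _ n]) auto
  define c where "c = (\<lambda>x. vec_index v (THE j. j < n \<and> xs ! j = x))"
  have c: "c (xs ! j) = vec_index v j" if "j < n" for j
  proof -
    have "(THE j'. j' < n \<and> xs ! j' = xs ! j) = j"
      using that assms by (intro the_equality) (auto simp: nth_eq_iff_index_eq)
    thus ?thesis by (simp add: c_def)
  qed
  show ?thesis
  proof
    fix i assume i: "i < n"
    have "(\<Sum>x\<in>set xs. G i x * c x) = (\<Sum>j<n. G i (xs ! j) * c (xs ! j))"
      using assms by (intro sum.reindex_bij_betw[symmetric] bij_betw_nth) auto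
    also have "\<dots> = vec_index (?A *\<^sub>v v) i"
      using i v(1) c by (auto simp: scalar_prod_def lessThan_atLeast0 intro!: sum.cong)
    finally show "(\<Sum>x\<in>set xs. G i x * c x) = 0" using v(3) i by simp
  next
    obtain j where "j < n" "vec_index v j \<noteq> 0" using v(1,2) by (metis carrier_vecD eq_vecI index_zero_vec)
    thus "\<exists>x\<in>set xs. c x \<noteq> 0" using c assms by (metis nth_mem)
  qed
qed

section \<open>Cochains of the deleted product\<close>

text \<open>The formula without the test for cells, so that it can be evaluated at pairs with an
  empty factor, which arise as facets of cells with a vertex factor.\<close>

definition raw_coboundary :: "('a set \<Rightarrow> 'a list) \<Rightarrow> 'a cochain \<Rightarrow> 'a set \<Rightarrow> 'a set \<Rightarrow> int" where
  "raw_coboundary ori c \<sigma> \<tau> = (\<Sum>v\<in>\<sigma>. incidence ori \<sigma> v * c (\<sigma> - {v}, \<tau>))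
       + (- 1) ^ simplex_dim \<sigma> * (\<Sum>w\<in>\<tau>. incidence ori \<tau> w * c (\<sigma>, \<tau> - {w}))"

lemma coboundary_apply:
  "coboundary L ori i c (\<sigma>, \<tau>) =
     (if (\<sigma>, \<tau>) \<in> deleted_cells L (Suc i) then raw_coboundary ori c \<sigma> \<tau> else 0)"
  by (simp add: coboundary_def raw_coboundary_def)

lemma swap_cochain_apply:
  "swap_cochain c (\<sigma>, \<tau>) = (- 1) ^ (simplex_dim \<sigma> * simplex_dim \<tau>) * c (\<tau>, \<sigma>)"
  by (simp add: swap_cochain_def)

lemma deleted_cells_swap:
  "(\<sigma>, \<tau>) \<in> deleted_cells L i \<longleftrightarrow> (\<tau>, \<sigma>) \<in> deleted_cells L i"
  by (auto simp: deleted_cells_def)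

lemma coboundary_in_cochains: "coboundary L ori i c \<in> cochains L (Suc i)"
  by (auto simp: cochains_def coboundary_apply)

lemma swap_in_cochains: "c \<in> cochains L i \<Longrightarrow> swap_cochain c \<in> cochains L i"
  by (auto simp: cochains_def swap_cochain_apply deleted_cells_swap)

lemma swap_cochain_involution: "swap_cochain (swap_cochain c) = c"
proof -
  have "(- 1::int) ^ (m * n) * ((- 1) ^ (n * m) * x) = x" for m n x
    by (simp add: mult.commute[of m n] flip: power_mult_distrib mult.assoc)
  thus ?thesis by (auto simp: fun_eq_iff swap_cochain_apply)
qed

lemma swap_cochain_add: "swap_cochain (\<lambda>e. a e + b e) = (\<lambda>e. swap_cochain a e + swap_cochain b e)"
  by (auto simp: fun_eq_iff swap_cochain_apply algebra_simps)

lemma swap_cochain_diff: "swap_cochain (\<lambda>e. a e - b e) = (\<lambda>e. swap_cochain a e - swap_cochain b e)"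
  by (auto simp: fun_eq_iff swap_cochain_apply algebra_simps)

lemma swap_cochain_scale: "swap_cochain (\<lambda>e. k * a e) = (\<lambda>e. k * swap_cochain a e)"
  by (auto simp: fun_eq_iff swap_cochain_apply algebra_simps)

lemma coboundary_add:
  "coboundary L ori i (\<lambda>e. a e + b e) = (\<lambda>e. coboundary L ori i a e + coboundary L ori i b e)"
  by (auto simp: fun_eq_iff coboundary_apply raw_coboundary_def algebra_simps sum.distrib)

lemma coboundary_diff:
  "coboundary L ori i (\<lambda>e. a e - b e) = (\<lambda>e. coboundary L ori i a e - coboundary L ori i b e)"
  by (auto simp: fun_eq_iff coboundary_apply raw_coboundary_def algebra_simps sum_subtractf)

lemma coboundary_scale:
  "coboundary L ori i (\<lambda>e. k * a e) = (\<lambda>e. k * coboundary L ori i a e)"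
  by (auto simp: fun_eq_iff coboundary_apply raw_coboundary_def algebra_simps sum_distrib_left)

lemma cochains_add: "a \<in> cochains L i \<Longrightarrow> b \<in> cochains L i \<Longrightarrow> (\<lambda>e. a e + b e) \<in> cochains L i"
  by (auto simp: cochains_def)

lemma cochains_diff: "a \<in> cochains L i \<Longrightarrow> b \<in> cochains L i \<Longrightarrow> (\<lambda>e. a e - b e) \<in> cochains L i"
  by (auto simp: cochains_def)

lemma cochains_scale: "a \<in> cochains L i \<Longrightarrow> (\<lambda>e. k * a e) \<in> cochains L i"
  by (auto simp: cochains_def)

text \<open>Extended by zero to the diagonal, \<open>g\<close> is antisymmetric, so the sum is its
  own negative. This cancels the two orders in which a pair of vertices can be removed.\<close>

lemma antisymmetric_double_sum:
  fixes g :: "'b \<Rightarrow> 'b \<Rightarrow> int"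
  assumes "finite A" "\<And>v w. v \<in> A \<Longrightarrow> w \<in> A \<Longrightarrow> v \<noteq> w \<Longrightarrow> g v w = - g w v"
  shows "(\<Sum>v\<in>A. \<Sum>w\<in>A - {v}. g v w) = 0"
proof -
  define h where "h = (\<lambda>v w. if v = w then 0 else g v w)"
  have "(\<Sum>w\<in>A - {v}. g v w) = (\<Sum>w\<in>A. h v w)" if "v \<in> A" for v
  proof -
    have "(\<Sum>w\<in>A. h v w) = h v v + (\<Sum>w\<in>A - {v}. h v w)"
      using assms(1) that by (rule sum.remove)
    also have "(\<Sum>w\<in>A - {v}. h v w) = (\<Sum>w\<in>A - {v}. g v w)"
      by (rule sum.cong) (auto simp: h_def)
    finally show ?thesis by (simp add: h_def)
  qed
  hence *: "(\<Sum>v\<in>A. \<Sum>w\<in>A - {v}. g v w) = (\<Sum>v\<in>A. \<Sum>w\<in>A. h v w)" by simp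
  have "(\<Sum>v\<in>A. \<Sum>w\<in>A. h v w) = (\<Sum>w\<in>A. \<Sum>v\<in>A. h v w)" by (rule sum.swap)
  also have "\<dots> = (\<Sum>w\<in>A. \<Sum>v\<in>A. - h w v)"
  proof (intro sum.cong refl)
    fix v w assume "w \<in> A" "v \<in> A"
    thus "h v w = - h w v" using assms(2)[of v w] by (simp add: h_def)
  qed
  also have "\<dots> = - (\<Sum>v\<in>A. \<Sum>w\<in>A. h v w)" by (simp add: sum_negf)
  finally show ?thesis using * by simp
qed

lemma simplex_dim_remove:
  assumes "finite \<sigma>" "v \<in> \<sigma>" "\<sigma> \<noteq> {v}"
  shows "simplex_dim \<sigma> = Suc (simplex_dim (\<sigma> - {v}))"
proof -
  have "\<sigma> - {v} \<noteq> {}" using assms by auto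
  hence "card (\<sigma> - {v}) > 0" using assms(1) by (simp add: card_gt_0_iff del: card_Diff_insert card_Diff_singleton)
  moreover have "card \<sigma> = Suc (card (\<sigma> - {v}))" using assms by (metis card.remove)
  ultimately show ?thesis by (simp add: simplex_dim_def)
qed

locale oriented_complex =
  fixes L :: "'a set set" and ori :: "'a set \<Rightarrow> 'a list"
  assumes cpx: "abstract_complex L" and ori: "orientation L ori"
begin

lemma finite_simplex: "\<sigma> \<in> L \<Longrightarrow> finite \<sigma>" and nonempty_simplex: "\<sigma> \<in> L \<Longrightarrow> \<sigma> \<noteq> {}"
  and finite_complex: "finite L"
  using cpx by (auto simp: abstract_complex_def)

lemma face_in: "\<sigma> \<in> L \<Longrightarrow> \<rho> \<subseteq> \<sigma> \<Longrightarrow> \<rho> \<noteq> {} \<Longrightarrow> \<rho> \<in> L"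
  using cpx unfolding abstract_complex_def by blast

lemma ori_simplex: "\<sigma> \<in> L \<Longrightarrow> distinct (ori \<sigma>)" "\<sigma> \<in> L \<Longrightarrow> set (ori \<sigma>) = \<sigma>"
  using ori by (auto simp: orientation_def)

lemma length_ori: "\<sigma> \<in> L \<Longrightarrow> length (ori \<sigma>) = card \<sigma>"
  using ori_simplex by (metis distinct_card)

lemma facet_in: "\<sigma> \<in> L \<Longrightarrow> \<sigma> \<noteq> {v} \<Longrightarrow> \<sigma> - {v} \<in> L"
  using face_in[of \<sigma> "\<sigma> - {v}"] nonempty_simplex[of \<sigma>] by blast

lemma not_cell [simp]: "({}, \<tau>) \<notin> deleted_cells L i" "(\<sigma>, {}) \<notin> deleted_cells L i"
  using nonempty_simplex by (auto simp: deleted_cells_def)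

lemma cochain_empty: "c \<in> cochains L i \<Longrightarrow> c ({}, \<tau>) = 0" "c \<in> cochains L i \<Longrightarrow> c (\<sigma>, {}) = 0"
  by (auto simp: cochains_def)

text \<open>Both products compare \<open>ori \<sigma>\<close> with a list that begins with the two
  removed vertices, and the two lists differ by one transposition. The remaining face has to be
  nonempty because \<open>ori\<close> is constrained only on simplices.\<close>

lemma incidence_flip:
  assumes "\<sigma> \<in> L" "v \<in> \<sigma>" "w \<in> \<sigma>" "v \<noteq> w" "\<sigma> - {v} - {w} \<noteq> {}"
  shows "incidence ori \<sigma> v * incidence ori (\<sigma> - {v}) w
       = - (incidence ori \<sigma> w * incidence ori (\<sigma> - {w}) v)"
proof -
  define xs where "xs = ori (\<sigma> - {v} - {w})"
  have L: "\<sigma> - {v} - {w} \<in> L" "\<sigma> - {v} \<in> L" "\<sigma> - {w} \<in> L"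
    using assms by (auto intro!: face_in[OF assms(1)])
  have xs: "distinct xs" "set xs = \<sigma> - {v, w}"
    using ori_simplex[OF L(1)] by (auto simp: xs_def)
  have *: "incidence ori \<sigma> a * incidence ori (\<sigma> - {a}) b = reorder_sign (a # b # xs) (ori \<sigma>)"
    if ab: "{a, b} = {v, w}" for a b
  proof -
    have eq: "\<sigma> - {a} - {b} = \<sigma> - {v} - {w}" and abd: "a \<in> \<sigma>" "b \<in> \<sigma>" "a \<noteq> b"
      using ab assms by (auto simp: doubleton_eq_iff)
    have La: "\<sigma> - {a} \<in> L" using ab L by (auto simp: doubleton_eq_iff)
    have xs': "set xs = \<sigma> - {a, b}" using xs ab by simp
    have 1: "same_elems (b # xs) (ori (\<sigma> - {a}))"
      using abd ori_simplex[OF La] xs(1) xs' by (auto simp: same_elems_def)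
    have 2: "same_elems (a # b # xs) (a # ori (\<sigma> - {a}))" "same_elems (a # ori (\<sigma> - {a})) (ori \<sigma>)"
      using abd ori_simplex[OF La] ori_simplex[OF assms(1)] xs(1) xs' by (auto simp: same_elems_def)
    have "incidence ori (\<sigma> - {a}) b = reorder_sign (b # xs) (ori (\<sigma> - {a}))"
      by (simp only: incidence_def eq xs_def)
    also have "\<dots> = reorder_sign (a # b # xs) (a # ori (\<sigma> - {a}))"
      using abd xs' by (intro reorder_sign_Cons[symmetric] 1) auto
    finally show ?thesis
      using reorder_sign_trans[OF 2] by (simp add: incidence_def mult.commute)
  qed
  have "reorder_sign (v # w # xs) (w # v # xs) = - 1"
    using assms xs by (intro reorder_sign_swap) auto
  moreover have "reorder_sign (v # w # xs) (w # v # xs) * reorder_sign (w # v # xs) (ori \<sigma>)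
     = reorder_sign (v # w # xs) (ori \<sigma>)"
    using assms xs ori_simplex[OF assms(1)] by (intro reorder_sign_trans) (auto simp: same_elems_def)
  ultimately show ?thesis using *[OF refl] *[of w v, OF insert_commute] by simp
qed

text \<open>A facet with an empty factor is not a cell, but there the raw formula vanishes too: each
  of its terms evaluates \<open>c\<close> at an empty factor. Hence no case distinction is needed
  when the coboundary is iterated.\<close>

lemma coboundary_facet:
  assumes c: "c \<in> cochains L i" and cell: "(\<sigma>, \<tau>) \<in> deleted_cells L (Suc (Suc i))"
  shows "v \<in> \<sigma> \<Longrightarrow> coboundary L ori i c (\<sigma> - {v}, \<tau>) = raw_coboundary ori c (\<sigma> - {v}) \<tau>"
    and "w \<in> \<tau> \<Longrightarrow> coboundary L ori i c (\<sigma>, \<tau> - {w}) = raw_coboundary ori c \<sigma> (\<tau> - {w})"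
proof -
  have L: "\<sigma> \<in> L" "\<tau> \<in> L" "\<sigma> \<inter> \<tau> = {}" "simplex_dim \<sigma> + simplex_dim \<tau> = Suc (Suc i)"
    using cell by (auto simp: deleted_cells_def)
  show "coboundary L ori i c (\<sigma> - {v}, \<tau>) = raw_coboundary ori c (\<sigma> - {v}) \<tau>" if "v \<in> \<sigma>"
  proof (cases "\<sigma> = {v}")
    case True
    thus ?thesis by (auto simp: coboundary_apply raw_coboundary_def cochain_empty[OF c])
  next
    case False
    hence "(\<sigma> - {v}, \<tau>) \<in> deleted_cells L (Suc i)"
      using L that facet_in simplex_dim_remove[of \<sigma> v] finite_simplex by (auto simp: deleted_cells_def)
    thus ?thesis by (simp add: coboundary_apply)
  qed
  show "coboundary L ori i c (\<sigma>, \<tau> - {w}) = raw_coboundary ori c \<sigma> (\<tau> - {w})" if "w \<in> \<tau>"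
  proof (cases "\<tau> = {w}")
    case True
    thus ?thesis by (auto simp: coboundary_apply raw_coboundary_def cochain_empty[OF c])
  next
    case False
    hence "(\<sigma>, \<tau> - {w}) \<in> deleted_cells L (Suc i)"
      using L that facet_in simplex_dim_remove[of \<tau> w] finite_simplex by (auto simp: deleted_cells_def)
    thus ?thesis by (simp add: coboundary_apply)
  qed
qed

lemma coboundary_coboundary:
  assumes c: "c \<in> cochains L i"
  shows "coboundary L ori (Suc i) (coboundary L ori i c) = (\<lambda>e. 0)"
proof (rule ext, clarify)
  fix \<sigma> \<tau>
  show "coboundary L ori (Suc i) (coboundary L ori i c) (\<sigma>, \<tau>) = 0"
  proof (cases "(\<sigma>, \<tau>) \<in> deleted_cells L (Suc (Suc i))")
    case True
    hence L: "\<sigma> \<in> L" "\<tau> \<in> L" "finite \<sigma>" "finite \<tau>"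
      by (auto simp: deleted_cells_def finite_simplex)
    let ?s = "(- 1::int) ^ simplex_dim \<sigma>"
    have A: "(\<Sum>v\<in>\<sigma>. \<Sum>v'\<in>\<sigma> - {v}. incidence ori \<sigma> v * incidence ori (\<sigma> - {v}) v' * c (\<sigma> - {v} - {v'}, \<tau>)) = 0"
    proof (rule antisymmetric_double_sum)
      fix v v' assume v: "v \<in> \<sigma>" "v' \<in> \<sigma>" "v \<noteq> v'"
      have e: "\<sigma> - {v'} - {v} = \<sigma> - {v} - {v'}" by auto
      show "incidence ori \<sigma> v * incidence ori (\<sigma> - {v}) v' * c (\<sigma> - {v} - {v'}, \<tau>) =
        - (incidence ori \<sigma> v' * incidence ori (\<sigma> - {v'}) v * c (\<sigma> - {v'} - {v}, \<tau>))"
      proof (cases "\<sigma> - {v} - {v'} = {}")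
        case True
        show ?thesis unfolding e True cochain_empty[OF c] by simp
      next
        case False
        thus ?thesis unfolding e using incidence_flip[OF L(1) v] by simp
      qed
    qed (use L in auto)
    have B: "(\<Sum>v\<in>\<tau>. \<Sum>v'\<in>\<tau> - {v}. incidence ori \<tau> v * incidence ori (\<tau> - {v}) v' * c (\<sigma>, \<tau> - {v} - {v'})) = 0"
    proof (rule antisymmetric_double_sum)
      fix v v' assume v: "v \<in> \<tau>" "v' \<in> \<tau>" "v \<noteq> v'"
      have e: "\<tau> - {v'} - {v} = \<tau> - {v} - {v'}" by auto
      show "incidence ori \<tau> v * incidence ori (\<tau> - {v}) v' * c (\<sigma>, \<tau> - {v} - {v'}) =
        - (incidence ori \<tau> v' * incidence ori (\<tau> - {v'}) v * c (\<sigma>, \<tau> - {v'} - {v}))"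
      proof (cases "\<tau> - {v} - {v'} = {}")
        case True
        show ?thesis unfolding e True cochain_empty[OF c] by simp
      next
        case False
        thus ?thesis unfolding e using incidence_flip[OF L(2) v] by simp
      qed
    qed (use L in auto)
    \<comment> \<open>This change of sign makes the mixed sums cancel, in which one vertex is
      removed from each factor.\<close>
    have C: "(- 1) ^ simplex_dim (\<sigma> - {v}) * c (\<sigma> - {v}, \<tau> - {w}) = - (?s * c (\<sigma> - {v}, \<tau> - {w}))"
      if "v \<in> \<sigma>" for v w
      using that simplex_dim_remove[of \<sigma> v] L cochain_empty[OF c] by (cases "\<sigma> = {v}") auto
    have "coboundary L ori (Suc i) (coboundary L ori i c) (\<sigma>, \<tau>) =
       (\<Sum>v\<in>\<sigma>. incidence ori \<sigma> v * raw_coboundary ori c (\<sigma> - {v}) \<tau>)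
       + ?s * (\<Sum>w\<in>\<tau>. incidence ori \<tau> w * raw_coboundary ori c \<sigma> (\<tau> - {w}))"
      unfolding coboundary_apply[of L ori "Suc i"] raw_coboundary_def[of ori "coboundary L ori i c"]
      using True by (simp add: coboundary_facet[OF c True] cong: sum.cong)
    also have "(\<Sum>v\<in>\<sigma>. incidence ori \<sigma> v * raw_coboundary ori c (\<sigma> - {v}) \<tau>) =
       - (?s * (\<Sum>v\<in>\<sigma>. \<Sum>w\<in>\<tau>. incidence ori \<sigma> v * incidence ori \<tau> w * c (\<sigma> - {v}, \<tau> - {w})))"
      (is "_ = ?R")
    proof -
      have "(\<Sum>v\<in>\<sigma>. incidence ori \<sigma> v * raw_coboundary ori c (\<sigma> - {v}) \<tau>) =
        (\<Sum>v\<in>\<sigma>. \<Sum>v'\<in>\<sigma> - {v}. incidence ori \<sigma> v * incidence ori (\<sigma> - {v}) v' * c (\<sigma> - {v} - {v'}, \<tau>))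
        + (\<Sum>v\<in>\<sigma>. \<Sum>w\<in>\<tau>. incidence ori \<sigma> v * incidence ori \<tau> w *
             ((- 1) ^ simplex_dim (\<sigma> - {v}) * c (\<sigma> - {v}, \<tau> - {w})))"
        by (simp add: raw_coboundary_def sum_distrib_left sum.distrib algebra_simps)
      also have "\<dots> = (\<Sum>v\<in>\<sigma>. \<Sum>w\<in>\<tau>. incidence ori \<sigma> v * incidence ori \<tau> w *
             (- (?s * c (\<sigma> - {v}, \<tau> - {w}))))"
        unfolding A by (simp add: C)
      also have "\<dots> = ?R" by (simp add: sum_distrib_left sum_negf algebra_simps)
      finally show ?thesis .
    qed
    also have "(\<Sum>w\<in>\<tau>. incidence ori \<tau> w * raw_coboundary ori c \<sigma> (\<tau> - {w})) =
       (\<Sum>w\<in>\<tau>. \<Sum>v\<in>\<sigma>. incidence ori \<sigma> v * incidence ori \<tau> w * c (\<sigma> - {v}, \<tau> - {w}))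
       + ?s * (\<Sum>v\<in>\<tau>. \<Sum>v'\<in>\<tau> - {v}. incidence ori \<tau> v * incidence ori (\<tau> - {v}) v' * c (\<sigma>, \<tau> - {v} - {v'}))"
      by (simp add: raw_coboundary_def sum_distrib_left sum.distrib algebra_simps)
    finally show ?thesis unfolding B by (simp add: sum.swap[of _ \<sigma> \<tau>])
  qed (simp add: coboundary_apply)
qed

lemma coboundary_swap:
  assumes c: "c \<in> cochains L i"
  shows "coboundary L ori i (swap_cochain c) = swap_cochain (coboundary L ori i c)"
proof (rule ext, clarify)
  fix \<sigma> \<tau>
  show "coboundary L ori i (swap_cochain c) (\<sigma>, \<tau>) = swap_cochain (coboundary L ori i c) (\<sigma>, \<tau>)"
  proof (cases "(\<sigma>, \<tau>) \<in> deleted_cells L (Suc i)")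
    case True
    hence L: "\<sigma> \<in> L" "\<tau> \<in> L" "finite \<sigma>" "finite \<tau>"
      by (auto simp: deleted_cells_def finite_simplex)
    let ?p = "simplex_dim \<sigma>" and ?q = "simplex_dim \<tau>"
    have 1: "swap_cochain c (\<sigma> - {v}, \<tau>) = (- 1) ^ (?p * ?q) * ((- 1) ^ ?q * c (\<tau>, \<sigma> - {v}))"
      if "v \<in> \<sigma>" for v
    proof (cases "\<sigma> = {v}")
      case False
      hence "?p * ?q + ?q = simplex_dim (\<sigma> - {v}) * ?q + 2 * ?q"
        using simplex_dim_remove[of \<sigma> v] L that by simp
      hence "(- 1::int) ^ (?p * ?q) * (- 1) ^ ?q = (- 1) ^ (simplex_dim (\<sigma> - {v}) * ?q)"
        by (metis power_add power_minus1_even mult.right_neutral)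
      thus ?thesis by (simp add: swap_cochain_apply flip: mult.assoc)
    qed (simp add: swap_cochain_apply cochain_empty[OF c])
    have 2: "(- 1) ^ ?p * swap_cochain c (\<sigma>, \<tau> - {w}) = (- 1) ^ (?p * ?q) * c (\<tau> - {w}, \<sigma>)"
      if "w \<in> \<tau>" for w
    proof (cases "\<tau> = {w}")
      case False
      hence "?p * ?q = ?p + ?p * simplex_dim (\<tau> - {w})"
        using simplex_dim_remove[of \<tau> w] L that by simp
      thus ?thesis by (simp add: swap_cochain_apply power_add)
    qed (simp add: swap_cochain_apply cochain_empty[OF c])
    have "coboundary L ori i (swap_cochain c) (\<sigma>, \<tau>) =
      (\<Sum>v\<in>\<sigma>. incidence ori \<sigma> v * swap_cochain c (\<sigma> - {v}, \<tau>)) +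
      (\<Sum>w\<in>\<tau>. incidence ori \<tau> w * ((- 1) ^ ?p * swap_cochain c (\<sigma>, \<tau> - {w})))"
      using True by (simp add: coboundary_apply raw_coboundary_def sum_distrib_left algebra_simps)
    also have "\<dots> = (- 1) ^ (?p * ?q) * raw_coboundary ori c \<tau> \<sigma>"
      using 1 2 by (simp add: raw_coboundary_def sum_distrib_left algebra_simps)
    finally show ?thesis
      using True deleted_cells_swap[of \<sigma> \<tau>] by (simp add: swap_cochain_apply coboundary_apply)
  qed (use deleted_cells_swap[of \<sigma> \<tau>] in \<open>simp add: swap_cochain_apply coboundary_apply\<close>)
qed

text \<open>The case left out of \<open>incidence_flip\<close>: the remaining face is empty, but
  vertices have only one ordering, so the two signs can be compared directly.\<close>

lemma incidence_edge:
  assumes "{u, v} \<in> L" "u \<noteq> v"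
  shows "incidence ori {u, v} u = - incidence ori {u, v} v"
proof -
  have L: "{u} \<in> L" "{v} \<in> L" by (auto intro!: face_in[OF assms(1)])
  have single: "ori {w} = [w]" if "{w} \<in> L" for w
  proof -
    have "length (ori {w}) = 1" using length_ori[OF that] by simp
    then obtain z where "ori {w} = [z]" by (metis One_nat_def length_0_conv length_Suc_conv)
    thus ?thesis using ori_simplex(2)[OF that] by simp
  qed
  have "{u, v} - {u} = {v}" "{u, v} - {v} = {u}" using assms by auto
  moreover have "reorder_sign [u, v] [v, u] = - 1" using assms by (intro reorder_sign_swap) auto
  moreover have "reorder_sign [u, v] [v, u] * reorder_sign [v, u] (ori {u, v}) = reorder_sign [u, v] (ori {u, v})"
    using assms ori_simplex[OF assms(1)] by (intro reorder_sign_trans) (auto simp: same_elems_def)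
  ultimately show ?thesis using single L by (simp add: incidence_def)
qed

lemma incidence_square:
  assumes "\<sigma> \<in> L" "v \<in> \<sigma>" "\<sigma> \<noteq> {v}"
  shows "incidence ori \<sigma> v * incidence ori \<sigma> v = 1"
  unfolding incidence_def
  using assms ori_simplex[OF assms(1)] ori_simplex[OF facet_in[OF assms(1,3)]]
  by (intro reorder_sign_square) (auto simp: same_elems_def)

end

subsection \<open>Smith sequences\<close>

text \<open>Picks one cell from each orbit of the free involution.\<close>

definition first_cell :: "('a set \<Rightarrow> nat) \<Rightarrow> 'a set \<Rightarrow> 'a set \<Rightarrow> bool" where
  "first_cell r \<sigma> \<tau> \<longleftrightarrow> card \<tau> < card \<sigma> \<or> card \<tau> = card \<sigma> \<and> r \<sigma> < r \<tau>"

definition half_cochain :: "('a set \<Rightarrow> nat) \<Rightarrow> 'a cochain \<Rightarrow> 'a cochain" where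
  "half_cochain r c = (\<lambda>(\<sigma>, \<tau>). if first_cell r \<sigma> \<tau> then c (\<sigma>, \<tau>) else 0)"

lemma half_cochain_in_cochains: "c \<in> cochains L i \<Longrightarrow> half_cochain r c \<in> cochains L i"
  by (auto simp: cochains_def half_cochain_def)

context oriented_complex
begin

text \<open>Disjoint nonempty simplices are distinct, so \<open>r\<close> separates them and exactly
  one cell of each orbit is selected; the value on the other one is forced by the symmetry of
  \<open>c\<close>. This is where the freeness of the involution enters.\<close>

lemma half_cochain_sum:
  assumes c: "c \<in> cochains L i" and r: "inj_on r L" and s: "s = 1 \<or> s = - 1"
    and sw: "swap_cochain c = (\<lambda>e. s * c e)"
  shows "c = (\<lambda>e. half_cochain r c e + s * swap_cochain (half_cochain r c) e)"
proof (rule ext, clarify)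
  fix \<sigma> \<tau>
  show "c (\<sigma>, \<tau>) = half_cochain r c (\<sigma>, \<tau>) + s * swap_cochain (half_cochain r c) (\<sigma>, \<tau>)"
  proof (cases "(\<sigma>, \<tau>) \<in> deleted_cells L i")
    case True
    hence "\<sigma> \<in> L" "\<tau> \<in> L" "\<sigma> \<noteq> \<tau>" using nonempty_simplex by (auto simp: deleted_cells_def)
    hence "r \<sigma> \<noteq> r \<tau>" using inj_onD[OF r] by blast
    hence f: "first_cell r \<tau> \<sigma> \<longleftrightarrow> \<not> first_cell r \<sigma> \<tau>"
      unfolding first_cell_def by linarith
    have "s * ((- 1) ^ (simplex_dim \<sigma> * simplex_dim \<tau>) * c (\<tau>, \<sigma>)) = c (\<sigma>, \<tau>)"
      using fun_cong[OF sw, of "(\<sigma>, \<tau>)"] s by (auto simp: swap_cochain_apply)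
    thus ?thesis by (simp add: half_cochain_def swap_cochain_apply f)
  next
    case False
    hence "c (\<sigma>, \<tau>) = 0" "c (\<tau>, \<sigma>) = 0"
      using c deleted_cells_swap[of \<sigma> \<tau>] by (auto simp: cochains_def)
    thus ?thesis by (simp add: half_cochain_def swap_cochain_apply)
  qed
qed

text \<open>Cochain representatives of the iterated Smith classes: \<open>\<psi> i\<close> is a
  preimage of \<open>x i\<close> under \<open>1 + \<tau>\<close> for even \<open>i\<close> and under
  \<open>1 - \<tau>\<close> for odd \<open>i\<close>, where \<open>\<tau>\<close> is the swap of
  cochains.\<close>

definition smith_sequence :: "nat \<Rightarrow> (nat \<Rightarrow> 'a cochain) \<Rightarrow> (nat \<Rightarrow> 'a cochain) \<Rightarrow> bool" where
  "smith_sequence n x \<psi> \<longleftrightarrow> (\<forall>i<n. \<psi> i \<in> cochains L i \<and>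
      x i = (\<lambda>e. \<psi> i e + (- 1) ^ i * swap_cochain (\<psi> i) e) \<and>
      x (Suc i) = coboundary L ori i (\<psi> i))"

text \<open>The Smith homomorphisms are well defined, in cochain form. If the terms in degree
  \<open>Suc i\<close> differ by the coboundary of \<open>c\<close>, then \<open>c\<close> has the
  symmetry that allows it to be halved, and the half \<open>b\<close> corrects the difference of the
  chosen preimages.\<close>

lemma smith_sequence_unique:
  assumes x: "smith_sequence n x \<psi>" and y: "smith_sequence n y \<phi>" and 0: "x 0 = y 0"
    and r: "inj_on (r :: 'a set \<Rightarrow> nat) L" and "i < n"
  shows "\<exists>c\<in>cochains L i. swap_cochain c = (\<lambda>e. (- 1) ^ Suc i * c e) \<and>
     (\<lambda>e. x (Suc i) e - y (Suc i) e) = coboundary L ori i c"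
  using \<open>i < n\<close>
proof (induction i)
  case 0
  define c where "c = (\<lambda>e. \<psi> 0 e - \<phi> 0 e)"
  have c: "c \<in> cochains L 0" unfolding c_def
    using x y 0 by (intro cochains_diff) (auto simp: smith_sequence_def)
  have xy: "x 0 = (\<lambda>e. \<psi> 0 e + swap_cochain (\<psi> 0) e)" "y 0 = (\<lambda>e. \<phi> 0 e + swap_cochain (\<phi> 0) e)"
    using x y 0 by (auto simp: smith_sequence_def)
  have "\<psi> 0 e + swap_cochain (\<psi> 0) e = \<phi> 0 e + swap_cochain (\<phi> 0) e" for e
    using \<open>x 0 = y 0\<close> fun_cong[OF xy(1), of e] fun_cong[OF xy(2), of e] by simp
  hence "swap_cochain c = (\<lambda>e. (- 1) ^ Suc 0 * c e)"
    unfolding c_def swap_cochain_diff by (auto simp: fun_eq_iff algebra_simps)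
  moreover have "(\<lambda>e. x (Suc 0) e - y (Suc 0) e) = coboundary L ori 0 c"
    using x y 0 unfolding c_def coboundary_diff by (auto simp: smith_sequence_def)
  ultimately show ?case using c by blast
next
  case (Suc i)
  then obtain c where c: "c \<in> cochains L i" "swap_cochain c = (\<lambda>e. (- 1) ^ Suc i * c e)"
     "(\<lambda>e. x (Suc i) e - y (Suc i) e) = coboundary L ori i c" by auto
  define s :: int where "s = (- 1) ^ Suc i"
  have s: "s = 1 \<or> s = - 1" unfolding s_def by (cases "even i") auto
  define b where "b = half_cochain r c"
  have b: "b \<in> cochains L i" "c = (\<lambda>e. b e + s * swap_cochain b e)"
    using half_cochain_sum[OF c(1) r s] c half_cochain_in_cochains by (auto simp: b_def s_def)
  define db where "db = coboundary L ori i b"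
  have db: "db \<in> cochains L (Suc i)" unfolding db_def by (rule coboundary_in_cochains)
  have dc: "coboundary L ori i c = (\<lambda>e. db e + s * swap_cochain db e)"
    by (subst b(2)) (simp add: coboundary_add coboundary_scale coboundary_swap[OF b(1)] db_def)
  \<comment> \<open>Subtracting \<open>db\<close> places the difference of the preimages in the
    kernel of the symmetrization and does not change its coboundary.\<close>
  define d where "d = (\<lambda>e. \<psi> (Suc i) e - \<phi> (Suc i) e - db e)"
  have d: "d \<in> cochains L (Suc i)" unfolding d_def
    using x y Suc.prems by (intro cochains_diff db) (auto simp: smith_sequence_def)
  have xs: "x (Suc i) = (\<lambda>e. \<psi> (Suc i) e + s * swap_cochain (\<psi> (Suc i)) e)"
    using x Suc.prems unfolding s_def smith_sequence_def by blast
  have ys: "y (Suc i) = (\<lambda>e. \<phi> (Suc i) e + s * swap_cochain (\<phi> (Suc i)) e)"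
    using y Suc.prems unfolding s_def smith_sequence_def by blast
  have "d e + s * swap_cochain d e = 0" for e
    using fun_cong[OF c(3), of e] fun_cong[OF xs, of e] fun_cong[OF ys, of e] fun_cong[OF dc, of e]
    unfolding d_def swap_cochain_diff by (simp add: algebra_simps)
  hence "swap_cochain d e = - s * d e" for e
    using s by (smt (verit, best) mult_cancel_right1 mult_minus_left)
  hence "swap_cochain d = (\<lambda>e. - s * d e)" by blast
  hence "swap_cochain d = (\<lambda>e. (- 1) ^ Suc (Suc i) * d e)" by (simp add: s_def)
  moreover have "coboundary L ori (Suc i) db = (\<lambda>e. 0)"
    unfolding db_def using b(1) by (rule coboundary_coboundary)
  hence "coboundary L ori (Suc i) d = (\<lambda>e. x (Suc (Suc i)) e - y (Suc (Suc i)) e)"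
    using x y Suc.prems unfolding d_def coboundary_diff by (auto simp: smith_sequence_def)
  ultimately show ?case using d by metis
qed

text \<open>The reference sequence: it depends on an order of the simplices but on no map, so
  geometric sequences and integrated ones can be compared with it.\<close>

primrec smith_cochain :: "('a set \<Rightarrow> nat) \<Rightarrow> nat \<Rightarrow> 'a cochain" where
  "smith_cochain r 0 = (\<lambda>e. if e \<in> deleted_cells L 0 then 1 else 0)"
| "smith_cochain r (Suc i) = coboundary L ori i (half_cochain r (smith_cochain r i))"

lemma smith_cochain_in_cochains: "smith_cochain r i \<in> cochains L i"
proof (cases i)
  case 0
  thus ?thesis by (simp add: cochains_def)
qed (simp add: coboundary_in_cochains)

lemma coboundary_smith_cochain: "coboundary L ori i (smith_cochain r i) = (\<lambda>e. 0)"
proof (cases i)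
  case 0
  have edge: "raw_coboundary ori (smith_cochain r 0) \<sigma> \<tau> = 0"
    if st: "(\<sigma>, \<tau>) \<in> deleted_cells L 1" for \<sigma> \<tau>
  proof -
    have L: "\<sigma> \<in> L" "\<tau> \<in> L" "\<sigma> \<inter> \<tau> = {}" "simplex_dim \<sigma> + simplex_dim \<tau> = 1"
      using st by (auto simp: deleted_cells_def)
    have zero: "(\<Sum>v\<in>\<rho>. incidence ori \<rho> v) = 0" if "\<rho> \<in> L" "simplex_dim \<rho> = 1" for \<rho>
    proof -
      have "card \<rho> = 2" using that by (auto simp: simplex_dim_def)
      then obtain u v where "\<rho> = {u, v}" "u \<noteq> v" by (auto simp: card_2_iff)
      thus ?thesis using incidence_edge[of u v] that by simp
    qed
    have vertex: "\<exists>v. \<rho> = {v}" if "\<rho> \<in> L" "simplex_dim \<rho> = 0" for \<rho>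
    proof -
      have "card \<rho> > 0" using that finite_simplex nonempty_simplex by (simp add: card_gt_0_iff)
      hence "card \<rho> = 1" using that by (simp add: simplex_dim_def)
      thus ?thesis by (auto simp: card_1_singleton_iff)
    qed
    consider "simplex_dim \<sigma> = 1" "simplex_dim \<tau> = 0" | "simplex_dim \<sigma> = 0" "simplex_dim \<tau> = 1"
      using L(4) by linarith
    thus ?thesis
    proof cases
      case 1
      then obtain w where w: "\<tau> = {w}" using vertex L by blast
      have "smith_cochain r 0 (\<sigma> - {v}, \<tau>) = 1" if "v \<in> \<sigma>" for v
      proof -
        have "\<sigma> \<noteq> {v}" using 1 by (auto simp: simplex_dim_def)
        thus ?thesis using 1 L that facet_in[of \<sigma> v] simplex_dim_remove[of \<sigma> v] finite_simplex[of \<sigma>]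
          by (auto simp: deleted_cells_def)
      qed
      thus ?thesis using zero[OF L(1) 1(1)] w
        by (simp add: raw_coboundary_def del: smith_cochain.simps) simp
    next
      case 2
      then obtain w where w: "\<sigma> = {w}" using vertex L by blast
      have "smith_cochain r 0 (\<sigma>, \<tau> - {v}) = 1" if "v \<in> \<tau>" for v
      proof -
        have "\<tau> \<noteq> {v}" using 2 by (auto simp: simplex_dim_def)
        thus ?thesis using 2 L that facet_in[of \<tau> v] simplex_dim_remove[of \<tau> v] finite_simplex[of \<tau>]
          by (auto simp: deleted_cells_def)
      qed
      thus ?thesis using zero[OF L(2) 2(2)] w
        by (simp add: raw_coboundary_def del: smith_cochain.simps) simp
    qed
  qed
  show ?thesis unfolding 0
    by (rule ext, clarify) (use edge in \<open>simp add: coboundary_apply del: smith_cochain.simps\<close>)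
next
  case (Suc j)
  thus ?thesis
    by (simp add: coboundary_coboundary half_cochain_in_cochains smith_cochain_in_cochains)
qed

text \<open>The symmetry in degree \<open>Suc i\<close> is the cocycle condition in degree
  \<open>i\<close>: the coboundary of a cochain written as a half plus or minus its swap is
  zero.\<close>

lemma smith_cochain_decompose:
  assumes r: "inj_on r L"
  shows "swap_cochain (smith_cochain r i) = (\<lambda>e. (- 1) ^ i * smith_cochain r i e) \<and>
     smith_cochain r i = (\<lambda>e. half_cochain r (smith_cochain r i) e
       + (- 1) ^ i * swap_cochain (half_cochain r (smith_cochain r i)) e)"
proof -
  have sgn: "(- 1::int) ^ i = 1 \<or> (- 1::int) ^ i = - 1" for i by (cases "even i") auto
  have *: "smith_cochain r i = (\<lambda>e. half_cochain r (smith_cochain r i) e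
       + (- 1) ^ i * swap_cochain (half_cochain r (smith_cochain r i)) e)"
    if "swap_cochain (smith_cochain r i) = (\<lambda>e. (- 1) ^ i * smith_cochain r i e)" for i
    using smith_cochain_in_cochains r sgn that by (rule half_cochain_sum)
  have "swap_cochain (smith_cochain r i) = (\<lambda>e. (- 1) ^ i * smith_cochain r i e)"
  proof (induction i)
    case 0
    have "swap_cochain (smith_cochain r 0) (\<sigma>, \<tau>) = smith_cochain r 0 (\<sigma>, \<tau>)" for \<sigma> \<tau>
      using deleted_cells_swap[of \<sigma> \<tau> L 0] by (auto simp: swap_cochain_apply deleted_cells_def)
    thus ?case by (auto simp: fun_eq_iff simp del: smith_cochain.simps)
  next
    case (Suc i)
    define h where "h = half_cochain r (smith_cochain r i)"
    have h: "h \<in> cochains L i" unfolding h_def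
      by (intro half_cochain_in_cochains smith_cochain_in_cochains)
    have "(\<lambda>e. 0) = coboundary L ori i (\<lambda>e. h e + (- 1) ^ i * swap_cochain h e)"
      using coboundary_smith_cochain[of i r] *[OF Suc.IH] by (simp add: h_def)
    also have "\<dots> = (\<lambda>e. coboundary L ori i h e + (- 1) ^ i * swap_cochain (coboundary L ori i h) e)"
      by (simp add: coboundary_add coboundary_scale coboundary_swap[OF h])
    finally have z: "coboundary L ori i h e + (- 1) ^ i * swap_cochain (coboundary L ori i h) e = 0" for e
      by (metis (no_types))
    have "swap_cochain (coboundary L ori i h) e = (- 1) ^ Suc i * coboundary L ori i h e" for e
      using z[of e] by (cases "even i") auto
    thus ?case by (auto simp: h_def)
  qed
  with * show ?thesis by blast
qed

lemma smith_sequence_smith_cochain: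
  assumes "inj_on r L"
  shows "smith_sequence n (smith_cochain r) (\<lambda>i. half_cochain r (smith_cochain r i))"
  unfolding smith_sequence_def
  using smith_cochain_decompose[OF assms]
  by (auto intro: half_cochain_in_cochains smith_cochain_in_cochains)

text \<open>\<open>first_cell\<close> prefers the larger first factor, so the half of the cochain of
  degree one vanishes on a vertex times an edge. Hence the cochain of degree two vanishes on a
  vertex times a triangle, by symmetry also in the other order, and the halving and the coboundary
  pass this on to all higher degrees. It supplies the vanishing that integration over the hexagon
  asks for.\<close>

lemma smith_cochain_vertex:
  assumes r: "inj_on r L" and "i \<ge> 2"
  shows "smith_cochain r i ({u}, \<tau>) = 0 \<and> smith_cochain r i (\<tau>, {u}) = 0"
proof -
  have half_empty: "half_cochain r (smith_cochain r i) ({}, \<tau>) = 0" for i \<tau>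
    using smith_cochain_in_cochains by (intro cochain_empty(1) half_cochain_in_cochains)
  have "smith_cochain r i ({u}, \<tau>) = 0 \<and> smith_cochain r i (\<tau>, {u}) = 0" for \<tau>
    using \<open>i \<ge> 2\<close>
  proof (induction i arbitrary: \<tau> rule: dec_induct)
    case base
    have half: "half_cochain r (smith_cochain r 1) ({u}, \<tau> - {w}) = 0" if "({u}, \<tau>) \<in> deleted_cells L 2" "w \<in> \<tau>" for w
    proof -
      have "card \<tau> = 3" "finite \<tau>" using that finite_simplex by (auto simp: deleted_cells_def simplex_dim_def)
      hence "\<not> first_cell r {u} (\<tau> - {w})" using that by (simp add: first_cell_def)
      thus ?thesis by (simp add: half_cochain_def)
    qed
    have "smith_cochain r (Suc 1) ({u}, \<tau>) = 0"
      unfolding smith_cochain.simps(2)[of r 1] coboundary_apply raw_coboundary_def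
      using half half_empty by (simp add: numeral_2_eq_2 del: smith_cochain.simps)
    hence "smith_cochain r 2 ({u}, \<tau>) = 0" by (simp add: numeral_2_eq_2)
    moreover have "swap_cochain (smith_cochain r 2) (\<tau>, {u}) = smith_cochain r 2 (\<tau>, {u})"
      using smith_cochain_decompose[OF r, of 2] by simp
    ultimately show ?case by (simp add: swap_cochain_apply)
  next
    case (step i)
    have "half_cochain r (smith_cochain r i) ({u}, \<tau>') = 0" for \<tau>'
      using step.IH by (simp add: half_cochain_def)
    hence "smith_cochain r (Suc i) ({u}, \<tau>) = 0"
      unfolding smith_cochain.simps(2) coboundary_apply raw_coboundary_def
      using half_empty by simp
    moreover have "swap_cochain (smith_cochain r (Suc i)) (\<tau>, {u}) = (- 1) ^ Suc i * smith_cochain r (Suc i) (\<tau>, {u})"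
      using smith_cochain_decompose[OF r, of "Suc i"] by simp
    ultimately show ?case by (auto simp: swap_cochain_apply simp del: smith_cochain.simps)
  qed
  thus ?thesis by blast
qed

end

section \<open>The join with three points\<close>

definition cone_simplex :: "3 \<Rightarrow> 'a set \<Rightarrow> (3 + 'a) set" where
  "cone_simplex i \<sigma> = insert (Inl i) (Inr ` \<sigma>)"

lemma cone_simplex_inj: "cone_simplex i \<sigma> = cone_simplex j \<tau> \<longleftrightarrow> i = j \<and> \<sigma> = \<tau>"
  by (auto simp: cone_simplex_def)

lemma cone_simplex_neq: "cone_simplex i \<sigma> \<noteq> Inr ` \<tau>" "Inr ` \<tau> \<noteq> cone_simplex i \<sigma>"
  by (auto simp: cone_simplex_def)

lemma cone_simplex_empty: "cone_simplex i {} = {Inl i}"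
  by (simp add: cone_simplex_def)

lemma cone_simplex_remove:
  "cone_simplex i \<sigma> - {Inl i} = Inr ` \<sigma>" "cone_simplex i \<sigma> - {Inr v} = cone_simplex i (\<sigma> - {v})"
  by (auto simp: cone_simplex_def)

lemma cone_simplex_Int: "cone_simplex i \<sigma> \<inter> cone_simplex j \<tau> = {} \<longleftrightarrow> i \<noteq> j \<and> \<sigma> \<inter> \<tau> = {}"
  "cone_simplex i \<sigma> \<inter> Inr ` \<tau> = {} \<longleftrightarrow> \<sigma> \<inter> \<tau> = {}" "Inr ` \<tau> \<inter> cone_simplex i \<sigma> = {} \<longleftrightarrow> \<tau> \<inter> \<sigma> = {}"
  by (auto simp: cone_simplex_def)

lemma simplex_dim_cone: "finite \<sigma> \<Longrightarrow> simplex_dim (cone_simplex i \<sigma>) = card \<sigma>"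
proof -
  assume "finite \<sigma>"
  moreover have "card (Inr ` \<sigma> :: (3 + 'a) set) = card \<sigma>" by (intro card_image) auto
  ultimately show ?thesis by (auto simp: simplex_dim_def cone_simplex_def card_insert_if)
qed

lemma simplex_dim_Inr: "simplex_dim (Inr ` \<sigma>) = simplex_dim \<sigma>"
  by (simp add: simplex_dim_def card_image)

lemma join_simplex_iff:
  "S \<in> simplicial_join three_points K \<longleftrightarrow>
    (\<exists>i \<sigma>. S = cone_simplex i \<sigma> \<and> (\<sigma> = {} \<or> \<sigma> \<in> K)) \<or> (\<exists>\<sigma>. S = Inr ` \<sigma> \<and> \<sigma> \<in> K \<and> \<sigma> \<noteq> {})"
  (is "?l \<longleftrightarrow> ?r")
proof
  assume ?l
  then obtain A B where AB: "S = A <+> B" "S \<noteq> {}" "A = {} \<or> (\<exists>i. A = {i})" "B = {} \<or> B \<in> K"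
    unfolding simplicial_join_def three_points_def by blast
  consider "A = {}" | i where "A = {i}" using AB(3) by blast
  thus ?r
  proof cases
    case 1
    with AB have "S = Inr ` B" "B \<noteq> {}" "B \<in> K" by (auto simp: Plus_def)
    thus ?r by blast
  next
    case 2
    with AB have "S = cone_simplex i B" by (auto simp: Plus_def cone_simplex_def)
    with AB show ?r by blast
  qed
next
  assume ?r
  thus ?l
  proof (elim disjE exE conjE)
    fix i \<sigma> assume *: "S = cone_simplex i \<sigma>" "\<sigma> \<in> K"
    hence "S = {i} <+> \<sigma>" "S \<noteq> {}" by (auto simp: Plus_def cone_simplex_def)
    with * show ?l unfolding simplicial_join_def three_points_def by blast
  next
    fix i \<sigma> assume *: "S = cone_simplex i \<sigma>" "\<sigma> = {}"
    hence "S = {i} <+> \<sigma>" "S \<noteq> {}" by (auto simp: Plus_def cone_simplex_def)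
    with * show ?l unfolding simplicial_join_def three_points_def by blast
  next
    fix \<sigma> assume *: "S = Inr ` \<sigma>" "\<sigma> \<in> K" "\<sigma> \<noteq> {}"
    hence "S = {} <+> \<sigma>" "S \<noteq> {}" by (auto simp: Plus_def)
    with * show ?l unfolding simplicial_join_def three_points_def by blast
  qed
qed

lemma abstract_complex_join:
  fixes K :: "'a set set"
  assumes K: "abstract_complex K"
  shows "abstract_complex (simplicial_join three_points K)"
  unfolding abstract_complex_def
proof (intro conjI ballI allI impI)
  have "simplicial_join three_points K \<subseteq>
    (\<Union>i. cone_simplex i ` insert {} K) \<union> (`) Inr ` K"
    unfolding join_simplex_iff by (force simp: join_simplex_iff)
  moreover have "finite K" using K by (simp add: abstract_complex_def)
  ultimately show "finite (simplicial_join three_points K)"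
    by (elim finite_subset) auto
next
  fix S assume "S \<in> simplicial_join three_points K"
  thus "finite S" "S \<noteq> {}" using K
    by (auto simp: join_simplex_iff abstract_complex_def cone_simplex_def)
next
  fix S R assume S: "S \<in> simplicial_join three_points K" and R: "R \<noteq> {} \<and> R \<subseteq> S"
  define B where "B = Inr -` R"
  have sub: "B \<subseteq> \<sigma> \<Longrightarrow> \<sigma> = {} \<or> \<sigma> \<in> K \<Longrightarrow> B = {} \<or> B \<in> K" for \<sigma>
    using K unfolding abstract_complex_def by blast
  obtain \<sigma> where \<sigma>: "\<sigma> = {} \<or> \<sigma> \<in> K" "Inr -` S = \<sigma>" and i: "\<exists>i. Inl -` S \<subseteq> {i}"
    using S by (auto simp: join_simplex_iff cone_simplex_def)
  have B: "B = {} \<or> B \<in> K"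
    using R \<sigma> by (intro sub[of \<sigma>]) (auto simp: B_def)
  obtain i where i: "Inl -` R \<subseteq> {i}" using i R by blast
  have dec: "R = Inl ` (Inl -` R) \<union> Inr ` B"
  proof (rule Set.set_eqI)
    fix x show "x \<in> R \<longleftrightarrow> x \<in> Inl ` (Inl -` R) \<union> Inr ` B" by (cases x) (auto simp: B_def)
  qed
  show "R \<in> simplicial_join three_points K"
  proof (cases "Inl -` R = {}")
    case True
    hence "R = Inr ` B" "B \<noteq> {}" using dec R by auto
    thus ?thesis using B by (auto simp: join_simplex_iff)
  next
    case False
    hence "Inl -` R = {i}" using i by blast
    hence "R = cone_simplex i B" using dec by (simp add: cone_simplex_def)
    thus ?thesis using B by (auto simp: join_simplex_iff)
  qed
qed

lemma has_dimension_join: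
  assumes K: "abstract_complex K" and d: "has_dimension K d"
  shows "has_dimension (simplicial_join three_points K) (d + 1)"
proof -
  have fin: "finite \<sigma>" "\<sigma> \<noteq> {}" if "\<sigma> \<in> K" for \<sigma> using K that by (auto simp: abstract_complex_def)
  have card: "card \<sigma> = Suc (simplex_dim \<sigma>)" if "\<sigma> \<in> K" for \<sigma>
    using fin[OF that] by (simp add: simplex_dim_def card_gt_0_iff)
  show ?thesis unfolding has_dimension_def
  proof (intro conjI ballI)
    fix S assume "S \<in> simplicial_join three_points K"
    then consider i \<sigma> where "S = cone_simplex i \<sigma>" "\<sigma> = {} \<or> \<sigma> \<in> K" | \<sigma> where "S = Inr ` \<sigma>" "\<sigma> \<in> K"
      by (auto simp: join_simplex_iff)
    thus "simplex_dim S \<le> d + 1"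
    proof cases
      case 1
      have "card \<sigma> \<le> d + 1" using 1(2) card d by (auto simp: has_dimension_def)
      moreover have "finite \<sigma>" using 1(2) fin by auto
      ultimately show ?thesis using 1(1) by (simp add: simplex_dim_cone)
    next
      case 2
      thus ?thesis using d by (auto simp: simplex_dim_Inr has_dimension_def intro: le_SucI)
    qed
  next
    obtain \<sigma> where "\<sigma> \<in> K" "simplex_dim \<sigma> = d" using d by (auto simp: has_dimension_def)
    thus "\<exists>S\<in>simplicial_join three_points K. simplex_dim S = d + 1"
      using fin card by (intro bexI[of _ "cone_simplex 1 \<sigma>"]) (auto simp: simplex_dim_cone join_simplex_iff)
  qed
qed

text \<open>The coefficients of the fundamental cycle of the deleted join of three points, a hexagon
  whose edges are the pairs \<open>(i, j)\<close> with \<open>i \<noteq> j\<close>.\<close>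

definition hexagon_sign :: "3 \<Rightarrow> 3 \<Rightarrow> int" where
  "hexagon_sign i j = (if j = i + 1 then 1 else if i = j + 1 then - 1 else 0)"

lemma hexagon_sign_values:
  "hexagon_sign 1 1 = 0" "hexagon_sign 1 2 = 1" "hexagon_sign 1 3 = - 1"
  "hexagon_sign 2 1 = - 1" "hexagon_sign 2 2 = 0" "hexagon_sign 2 3 = 1"
  "hexagon_sign 3 1 = 1" "hexagon_sign 3 2 = - 1" "hexagon_sign 3 3 = 0"
  by (simp_all add: hexagon_sign_def)

lemma hexagon_sign_swap: "hexagon_sign j i = - hexagon_sign i j"
  using exhaust_3[of i] exhaust_3[of j] by (auto simp: hexagon_sign_values)

lemma hexagon_sign_diag [simp]: "hexagon_sign i i = 0"
  using exhaust_3[of i] by (auto simp: hexagon_sign_values)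

lemma sum_hexagon_sign: "(\<Sum>i\<in>UNIV. hexagon_sign i j) = 0" "(\<Sum>j\<in>UNIV. hexagon_sign i j) = 0"
  using exhaust_3[of i] exhaust_3[of j] by (auto simp: hexagon_sign_values sum_3)

text \<open>The hexagon is a circle, so a cochain on its edges with zero integral is a coboundary,
  up to signs. Its vertices are the three points of the first copy, with values \<open>w\<close>,
  and those of the second copy, with values \<open>u\<close>.\<close>

lemma hexagon_cochain_exact:
  fixes \<theta> :: "3 \<Rightarrow> 3 \<Rightarrow> int"
  assumes "(\<Sum>i\<in>UNIV. \<Sum>j\<in>UNIV. hexagon_sign i j * \<theta> i j) = 0"
  shows "\<exists>u w. \<forall>i j. i \<noteq> j \<longrightarrow> \<theta> i j = u j + w i"
proof -
  have s: "\<theta> 1 2 - \<theta> 1 3 - \<theta> 2 1 + \<theta> 2 3 + \<theta> 3 1 - \<theta> 3 2 = 0"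
    using assms by (simp add: sum_3 hexagon_sign_values)
  \<comment> \<open>Normalize \<open>w 1 = 0\<close> and propagate along five of the six edges; the
    vanishing integral settles the edge \<open>(2, 1)\<close>.\<close>
  define w where "w = (\<lambda>i::3. if i = 1 then 0 else if i = 2 then \<theta> 2 3 - \<theta> 1 3 else \<theta> 3 2 - \<theta> 1 2)"
  define u where "u = (\<lambda>j::3. if j = 1 then \<theta> 3 1 - w 3 else \<theta> 1 j)"
  have "\<theta> i j = u j + w i" if "i \<noteq> j" for i j
    using exhaust_3[of i] exhaust_3[of j] that s by (auto simp: u_def w_def)
  thus ?thesis by blast
qed

section \<open>Orientations of cones and integration over the hexagon\<close>

locale three_join = K: oriented_complex K oriK
  + J: oriented_complex "simplicial_join three_points K" oriJ
  for K :: "'a set set" and oriK :: "'a set \<Rightarrow> 'a list" and oriJ :: "(3 + 'a) set \<Rightarrow> (3 + 'a) list"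
begin

abbreviation "J \<equiv> simplicial_join three_points K"

text \<open>\<open>oriJ\<close> is unrelated to \<open>oriK\<close>. This sign and
  \<open>base_sign\<close> compare it with the orientations induced from \<open>oriK\<close>, the
  apex of a cone coming first; multiplying by them makes the formulas below independent of
  \<open>oriJ\<close>.\<close>

definition cone_sign :: "3 \<Rightarrow> 'a set \<Rightarrow> int" where
  "cone_sign i \<sigma> = reorder_sign (Inl i # map Inr (oriK \<sigma>)) (oriJ (cone_simplex i \<sigma>))"

definition base_sign :: "'a set \<Rightarrow> int" where
  "base_sign \<sigma> = reorder_sign (map Inr (oriK \<sigma>)) (oriJ (Inr ` \<sigma>))"

lemma cone_in: "\<sigma> \<in> K \<Longrightarrow> cone_simplex i \<sigma> \<in> J" and base_in: "\<sigma> \<in> K \<Longrightarrow> Inr ` \<sigma> \<in> J"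
  using K.nonempty_simplex by (auto simp: join_simplex_iff)

lemma dim_cone: "\<sigma> \<in> K \<Longrightarrow> simplex_dim (cone_simplex i \<sigma>) = Suc (simplex_dim \<sigma>)"
  using K.finite_simplex[of \<sigma>] K.nonempty_simplex[of \<sigma>]
  by (simp add: simplex_dim_cone) (simp add: simplex_dim_def card_gt_0_iff)

lemma cone_cell:
  assumes "\<sigma> \<in> K" "\<tau> \<in> K" "\<sigma> \<inter> \<tau> = {}" "i \<noteq> j"
  shows "(cone_simplex i \<sigma>, cone_simplex j \<tau>) \<in> deleted_cells J n \<longleftrightarrow>
    simplex_dim \<sigma> + simplex_dim \<tau> + 2 = n"
  using assms by (auto simp: deleted_cells_def cone_in dim_cone cone_simplex_Int)

lemma same_elems_cone:
  "\<sigma> \<in> K \<Longrightarrow> same_elems (Inl i # map Inr (oriK \<sigma>)) (oriJ (cone_simplex i \<sigma>))"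
  using K.ori_simplex J.ori_simplex[OF cone_in]
  by (auto simp: same_elems_def distinct_map cone_simplex_def)

lemma same_elems_base:
  "\<sigma> \<in> K \<Longrightarrow> same_elems (map Inr (oriK \<sigma>)) (oriJ (Inr ` \<sigma>))"
  using K.ori_simplex J.ori_simplex[OF base_in]
  by (auto simp: same_elems_def distinct_map)

lemma cone_sign_square: "\<sigma> \<in> K \<Longrightarrow> cone_sign i \<sigma> * cone_sign i \<sigma> = 1"
  unfolding cone_sign_def by (intro reorder_sign_square same_elems_cone)

lemma base_sign_square: "\<sigma> \<in> K \<Longrightarrow> base_sign \<sigma> * base_sign \<sigma> = 1"
  unfolding base_sign_def by (intro reorder_sign_square same_elems_base)

lemma incidence_apex:
  assumes s: "\<sigma> \<in> K"
  shows "cone_sign i \<sigma> * incidence oriJ (cone_simplex i \<sigma>) (Inl i) = base_sign \<sigma>"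
proof -
  let ?a = "Inl i # map Inr (oriK \<sigma>)" and ?b = "Inl i # oriJ (Inr ` \<sigma>)"
  have se: "same_elems ?a ?b" "same_elems ?b (oriJ (cone_simplex i \<sigma>))"
    using same_elems_base[OF s] same_elems_cone[OF s, of i] by (auto simp: same_elems_def)
  have "base_sign \<sigma> = reorder_sign ?a ?b" unfolding base_sign_def
    using same_elems_base[OF s] by (intro reorder_sign_Cons[symmetric]) auto
  moreover have "incidence oriJ (cone_simplex i \<sigma>) (Inl i) = reorder_sign ?b (oriJ (cone_simplex i \<sigma>))"
    by (simp add: incidence_def cone_simplex_remove)
  ultimately have "base_sign \<sigma> * incidence oriJ (cone_simplex i \<sigma>) (Inl i) = cone_sign i \<sigma>"
    using reorder_sign_trans[OF se] by (simp add: cone_sign_def)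
  moreover have "incidence oriJ (cone_simplex i \<sigma>) (Inl i) * incidence oriJ (cone_simplex i \<sigma>) (Inl i) = 1"
    using K.nonempty_simplex[OF s]
    by (intro J.incidence_square cone_in s) (auto simp: cone_simplex_def)
  ultimately show ?thesis by (metis mult.assoc mult.right_neutral)
qed

text \<open>A vertex of the base has to pass the apex on its way to the front of the list, hence the
  minus sign. The proof compares two routes from \<open>?a\<close> to \<open>?o\<close>: one through
  \<open>?b\<close> and \<open>?c\<close>, the other through \<open>?d\<close>.\<close>

lemma incidence_cone:
  assumes s: "\<sigma> \<in> K" "v \<in> \<sigma>" "\<sigma> \<noteq> {v}"
  shows "cone_sign i \<sigma> * incidence oriJ (cone_simplex i \<sigma>) (Inr v) =
    - (incidence oriK \<sigma> v * cone_sign i (\<sigma> - {v}))"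
proof -
  have f: "\<sigma> - {v} \<in> K" using s by (intro K.facet_in)
  let ?x = "map Inr (oriK (\<sigma> - {v}))" and ?o = "oriJ (cone_simplex i \<sigma>)"
  let ?a = "Inr v # Inl i # ?x" and ?b = "Inl i # Inr v # ?x" and ?c = "Inl i # map Inr (oriK \<sigma>)"
  let ?d = "Inr v # oriJ (cone_simplex i (\<sigma> - {v}))"
  note k = K.ori_simplex[OF s(1)] K.ori_simplex[OF f]
  note c = same_elems_cone[OF s(1), of i] same_elems_cone[OF f, of i]
  have m: "set ?o = insert (Inl i) (Inr ` \<sigma>)" "distinct ?o"
    "set (oriJ (cone_simplex i (\<sigma> - {v}))) = insert (Inl i) (Inr ` (\<sigma> - {v}))"
    "distinct (oriJ (cone_simplex i (\<sigma> - {v})))"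
    using c k by (auto simp: same_elems_def)
  have se: "same_elems ?a ?b" "same_elems ?b ?c" "same_elems ?c ?o" "same_elems ?a ?d" "same_elems ?d ?o"
     "same_elems (v # oriK (\<sigma> - {v})) (oriK \<sigma>)"
    using k m s by (auto simp: same_elems_def distinct_map)
  have 1: "reorder_sign ?a ?b = - 1"
    using se(1) by (intro reorder_sign_swap) (auto simp: same_elems_def)
  have 2: "reorder_sign ?b ?c = incidence oriK \<sigma> v"
  proof -
    have "reorder_sign ?b ?c = reorder_sign (map (Inr :: 'a \<Rightarrow> 3 + 'a) (v # oriK (\<sigma> - {v}))) (map Inr (oriK \<sigma>))"
      using se(2) by (subst reorder_sign_Cons) (auto simp: same_elems_def)
    also have "\<dots> = reorder_sign (v # oriK (\<sigma> - {v})) (oriK \<sigma>)"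
      using se(6) by (rule reorder_sign_map) auto
    finally show ?thesis by (simp add: incidence_def)
  qed
  have 3: "reorder_sign ?a ?d = cone_sign i (\<sigma> - {v})"
    unfolding cone_sign_def using c(2) k by (intro reorder_sign_Cons) auto
  have 4: "reorder_sign ?d ?o = incidence oriJ (cone_simplex i \<sigma>) (Inr v)"
    by (simp add: incidence_def cone_simplex_remove)
  have ao: "same_elems ?a ?c" "same_elems ?a ?o" using se by (auto simp: same_elems_def)
  have "reorder_sign ?a ?o = - (incidence oriK \<sigma> v * cone_sign i \<sigma>)"
  proof -
    have ac: "reorder_sign ?a ?c = - incidence oriK \<sigma> v"
      using reorder_sign_trans[OF se(1,2)] 1 2 by simp
    show ?thesis
      using reorder_sign_trans[OF ao(1) se(3)] unfolding ac by (simp add: cone_sign_def)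
  qed
  moreover have "reorder_sign ?a ?o = cone_sign i (\<sigma> - {v}) * incidence oriJ (cone_simplex i \<sigma>) (Inr v)"
    using reorder_sign_trans[OF se(4,5)] 3 4 by simp
  ultimately have *: "cone_sign i (\<sigma> - {v}) * incidence oriJ (cone_simplex i \<sigma>) (Inr v)
     = - (incidence oriK \<sigma> v * cone_sign i \<sigma>)" by simp
  have "cone_sign i \<sigma> * incidence oriJ (cone_simplex i \<sigma>) (Inr v)
    = cone_sign i \<sigma> * (cone_sign i (\<sigma> - {v}) * cone_sign i (\<sigma> - {v})) * incidence oriJ (cone_simplex i \<sigma>) (Inr v)"
    using cone_sign_square[OF f] by simp
  also have "\<dots> = cone_sign i \<sigma> * cone_sign i (\<sigma> - {v}) * (- (incidence oriK \<sigma> v * cone_sign i \<sigma>))"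
    unfolding *[symmetric] by (simp add: algebra_simps)
  also have "\<dots> = - (incidence oriK \<sigma> v * cone_sign i (\<sigma> - {v})) * (cone_sign i \<sigma> * cone_sign i \<sigma>)"
    by (simp add: algebra_simps)
  finally show ?thesis using cone_sign_square[OF s(1)] by simp
qed

text \<open>The slant product with the fundamental cycle of the hexagon, a pair of cones being read
  as an edge of the hexagon times a cell of the deleted product of \<open>K\<close>. Up to a global
  sign, \<open>(- 1) ^ simplex_dim \<sigma>\<close> is the cost of moving the second apex past
  \<open>\<sigma>\<close>.\<close>

definition hexagon_integral :: "(3 + 'a) cochain \<Rightarrow> 'a cochain" where
  "hexagon_integral C = (\<lambda>(\<sigma>, \<tau>). if \<sigma> \<in> K \<and> \<tau> \<in> K \<and> \<sigma> \<inter> \<tau> = {} then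
     (- 1) ^ simplex_dim \<sigma> * (\<Sum>i\<in>UNIV. \<Sum>j\<in>UNIV. hexagon_sign i j *
        (cone_sign i \<sigma> * cone_sign j \<tau> * C (cone_simplex i \<sigma>, cone_simplex j \<tau>))) else 0)"

lemma hexagon_integral_apply:
  "\<sigma> \<in> K \<Longrightarrow> \<tau> \<in> K \<Longrightarrow> \<sigma> \<inter> \<tau> = {} \<Longrightarrow> hexagon_integral C (\<sigma>, \<tau>) =
     (- 1) ^ simplex_dim \<sigma> * (\<Sum>i\<in>UNIV. \<Sum>j\<in>UNIV. hexagon_sign i j *
        (cone_sign i \<sigma> * cone_sign j \<tau> * C (cone_simplex i \<sigma>, cone_simplex j \<tau>)))"
  by (simp add: hexagon_integral_def)

lemma hexagon_integral_in_cochains: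
  assumes "C \<in> cochains J (m + 2)"
  shows "hexagon_integral C \<in> cochains K m"
  unfolding cochains_def
proof (rule CollectI, clarify)
  fix \<sigma> \<tau> assume n: "(\<sigma>, \<tau>) \<notin> deleted_cells K m"
  show "hexagon_integral C (\<sigma>, \<tau>) = 0"
  proof (cases "\<sigma> \<in> K \<and> \<tau> \<in> K \<and> \<sigma> \<inter> \<tau> = {}")
    case True
    have "hexagon_sign i j * (cone_sign i \<sigma> * cone_sign j \<tau> * C (cone_simplex i \<sigma>, cone_simplex j \<tau>)) = 0" for i j
    proof (cases "i = j")
      case False
      have "(cone_simplex i \<sigma>, cone_simplex j \<tau>) \<notin> deleted_cells J (m + 2)"
        using True False n by (subst cone_cell) (auto simp: deleted_cells_def)
      thus ?thesis using assms by (auto simp: cochains_def)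
    qed simp
    thus ?thesis
      unfolding hexagon_integral_def by (simp only: prod.case sum.neutral_const mult_zero_right if_cancel)
  qed (auto simp: hexagon_integral_def)
qed

lemma hexagon_integral_add:
  "hexagon_integral (\<lambda>e. a e + b e) = (\<lambda>e. hexagon_integral a e + hexagon_integral b e)"
  by (auto simp: fun_eq_iff hexagon_integral_def algebra_simps sum.distrib)

lemma hexagon_integral_diff:
  "hexagon_integral (\<lambda>e. a e - b e) = (\<lambda>e. hexagon_integral a e - hexagon_integral b e)"
  by (auto simp: fun_eq_iff hexagon_integral_def algebra_simps sum_subtractf)

lemma hexagon_integral_scale:
  "hexagon_integral (\<lambda>e. k * a e) = (\<lambda>e. k * hexagon_integral a e)"
  by (auto simp: fun_eq_iff hexagon_integral_def algebra_simps sum_distrib_left)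

lemma hexagon_integral_swap:
  "hexagon_integral (swap_cochain C) = swap_cochain (hexagon_integral C)"
proof (rule ext, clarify)
  fix \<sigma> \<tau>
  show "hexagon_integral (swap_cochain C) (\<sigma>, \<tau>) = swap_cochain (hexagon_integral C) (\<sigma>, \<tau>)"
  proof (cases "\<sigma> \<in> K \<and> \<tau> \<in> K \<and> \<sigma> \<inter> \<tau> = {}")
    case True
    let ?p = "simplex_dim \<sigma>" and ?q = "simplex_dim \<tau>"
    \<comment> \<open>Coning both factors changes the exponent of the swap from
      \<open>?p * ?q\<close> to \<open>Suc ?p * Suc ?q\<close>. The minus sign left over is absorbed
      by the antisymmetry of \<open>hexagon_sign\<close>.\<close>
    have sgn: "(- 1::int) ^ ?p * (- 1) ^ (Suc ?p * Suc ?q) = - ((- 1) ^ (?p * ?q) * (- 1) ^ ?q)"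
      by (cases "even ?p"; cases "even ?q") auto
    have "hexagon_integral (swap_cochain C) (\<sigma>, \<tau>) = (- 1) ^ ?p *
      (\<Sum>i\<in>UNIV. \<Sum>j\<in>UNIV. hexagon_sign i j *
        (cone_sign i \<sigma> * cone_sign j \<tau> * ((- 1) ^ (Suc ?p * Suc ?q) * C (cone_simplex j \<tau>, cone_simplex i \<sigma>))))"
      using True by (simp add: hexagon_integral_apply swap_cochain_apply dim_cone)
    also have "\<dots> = ((- 1) ^ ?p * (- 1) ^ (Suc ?p * Suc ?q)) *
      (\<Sum>i\<in>UNIV. \<Sum>j\<in>UNIV. hexagon_sign i j *
        (cone_sign i \<sigma> * cone_sign j \<tau> * C (cone_simplex j \<tau>, cone_simplex i \<sigma>)))"
      by (simp add: sum_distrib_left algebra_simps)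
    also have "\<dots> = (- 1) ^ (?p * ?q) * (- 1) ^ ?q *
      (\<Sum>i\<in>UNIV. \<Sum>j\<in>UNIV. hexagon_sign j i *
        (cone_sign j \<tau> * cone_sign i \<sigma> * C (cone_simplex j \<tau>, cone_simplex i \<sigma>)))"
    proof -
      have "(\<Sum>i\<in>UNIV. \<Sum>j\<in>UNIV. hexagon_sign i j *
        (cone_sign i \<sigma> * cone_sign j \<tau> * C (cone_simplex j \<tau>, cone_simplex i \<sigma>)))
        = (\<Sum>i\<in>UNIV. \<Sum>j\<in>UNIV. - (hexagon_sign j i *
        (cone_sign j \<tau> * cone_sign i \<sigma> * C (cone_simplex j \<tau>, cone_simplex i \<sigma>))))"
      proof (intro sum.cong refl)
        fix i j
        have "hexagon_sign i j = - hexagon_sign j i" by (rule hexagon_sign_swap)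
        thus "hexagon_sign i j * (cone_sign i \<sigma> * cone_sign j \<tau> * C (cone_simplex j \<tau>, cone_simplex i \<sigma>))
          = - (hexagon_sign j i * (cone_sign j \<tau> * cone_sign i \<sigma> * C (cone_simplex j \<tau>, cone_simplex i \<sigma>)))"
          by (simp only: minus_mult_left mult.commute[of "cone_sign i \<sigma>"])
      qed
      thus ?thesis unfolding sgn by (simp add: sum_negf)
    qed
    also have "\<dots> = swap_cochain (hexagon_integral C) (\<sigma>, \<tau>)"
      using True by (subst sum.swap) (simp add: hexagon_integral_apply swap_cochain_apply Int_commute)
    finally show ?thesis .
  next
    case False
    hence "\<not> (\<tau> \<in> K \<and> \<sigma> \<in> K \<and> \<tau> \<inter> \<sigma> = {})" by auto
    with False show ?thesis unfolding swap_cochain_apply unfolding hexagon_integral_def by auto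
  qed
qed

lemma sum_cone:
  assumes "finite \<sigma>"
  shows "(\<Sum>x\<in>cone_simplex i \<sigma>. f x) = f (Inl i) + (\<Sum>v\<in>\<sigma>. f (Inr v))"
  unfolding cone_simplex_def using assms
  by (subst sum.insert) (auto simp: sum.reindex)

text \<open>The hypothesis holds in degrees above two for the Smith cochains; without it the
  restriction to the cells over the vertices \<open>{Inl i}\<close> would contribute.\<close>

lemma hexagon_integral_coboundary:
  assumes C: "C \<in> cochains J (m + 2)"
    and zero: "\<And>i S. C ({Inl i}, S) = 0" "\<And>i S. C (S, {Inl i}) = 0"
  shows "hexagon_integral (coboundary J oriJ (m + 2) C) = coboundary K oriK m (hexagon_integral C)"
proof (rule ext, clarify)
  fix \<sigma> \<tau>
  show "hexagon_integral (coboundary J oriJ (m + 2) C) (\<sigma>, \<tau>) = coboundary K oriK m (hexagon_integral C) (\<sigma>, \<tau>)"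
  proof (cases "(\<sigma>, \<tau>) \<in> deleted_cells K (Suc m)")
    case False
    have "hexagon_integral (coboundary J oriJ (m + 2) C) \<in> cochains K (Suc m)"
      using coboundary_in_cochains[of J oriJ "m + 2" C] by (intro hexagon_integral_in_cochains) simp
    thus ?thesis using False by (auto simp: cochains_def coboundary_apply)
  next
    case True
    hence L: "\<sigma> \<in> K" "\<tau> \<in> K" "\<sigma> \<inter> \<tau> = {}" and m: "simplex_dim \<sigma> + simplex_dim \<tau> = Suc m"
      by (auto simp: deleted_cells_def)
    have fin: "finite \<sigma>" "finite \<tau>" using L K.finite_simplex by auto
    let ?s = "(- 1::int) ^ simplex_dim \<sigma>"
    define A where "A = (\<lambda>\<sigma> \<tau> i j. cone_sign i \<sigma> * cone_sign j \<tau> * C (cone_simplex i \<sigma>, cone_simplex j \<tau>))"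
    have AI: "hexagon_integral C (\<sigma>', \<tau>') = (- 1) ^ simplex_dim \<sigma>' * (\<Sum>i\<in>UNIV. \<Sum>j\<in>UNIV. hexagon_sign i j * A \<sigma>' \<tau>' i j)"
      if "\<sigma>' \<in> K" "\<tau>' \<in> K" "\<sigma>' \<inter> \<tau>' = {}" for \<sigma>' \<tau>'
      using that by (simp add: hexagon_integral_apply A_def)
    \<comment> \<open>\<open>incidence_cone\<close> does not apply to \<open>\<sigma> = {v}\<close>.
      There both sides contain a value of \<open>C\<close> with the factor \<open>{Inl i}\<close>,
      which vanishes by assumption.\<close>
    have term1: "cone_sign i \<sigma> * incidence oriJ (cone_simplex i \<sigma>) (Inr v) * (cone_sign j \<tau> * C (cone_simplex i (\<sigma> - {v}), cone_simplex j \<tau>))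
       = - (incidence oriK \<sigma> v * A (\<sigma> - {v}) \<tau> i j)" if "v \<in> \<sigma>" for v i j
    proof (cases "\<sigma> = {v}")
      case True
      thus ?thesis by (simp add: A_def cone_simplex_empty zero)
    next
      case False
      show ?thesis using incidence_cone[OF L(1) that False, of i] by (simp add: A_def)
    qed
    have term2: "cone_sign j \<tau> * incidence oriJ (cone_simplex j \<tau>) (Inr v) * (cone_sign i \<sigma> * C (cone_simplex i \<sigma>, cone_simplex j (\<tau> - {v})))
       = - (incidence oriK \<tau> v * A \<sigma> (\<tau> - {v}) i j)" if "v \<in> \<tau>" for v i j
    proof (cases "\<tau> = {v}")
      case True
      thus ?thesis by (simp add: A_def cone_simplex_empty zero)
    next
      case False
      show ?thesis using incidence_cone[OF L(2) that False, of j] by (simp add: A_def)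
    qed
    \<comment> \<open>The terms that remove an apex depend on only one of \<open>i\<close> and
      \<open>j\<close>. They disappear in the double sum because the rows and columns of
      \<open>hexagon_sign\<close> sum to zero, that is, because the hexagon is a cycle.\<close>
    define U where "U = (\<lambda>j. base_sign \<sigma> * cone_sign j \<tau> * C (Inr ` \<sigma>, cone_simplex j \<tau>))"
    define W where "W = (\<lambda>i. base_sign \<tau> * cone_sign i \<sigma> * C (cone_simplex i \<sigma>, Inr ` \<tau>))"
    have raw: "cone_sign i \<sigma> * cone_sign j \<tau> * raw_coboundary oriJ C (cone_simplex i \<sigma>) (cone_simplex j \<tau>)
       = U j - (\<Sum>v\<in>\<sigma>. incidence oriK \<sigma> v * A (\<sigma> - {v}) \<tau> i j)
         - ?s * (W i - (\<Sum>w\<in>\<tau>. incidence oriK \<tau> w * A \<sigma> (\<tau> - {w}) i j))" for i j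
    proof -
      have "cone_sign i \<sigma> * cone_sign j \<tau> * raw_coboundary oriJ C (cone_simplex i \<sigma>) (cone_simplex j \<tau>) =
        (cone_sign i \<sigma> * incidence oriJ (cone_simplex i \<sigma>) (Inl i)) * (cone_sign j \<tau> * C (Inr ` \<sigma>, cone_simplex j \<tau>))
        + (\<Sum>v\<in>\<sigma>. cone_sign i \<sigma> * incidence oriJ (cone_simplex i \<sigma>) (Inr v) * (cone_sign j \<tau> * C (cone_simplex i (\<sigma> - {v}), cone_simplex j \<tau>)))
        - ?s * ((cone_sign j \<tau> * incidence oriJ (cone_simplex j \<tau>) (Inl j)) * (cone_sign i \<sigma> * C (cone_simplex i \<sigma>, Inr ` \<tau>))
        + (\<Sum>v\<in>\<tau>. cone_sign j \<tau> * incidence oriJ (cone_simplex j \<tau>) (Inr v) * (cone_sign i \<sigma> * C (cone_simplex i \<sigma>, cone_simplex j (\<tau> - {v})))))"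
        by (simp add: raw_coboundary_def sum_cone[OF fin(1)] sum_cone[OF fin(2)] cone_simplex_remove
            dim_cone[OF L(1)] sum_distrib_left sum_negf algebra_simps)
      also have "\<dots> = U j + (\<Sum>v\<in>\<sigma>. - (incidence oriK \<sigma> v * A (\<sigma> - {v}) \<tau> i j))
        - ?s * (W i + (\<Sum>w\<in>\<tau>. - (incidence oriK \<tau> w * A \<sigma> (\<tau> - {w}) i j)))"
        using term1 term2 by (simp add: incidence_apex L U_def W_def)
      finally show ?thesis by (simp add: sum_negf)
    qed
    have cell: "coboundary J oriJ (m + 2) C (cone_simplex i \<sigma>, cone_simplex j \<tau>) = raw_coboundary oriJ C (cone_simplex i \<sigma>) (cone_simplex j \<tau>)"
      if "i \<noteq> j" for i j
      using cone_cell[OF L that] m by (simp add: coboundary_apply)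
    have UW: "(\<Sum>i\<in>UNIV. \<Sum>j\<in>UNIV. hexagon_sign i j * U j) = 0" "(\<Sum>i\<in>UNIV. \<Sum>j\<in>UNIV. hexagon_sign i j * W i) = 0"
      by (subst sum.swap, simp add: sum_hexagon_sign flip: sum_distrib_right)
         (simp add: sum_hexagon_sign flip: sum_distrib_right)
    define B where "B = (\<lambda>\<sigma> \<tau>. \<Sum>i\<in>UNIV. \<Sum>j\<in>UNIV. hexagon_sign i j * A \<sigma> \<tau> i j)"
    have Bs: "(\<Sum>i\<in>UNIV. \<Sum>j\<in>UNIV. hexagon_sign i j * (\<Sum>v\<in>S. c v * A (F v) (G v) i j)) = (\<Sum>v\<in>S. c v * B (F v) (G v))"
      for S :: "'a set" and c F G
    proof -
      have "(\<Sum>i\<in>UNIV. \<Sum>j\<in>UNIV. hexagon_sign i j * (\<Sum>v\<in>S. c v * A (F v) (G v) i j))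
        = (\<Sum>i\<in>UNIV. \<Sum>v\<in>S. \<Sum>j\<in>UNIV. c v * (hexagon_sign i j * A (F v) (G v) i j))"
        by (intro sum.cong refl, subst sum.swap) (simp add: sum_distrib_left algebra_simps)
      also have "\<dots> = (\<Sum>v\<in>S. \<Sum>i\<in>UNIV. \<Sum>j\<in>UNIV. c v * (hexagon_sign i j * A (F v) (G v) i j))"
        by (rule sum.swap)
      finally show ?thesis by (simp add: B_def sum_distrib_left)
    qed
    have "hexagon_integral (coboundary J oriJ (m + 2) C) (\<sigma>, \<tau>) =
      ?s * (\<Sum>i\<in>UNIV. \<Sum>j\<in>UNIV. hexagon_sign i j *
        (cone_sign i \<sigma> * cone_sign j \<tau> * raw_coboundary oriJ C (cone_simplex i \<sigma>) (cone_simplex j \<tau>)))"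
    proof -
      have eq: "hexagon_sign i j * (cone_sign i \<sigma> * cone_sign j \<tau> * coboundary J oriJ (m + 2) C (cone_simplex i \<sigma>, cone_simplex j \<tau>))
         = hexagon_sign i j * (cone_sign i \<sigma> * cone_sign j \<tau> * raw_coboundary oriJ C (cone_simplex i \<sigma>) (cone_simplex j \<tau>))" for i j
        using cell[of i j] by (cases "i = j") auto
      show ?thesis unfolding hexagon_integral_apply[OF L] by (simp only: eq)
    qed
    also have "\<dots> = ?s * ((\<Sum>i\<in>UNIV. \<Sum>j\<in>UNIV. hexagon_sign i j * U j)
       - (\<Sum>i\<in>UNIV. \<Sum>j\<in>UNIV. hexagon_sign i j * (\<Sum>v\<in>\<sigma>. incidence oriK \<sigma> v * A (\<sigma> - {v}) \<tau> i j))
       - ?s * ((\<Sum>i\<in>UNIV. \<Sum>j\<in>UNIV. hexagon_sign i j * W i)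
           - (\<Sum>i\<in>UNIV. \<Sum>j\<in>UNIV. hexagon_sign i j * (\<Sum>w\<in>\<tau>. incidence oriK \<tau> w * A \<sigma> (\<tau> - {w}) i j))))"
    proof -
      have "(\<Sum>i\<in>UNIV. \<Sum>j\<in>UNIV. hexagon_sign i j * (a i j - b i j - ?s * (c i j - d i j))) =
         (\<Sum>i\<in>UNIV. \<Sum>j\<in>UNIV. hexagon_sign i j * a i j) - (\<Sum>i\<in>UNIV. \<Sum>j\<in>UNIV. hexagon_sign i j * b i j)
         - ?s * ((\<Sum>i\<in>UNIV. \<Sum>j\<in>UNIV. hexagon_sign i j * c i j) - (\<Sum>i\<in>UNIV. \<Sum>j\<in>UNIV. hexagon_sign i j * d i j))"
        for a b c d
        by (simp add: algebra_simps sum.distrib sum_subtractf sum_distrib_left)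
      from this[of "\<lambda>i j. U j" _ "\<lambda>i j. W i"] show ?thesis unfolding raw by simp
    qed
    also have "\<dots> = ?s * (?s * (\<Sum>w\<in>\<tau>. incidence oriK \<tau> w * B \<sigma> (\<tau> - {w})) - (\<Sum>v\<in>\<sigma>. incidence oriK \<sigma> v * B (\<sigma> - {v}) \<tau>))"
      unfolding UW Bs by simp
    also have "\<dots> = (\<Sum>v\<in>\<sigma>. incidence oriK \<sigma> v * (- ?s * B (\<sigma> - {v}) \<tau>)) +
       ?s * (\<Sum>w\<in>\<tau>. incidence oriK \<tau> w * (?s * B \<sigma> (\<tau> - {w})))"
      by (simp add: sum_distrib_left sum_negf algebra_simps)
    also have "\<dots> = raw_coboundary oriK (hexagon_integral C) \<sigma> \<tau>"
    proof -
      have z: "A {} \<tau>' i j = 0" "A \<sigma>' {} i j = 0" for \<sigma>' \<tau>' i j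
        by (simp_all add: A_def cone_simplex_empty zero)
      have "- ?s * B (\<sigma> - {v}) \<tau> = hexagon_integral C (\<sigma> - {v}, \<tau>)" if "v \<in> \<sigma>" for v
      proof (cases "\<sigma> = {v}")
        case True
        moreover have "{} \<notin> K" using K.nonempty_simplex by blast
        ultimately show ?thesis by (simp add: B_def z hexagon_integral_def)
      next
        case False
        thus ?thesis using AI[of "\<sigma> - {v}" \<tau>] K.facet_in[OF L(1) False] L simplex_dim_remove[OF fin(1) that False]
          by (simp add: B_def Diff_Int_distrib2)
      qed
      moreover have "?s * B \<sigma> (\<tau> - {w}) = hexagon_integral C (\<sigma>, \<tau> - {w})" if "w \<in> \<tau>" for w
      proof (cases "\<tau> = {w}")
        case True
        moreover have "{} \<notin> K" using K.nonempty_simplex by blast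
        ultimately show ?thesis by (simp add: B_def z hexagon_integral_def)
      next
        case False
        have "\<sigma> \<inter> (\<tau> - {w}) = {}" using L by auto
        thus ?thesis using AI[of \<sigma> "\<tau> - {w}"] K.facet_in[OF L(2) False] L
          by (simp add: B_def)
      qed
      ultimately show ?thesis by (simp add: raw_coboundary_def)
    qed
    finally show ?thesis using True by (simp add: coboundary_apply)
  qed
qed

end

section \<open>The Smith cochains of the join and the shift by two degrees\<close>

lemma (in oriented_complex) ori_singleton:
  assumes "{v} \<in> L"
  shows "ori {v} = [v]"
proof -
  have "length (ori {v}) = 1" using length_ori[OF assms] by simp
  then obtain z where "ori {v} = [z]" by (metis One_nat_def length_0_conv length_Suc_conv)
  thus ?thesis using ori_simplex(2)[OF assms] by simp
qed

lemma (in oriented_complex) card_pos: "\<sigma> \<in> L \<Longrightarrow> card \<sigma> = Suc (simplex_dim \<sigma>)"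
  using finite_simplex[of \<sigma>] nonempty_simplex[of \<sigma>]
  by (simp add: simplex_dim_def card_gt_0_iff)

context three_join
begin

text \<open>In degree one the halving keeps only edge times vertex, so just the vertices of the
  second edge are removed. Expanding twice gives an alternating sum of four comparisons between the
  vertices of the two edges; the assumption on \<open>r\<close> settles two of them, and they leave
  the constant \<open>- 1\<close>.\<close>

lemma smith_cochain_two:
  assumes r: "\<And>i a. {a} \<in> K \<Longrightarrow> r {Inl i} < r {Inr a}"
    and ab: "{a} \<in> K" "{b} \<in> K" "a \<noteq> b" and ij: "i \<noteq> j"
  shows "cone_sign i {a} * cone_sign j {b} * J.smith_cochain r 2 (cone_simplex i {a}, cone_simplex j {b})
    = - (of_bool (r {Inr a} < r {Inr b}) - 1 + of_bool (r {Inl i} < r {Inl j}))"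
proof -
  define e where "e = cone_simplex i {a}"
  define e' where "e' = cone_simplex j {b}"
  have e: "e = {Inl i, Inr a}" "e' = {Inl j, Inr b}" by (auto simp: e_def e'_def cone_simplex_def)
  have eJ: "e \<in> J" "e' \<in> J" unfolding e_def e'_def using ab by (auto intro: cone_in)
  have d: "simplex_dim e = 1" "simplex_dim e' = 1" by (auto simp: e simplex_dim_def)
  have V: "{Inl i} \<in> J" "{Inr a} \<in> J" "{Inl j} \<in> J" "{Inr b} \<in> J"
    using J.face_in[OF eJ(1)] J.face_in[OF eJ(2)] by (auto simp: e)
  define A where "A = J.smith_cochain r"
  have A1: "A 1 (e, {w}) = incidence oriJ e (Inl i) * (of_bool (r {Inr a} < r {w}) - of_bool (r {Inl i} < r {w}))"
    if w: "{w} \<in> J" "w \<notin> e" for w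
  proof -
    have cell: "(e, {w}) \<in> deleted_cells J 1" using w eJ d by (auto simp: deleted_cells_def simplex_dim_def[of "{w}"])
    have h: "half_cochain r (A 0) ({u}, {w}) = of_bool (r {u} < r {w})" if "{u} \<in> J" "u \<noteq> w" for u
      using that w by (auto simp: half_cochain_def first_cell_def A_def deleted_cells_def simplex_dim_def)
    have h0: "half_cochain r (A 0) (e, {}) = 0"
      using J.smith_cochain_in_cochains unfolding A_def
      by (intro J.cochain_empty(2) half_cochain_in_cochains)
    have eq: "e - {Inl i} = {Inr a}" "e - {Inr a} = {Inl i}" by (auto simp: e)
    have "A (Suc 0) (e, {w}) = raw_coboundary oriJ (half_cochain r (A 0)) e {w}"
      unfolding A_def J.smith_cochain.simps(2) coboundary_apply using cell by simp
    also have "\<dots> = (\<Sum>v\<in>{Inl i, Inr a}. incidence oriJ e v * half_cochain r (A 0) (e - {v}, {w}))"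
      unfolding raw_coboundary_def using h0 by (simp flip: e)
    also have "\<dots> = incidence oriJ e (Inl i) * half_cochain r (A 0) ({Inr a}, {w})
       + incidence oriJ e (Inr a) * half_cochain r (A 0) ({Inl i}, {w})"
      by (simp add: eq)
    also have "incidence oriJ e (Inr a) = - incidence oriJ e (Inl i)"
      using J.incidence_edge[of "Inl i" "Inr a"] eJ(1) unfolding e by simp
    finally show ?thesis using h[OF V(2)] h[OF V(1)] w by (auto simp: e algebra_simps)
  qed
  have cell2: "(e, e') \<in> deleted_cells J 2"
    using eJ d ab ij by (auto simp: deleted_cells_def e)
  have "A (Suc 1) (e, e') = raw_coboundary oriJ (half_cochain r (A 1)) e e'"
    unfolding A_def J.smith_cochain.simps(2)[of r 1] coboundary_apply using cell2 by (simp add: numeral_2_eq_2)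
  also have "\<dots> = - (\<Sum>w\<in>{Inl j, Inr b}. incidence oriJ e' w * half_cochain r (A 1) (e, e' - {w}))"
  proof -
    have "half_cochain r (A 1) (e - {v}, e') = 0" if "v \<in> e" for v
      using that by (auto simp: half_cochain_def first_cell_def e)
    thus ?thesis unfolding raw_coboundary_def d by (simp flip: e)
  qed
  also have "\<dots> = - (incidence oriJ e' (Inl j) * half_cochain r (A 1) (e, {Inr b})
       + incidence oriJ e' (Inr b) * half_cochain r (A 1) (e, {Inl j}))"
  proof -
    have "e' - {Inl j} = {Inr b}" "e' - {Inr b} = {Inl j}" by (auto simp: e)
    thus ?thesis by simp
  qed
  also have "incidence oriJ e' (Inr b) = - incidence oriJ e' (Inl j)"
    using J.incidence_edge[of "Inl j" "Inr b"] eJ(2) unfolding e by simp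
  moreover have "half_cochain r (A 1) (e, {w}) = A 1 (e, {w})" for w
    by (auto simp: half_cochain_def first_cell_def e)
  ultimately have A2: "A 2 (e, e') = - (incidence oriJ e' (Inl j) * (A 1 (e, {Inr b}) - A 1 (e, {Inl j})))"
    by (simp add: numeral_2_eq_2 algebra_simps)
  have one: "cone_sign k {c} * incidence oriJ (cone_simplex k {c}) (Inl k) = 1" if "{c} \<in> K" for k c
  proof -
    have "{Inr c} \<in> J" using base_in[OF that] by simp
    hence "base_sign {c} = 1"
      using that by (simp add: base_sign_def K.ori_singleton J.ori_singleton)
    thus ?thesis using incidence_apex[OF that, of k] by simp
  qed
  have w: "Inr b \<notin> e" "Inl j \<notin> e" using ab ij by (auto simp: e)
  have "cone_sign i {a} * cone_sign j {b} * A 2 (e, e') =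
     - ((cone_sign i {a} * incidence oriJ e (Inl i)) * (cone_sign j {b} * incidence oriJ e' (Inl j)) *
     ((of_bool (r {Inr a} < r {Inr b}) - of_bool (r {Inl i} < r {Inr b}))
      - (of_bool (r {Inr a} < r {Inl j}) - of_bool (r {Inl i} < r {Inl j}))))"
    unfolding A2 A1[OF V(4) w(1)] A1[OF V(3) w(2)] by (simp add: algebra_simps)
  also have "\<dots> = - (of_bool (r {Inr a} < r {Inr b}) - 1 + of_bool (r {Inl i} < r {Inl j}))"
    using r[OF ab(1), of j] r[OF ab(2), of i] one ab unfolding e_def e'_def by simp
  finally show ?thesis by (simp add: A_def e_def e'_def)
qed

lemma hexagon_integral_smith_cochain_two:
  assumes r: "\<And>i a. {a} \<in> K \<Longrightarrow> r {Inl i} < r {Inr a}"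
    and lt: "r {Inl 1} < r {Inl 2}" "r {Inl 2} < r {Inl 3}"
  shows "hexagon_integral (J.smith_cochain r 2) = (\<lambda>e. - K.smith_cochain rK 0 e)"
proof (rule ext, clarify)
  fix \<sigma> \<tau>
  show "hexagon_integral (J.smith_cochain r 2) (\<sigma>, \<tau>) = - K.smith_cochain rK 0 (\<sigma>, \<tau>)"
  proof (cases "(\<sigma>, \<tau>) \<in> deleted_cells K 0")
    case False
    have "hexagon_integral (J.smith_cochain r 2) \<in> cochains K 0"
      using J.smith_cochain_in_cochains[of r 2] by (intro hexagon_integral_in_cochains) (simp add: numeral_2_eq_2 del: J.smith_cochain.simps)
    thus ?thesis using False by (auto simp: cochains_def)
  next
    case True
    hence L: "\<sigma> \<in> K" "\<tau> \<in> K" "\<sigma> \<inter> \<tau> = {}" "simplex_dim \<sigma> = 0" "simplex_dim \<tau> = 0"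
      by (auto simp: deleted_cells_def)
    then obtain a b where ab: "\<sigma> = {a}" "\<tau> = {b}"
      using K.card_pos[of \<sigma>] K.card_pos[of \<tau>] by (auto simp: card_1_singleton_iff)
    define t :: int where "t = of_bool (r {Inr a} < r {Inr b}) - 1"
    define A where "A = J.smith_cochain r 2"
    have "hexagon_integral A (\<sigma>, \<tau>) = (\<Sum>i\<in>UNIV. \<Sum>j\<in>UNIV. hexagon_sign i j *
        (cone_sign i \<sigma> * cone_sign j \<tau> * A (cone_simplex i \<sigma>, cone_simplex j \<tau>)))"
      using L by (simp add: hexagon_integral_apply)
    also have "\<dots> = (\<Sum>i\<in>UNIV. \<Sum>j\<in>UNIV. hexagon_sign i j * (- (t + of_bool (r {Inl i} < r {Inl j}))))"
    proof (intro sum.cong refl)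
      fix i j
      show "hexagon_sign i j * (cone_sign i \<sigma> * cone_sign j \<tau> * A (cone_simplex i \<sigma>, cone_simplex j \<tau>)) =
         hexagon_sign i j * (- (t + of_bool (r {Inl i} < r {Inl j})))"
        using smith_cochain_two[OF r, of a b i j] L ab by (cases "i = j") (auto simp: A_def t_def)
    qed
    \<comment> \<open>The summand \<open>t\<close> integrates to zero, and over \<open>i < j\<close>
      the coefficients of the hexagon add up to \<open>1 - 1 + 1\<close>.\<close>
    also have "\<dots> = - 1"
      using lt by (simp add: sum_3 hexagon_sign_values)
    finally show ?thesis using True by (simp add: A_def)
  qed
qed

text \<open>The negated integrals of the Smith cochains of degrees \<open>i + 2\<close> form a Smith
  sequence of \<open>K\<close> that starts with the constant cocycle, so
  \<open>smith_sequence_unique\<close> applies. The negation, which comes from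
  \<open>hexagon_integral_smith_cochain_two\<close>, explains the plus sign in the
  conclusion.\<close>

lemma smith_cochain_join:
  assumes rK: "inj_on rK K" and rJ: "inj_on rJ J"
    and r: "\<And>i a. {a} \<in> K \<Longrightarrow> rJ {Inl i} < rJ {Inr a}"
    and lt: "rJ {Inl 1} < rJ {Inl 2}" "rJ {Inl 2} < rJ {Inl 3}"
  shows "\<exists>c\<in>cochains K n. swap_cochain c = (\<lambda>e. (- 1) ^ Suc n * c e) \<and>
    (\<lambda>e. K.smith_cochain rK (Suc n) e + hexagon_integral (J.smith_cochain rJ (n + 3)) e) = coboundary K oriK n c"
proof -
  define A where "A = J.smith_cochain rJ"
  define x where "x = (\<lambda>i e. (- 1) * hexagon_integral (A (i + 2)) e)"
  define \<psi> where "\<psi> = (\<lambda>i e. (- 1) * hexagon_integral (half_cochain rJ (A (i + 2))) e)"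
  have hA: "half_cochain rJ (A i) \<in> cochains J i" for i
    unfolding A_def by (intro half_cochain_in_cochains J.smith_cochain_in_cochains)
  have seq: "K.smith_sequence (Suc n) x \<psi>"
    unfolding K.smith_sequence_def
  proof (intro allI impI conjI)
    fix i
    show "\<psi> i \<in> cochains K i" unfolding \<psi>_def by (intro cochains_scale hexagon_integral_in_cochains hA)
    have "A (i + 2) = (\<lambda>e. half_cochain rJ (A (i + 2)) e
       + (- 1) ^ i * swap_cochain (half_cochain rJ (A (i + 2))) e)"
      using conjunct2[OF J.smith_cochain_decompose[OF rJ, of "i + 2"]] unfolding A_def power_add by simp
    hence "hexagon_integral (A (i + 2)) = hexagon_integral (\<lambda>e. half_cochain rJ (A (i + 2)) e
       + (- 1) ^ i * swap_cochain (half_cochain rJ (A (i + 2))) e)" by simp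
    thus "x i = (\<lambda>e. \<psi> i e + (- 1) ^ i * swap_cochain (\<psi> i) e)"
      unfolding x_def \<psi>_def hexagon_integral_add hexagon_integral_scale hexagon_integral_swap swap_cochain_scale
      by (auto simp: fun_eq_iff)
    have z: "half_cochain rJ (A (i + 2)) ({Inl k}, S) = 0" "half_cochain rJ (A (i + 2)) (S, {Inl k}) = 0" for k S
      using J.smith_cochain_vertex[OF rJ, of "i + 2"] by (auto simp: half_cochain_def A_def)
    have "A (Suc i + 2) = coboundary J oriJ (i + 2) (half_cochain rJ (A (i + 2)))"
      by (simp add: A_def)
    thus "x (Suc i) = coboundary K oriK i (\<psi> i)"
      unfolding x_def \<psi>_def coboundary_scale using hexagon_integral_coboundary[OF hA z] by simp
  qed
  have x0: "K.smith_cochain rK 0 = x 0"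
    using hexagon_integral_smith_cochain_two[OF r lt, of rK] unfolding x_def A_def
    by (simp add: numeral_2_eq_2 del: J.smith_cochain.simps K.smith_cochain.simps)
  have e: "(\<lambda>e. K.smith_cochain rK (Suc n) e + hexagon_integral (J.smith_cochain rJ (n + 3)) e) =
     (\<lambda>e. K.smith_cochain rK (Suc n) e - x (Suc n) e)"
    unfolding x_def A_def by (simp add: numeral_3_eq_3 del: J.smith_cochain.simps K.smith_cochain.simps)
  show ?thesis unfolding e
    using K.smith_sequence_smith_cochain[OF rK] seq x0 rK lessI by (rule K.smith_sequence_unique)
qed

section \<open>Lifting along the integral, and exactness in the top degree\<close>

lemma incidence_apex_base:
  assumes "\<sigma> \<in> K"
  shows "incidence oriJ (cone_simplex i \<sigma>) (Inl i) * base_sign \<sigma> = cone_sign i \<sigma>" (is "?I * ?b = ?c")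
proof -
  have "?I * ?b = (?c * ?c) * (?I * ?b)" using cone_sign_square[OF assms] by simp
  also have "\<dots> = ?c * ((?c * ?I) * ?b)" by (simp only: ac_simps)
  also have "\<dots> = ?c" using incidence_apex[OF assms, of i] base_sign_square[OF assms] by simp
  finally show ?thesis .
qed

text \<open>A section of the integration map, concentrated on one edge of the hexagon.\<close>

definition hexagon_lift :: "'a cochain \<Rightarrow> (3 + 'a) cochain" where
  "hexagon_lift b = (\<lambda>(S, T). let \<sigma> = Inr -` S; \<tau> = Inr -` T in
     if S = cone_simplex 1 \<sigma> \<and> T = cone_simplex 2 \<tau> \<and> \<sigma> \<in> K \<and> \<tau> \<in> K
     then (- 1) ^ simplex_dim \<sigma> * cone_sign 1 \<sigma> * cone_sign 2 \<tau> * b (\<sigma>, \<tau>) else 0)"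

lemma cone_vimage: "Inr -` cone_simplex i \<sigma> = \<sigma>"
  by (auto simp: cone_simplex_def)

lemma hexagon_lift_in_cochains:
  assumes "b \<in> cochains K m"
  shows "hexagon_lift b \<in> cochains J (m + 2)"
  unfolding cochains_def
proof (rule CollectI, clarify)
  fix S T assume n: "(S, T) \<notin> deleted_cells J (m + 2)"
  show "hexagon_lift b (S, T) = 0"
  proof (rule ccontr)
    assume "hexagon_lift b (S, T) \<noteq> 0"
    then obtain \<sigma> \<tau> where st: "S = cone_simplex 1 \<sigma>" "T = cone_simplex 2 \<tau>" "\<sigma> \<in> K" "\<tau> \<in> K" "b (\<sigma>, \<tau>) \<noteq> 0"
      unfolding hexagon_lift_def Let_def by (auto split: if_splits)
    hence "(\<sigma>, \<tau>) \<in> deleted_cells K m" using assms by (auto simp: cochains_def)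
    hence "(S, T) \<in> deleted_cells J (m + 2)"
      using st cone_cell[of \<sigma> \<tau> 1 2 "m + 2"] by (auto simp: deleted_cells_def)
    with n show False by blast
  qed
qed

lemma hexagon_integral_lift:
  assumes b: "b \<in> cochains K m"
  shows "hexagon_integral (hexagon_lift b) = b"
proof (rule ext, clarify)
  fix \<sigma> \<tau>
  show "hexagon_integral (hexagon_lift b) (\<sigma>, \<tau>) = b (\<sigma>, \<tau>)"
  proof (cases "\<sigma> \<in> K \<and> \<tau> \<in> K \<and> \<sigma> \<inter> \<tau> = {}")
    case True
    hence L: "\<sigma> \<in> K" "\<tau> \<in> K" "\<sigma> \<inter> \<tau> = {}" by auto
    have v: "hexagon_lift b (cone_simplex i \<sigma>, cone_simplex j \<tau>) =
      (if i = 1 \<and> j = 2 then (- 1) ^ simplex_dim \<sigma> * cone_sign 1 \<sigma> * cone_sign 2 \<tau> * b (\<sigma>, \<tau>) else 0)" for i j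
      using L by (simp add: hexagon_lift_def cone_vimage cone_simplex_inj)
    have "hexagon_integral (hexagon_lift b) (\<sigma>, \<tau>) =
       ((- 1) ^ simplex_dim \<sigma> * (- 1) ^ simplex_dim \<sigma>) * (cone_sign 1 \<sigma> * cone_sign 1 \<sigma>) * (cone_sign 2 \<tau> * cone_sign 2 \<tau>) * b (\<sigma>, \<tau>)"
      using L by (simp add: hexagon_integral_apply v sum_3 hexagon_sign_values)
    thus ?thesis using L by (simp add: cone_sign_square flip: power_mult_distrib)
  next
    case False
    hence "(\<sigma>, \<tau>) \<notin> deleted_cells K m" by (auto simp: deleted_cells_def)
    thus ?thesis using b False by (auto simp: cochains_def hexagon_integral_def)
  qed
qed

lemma invariant_cochains_iff: "c \<in> invariant_cochains L i \<longleftrightarrow> c \<in> cochains L i \<and> swap_cochain c = c"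
  by (simp add: invariant_cochains_def)

text \<open>The restriction of \<open>\<Theta>\<close> to each hexagon is exact, and in the top dimension the primitives on
  different hexagons do not interfere.\<close>

lemma hexagon_integral_zero_imp_coboundary:
  assumes dim: "has_dimension K d" and \<Theta>: "\<Theta> \<in> invariant_cochains J (2 * d + 2)"
    and zero: "hexagon_integral \<Theta> = (\<lambda>e. 0)" and rK: "inj_on (rK :: 'a set \<Rightarrow> nat) K"
  shows "\<exists>c\<in>invariant_cochains J (2 * d + 1). coboundary J oriJ (2 * d + 1) c = \<Theta>"
proof -
  \<comment> \<open>Halving by the rank of the base simplices keeps or drops whole hexagons, whereas
    an order on the simplices of the join could cut a hexagon apart.\<close>
  define \<beta> where "\<beta> = (\<lambda>(S, T). if rK (Inr -` S) < rK (Inr -` T) then \<Theta> (S, T) else 0)"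
  define top where "top \<sigma> \<tau> \<longleftrightarrow> \<sigma> \<in> K \<and> \<tau> \<in> K \<and> \<sigma> \<inter> \<tau> = {} \<and> simplex_dim \<sigma> = d \<and> simplex_dim \<tau> = d" for \<sigma> \<tau>
  have top_cell: "\<exists>i j \<sigma> \<tau>. S = cone_simplex i \<sigma> \<and> T = cone_simplex j \<tau> \<and> i \<noteq> j \<and> top \<sigma> \<tau>"
    if ST: "(S, T) \<in> deleted_cells J (2 * d + 2)" for S T
  proof -
    have J: "S \<in> J" "T \<in> J" "S \<inter> T = {}" "simplex_dim S + simplex_dim T = 2 * d + 2"
      using ST by (auto simp: deleted_cells_def)
    have "has_dimension J (d + 1)" using K.cpx dim by (rule has_dimension_join)
    hence "simplex_dim S \<le> d + 1" "simplex_dim T \<le> d + 1" using J by (auto simp: has_dimension_def)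
    hence D: "simplex_dim S = Suc d" "simplex_dim T = Suc d" using J(4) by auto
    have top1: "\<exists>i \<sigma>. S = cone_simplex i \<sigma> \<and> \<sigma> \<in> K \<and> simplex_dim \<sigma> = d"
      if S: "S \<in> J" "simplex_dim S = Suc d" for S
    proof -
      consider i where "S = cone_simplex i {}" | i \<sigma> where "S = cone_simplex i \<sigma>" "\<sigma> \<in> K" | \<sigma> where "S = Inr ` \<sigma>" "\<sigma> \<in> K"
        using S(1) unfolding join_simplex_iff by blast
      thus ?thesis
      proof cases
        case 1
        thus ?thesis using S(2) by (simp add: simplex_dim_cone)
      next
        case 2
        thus ?thesis using S(2) dim_cone by auto
      next
        case 3
        hence "simplex_dim S \<le> d" using dim by (auto simp: has_dimension_def simplex_dim_Inr)
        thus ?thesis using S(2) by simp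
      qed
    qed
    obtain i \<sigma> j \<tau> where "S = cone_simplex i \<sigma>" "\<sigma> \<in> K" "simplex_dim \<sigma> = d"
       "T = cone_simplex j \<tau>" "\<tau> \<in> K" "simplex_dim \<tau> = d"
      using top1[OF J(1) D(1)] top1[OF J(2) D(2)] by blast
    thus ?thesis using J(3) by (auto simp: top_def cone_simplex_Int)
  qed
  have \<Theta>': "\<Theta> \<in> cochains J (2 * d + 2)" "swap_cochain \<Theta> = \<Theta>" using \<Theta> by (auto simp: invariant_cochains_def)
  have \<beta>: "\<beta> \<in> cochains J (2 * d + 2)" using \<Theta>'(1) by (auto simp: cochains_def \<beta>_def)
  have neq: "rK \<sigma> \<noteq> rK \<tau>" if "top \<sigma> \<tau>" for \<sigma> \<tau>
  proof -
    have "\<sigma> \<noteq> \<tau>" using that K.nonempty_simplex by (auto simp: top_def)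
    thus ?thesis using inj_onD[OF rK] that unfolding top_def by blast
  qed
  have dec: "\<Theta> e = \<beta> e + swap_cochain \<beta> e" for e
  proof (cases e)
    case (Pair S T)
    show ?thesis
    proof (cases "e \<in> deleted_cells J (2 * d + 2)")
      case True
      then obtain i j \<sigma> \<tau> where st: "S = cone_simplex i \<sigma>" "T = cone_simplex j \<tau>" "top \<sigma> \<tau>"
        using top_cell Pair by blast
      have "\<Theta> (S, T) = (- 1) ^ (simplex_dim S * simplex_dim T) * \<Theta> (T, S)"
        using fun_cong[OF \<Theta>'(2), of "(S, T)"] by (simp add: swap_cochain_apply)
      thus ?thesis using neq[OF st(3)] by (auto simp: Pair \<beta>_def swap_cochain_apply st cone_vimage)
    next
      case False
      thus ?thesis using \<Theta>'(1) \<beta> swap_in_cochains[OF \<beta>]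
        by (simp add: cochains_def del: split_paired_All)
    qed
  qed
  define \<theta> where "\<theta> = (\<lambda>\<sigma> \<tau> i j. cone_sign i \<sigma> * cone_sign j \<tau> * \<beta> (cone_simplex i \<sigma>, cone_simplex j \<tau>))"
  have "\<exists>u w. \<forall>i j. i \<noteq> j \<longrightarrow> \<theta> \<sigma> \<tau> i j = u j + w i" if "top \<sigma> \<tau>" for \<sigma> \<tau>
  proof (rule hexagon_cochain_exact)
    show "(\<Sum>i\<in>UNIV. \<Sum>j\<in>UNIV. hexagon_sign i j * \<theta> \<sigma> \<tau> i j) = 0"
    proof (cases "rK \<sigma> < rK \<tau>")
      case True
      have "hexagon_integral \<Theta> (\<sigma>, \<tau>) = 0" using zero by simp
      hence "(\<Sum>i\<in>UNIV. \<Sum>j\<in>UNIV. hexagon_sign i j *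
        (cone_sign i \<sigma> * cone_sign j \<tau> * \<Theta> (cone_simplex i \<sigma>, cone_simplex j \<tau>))) = 0"
        using that by (simp add: hexagon_integral_apply top_def)
      thus ?thesis using True by (simp add: \<theta>_def \<beta>_def cone_vimage)
    qed (simp add: \<theta>_def \<beta>_def cone_vimage)
  qed
  then obtain u w where uw: "\<And>\<sigma> \<tau> i j. top \<sigma> \<tau> \<Longrightarrow> i \<noteq> j \<Longrightarrow> \<theta> \<sigma> \<tau> i j = u \<sigma> \<tau> j + w \<sigma> \<tau> i"
    by metis
  \<comment> \<open>The primitives found on a hexagon live on its vertices, that is, on the cells
    where one of the two apexes is dropped. The factor \<open>(- 1) ^ Suc d\<close> cancels the sign
    of the second factor in the coboundary.\<close>
  define \<gamma> where "\<gamma> = (\<lambda>(S, T). let \<sigma> = Inr -` S; \<tau> = Inr -` T in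
    if top \<sigma> \<tau> then
      if S = Inr ` \<sigma> then
        (\<Sum>j\<in>UNIV. if T = cone_simplex j \<tau> then base_sign \<sigma> * cone_sign j \<tau> * u \<sigma> \<tau> j else 0)
      else if T = Inr ` \<tau> then
        (\<Sum>i\<in>UNIV. if S = cone_simplex i \<sigma> then (- 1) ^ Suc d * cone_sign i \<sigma> * base_sign \<tau> * w \<sigma> \<tau> i else 0)
      else 0
    else 0)"
  have Inr_vimage: "Inr -` Inr ` \<sigma> = \<sigma>" for \<sigma> :: "'a set" by auto
  have \<gamma>1: "\<gamma> (Inr ` \<sigma>, cone_simplex j \<tau>) = base_sign \<sigma> * cone_sign j \<tau> * u \<sigma> \<tau> j" if "top \<sigma> \<tau>" for \<sigma> \<tau> j
    using that by (simp add: \<gamma>_def cone_vimage Inr_vimage cone_simplex_inj)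
  have \<gamma>2: "\<gamma> (cone_simplex i \<sigma>, Inr ` \<tau>) = (- 1) ^ Suc d * cone_sign i \<sigma> * base_sign \<tau> * w \<sigma> \<tau> i" if "top \<sigma> \<tau>" for \<sigma> \<tau> i
    using that by (simp add: \<gamma>_def cone_vimage Inr_vimage cone_simplex_inj cone_simplex_neq)
  have \<gamma>3: "\<gamma> (cone_simplex i \<sigma>, cone_simplex j \<tau>) = 0" for i \<sigma> j \<tau>
    by (simp add: \<gamma>_def cone_vimage cone_simplex_neq)
  have \<gamma>: "\<gamma> \<in> cochains J (2 * d + 1)"
    unfolding cochains_def
  proof (rule CollectI, clarify)
    fix S T assume n: "(S, T) \<notin> deleted_cells J (2 * d + 1)"
    show "\<gamma> (S, T) = 0"
    proof (rule ccontr)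
      assume nz: "\<gamma> (S, T) \<noteq> 0"
      define \<sigma> where "\<sigma> = Inr -` S"
      define \<tau> where "\<tau> = Inr -` T"
      have t: "top \<sigma> \<tau>" using nz by (auto simp: \<gamma>_def Let_def \<sigma>_def \<tau>_def split: if_splits)
      have "(S = Inr ` \<sigma> \<and> (\<exists>j. T = cone_simplex j \<tau>)) \<or> (T = Inr ` \<tau> \<and> (\<exists>i. S = cone_simplex i \<sigma>))"
      proof (rule ccontr)
        assume n: "\<not> ?thesis"
        have eq: "\<gamma> (S, T) = (if top \<sigma> \<tau> then
      if S = Inr ` \<sigma> then
        (\<Sum>j\<in>UNIV. if T = cone_simplex j \<tau> then base_sign \<sigma> * cone_sign j \<tau> * u \<sigma> \<tau> j else 0)
      else if T = Inr ` \<tau> then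
        (\<Sum>i\<in>UNIV. if S = cone_simplex i \<sigma> then (- 1) ^ Suc d * cone_sign i \<sigma> * base_sign \<tau> * w \<sigma> \<tau> i else 0)
      else 0
    else 0)" by (simp only: \<gamma>_def prod.case Let_def \<sigma>_def \<tau>_def)
        have "S = Inr ` \<sigma> \<Longrightarrow> (\<Sum>j\<in>UNIV. if T = cone_simplex j \<tau> then base_sign \<sigma> * cone_sign j \<tau> * u \<sigma> \<tau> j else 0) = 0"
          by (rule sum.neutral) (use n in auto)
        moreover have "T = Inr ` \<tau> \<Longrightarrow> (\<Sum>i\<in>UNIV. if S = cone_simplex i \<sigma> then (- 1) ^ Suc d * cone_sign i \<sigma> * base_sign \<tau> * w \<sigma> \<tau> i else 0) = 0"
          by (rule sum.neutral) (use n in auto)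
        ultimately have "\<gamma> (S, T) = 0" unfolding eq by presburger
        with nz show False by simp
      qed
      hence "(S, T) \<in> deleted_cells J (2 * d + 1)"
        using t by (auto simp: deleted_cells_def top_def cone_in base_in dim_cone simplex_dim_Inr)
          (auto simp: cone_simplex_def)
      with n show False by blast
    qed
  qed
  have cob: "coboundary J oriJ (2 * d + 1) \<gamma> = \<beta>"
  proof (rule ext, clarify)
    fix S T
    show "coboundary J oriJ (2 * d + 1) \<gamma> (S, T) = \<beta> (S, T)"
    proof (cases "(S, T) \<in> deleted_cells J (2 * d + 2)")
      case False
      thus ?thesis using \<beta> by (auto simp: cochains_def coboundary_apply)
    next
      case True
      then obtain i j \<sigma> \<tau> where st: "S = cone_simplex i \<sigma>" "T = cone_simplex j \<tau>" "i \<noteq> j" "top \<sigma> \<tau>"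
        using top_cell by blast
      hence L: "\<sigma> \<in> K" "\<tau> \<in> K" "finite \<sigma>" "finite \<tau>" "simplex_dim \<sigma> = d" using K.finite_simplex by (auto simp: top_def)
      let ?I = "incidence oriJ (cone_simplex i \<sigma>) (Inl i)" and ?J = "incidence oriJ (cone_simplex j \<tau>) (Inl j)"
      have sq: "?I * base_sign \<sigma> = cone_sign i \<sigma>" "?J * base_sign \<tau> = cone_sign j \<tau>"
        by (intro incidence_apex_base L)+
      have "coboundary J oriJ (2 * d + 1) \<gamma> (S, T) = raw_coboundary oriJ \<gamma> S T"
        using True by (simp add: coboundary_apply)
      \<comment> \<open>Dropping a vertex of \<open>K\<close> leaves a pair of cones, where
        \<open>\<gamma>\<close> vanishes. Only the two apexes contribute, so different hexagons do
        not mix.\<close>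
      also have "\<dots> = ?I * \<gamma> (Inr ` \<sigma>, cone_simplex j \<tau>) - (- 1) ^ d * (?J * \<gamma> (cone_simplex i \<sigma>, Inr ` \<tau>))"
        by (simp add: raw_coboundary_def st(1,2) sum_cone L cone_simplex_remove \<gamma>3 dim_cone)
      also have "\<dots> = (?I * base_sign \<sigma>) * cone_sign j \<tau> * u \<sigma> \<tau> j
         + ((- 1) ^ d * (- 1) ^ d) * cone_sign i \<sigma> * (?J * base_sign \<tau>) * w \<sigma> \<tau> i"
        by (simp add: \<gamma>1[OF st(4)] \<gamma>2[OF st(4)] algebra_simps)
      also have "\<dots> = cone_sign i \<sigma> * cone_sign j \<tau> * \<theta> \<sigma> \<tau> i j"
        unfolding sq uw[OF st(4,3)] by (simp add: algebra_simps flip: power_mult_distrib)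
      also have "\<dots> = (cone_sign i \<sigma> * cone_sign i \<sigma>) * (cone_sign j \<tau> * cone_sign j \<tau>) * \<beta> (S, T)"
        by (simp add: \<theta>_def st)
      finally show ?thesis using cone_sign_square L by simp
    qed
  qed
  define c where "c = (\<lambda>e. \<gamma> e + swap_cochain \<gamma> e)"
  have "c \<in> invariant_cochains J (2 * d + 1)"
    unfolding invariant_cochains_iff c_def swap_cochain_add swap_cochain_involution
    using cochains_add[OF \<gamma> swap_in_cochains[OF \<gamma>]] by (simp add: add.commute)
  moreover have "coboundary J oriJ (2 * d + 1) c = \<Theta>"
    unfolding c_def coboundary_add J.coboundary_swap[OF \<gamma>] cob using dec by auto
  ultimately show ?thesis by blast
qed

text \<open>From the join to \<open>K\<close>, a primitive is integrated and corrected by the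
  cochain \<open>c0\<close> of \<open>smith_cochain_join\<close>. Conversely, a primitive of the
  integral is lifted to \<open>C\<close>; what the coboundary of \<open>C\<close> misses of the
  Smith cochain of the join has integral zero, so it is a coboundary as well.\<close>

theorem smith_cochain_join_coboundary:
  assumes dim: "has_dimension K d" "d \<ge> 1" and rK: "inj_on rK K" and rJ: "inj_on rJ J"
    and r: "\<And>i a. {a} \<in> K \<Longrightarrow> rJ {Inl i} < rJ {Inr a}"
    and lt: "rJ {Inl 1} < rJ {Inl 2}" "rJ {Inl 2} < rJ {Inl 3}"
  shows "(\<exists>c\<in>invariant_cochains K (2 * d - 1). coboundary K oriK (2 * d - 1) c = K.smith_cochain rK (2 * d)) \<longleftrightarrow>
    (\<exists>c\<in>invariant_cochains J (2 * d + 1). coboundary J oriJ (2 * d + 1) c = J.smith_cochain rJ (2 * d + 2))"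
proof -
  define n where "n = 2 * d - 1"
  have n: "2 * d = Suc n" "2 * d + 1 = n + 2" "2 * d + 2 = n + 3" using dim(2) by (auto simp: n_def)
  have sg: "(- 1::int) ^ Suc n = 1" by (simp flip: n(1))
  define A where "A = J.smith_cochain rJ (n + 3)"
  define B where "B = K.smith_cochain rK (Suc n)"
  obtain c0 where c0: "c0 \<in> cochains K n" "swap_cochain c0 = c0"
    "\<And>e. B e + hexagon_integral A e = coboundary K oriK n c0 e"
    using smith_cochain_join[OF rK rJ r lt, of n] unfolding A_def B_def sg by (auto simp: fun_eq_iff)
  have "has_dimension J (d + 1)" using K.cpx dim(1) by (rule has_dimension_join)
  \<comment> \<open>The other factor of such a cell would have dimension \<open>2 * d + 1\<close>,
    which exceeds \<open>d + 1\<close> because \<open>d \<ge> 1\<close>.\<close>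
  hence no_vertex: "c ({Inl i}, S) = 0 \<and> c (S, {Inl i}) = 0" if "c \<in> cochains J (n + 2)" for c i S
  proof -
    have "simplex_dim S \<le> d + 1" if "S \<in> J" using that \<open>has_dimension J (d + 1)\<close> by (simp add: has_dimension_def)
    hence "({Inl i}, S) \<notin> deleted_cells J (n + 2)" "(S, {Inl i}) \<notin> deleted_cells J (n + 2)"
      using dim(2) n(1) by (auto simp: deleted_cells_def simplex_dim_def[of "{Inl i}"])
    thus ?thesis using that by (auto simp: cochains_def)
  qed
  have "(\<exists>c\<in>invariant_cochains K n. coboundary K oriK n c = B) \<longleftrightarrow>
    (\<exists>c\<in>invariant_cochains J (n + 2). coboundary J oriJ (n + 2) c = A)"
  proof
    assume "\<exists>c\<in>invariant_cochains J (n + 2). coboundary J oriJ (n + 2) c = A"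
    then obtain c where c: "c \<in> cochains J (n + 2)" "swap_cochain c = c" "coboundary J oriJ (n + 2) c = A"
      by (auto simp: invariant_cochains_iff)
    have h: "hexagon_integral A = coboundary K oriK n (hexagon_integral c)"
      unfolding c(3)[symmetric] using no_vertex[OF c(1)] by (intro hexagon_integral_coboundary c(1)) auto
    have "coboundary K oriK n (\<lambda>e. c0 e - hexagon_integral c e) = B"
      unfolding coboundary_diff h[symmetric] c0(3)[symmetric] by simp
    moreover have "(\<lambda>e. c0 e - hexagon_integral c e) \<in> invariant_cochains K n"
      using c0 hexagon_integral_in_cochains[OF c(1)] c(2) hexagon_integral_swap[of c]
      by (auto simp: invariant_cochains_iff swap_cochain_diff intro!: cochains_diff)
    ultimately show "\<exists>c\<in>invariant_cochains K n. coboundary K oriK n c = B" by blast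
  next
    assume "\<exists>c\<in>invariant_cochains K n. coboundary K oriK n c = B"
    then obtain c where c: "c \<in> cochains K n" "swap_cochain c = c" "coboundary K oriK n c = B"
      by (auto simp: invariant_cochains_iff)
    define c' where "c' = (\<lambda>e. c0 e - c e)"
    have c': "c' \<in> cochains K n" "swap_cochain c' = c'" unfolding c'_def swap_cochain_diff
      using c0 c by (auto intro: cochains_diff)
    have dc': "coboundary K oriK n c' = hexagon_integral A"
      unfolding c'_def coboundary_diff c(3) c0(3)[symmetric] by simp
    define b where "b = half_cochain rK c'"
    have b: "b \<in> cochains K n" "c' = (\<lambda>e. b e + swap_cochain b e)"
      using half_cochain_in_cochains[OF c'(1)] K.half_cochain_sum[OF c'(1) rK, of 1] c'(2) by (auto simp: b_def)
    \<comment> \<open>The lift is not invariant, so half of \<open>c'\<close> is lifted and the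
      result symmetrized. As integration commutes with the swap, the integral of \<open>C\<close> is
      again \<open>c'\<close>.\<close>
    define C where "C = (\<lambda>e. hexagon_lift b e + swap_cochain (hexagon_lift b) e)"
    have lift: "hexagon_lift b \<in> cochains J (n + 2)" using b(1) by (rule hexagon_lift_in_cochains)
    have C: "C \<in> cochains J (n + 2)" "swap_cochain C = C"
      unfolding C_def swap_cochain_add swap_cochain_involution
      using cochains_add[OF lift swap_in_cochains[OF lift]] by (auto simp: add.commute)
    have "hexagon_integral C = c'"
      unfolding C_def hexagon_integral_add hexagon_integral_swap hexagon_integral_lift[OF b(1)] b(2) ..
    hence dC: "hexagon_integral (coboundary J oriJ (n + 2) C) = coboundary K oriK n c'"
      using no_vertex[OF C(1)] hexagon_integral_coboundary[OF C(1)] by simp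
    define \<Theta> where "\<Theta> = (\<lambda>e. A e - coboundary J oriJ (n + 2) C e)"
    have swA: "swap_cochain A = A"
    proof -
      have "(- 1::int) ^ (n + 3) = 1" by (simp flip: n(3))
      thus ?thesis using conjunct1[OF J.smith_cochain_decompose[OF rJ, of "n + 3"]] unfolding A_def by simp
    qed
    have cC: "coboundary J oriJ (n + 2) C \<in> cochains J (n + 3)"
      using coboundary_in_cochains[of J oriJ "n + 2" C] by (simp add: numeral_3_eq_3)
    have "\<Theta> \<in> invariant_cochains J (n + 3)"
      unfolding invariant_cochains_iff \<Theta>_def swap_cochain_diff swA
        J.coboundary_swap[OF C(1), symmetric] C(2)
      using cochains_diff[OF J.smith_cochain_in_cochains[of rJ "n + 3"] cC] by (simp add: A_def)
    moreover have "hexagon_integral \<Theta> = (\<lambda>e. 0)"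
      unfolding \<Theta>_def hexagon_integral_diff dC dc' by simp
    ultimately obtain D where D: "D \<in> invariant_cochains J (n + 2)" "coboundary J oriJ (n + 2) D = \<Theta>"
      using hexagon_integral_zero_imp_coboundary[OF dim(1) _ _ rK, of \<Theta>] unfolding n(2,3) by blast
    have "coboundary J oriJ (n + 2) (\<lambda>e. C e + D e) = A"
      unfolding coboundary_add D(2) \<Theta>_def by simp
    moreover have "(\<lambda>e. C e + D e) \<in> invariant_cochains J (n + 2)"
      using C D(1) by (auto simp: invariant_cochains_iff swap_cochain_add intro: cochains_add)
    ultimately show "\<exists>c\<in>invariant_cochains J (n + 2). coboundary J oriJ (n + 2) c = A" by blast
  qed
  thus ?thesis unfolding n_def[symmetric] n(2,3) unfolding n(1) A_def B_def .
qed

end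

section \<open>Counting solutions of linear systems\<close>

definition int_sgn :: "real \<Rightarrow> int" where
  "int_sgn x = (if x > 0 then 1 else if x < 0 then - 1 else 0)"

lemma int_sgn_mult: "int_sgn (x * y) = int_sgn x * int_sgn y"
  by (auto simp: int_sgn_def zero_less_mult_iff mult_less_0_iff)

lemma int_sgn_minus: "int_sgn (- x) = - int_sgn x"
  by (auto simp: int_sgn_def)

lemma int_sgn_0 [simp]: "int_sgn 0 = 0" by (simp add: int_sgn_def)

lemma int_sgn_of_int: "k = 1 \<or> k = - 1 \<Longrightarrow> int_sgn (of_int k) = k"
  by (auto simp: int_sgn_def)

lemma int_sgn_eq_0: "int_sgn x = 0 \<longleftrightarrow> x = 0" by (simp add: int_sgn_def)

text \<open>The rows \<open>G 0\<close> and \<open>G 1\<close> will be the indicator functions of the vertices of two disjoint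
  simplices, so that a solution consists of barycentric coordinates of a point in each of them;
  the other rows say that the two points have the same image.\<close>

definition solves :: "nat \<Rightarrow> (nat \<Rightarrow> 'v \<Rightarrow> real) \<Rightarrow> 'v set \<Rightarrow> ('v \<Rightarrow> real) \<Rightarrow> bool" where
  "solves n G Z z \<longleftrightarrow> (\<forall>x\<in>Z. 0 \<le> z x) \<and> (\<forall>r<n. (\<Sum>x\<in>Z. G r x * z x) = (if r < 2 then 1 else 0))"

lemma solves_Suc:
  assumes "n \<ge> 2"
  shows "solves (Suc n) G Z z \<longleftrightarrow> solves n G Z z \<and> (\<Sum>x\<in>Z. G n x * z x) = 0"
proof -
  have "(\<forall>r<Suc n. P r) \<longleftrightarrow> (\<forall>r<n. P r) \<and> P n" for P :: "nat \<Rightarrow> bool" by (metis less_Suc_eq)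
  thus ?thesis using assms unfolding solves_def by auto
qed

text \<open>For \<open>n\<close> points and a nonzero determinant there is at most one solution, and
  a vanishing determinant contributes zero; a single sign is therefore the algebraic count.\<close>

definition zero_count :: "nat \<Rightarrow> (nat \<Rightarrow> 'v \<Rightarrow> real) \<Rightarrow> 'v list \<Rightarrow> int" where
  "zero_count n G xs = (if \<exists>z. solves n G (set xs) z then int_sgn (col_det n G xs) else 0)"

text \<open>The factor \<open>(- 1) ^ n\<close> fixes which side is counted. It cancels the sign in
  \<open>col_det_expand_last\<close>, so that the boundary formula holds without a further
  sign.\<close>

definition half_count :: "nat \<Rightarrow> (nat \<Rightarrow> 'v \<Rightarrow> real) \<Rightarrow> 'v list \<Rightarrow> int" where
  "half_count n G xs = (if \<exists>z. solves n G (set xs) z \<and> (- 1) ^ n * (\<Sum>x\<in>set xs. G n x * z x) < 0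
     then int_sgn (col_det n G xs) else 0)"

text \<open>The solutions of the first \<open>n\<close> equations form a segment, whose end points correspond to
  the terms on the left; the next equation vanishes on it at most once, and it does so iff it has
  different signs at the end points.\<close>

lemma half_count_boundary:
  fixes G :: "nat \<Rightarrow> 'v \<Rightarrow> real"
  assumes xs: "distinct xs" "length xs = Suc n" and n: "n \<ge> 2"
    and ys: "\<And>x. x \<in> set xs \<Longrightarrow> distinct (ys x) \<and> set (ys x) = set xs - {x}"
    and pos: "\<And>x. x \<in> set xs \<Longrightarrow> G 0 x + G 1 x = 1"
    and g1: "\<And>z x y. solves n G (set xs) z \<Longrightarrow> x \<in> set xs \<Longrightarrow> y \<in> set xs \<Longrightarrow> z x = 0 \<Longrightarrow> z y = 0 \<Longrightarrow> x = y"
    and g2: "\<And>z x. solves (Suc n) G (set xs) z \<Longrightarrow> x \<in> set xs \<Longrightarrow> z x \<noteq> 0"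
  shows "(\<Sum>x\<in>set xs. reorder_sign (x # ys x) xs * half_count n G (ys x)) = zero_count (Suc n) G xs"
proof -
  define Z where "Z = set xs"
  \<comment> \<open>By \<open>ker\<close> this vector is a direction in which the first
    \<open>n\<close> equations stay valid; a nonzero entry of it makes the solution set of these
    equations a line.\<close>
  define K where "K = (\<lambda>x. of_int (reorder_sign (x # ys x) xs) * col_det n G (ys x))"
  define D where "D = col_det (Suc n) G xs"
  have fin: "finite Z" by (simp add: Z_def)
  have se: "same_elems (x # ys x) xs" if "x \<in> Z" for x
    using ys[of x] that xs by (auto simp: same_elems_def Z_def)
  have lys: "length (ys x) = n" if "x \<in> Z" for x
  proof -
    have "length (ys x) = card (Z - {x})" using ys[of x] that by (metis Z_def distinct_card)
    also have "\<dots> = n" using that xs distinct_card[OF xs(1)] by (simp add: Z_def)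
    finally show ?thesis .
  qed
  have isK: "int_sgn (K x) = reorder_sign (x # ys x) xs * int_sgn (col_det n G (ys x))" if "x \<in> Z" for x
    unfolding K_def int_sgn_mult using int_sgn_of_int reorder_sign_cases[OF se[OF that]] by metis
  have ker: "(\<Sum>x\<in>Z. G r x * K x) = 0" if "r < n" for r
    unfolding Z_def K_def by (rule col_det_kernel) (use xs that ys in auto)
  have last: "(\<Sum>x\<in>Z. G n x * K x) = (- 1) ^ n * D"
    unfolding Z_def K_def D_def by (rule col_det_expand_last) (use xs ys in auto)
  have ext: "(\<exists>z. solves n G (set (ys x)) z \<and> (- 1) ^ n * (\<Sum>y\<in>set (ys x). G n y * z y) < 0) \<longleftrightarrow>
     (\<exists>z. solves n G Z z \<and> z x = 0 \<and> (- 1) ^ n * (\<Sum>y\<in>Z. G n y * z y) < 0)" if x: "x \<in> Z" for x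
  proof -
    have s: "(\<Sum>y\<in>set (ys x). G r y * z y) = (\<Sum>y\<in>Z. G r y * z y)" if "z x = 0" for z r
      using ys[of x] x that fin unfolding Z_def by (simp add: sum_diff1)
    have s2: "(\<Sum>y\<in>set (ys x). G r y * (z(x := 0)) y) = (\<Sum>y\<in>set (ys x). G r y * z y)" for z r
      using ys[of x] x by (intro sum.cong) (auto simp: Z_def)
    show ?thesis
    proof
      assume "\<exists>z. solves n G (set (ys x)) z \<and> (- 1) ^ n * (\<Sum>y\<in>set (ys x). G n y * z y) < 0"
      then obtain z where z: "solves n G (set (ys x)) z" "(- 1) ^ n * (\<Sum>y\<in>set (ys x). G n y * z y) < 0" by blast
      have "solves n G Z (z(x := 0))"
        using z(1) s[of "z(x := 0)"] s2 ys[of x] x by (auto simp: solves_def Z_def)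
      thus "\<exists>z. solves n G Z z \<and> z x = 0 \<and> (- 1) ^ n * (\<Sum>y\<in>Z. G n y * z y) < 0"
        using z(2) s[of "z(x := 0)" n] s2[of n z] by (intro exI[of _ "z(x := 0)"]) auto
    next
      assume "\<exists>z. solves n G Z z \<and> z x = 0 \<and> (- 1) ^ n * (\<Sum>y\<in>Z. G n y * z y) < 0"
      then obtain z where z: "solves n G Z z" "z x = 0" "(- 1) ^ n * (\<Sum>y\<in>Z. G n y * z y) < 0" by blast
      thus "\<exists>z. solves n G (set (ys x)) z \<and> (- 1) ^ n * (\<Sum>y\<in>set (ys x). G n y * z y) < 0"
        using s[of z] ys[of x] x by (intro exI[of _ z]) (auto simp: solves_def Z_def)
    qed
  qed
  define c where "c = (\<lambda>x. \<exists>z. solves n G Z z \<and> z x = 0 \<and> (- 1) ^ n * (\<Sum>y\<in>Z. G n y * z y) < 0)"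
  have LHS: "(\<Sum>x\<in>set xs. reorder_sign (x # ys x) xs * half_count n G (ys x)) = (\<Sum>x\<in>Z. if c x then int_sgn (K x) else 0)"
    unfolding Z_def[symmetric] half_count_def using ext isK by (intro sum.cong) (auto simp: c_def)
  have RHS: "zero_count (Suc n) G xs = (if \<exists>z. solves (Suc n) G Z z then int_sgn D else 0)"
    by (simp add: zero_count_def Z_def D_def)
  show ?thesis
  proof (cases "(\<forall>x\<in>Z. K x = 0) \<or> \<not> (\<exists>z. solves n G Z z)")
    case True
    hence "(\<Sum>x\<in>Z. if c x then int_sgn (K x) else 0) = 0"
      by (intro sum.neutral) (auto simp: c_def)
    moreover have "(if \<exists>z. solves (Suc n) G Z z then int_sgn D else 0) = 0"
      using True
    proof
      assume "\<forall>x\<in>Z. K x = 0"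
      thus ?thesis using last by simp
    next
      assume "\<not> (\<exists>z. solves n G Z z)"
      hence "\<not> (\<exists>z. solves (Suc n) G Z z)" using solves_Suc[OF n] by blast
      thus ?thesis by simp
    qed
    ultimately show ?thesis using LHS RHS by simp
  next
    case False
    then obtain k z0 where k: "k \<in> Z" "K k \<noteq> 0" and z0: "solves n G Z z0" by blast
    define \<zeta> where "\<zeta> = (\<lambda>t x. z0 x + t * K x)"
    have sum\<zeta>: "(\<Sum>x\<in>Z. G r x * \<zeta> t x) = (\<Sum>x\<in>Z. G r x * z0 x) + t * (\<Sum>x\<in>Z. G r x * K x)" for r t
      by (simp add: \<zeta>_def algebra_simps sum.distrib sum_distrib_left)
    have sol\<zeta>: "solves n G Z (\<zeta> t) \<longleftrightarrow> (\<forall>x\<in>Z. 0 \<le> \<zeta> t x)" for t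
      using z0 ker by (auto simp: solves_def sum\<zeta>)
    have all: "\<exists>t. \<forall>x\<in>Z. z x = \<zeta> t x" if z: "solves n G Z z" for z
    proof -
      define t where "t = (z k - z0 k) / K k"
      define d where "d = (\<lambda>x. z x - \<zeta> t x)"
      have dk: "d k = 0" using k by (simp add: d_def t_def \<zeta>_def)
      have d0: "(\<Sum>x\<in>set (ys k). G i x * d x) = 0" if "i < n" for i
      proof -
        have "(\<Sum>x\<in>Z. G i x * d x) = (\<Sum>x\<in>Z. G i x * z x) - (\<Sum>x\<in>Z. G i x * \<zeta> t x)"
          by (simp add: d_def algebra_simps sum_subtractf)
        also have "\<dots> = 0" using z z0 ker that by (simp add: sum\<zeta> solves_def)
        finally show ?thesis using dk ys[of k] k fin unfolding Z_def by (simp add: sum_diff1)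
      qed
      have "col_det n G (ys k) \<noteq> 0" using k by (auto simp: K_def)
      hence "d x = 0" if "x \<in> Z" for x
        using col_det_nonzero_imp_independent[of "ys k" n G d x] lys[OF k(1)] ys[of k] d0 dk that k(1)
        by (cases "x = k") (auto simp: Z_def)
      thus ?thesis by (auto simp: d_def)
    qed
    \<comment> \<open>The first two rows add up to the constant one. So the entries of
      \<open>K\<close> sum to zero and take both signs, which bounds the segment at both
      ends.\<close>
    have sumK: "(\<Sum>x\<in>Z. K x) = 0"
    proof -
      have "(\<Sum>x\<in>Z. K x) = (\<Sum>x\<in>Z. (G 0 x + G 1 x) * K x)" using pos by (intro sum.cong) (auto simp: Z_def)
      also have "\<dots> = 0" using ker[of 0] ker[of 1] n by (simp add: distrib_right sum.distrib)
      finally show ?thesis .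
    qed
    define P where "P = {x\<in>Z. K x > 0}"
    define N where "N = {x\<in>Z. K x < 0}"
    have Pne: "P \<noteq> {}"
    proof
      assume "P = {}"
      hence le: "\<forall>x\<in>Z. 0 \<le> - K x" by (auto simp: P_def not_less)
      have "(\<Sum>x\<in>Z. - K x) = 0" using sumK by (simp add: sum_negf)
      hence "- K k = 0" using sum_nonneg_eq_0_iff[OF fin, of "\<lambda>x. - K x"] le k(1) by blast
      thus False using k by simp
    qed
    have Nne: "N \<noteq> {}"
    proof
      assume "N = {}"
      hence "\<forall>x\<in>Z. 0 \<le> K x" by (auto simp: N_def not_less)
      hence "K k = 0" using sum_nonneg_eq_0_iff[OF fin, of K] sumK k(1) by blast
      thus False using k by simp
    qed
    have finPN: "finite P" "finite N" using fin by (auto simp: P_def N_def)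
    \<comment> \<open>The parameter at which the coordinate \<open>x\<close> reaches zero: a lower
      bound for feasible \<open>t\<close> if \<open>x \<in> P\<close>, an upper bound if
      \<open>x \<in> N\<close>.\<close>
    define q where "q = (\<lambda>x. - z0 x / K x)"
    define t0 where "t0 = Max (q ` P)"
    define t1 where "t1 = Min (q ` N)"
    have "t0 \<in> q ` P" "t1 \<in> q ` N"
      unfolding t0_def t1_def using Pne Nne finPN by (auto intro!: Max_in Min_in)
    then obtain x0 x1 where x0: "x0 \<in> P" "q x0 = t0" and x1: "x1 \<in> N" "q x1 = t1" by auto
    have t0: "q x \<le> t0" if "x \<in> P" for x unfolding t0_def using finPN that by auto
    have t1: "t1 \<le> q x" if "x \<in> N" for x unfolding t1_def using finPN that by auto
    have nonneg: "0 \<le> z0 x" if "x \<in> Z" for x using z0 that by (auto simp: solves_def)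
    have qP: "q x \<le> 0" if "x \<in> P" for x using that nonneg[of x] by (auto simp: q_def P_def divide_nonpos_pos)
    have qN: "0 \<le> q x" if "x \<in> N" for x using that nonneg[of x] by (auto simp: q_def N_def divide_nonneg_neg)
    have t01: "t0 \<le> t1" using qP[OF x0(1)] qN[OF x1(1)] x0 x1 by simp
    have feas: "(\<forall>x\<in>Z. 0 \<le> \<zeta> t x) \<longleftrightarrow> t0 \<le> t \<and> t \<le> t1" for t
    proof
      assume f: "\<forall>x\<in>Z. 0 \<le> \<zeta> t x"
      have "0 \<le> \<zeta> t x0" "K x0 > 0" "0 \<le> \<zeta> t x1" "K x1 < 0" using f x0 x1 by (auto simp: P_def N_def)
      thus "t0 \<le> t \<and> t \<le> t1" unfolding x0(2)[symmetric] x1(2)[symmetric] q_def \<zeta>_def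
        by (auto simp: field_simps)
    next
      assume t: "t0 \<le> t \<and> t \<le> t1"
      show "\<forall>x\<in>Z. 0 \<le> \<zeta> t x"
      proof
        fix x assume x: "x \<in> Z"
        consider "x \<in> P" | "x \<in> N" | "K x = 0" using x by (fastforce simp: P_def N_def)
        thus "0 \<le> \<zeta> t x"
        proof cases
          case 1
          hence "q x \<le> t" "K x > 0" using t t0[OF 1] by (auto simp: P_def)
          thus ?thesis by (simp add: q_def \<zeta>_def field_simps)
        next
          case 2
          hence "t \<le> q x" "K x < 0" using t t1[OF 2] by (auto simp: N_def)
          thus ?thesis by (simp add: q_def \<zeta>_def field_simps)
        next
          case 3
          thus ?thesis using nonneg[OF x] by (simp add: \<zeta>_def)
        qed
      qed
    qed
    \<comment> \<open>The normalized next equation along the line; with the factor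
      \<open>(- 1) ^ n\<close> its slope is exactly \<open>D\<close>.\<close>
    define \<delta> where "\<delta> = (\<lambda>t. (- 1) ^ n * (\<Sum>y\<in>Z. G n y * \<zeta> t y))"
    have \<delta>: "\<delta> t = \<delta> 0 + t * D" for t
    proof -
      have "\<delta> t = (- 1) ^ n * (\<Sum>x\<in>Z. G n x * z0 x) + t * (((- 1) ^ n * (- 1) ^ n) * D)"
        unfolding \<delta>_def sum\<zeta> last by (simp add: algebra_simps)
      moreover have "(- 1::real) ^ n * (- 1) ^ n = 1" by (simp flip: power_mult_distrib)
      moreover have "\<delta> 0 = (- 1) ^ n * (\<Sum>x\<in>Z. G n x * z0 x)" by (simp add: \<delta>_def sum\<zeta>)
      ultimately show ?thesis by simp
    qed
    have c_iff: "c x \<longleftrightarrow> t0 \<le> q x \<and> q x \<le> t1 \<and> \<delta> (q x) < 0" if x: "x \<in> Z" "K x \<noteq> 0" for x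
    proof
      assume "c x"
      then obtain z where z: "solves n G Z z" "z x = 0" "(- 1) ^ n * (\<Sum>y\<in>Z. G n y * z y) < 0"
        by (auto simp: c_def)
      obtain t where t: "\<And>y. y \<in> Z \<Longrightarrow> z y = \<zeta> t y" using all[OF z(1)] by blast
      have "t = q x" using t[OF x(1)] z(2) x(2) by (simp add: \<zeta>_def q_def field_simps)
      moreover have "(\<Sum>y\<in>Z. G n y * z y) = (\<Sum>y\<in>Z. G n y * \<zeta> t y)" using t by (intro sum.cong) auto
      moreover have "\<forall>y\<in>Z. 0 \<le> \<zeta> t y" using z(1) t by (auto simp: solves_def)
      ultimately show "t0 \<le> q x \<and> q x \<le> t1 \<and> \<delta> (q x) < 0" using feas z(3) by (simp add: \<delta>_def)
    next
      assume "t0 \<le> q x \<and> q x \<le> t1 \<and> \<delta> (q x) < 0"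
      moreover from this have "solves n G Z (\<zeta> (q x))" using sol\<zeta> feas by blast
      moreover have "\<zeta> (q x) x = 0" using x by (simp add: \<zeta>_def q_def)
      ultimately show "c x" unfolding c_def \<delta>_def by blast
    qed
    have sol01: "solves n G Z (\<zeta> t0)" "solves n G Z (\<zeta> t1)" using sol\<zeta> feas t01 by auto
    have zero01: "\<zeta> t0 x0 = 0" "\<zeta> t1 x1 = 0"
      using x0 x1 by (auto simp: \<zeta>_def q_def P_def N_def)
    have x01: "x0 \<in> Z" "x1 \<in> Z" "K x0 > 0" "K x1 < 0" using x0 x1 by (auto simp: P_def N_def)
    \<comment> \<open>By \<open>g1\<close> each end point of the segment has only one vanishing
      coordinate, so no third facet is met.\<close>
    have uniq: "x = x0 \<or> x = x1" if x: "x \<in> Z" "K x \<noteq> 0" "c x" for x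
    proof -
      have qx: "t0 \<le> q x" "q x \<le> t1" using c_iff x by auto
      have zx: "\<zeta> (q x) x = 0" using x by (simp add: \<zeta>_def q_def)
      show ?thesis
      proof (cases "K x > 0")
        case True
        hence "q x = t0" using t0[of x] qx x by (auto simp: P_def)
        thus ?thesis using g1[of "\<zeta> t0" x x0] sol01 zero01 zx x x01 by (simp add: Z_def)
      next
        case False
        hence "q x = t1" using t1[of x] qx x by (auto simp: N_def)
        thus ?thesis using g1[of "\<zeta> t1" x x1] sol01 zero01 zx x x01 by (simp add: Z_def)
      qed
    qed
    \<comment> \<open>The two ends carry opposite signs of \<open>K\<close>. The difference of the
      two indicators is nonzero iff \<open>\<delta>\<close> changes sign, and then it is the sign of
      the slope \<open>D\<close>.\<close>
    have "(\<Sum>x\<in>Z. if c x then int_sgn (K x) else 0) = (\<Sum>x\<in>{x0, x1}. if c x then int_sgn (K x) else 0)"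
      using fin x01 uniq by (intro sum.mono_neutral_right) (auto simp: int_sgn_eq_0)
    also have "\<dots> = of_bool (\<delta> t0 < 0) - of_bool (\<delta> t1 < 0)"
    proof -
      have "x0 \<noteq> x1" using x01 by auto
      moreover have "c x0 \<longleftrightarrow> \<delta> t0 < 0" using c_iff[of x0] x01 x0(2) t01 by auto
      moreover have "c x1 \<longleftrightarrow> \<delta> t1 < 0" using c_iff[of x1] x01 x1(2) t01 by auto
      ultimately show ?thesis using x01 by (simp add: int_sgn_def)
    qed
    finally have L: "(\<Sum>x\<in>Z. if c x then int_sgn (K x) else 0) = of_bool (\<delta> t0 < 0) - of_bool (\<delta> t1 < 0)" .
    have solS: "solves (Suc n) G Z (\<zeta> t) \<longleftrightarrow> t0 \<le> t \<and> t \<le> t1 \<and> \<delta> t = 0" for t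
    proof -
      have "solves (Suc n) G Z (\<zeta> t) \<longleftrightarrow> solves n G Z (\<zeta> t) \<and> (\<Sum>y\<in>Z. G n y * \<zeta> t y) = 0"
        by (rule solves_Suc[OF n])
      thus ?thesis using sol\<zeta>[of t] feas[of t] by (simp add: \<delta>_def)
    qed
    have R: "(\<exists>z. solves (Suc n) G Z z) \<longleftrightarrow> (\<exists>t. t0 \<le> t \<and> t \<le> t1 \<and> \<delta> t = 0)"
    proof
      assume "\<exists>z. solves (Suc n) G Z z"
      then obtain z where z: "solves (Suc n) G Z z" by blast
      hence "solves n G Z z" using solves_Suc[OF n] by blast
      then obtain t where t: "\<And>x. x \<in> Z \<Longrightarrow> z x = \<zeta> t x" using all by blast
      have "(\<Sum>y\<in>Z. G r y * z y) = (\<Sum>y\<in>Z. G r y * \<zeta> t y)" for r using t by (intro sum.cong) auto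
      hence "solves (Suc n) G Z (\<zeta> t)" using z t unfolding solves_def by simp
      thus "\<exists>t. t0 \<le> t \<and> t \<le> t1 \<and> \<delta> t = 0" using solS by blast
    qed (use solS in blast)
    \<comment> \<open>An end point has a vanishing coordinate, so by \<open>g2\<close> it cannot
      solve the next equation.\<close>
    have ne: "\<delta> t0 \<noteq> 0" "\<delta> t1 \<noteq> 0"
      using solS[of t0] solS[of t1] g2[of "\<zeta> t0" x0] g2[of "\<zeta> t1" x1] zero01 x01 t01 by (auto simp: Z_def)
    have "(if \<exists>t. t0 \<le> t \<and> t \<le> t1 \<and> \<delta> t = 0 then int_sgn D else 0) = of_bool (\<delta> t0 < 0) - of_bool (\<delta> t1 < 0)"
    proof (cases "D = 0")
      case True
      thus ?thesis using \<delta>[of t0] \<delta>[of t1] by simp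
    next
      case False
      have diff: "\<delta> t - \<delta> s = (t - s) * D" for s t using \<delta>[of t] \<delta>[of s] by (simp add: algebra_simps)
      have root: "\<delta> (- \<delta> 0 / D) = 0" using \<delta>[of "- \<delta> 0 / D"] False by simp
      have iff: "(\<exists>t. t0 \<le> t \<and> t \<le> t1 \<and> \<delta> t = 0) \<longleftrightarrow> \<delta> t0 * \<delta> t1 < 0"
      proof
        assume "\<exists>t. t0 \<le> t \<and> t \<le> t1 \<and> \<delta> t = 0"
        then obtain t where t: "t0 \<le> t" "t \<le> t1" "\<delta> t = 0" by blast
        have "\<delta> t0 = (t0 - t) * D" "\<delta> t1 = (t1 - t) * D" using diff[of t0 t] diff[of t1 t] t by auto
        hence "\<delta> t0 * \<delta> t1 = ((t0 - t) * (t1 - t)) * (D * D)" by simp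
        moreover have "(t0 - t) * (t1 - t) \<le> 0" using t by (intro mult_nonpos_nonneg) auto
        moreover have "D * D > 0" using False by (simp add: mult_pos_pos zero_less_mult_iff not_less_iff_gr_or_eq) linarith
        ultimately have "\<delta> t0 * \<delta> t1 \<le> 0" by (simp add: mult_nonpos_nonneg)
        thus "\<delta> t0 * \<delta> t1 < 0" using ne by (simp add: order.strict_iff_order)
      next
        assume neg: "\<delta> t0 * \<delta> t1 < 0"
        define t where "t = - \<delta> 0 / D"
        have e: "\<delta> t0 = (t0 - t) * D" "\<delta> t1 = (t1 - t) * D"
          using diff[of t0 t] diff[of t1 t] root by (auto simp: t_def)
        have "(t0 - t) * (t1 - t) * (D * D) < 0" using neg unfolding e by (simp add: algebra_simps)
        hence "(t0 - t) * (t1 - t) < 0" using mult_nonneg_nonneg[of "(t0 - t) * (t1 - t)" "D * D"] by (meson not_less zero_le_square)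
        hence "t0 \<le> t" "t \<le> t1" using t01 by (auto simp: mult_less_0_iff)
        thus "\<exists>t. t0 \<le> t \<and> t \<le> t1 \<and> \<delta> t = 0" using root t_def by blast
      qed
      have "\<delta> t1 - \<delta> t0 = (t1 - t0) * D" by (rule diff)
      moreover have "D > 0 \<Longrightarrow> 0 \<le> (t1 - t0) * D" "D < 0 \<Longrightarrow> (t1 - t0) * D \<le> 0"
        using t01 by (auto intro: mult_nonneg_nonneg mult_nonneg_nonpos)
      ultimately have sgn: "D > 0 \<Longrightarrow> \<delta> t0 \<le> \<delta> t1" "D < 0 \<Longrightarrow> \<delta> t1 \<le> \<delta> t0"
        by auto
      show ?thesis unfolding iff using ne False sgn
        by (auto simp: int_sgn_def mult_less_0_iff of_bool_def)
    qed
    thus ?thesis using LHS RHS L R by simp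
  qed
qed

subsection \<open>Pairs of simplices\<close>

definition pair_row :: "(nat \<Rightarrow> 'p \<Rightarrow> real) \<Rightarrow> nat \<Rightarrow> 'p + 'p \<Rightarrow> real" where
  "pair_row \<phi> r x = (case x of
      Inl a \<Rightarrow> if r = 0 then 1 else if r = 1 then 0 else \<phi> (r - 2) a
    | Inr b \<Rightarrow> if r = 0 then 0 else if r = 1 then 1 else - \<phi> (r - 2) b)"

abbreviation pair_list :: "'p list \<Rightarrow> 'p list \<Rightarrow> ('p + 'p) list" where
  "pair_list as bs \<equiv> map Inl as @ map Inr bs"

text \<open>General position for the projection to the first \<open>j\<close> coordinates: any at
  most \<open>j + 1\<close> of the points become affinely independent.\<close>

definition generic_rows :: "nat \<Rightarrow> 'p set \<Rightarrow> (nat \<Rightarrow> 'p \<Rightarrow> real) \<Rightarrow> bool" where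
  "generic_rows j V \<phi> \<longleftrightarrow> (\<forall>S c. finite S \<and> S \<subseteq> V \<and> card S \<le> j + 1 \<and> (\<Sum>v\<in>S. c v) = 0 \<and>
     (\<forall>r<j. (\<Sum>v\<in>S. c v * \<phi> r v) = 0) \<longrightarrow> (\<forall>v\<in>S. c v = 0))"

lemma sum_pair_row:
  assumes "finite S" "finite S'"
  shows "(\<Sum>x\<in>S <+> S'. pair_row \<phi> 0 x * z x) = (\<Sum>a\<in>S. z (Inl a))"
    "(\<Sum>x\<in>S <+> S'. pair_row \<phi> (Suc 0) x * z x) = (\<Sum>b\<in>S'. z (Inr b))"
    "(\<Sum>x\<in>S <+> S'. pair_row \<phi> (Suc (Suc r)) x * z x) = (\<Sum>a\<in>S. \<phi> r a * z (Inl a)) - (\<Sum>b\<in>S'. \<phi> r b * z (Inr b))"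
  using assms by (simp_all add: sum.Plus pair_row_def o_def sum_negf)

text \<open>A solution is an affine dependence between the points of \<open>S\<close> and
  \<open>S'\<close>, once the coefficients on \<open>S'\<close> are negated, and genericity forbids
  a nontrivial one on at most \<open>j + 1\<close> points. Disjointness keeps the two sets of
  coefficients from interfering.\<close>

lemma generic_rows_support:
  assumes gen: "generic_rows j V \<phi>" and S: "S \<subseteq> V" "S' \<subseteq> V" "S \<inter> S' = {}" "finite S" "finite S'"
    and z: "solves (j + 2) (pair_row \<phi>) (S <+> S') z"
  shows "card {x \<in> S <+> S'. z x \<noteq> 0} > j + 1"
proof (rule ccontr)
  assume "\<not> ?thesis"
  hence le: "card {x \<in> S <+> S'. z x \<noteq> 0} \<le> j + 1" by simp
  define T where "T = {a \<in> S. z (Inl a) \<noteq> 0}"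
  define T' where "T' = {b \<in> S'. z (Inr b) \<noteq> 0}"
  have fin: "finite T" "finite T'" "T \<inter> T' = {}" using S by (auto simp: T_def T'_def)
  have "{x \<in> S <+> S'. z x \<noteq> 0} = T <+> T'" by (auto simp: T_def T'_def)
  hence card: "card (T \<union> T') \<le> j + 1" using le fin by (simp add: card_Plus card_Un_disjoint)
  define c where "c = (\<lambda>v. if v \<in> S then z (Inl v) else - z (Inr v))"
  have sc: "(\<Sum>v\<in>T \<union> T'. c v * f v) = (\<Sum>a\<in>S. f a * z (Inl a)) - (\<Sum>b\<in>S'. f b * z (Inr b))" for f
  proof -
    have "(\<Sum>v\<in>T \<union> T'. c v * f v) = (\<Sum>v\<in>T. c v * f v) + (\<Sum>v\<in>T'. c v * f v)"
      using fin by (intro sum.union_disjoint)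
    also have "(\<Sum>v\<in>T. c v * f v) = (\<Sum>v\<in>T. f v * z (Inl v))"
      by (intro sum.cong) (auto simp: c_def T_def)
    also have "\<dots> = (\<Sum>v\<in>S. f v * z (Inl v))"
      using S by (intro sum.mono_neutral_left) (auto simp: T_def)
    also have "(\<Sum>v\<in>T'. c v * f v) = (\<Sum>v\<in>T'. - (f v * z (Inr v)))"
      using S by (intro sum.cong) (auto simp: c_def T'_def)
    also have "\<dots> = - (\<Sum>v\<in>S'. f v * z (Inr v))"
      using S by (subst sum_negf) (auto simp: T'_def intro!: sum.mono_neutral_left)
    finally show ?thesis by simp
  qed
  have eqs: "(\<Sum>x\<in>S <+> S'. pair_row \<phi> r x * z x) = (if r < 2 then 1 else 0)" if "r < j + 2" for r
    using z that by (simp add: solves_def)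
  have "(\<Sum>v\<in>T \<union> T'. c v) = 0"
    using sc[of "\<lambda>_. 1"] eqs[of 0] eqs[of 1] S by (simp add: sum_pair_row)
  hence s0: "(\<Sum>v\<in>T \<union> T'. c v) = 0 \<and> (\<forall>r<j. (\<Sum>v\<in>T \<union> T'. c v * \<phi> r v) = 0)"
    using sc[of "\<phi> r" for r] eqs[of "Suc (Suc r)" for r] S by (simp add: sum_pair_row)
  have c0: "\<forall>v\<in>T \<union> T'. c v = 0"
  proof -
    have "finite (T \<union> T')" "T \<union> T' \<subseteq> V" using fin S by (auto simp: T_def T'_def)
    with gen[unfolded generic_rows_def, rule_format, of "T \<union> T'" c] show ?thesis
      using card s0 by blast
  qed
  have "z (Inl a) = 0" if "a \<in> S" for a
  proof (rule ccontr)
    assume nz: "z (Inl a) \<noteq> 0"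
    hence "a \<in> T \<union> T'" using that by (simp add: T_def)
    with c0 have "c a = 0" by blast
    thus False using nz that by (simp add: c_def)
  qed
  thus False using eqs[of 0] S by (simp add: sum_pair_row)
qed

lemma set_pair_list: "set (pair_list as bs) = set as <+> set bs"
  by (auto simp: Plus_def)

lemma same_elems_pair_list:
  "same_elems as as' \<Longrightarrow> same_elems bs bs' \<Longrightarrow> same_elems (pair_list as bs) (pair_list as' bs')"
  by (auto simp: same_elems_def distinct_map)

lemma reorder_sign_pair_list:
  assumes "same_elems as as'" "same_elems bs bs'"
  shows "reorder_sign (pair_list as (bs :: 'a list)) (pair_list as' bs') = reorder_sign as as' * reorder_sign bs bs'"
proof -
  have "reorder_sign (pair_list as bs) (pair_list as' bs') =
     reorder_sign (map Inl as :: ('a + 'a) list) (map Inl as') * reorder_sign (map Inr bs :: ('a + 'a) list) (map Inr bs')"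
    using assms by (intro reorder_sign_append2) (auto simp: same_elems_def distinct_map)
  also have "reorder_sign (map Inl as :: ('a + 'a) list) (map Inl as') = reorder_sign as as'"
    using assms by (intro reorder_sign_map) auto
  also have "reorder_sign (map Inr bs :: ('a + 'a) list) (map Inr bs') = reorder_sign bs bs'"
    using assms by (intro reorder_sign_map) auto
  finally show ?thesis .
qed

text \<open>Among \<open>j + 3\<close> points, genericity of \<open>j\<close> rows leaves at most
  one zero coordinate in a solution of \<open>j + 2\<close> equations, and genericity of
  \<open>Suc j\<close> rows leaves none in a solution of one more. These are the nondegeneracy
  conditions of \<open>half_count_boundary\<close>. The sign \<open>(- 1) ^ card S\<close> moves a
  vertex of the second simplex past the first one.\<close>

lemma half_count_pair_boundary:
  assumes gen: "generic_rows j V \<phi>" "generic_rows (Suc j) V \<phi>"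
    and S: "S \<subseteq> V" "S' \<subseteq> V" "S \<inter> S' = {}" "finite S" "finite S'" "card S + card S' = j + 3"
    and lst: "\<And>R. R \<subseteq> S \<or> R \<subseteq> S' \<Longrightarrow> distinct (lst R) \<and> set (lst R) = R"
  shows "(\<Sum>a\<in>S. incidence lst S a * half_count (j + 2) (pair_row \<phi>) (pair_list (lst (S - {a})) (lst S')))
    + (- 1) ^ card S * (\<Sum>b\<in>S'. incidence lst S' b * half_count (j + 2) (pair_row \<phi>) (pair_list (lst S) (lst (S' - {b}))))
    = zero_count (j + 3) (pair_row \<phi>) (pair_list (lst S) (lst S'))"
proof -
  let ?xs = "pair_list (lst S) (lst S')"
  define ys where "ys = (\<lambda>x. case x of Inl a \<Rightarrow> pair_list (lst (S - {a})) (lst S')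
     | Inr b \<Rightarrow> pair_list (lst S) (lst (S' - {b})))"
  have l: "distinct (lst S)" "set (lst S) = S" "distinct (lst S')" "set (lst S') = S'"
    using lst[of S] lst[of S'] by auto
  have lr: "distinct (lst (S - {a}))" "set (lst (S - {a})) = S - {a}"
    "distinct (lst (S' - {a}))" "set (lst (S' - {a})) = S' - {a}" for a
    using lst[of "S - {a}"] lst[of "S' - {a}"] by auto
  have len: "length (lst S) = card S" "length (lst S') = card S'"
    using l by (metis distinct_card)+
  have set: "set ?xs = S <+> S'" using l by (simp add: set_pair_list Plus_def)
  have cZ: "card (S <+> S') = j + 3" using S by (simp add: card_Plus)
  have supp: "card {x \<in> S <+> S'. z x \<noteq> 0} + card {x \<in> S <+> S'. z x = 0} = j + 3" for z :: "'a + 'a \<Rightarrow> real"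
  proof -
    have "card ({x \<in> S <+> S'. z x \<noteq> 0} \<union> {x \<in> S <+> S'. z x = 0}) = card {x \<in> S <+> S'. z x \<noteq> 0} + card {x \<in> S <+> S'. z x = 0}"
      using S by (intro card_Un_disjoint) auto
    moreover have "{x \<in> S <+> S'. z x \<noteq> 0} \<union> {x \<in> S <+> S'. z x = 0} = S <+> S'" by auto
    ultimately show ?thesis using cZ by simp
  qed
  have "(\<Sum>x\<in>set ?xs. reorder_sign (x # ys x) ?xs * half_count (j + 2) (pair_row \<phi>) (ys x))
      = zero_count (Suc (j + 2)) (pair_row \<phi>) ?xs"
  proof (rule half_count_boundary)
    show "distinct ?xs" using l by (auto simp: distinct_map)
    show "length ?xs = Suc (j + 2)" using len S by simp
    show "distinct (ys x) \<and> set (ys x) = set ?xs - {x}" if "x \<in> set ?xs" for x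
      using that l lr by (auto simp: ys_def distinct_map)
    show "pair_row \<phi> 0 x + pair_row \<phi> 1 x = 1" for x
      by (cases x) (auto simp: pair_row_def)
    show "x = y" if z: "solves (j + 2) (pair_row \<phi>) (set ?xs) z" and xy: "x \<in> set ?xs" "y \<in> set ?xs" "z x = 0" "z y = 0" for z x y
    proof (rule ccontr)
      assume "x \<noteq> y"
      hence "2 = card {x, y}" by simp
      also have "\<dots> \<le> card {x \<in> S <+> S'. z x = 0}" using xy S set by (intro card_mono) auto
      finally show False
        using generic_rows_support[OF gen(1) S(1-5), of z] z supp[of z] set by simp
    qed
    show "z x \<noteq> 0" if z: "solves (Suc (j + 2)) (pair_row \<phi>) (set ?xs) z" and x: "x \<in> set ?xs" for z x
    proof
      assume "z x = 0"
      hence "card {x} \<le> card {x \<in> S <+> S'. z x = 0}" using x S set by (intro card_mono) auto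
      thus False
        using generic_rows_support[OF gen(2) S(1-5), of z] z supp[of z] set by simp
    qed
  qed simp
  also have "(\<Sum>x\<in>set ?xs. reorder_sign (x # ys x) ?xs * half_count (j + 2) (pair_row \<phi>) (ys x)) =
    (\<Sum>a\<in>S. reorder_sign (Inl a # ys (Inl a)) ?xs * half_count (j + 2) (pair_row \<phi>) (ys (Inl a))) +
    (\<Sum>b\<in>S'. reorder_sign (Inr b # ys (Inr b)) ?xs * half_count (j + 2) (pair_row \<phi>) (ys (Inr b)))"
    unfolding set using S by (simp add: sum.Plus o_def)
  also have "(\<Sum>a\<in>S. reorder_sign (Inl a # ys (Inl a)) ?xs * half_count (j + 2) (pair_row \<phi>) (ys (Inl a)))
    = (\<Sum>a\<in>S. incidence lst S a * half_count (j + 2) (pair_row \<phi>) (pair_list (lst (S - {a})) (lst S')))"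
  proof (intro sum.cong refl)
    fix a assume a: "a \<in> S"
    have "reorder_sign (pair_list (a # lst (S - {a})) (lst S')) ?xs = reorder_sign (a # lst (S - {a})) (lst S) * reorder_sign (lst S') (lst S')"
      using a l lr by (intro reorder_sign_pair_list) (auto simp: same_elems_def)
    thus "reorder_sign (Inl a # ys (Inl a)) ?xs * half_count (j + 2) (pair_row \<phi>) (ys (Inl a)) =
       incidence lst S a * half_count (j + 2) (pair_row \<phi>) (pair_list (lst (S - {a})) (lst S'))"
      using l by (simp add: ys_def incidence_def)
  qed
  also have "(\<Sum>b\<in>S'. reorder_sign (Inr b # ys (Inr b)) ?xs * half_count (j + 2) (pair_row \<phi>) (ys (Inr b)))
    = (- 1) ^ card S * (\<Sum>b\<in>S'. incidence lst S' b * half_count (j + 2) (pair_row \<phi>) (pair_list (lst S) (lst (S' - {b}))))"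
    unfolding sum_distrib_left
  proof (intro sum.cong refl)
    fix b assume b: "b \<in> S'"
    let ?m = "map Inl (lst S) @ Inr b # map Inr (lst (S' - {b}))"
    have "reorder_sign (pair_list (lst S) (b # lst (S' - {b}))) ?xs = reorder_sign (lst S) (lst S) * reorder_sign (b # lst (S' - {b})) (lst S')"
      using b l lr by (intro reorder_sign_pair_list) (auto simp: same_elems_def)
    moreover have "reorder_sign (Inr b # ys (Inr b)) ?m = (- 1) ^ card S"
    proof -
      have "distinct (Inr b # map Inl (lst S) @ map Inr (lst (S' - {b})))" using l lr by (auto simp: distinct_map)
      from reorder_sign_to_front[OF this] show ?thesis by (simp add: ys_def len)
    qed
    moreover have "reorder_sign (Inr b # ys (Inr b)) ?m * reorder_sign ?m ?xs = reorder_sign (Inr b # ys (Inr b)) ?xs"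
      using b l lr by (intro reorder_sign_trans) (auto simp: same_elems_def distinct_map ys_def)
    ultimately show "reorder_sign (Inr b # ys (Inr b)) ?xs * half_count (j + 2) (pair_row \<phi>) (ys (Inr b)) =
       (- 1) ^ card S * (incidence lst S' b * half_count (j + 2) (pair_row \<phi>) (pair_list (lst S) (lst (S' - {b}))))"
      using l by (simp add: ys_def incidence_def)
  qed
  finally show ?thesis by (simp add: numeral_3_eq_3)
qed

section \<open>Exchanging the two simplices of a pair\<close>

lemma col_det_scale_rows:
  "col_det n (\<lambda>r x. c r * G r x) xs = (\<Prod>r<n. c r) * col_det n G xs"
proof -
  have "col_det n (\<lambda>r x. c r * G r x) xs = (\<Sum>p | p permutes {0..<n}. signof p * (\<Prod>i=0..<n. c i * G i (xs ! p i)))"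
    unfolding col_det_def by (subst det_def'[of _ n]) (auto intro!: sum.cong prod.cong)
  also have "\<dots> = (\<Prod>r<n. c r) * (\<Sum>p | p permutes {0..<n}. signof p * (\<Prod>i=0..<n. G i (xs ! p i)))"
    by (simp add: prod.distrib sum_distrib_left lessThan_atLeast0 algebra_simps)
  also have "(\<Sum>p | p permutes {0..<n}. signof p * (\<Prod>i=0..<n. G i (xs ! p i))) = col_det n G xs"
    unfolding col_det_def by (subst det_def'[of _ n]) (auto intro!: sum.cong prod.cong)
  finally show ?thesis .
qed

lemma col_det_swap_rows:
  assumes "n \<ge> 2"
  shows "col_det n (\<lambda>r. if r = 0 then G 1 else if r = 1 then G 0 else G r) xs = - col_det n G xs"
proof -
  let ?A = "Matrix.mat n n (\<lambda>(i, j). G i (xs ! j))"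
  have "Matrix.mat n n (\<lambda>(i, j). (if i = 0 then G 1 else if i = 1 then G 0 else G i) (xs ! j)) = swaprows 0 1 ?A"
    using assms by (intro eq_matI) auto
  moreover have "Determinant.det (swaprows 0 1 ?A) = - Determinant.det ?A"
    using assms by (intro det_swaprows[of _ n]) auto
  ultimately show ?thesis by (simp add: col_det_def)
qed

definition swap_tag :: "'p + 'p \<Rightarrow> 'p + 'p" where
  "swap_tag x = (case x of Inl a \<Rightarrow> Inr a | Inr b \<Rightarrow> Inl b)"

lemma swap_tag_simps [simp]: "swap_tag (Inl a) = Inr a" "swap_tag (Inr a) = Inl a"
  by (auto simp: swap_tag_def)

lemma pair_row_swap_tag:
  "pair_row \<phi> r (swap_tag x) = (if r = 0 then pair_row \<phi> 1 x else if r = 1 then pair_row \<phi> 0 x else - pair_row \<phi> r x)"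
  by (cases x) (auto simp: pair_row_def)

text \<open>The exponent collects three effects: the two normalization rows trade places, the
  \<open>j\<close> difference rows change sign, and the two blocks of columns are exchanged.\<close>

lemma col_det_pair_swap:
  assumes "distinct as" "distinct bs" "length as + length bs = j + 2"
  shows "col_det (j + 2) (pair_row \<phi>) (pair_list bs as) =
    (- 1) ^ (1 + j + length as * length bs) * col_det (j + 2) (pair_row \<phi>) (pair_list as bs)"
proof -
  let ?n = "j + 2"
  let ?ba = "map Inr bs @ map Inl as"
  have eq: "pair_list bs as = map swap_tag ?ba" by simp
  have "col_det ?n (pair_row \<phi>) (pair_list bs as) = col_det ?n (\<lambda>r x. pair_row \<phi> r (swap_tag x)) ?ba"
    unfolding col_det_def eq using assms
    by (intro arg_cong[where f = Determinant.det] cong_mat) (auto simp del: map_append map_map)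
  also have "\<dots> = of_int (reorder_sign (pair_list as bs) ?ba) * col_det ?n (\<lambda>r x. pair_row \<phi> r (swap_tag x)) (pair_list as bs)"
    using assms by (intro col_det_reorder) (auto simp: same_elems_def distinct_map)
  also have "reorder_sign (pair_list as bs) ?ba = (- 1) ^ (length as * length bs)"
    using assms by (subst reorder_sign_swap_append) (auto simp: distinct_map)
  also have "col_det ?n (\<lambda>r x. pair_row \<phi> r (swap_tag x)) (pair_list as bs) =
     col_det ?n (\<lambda>r x. (if r < 2 then 1 else - 1) * (if r = 0 then pair_row \<phi> 1 else if r = 1 then pair_row \<phi> 0 else pair_row \<phi> r) x) (pair_list as bs)"
    unfolding pair_row_swap_tag by (rule arg_cong[where f = "\<lambda>G. col_det ?n G (pair_list as bs)"]) (auto simp: fun_eq_iff)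
  also have "\<dots> = (\<Prod>r<?n. if r < 2 then 1 else - 1) * (- col_det ?n (pair_row \<phi>) (pair_list as bs))"
    by (subst col_det_scale_rows) (subst col_det_swap_rows, auto)
  also have "(\<Prod>r<?n. if r < 2 then 1 else - 1 :: real) = (- 1) ^ j"
    by (induction j) (auto simp: numeral_2_eq_2)
  finally show ?thesis by (simp add: power_add)
qed

lemma solves_pair_swap:
  assumes "finite S" "finite S'"
  shows "n \<ge> 2 \<Longrightarrow> solves n (pair_row \<phi>) (S' <+> S) (z \<circ> swap_tag) \<longleftrightarrow> solves n (pair_row \<phi>) (S <+> S') z"
    and "(\<Sum>x\<in>S' <+> S. pair_row \<phi> (Suc (Suc r)) x * (z \<circ> swap_tag) x) = - (\<Sum>x\<in>S <+> S'. pair_row \<phi> (Suc (Suc r)) x * z x)"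
proof -
  have s: "(\<Sum>x\<in>S' <+> S. pair_row \<phi> r x * (z \<circ> swap_tag) x) =
     (if r = 0 then \<Sum>x\<in>S <+> S'. pair_row \<phi> 1 x * z x else if r = 1 then \<Sum>x\<in>S <+> S'. pair_row \<phi> 0 x * z x
      else - (\<Sum>x\<in>S <+> S'. pair_row \<phi> r x * z x))" for r
  proof -
    obtain r' where "r = 0 \<or> r = 1 \<or> r = Suc (Suc r')" by (metis One_nat_def not0_implies_Suc)
    thus ?thesis using assms by (auto simp: sum_pair_row)
  qed
  show "(\<Sum>x\<in>S' <+> S. pair_row \<phi> (Suc (Suc r)) x * (z \<circ> swap_tag) x) = - (\<Sum>x\<in>S <+> S'. pair_row \<phi> (Suc (Suc r)) x * z x)"
    using s[of "Suc (Suc r)"] by simp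
  have nn: "(\<forall>x\<in>S' <+> S. 0 \<le> (z \<circ> swap_tag) x) \<longleftrightarrow> (\<forall>x\<in>S <+> S'. 0 \<le> z x)"
    by (auto simp: Plus_def ball_Un)
  have e: "(\<forall>r<n. (\<Sum>x\<in>S' <+> S. pair_row \<phi> r x * (z \<circ> swap_tag) x) = (if r < 2 then 1 else 0)) \<longleftrightarrow>
      (\<forall>r<n. (\<Sum>x\<in>S <+> S'. pair_row \<phi> r x * z x) = (if r < 2 then 1 else 0))"
    (is "(\<forall>r<n. ?A r) \<longleftrightarrow> (\<forall>r<n. ?B r)") if n: "n \<ge> 2"
  proof -
    define p where "p = (\<lambda>r::nat. if r = 0 then 1 else if r = 1 then 0 else r)"
    have p: "p r < n" if "r < n" for r using that n by (auto simp: p_def)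
    have pp: "p (p r) = r" for r by (auto simp: p_def)
    have AB: "?A r \<longleftrightarrow> ?B (p r)" for r unfolding s p_def by auto
    show ?thesis
    proof (intro iffI allI impI)
      fix r assume "\<forall>r<n. ?A r" "r < n"
      hence "?A (p r)" using p by blast
      thus "?B r" unfolding AB pp .
    next
      fix r assume "\<forall>r<n. ?B r" "r < n"
      hence "?B (p r)" using p by blast
      thus "?A r" unfolding AB .
    qed
  qed
  show "solves n (pair_row \<phi>) (S' <+> S) (z \<circ> swap_tag) \<longleftrightarrow> solves n (pair_row \<phi>) (S <+> S') z" if "n \<ge> 2"
    unfolding solves_def nn e[OF that] ..
qed

lemma swap_tag_swap_tag [simp]: "swap_tag \<circ> swap_tag = id"
proof
  fix x :: "'a + 'a"
  show "(swap_tag \<circ> swap_tag) x = id x" by (cases x) auto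
qed

text \<open>If the determinant is nonzero, the solution is unique, and by genericity the next
  coordinate difference does not vanish there, so it is on exactly one side. Exchanging the
  simplices negates that difference and turns the other side into the counted one.\<close>

lemma zero_count_decompose:
  assumes gen: "generic_rows (Suc j) V \<phi>"
    and S: "S \<subseteq> V" "S' \<subseteq> V" "S \<inter> S' = {}" "card S + card S' = j + 2"
    and l: "distinct as" "set as = S" "distinct bs" "set bs = S'"
  shows "zero_count (j + 2) (pair_row \<phi>) (pair_list as bs) = half_count (j + 2) (pair_row \<phi>) (pair_list as bs)
    + (- 1) ^ (1 + j + card S * card S') * half_count (j + 2) (pair_row \<phi>) (pair_list bs as)"
proof -
  define D where "D = col_det (j + 2) (pair_row \<phi>) (pair_list as bs)"
  define e where "e = 1 + j + card S * card S'"
  define sol where "sol = (\<lambda>z. solves (j + 2) (pair_row \<phi>) (S <+> S') z)"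
  define g where "g = (\<lambda>z. (\<Sum>x\<in>S <+> S'. pair_row \<phi> (j + 2) x * z x))"
  have fin: "finite S" "finite S'" using l by auto
  have len: "length as = card S" "length bs = card S'" using l by (metis distinct_card)+
  have D': "col_det (j + 2) (pair_row \<phi>) (pair_list bs as) = (- 1) ^ e * D"
    unfolding D_def e_def using col_det_pair_swap[OF l(1,3)] len S(4) by simp
  have isD: "int_sgn ((- 1) ^ e * D) = (- 1) ^ e * int_sgn D" by (cases "even e") (auto simp: int_sgn_minus)
  have exq: "(\<exists>z. solves (j + 2) (pair_row \<phi>) (S' <+> S) z \<and> (- 1) ^ (j + 2) * (\<Sum>x\<in>S' <+> S. pair_row \<phi> (j + 2) x * z x) < 0)
    \<longleftrightarrow> (\<exists>z. sol z \<and> (- 1) ^ (j + 2) * g z > 0)" (is "(\<exists>z. ?P z) \<longleftrightarrow> (\<exists>z. ?Q z)")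
  proof -
    have *: "?P (z \<circ> swap_tag) \<longleftrightarrow> ?Q z" for z
      using solves_pair_swap(1)[OF fin, where n = "j + 2" and \<phi> = \<phi> and z = z]
        solves_pair_swap(2)[OF fin, where r = j and \<phi> = \<phi> and z = z]
      by (simp add: sol_def g_def)
    show ?thesis
    proof
      assume "\<exists>z. ?P z"
      then obtain z where "?P z" by blast
      hence "?P ((z \<circ> swap_tag) \<circ> swap_tag)" by (simp only: o_assoc[symmetric] swap_tag_swap_tag comp_id)
      thus "\<exists>z. ?Q z" using * by blast
    qed (use * in blast)
  qed
  have h2: "half_count (j + 2) (pair_row \<phi>) (pair_list bs as) =
     (if \<exists>z. sol z \<and> (- 1) ^ (j + 2) * g z > 0 then (- 1) ^ e * int_sgn D else 0)"
    unfolding half_count_def set_pair_list l D' by (simp only: isD exq)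
  have h1: "half_count (j + 2) (pair_row \<phi>) (pair_list as bs) =
     (if \<exists>z. sol z \<and> (- 1) ^ (j + 2) * g z < 0 then int_sgn D else 0)"
    unfolding half_count_def set_pair_list l D_def sol_def g_def ..
  have z: "zero_count (j + 2) (pair_row \<phi>) (pair_list as bs) = (if \<exists>z. sol z then int_sgn D else 0)"
    unfolding zero_count_def set_pair_list l D_def sol_def ..
  have ee: "(- 1::int) ^ e * ((- 1) ^ e * k) = k" for k by (simp flip: mult.assoc power_mult_distrib)
  have "(if \<exists>z. sol z then int_sgn D else 0) = (if \<exists>z. sol z \<and> (- 1) ^ (j + 2) * g z < 0 then int_sgn D else 0)
     + (if \<exists>z. sol z \<and> (- 1) ^ (j + 2) * g z > 0 then int_sgn D else 0)"
  proof (cases "D = 0 \<or> \<not> (\<exists>z. sol z)")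
    case False
    then obtain z where z: "sol z" and D: "D \<noteq> 0" by blast
    have geq: "g z' = g z" if z': "sol z'" for z'
      unfolding g_def
    proof (rule sum.cong[OF refl])
      fix x assume x: "x \<in> S <+> S'"
      have "z' x - z x = 0"
      proof (rule col_det_nonzero_imp_independent[of "pair_list as bs" "j + 2" "pair_row \<phi>" "\<lambda>x. z' x - z x"])
        show "col_det (j + 2) (pair_row \<phi>) (pair_list as bs) \<noteq> 0" using D by (simp add: D_def)
        show "(\<Sum>x\<in>set (pair_list as bs). pair_row \<phi> i x * (z' x - z x)) = 0" if "i < j + 2" for i
          using z z' that unfolding set_pair_list l sol_def solves_def
          by (simp add: right_diff_distrib sum_subtractf)
        show "distinct (pair_list as bs)" using l by (auto simp: distinct_map)
      qed (use x l len S(4) in \<open>auto simp: set_pair_list\<close>)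
      thus "pair_row \<phi> (j + 2) x * z' x = pair_row \<phi> (j + 2) x * z x" by simp
    qed
    have gz: "g z \<noteq> 0"
    proof
      assume "g z = 0"
      hence "solves (Suc j + 2) (pair_row \<phi>) (S <+> S') z"
        using solves_Suc[of "j + 2" "pair_row \<phi>" "S <+> S'" z] z by (simp add: sol_def g_def)
      from generic_rows_support[OF gen S(1-3) fin this]
      have "j + 2 < card {x \<in> S <+> S'. z x \<noteq> 0}" by simp
      also have "\<dots> \<le> card (S <+> S')" using fin by (intro card_mono) auto
      also have "\<dots> = j + 2" using S fin by (simp add: card_Plus)
      finally show False by simp
    qed
    have E: "(\<exists>z'. sol z' \<and> P (g z')) \<longleftrightarrow> P (g z)" for P
    proof
      assume "\<exists>z'. sol z' \<and> P (g z')"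
      then obtain z' where "sol z'" "P (g z')" by blast
      thus "P (g z)" using geq[of z'] by simp
    qed (use z in blast)
    define y where "y = (- 1) ^ (j + 2) * g z"
    have y: "y \<noteq> 0" "\<exists>z. sol z" using gz z by (auto simp: y_def)
    show ?thesis
      unfolding E[of "\<lambda>y. (- 1) ^ (j + 2) * y < 0"] E[of "\<lambda>y. (- 1) ^ (j + 2) * y > 0"] y_def[symmetric]
      using y by (cases "y < 0") auto
  qed auto
  moreover have "(- 1) ^ e * (if Q then (- 1) ^ e * int_sgn D else 0) = (if Q then int_sgn D else 0)" for Q
    using ee by simp
  ultimately show ?thesis unfolding z h1 h2 e_def[symmetric] by (simp only:)
qed

section \<open>Subdivided simplices as pseudomanifolds\<close>

lemma realization_iff:
  fixes \<sigma> :: "'a::finite set"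
  shows "x \<in> realization \<sigma> \<longleftrightarrow> (\<forall>v. 0 \<le> x $ v) \<and> (\<Sum>v\<in>UNIV. x $ v) = 1 \<and> (\<forall>v. v \<notin> \<sigma> \<longrightarrow> x $ v = 0)"
proof -
  have inj: "inj_on (\<lambda>v. axis v (1::real)) \<sigma>" by (auto simp: inj_on_def axis_eq_axis)
  have comp: "(\<Sum>v\<in>\<sigma>. u v *\<^sub>R axis v (1::real)) $ w = (if w \<in> \<sigma> then u w else 0)" for u w
    by (auto simp: axis_def if_distrib[of "\<lambda>x. _ * x"] cong: if_cong)
  have restr: "(\<Sum>v\<in>\<sigma>. y $ v) = (\<Sum>v\<in>UNIV. y $ v)" if "\<forall>v. v \<notin> \<sigma> \<longrightarrow> y $ v = 0" for y :: "real ^ 'a"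
    using that by (intro sum.mono_neutral_left) auto
  have "realization \<sigma> = {y. \<exists>u. (\<forall>v\<in>\<sigma>. 0 \<le> u v) \<and> sum u \<sigma> = 1 \<and> (\<Sum>v\<in>\<sigma>. u v *\<^sub>R axis v (1::real)) = y}"
  proof -
    have "realization \<sigma> = {y. \<exists>u. (\<forall>x\<in>(\<lambda>v. axis v (1::real)) ` \<sigma>. 0 \<le> u x) \<and> sum u ((\<lambda>v. axis v 1) ` \<sigma>) = 1 \<and>
       (\<Sum>x\<in>(\<lambda>v. axis v 1) ` \<sigma>. u x *\<^sub>R x) = y}"
      unfolding realization_def by (rule convex_hull_finite) simp
    also have "\<dots> = {y. \<exists>u. (\<forall>v\<in>\<sigma>. 0 \<le> u v) \<and> sum u \<sigma> = 1 \<and> (\<Sum>v\<in>\<sigma>. u v *\<^sub>R axis v (1::real)) = y}"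
    proof (intro Collect_cong iffI)
      fix y assume "\<exists>u. (\<forall>x\<in>(\<lambda>v. axis v (1::real)) ` \<sigma>. 0 \<le> u x) \<and> sum u ((\<lambda>v. axis v 1) ` \<sigma>) = 1 \<and>
       (\<Sum>x\<in>(\<lambda>v. axis v 1) ` \<sigma>. u x *\<^sub>R x) = y"
      then obtain u where u: "\<forall>x\<in>(\<lambda>v. axis v (1::real)) ` \<sigma>. 0 \<le> u x" "sum u ((\<lambda>v. axis v 1) ` \<sigma>) = 1"
        "(\<Sum>x\<in>(\<lambda>v. axis v 1) ` \<sigma>. u x *\<^sub>R x) = y" by blast
      show "\<exists>u. (\<forall>v\<in>\<sigma>. 0 \<le> u v) \<and> sum u \<sigma> = 1 \<and> (\<Sum>v\<in>\<sigma>. u v *\<^sub>R axis v (1::real)) = y"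
        using u by (intro exI[of _ "\<lambda>v. u (axis v 1)"]) (simp add: sum.reindex[OF inj] o_def)
    next
      fix y assume "\<exists>u. (\<forall>v\<in>\<sigma>. 0 \<le> u v) \<and> sum u \<sigma> = 1 \<and> (\<Sum>v\<in>\<sigma>. u v *\<^sub>R axis v (1::real)) = y"
      then obtain u where u: "\<forall>v\<in>\<sigma>. 0 \<le> u v" "sum u \<sigma> = 1" "(\<Sum>v\<in>\<sigma>. u v *\<^sub>R axis v (1::real)) = y" by blast
      have i: "inv_into \<sigma> (\<lambda>v. axis v (1::real)) (axis v 1) = v" if "v \<in> \<sigma>" for v
        using inj that by (rule inv_into_f_f)
      show "\<exists>u. (\<forall>x\<in>(\<lambda>v. axis v (1::real)) ` \<sigma>. 0 \<le> u x) \<and> sum u ((\<lambda>v. axis v 1) ` \<sigma>) = 1 \<and>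
       (\<Sum>x\<in>(\<lambda>v. axis v 1) ` \<sigma>. u x *\<^sub>R x) = y"
        using u i by (intro exI[of _ "\<lambda>x. u (inv_into \<sigma> (\<lambda>v. axis v 1) x)"]) (simp add: sum.reindex[OF inj] o_def)
    qed
    finally show ?thesis .
  qed
  also have "x \<in> \<dots> \<longleftrightarrow> (\<forall>v. 0 \<le> x $ v) \<and> (\<Sum>v\<in>UNIV. x $ v) = 1 \<and> (\<forall>v. v \<notin> \<sigma> \<longrightarrow> x $ v = 0)"
  proof
    assume "x \<in> {y. \<exists>u. (\<forall>v\<in>\<sigma>. 0 \<le> u v) \<and> sum u \<sigma> = 1 \<and> (\<Sum>v\<in>\<sigma>. u v *\<^sub>R axis v (1::real)) = y}"
    then obtain u where u: "\<forall>v\<in>\<sigma>. 0 \<le> u v" "sum u \<sigma> = 1" "(\<Sum>v\<in>\<sigma>. u v *\<^sub>R axis v (1::real)) = x" by blast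
    have x: "x $ w = (if w \<in> \<sigma> then u w else 0)" for w using comp[of u w] u(3) by simp
    hence "(\<Sum>v\<in>UNIV. x $ v) = (\<Sum>v\<in>\<sigma>. u v)" using restr[of x] by simp
    thus "(\<forall>v. 0 \<le> x $ v) \<and> (\<Sum>v\<in>UNIV. x $ v) = 1 \<and> (\<forall>v. v \<notin> \<sigma> \<longrightarrow> x $ v = 0)" using x u by auto
  next
    assume *: "(\<forall>v. 0 \<le> x $ v) \<and> (\<Sum>v\<in>UNIV. x $ v) = 1 \<and> (\<forall>v. v \<notin> \<sigma> \<longrightarrow> x $ v = 0)"
    have "(\<Sum>v\<in>\<sigma>. x $ v *\<^sub>R axis v (1::real)) = x"
      using * comp[of "\<lambda>v. x $ v"] by (auto simp: Finite_Cartesian_Product.vec_eq_iff)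
    thus "x \<in> {y. \<exists>u. (\<forall>v\<in>\<sigma>. 0 \<le> u v) \<and> sum u \<sigma> = 1 \<and> (\<Sum>v\<in>\<sigma>. u v *\<^sub>R axis v (1::real)) = y}"
      using * restr[of x] by auto
  qed
  finally show ?thesis .
qed

lemma realization_Int: "realization \<sigma> \<inter> realization \<tau> = realization (\<sigma> \<inter> \<tau>)"
  by (auto simp: realization_iff)

lemma realization_empty: "realization {} = {}"
  by (simp add: realization_def)

lemma convex_realization: "convex (realization \<sigma>)"
  by (simp add: realization_def)

lemma axis_in_realization: "v \<in> \<sigma> \<Longrightarrow> axis v 1 \<in> realization \<sigma>"
  unfolding realization_def by (intro hull_inc) auto

lemma realization_face:
  assumes "\<rho> \<subseteq> \<sigma>"
  shows "realization \<rho> face_of realization \<sigma>"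
  unfolding face_of_def
proof (intro conjI ballI impI)
  show "realization \<rho> \<subseteq> realization \<sigma>"
    using assms unfolding subset_iff realization_iff by blast
  show "convex (realization \<rho>)" by (rule convex_realization)
next
  fix a b x assume ab: "a \<in> realization \<sigma>" "b \<in> realization \<sigma>" "x \<in> realization \<rho>" "x \<in> open_segment a b"
  then obtain u where u: "0 < u" "u < 1" "x = (1 - u) *\<^sub>R a + u *\<^sub>R b" by (auto simp: in_segment)
  have "a $ v = 0 \<and> b $ v = 0" if "v \<notin> \<rho>" for v
  proof -
    have "0 \<le> a $ v" "0 \<le> b $ v" using ab by (auto simp: realization_iff)
    moreover have "(1 - u) * a $ v + u * b $ v = 0" using u(3) ab(3) that by (auto simp: realization_iff)
    moreover have "0 \<le> (1 - u) * a $ v" "0 \<le> u * b $ v" using calculation u by auto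
    ultimately have "(1 - u) * a $ v = 0" "u * b $ v = 0" by linarith+
    thus ?thesis using u by auto
  qed
  thus "a \<in> realization \<rho>" "b \<in> realization \<rho>" using ab by (auto simp: realization_iff)
qed

section \<open>Affine independence and determinants in barycentric coordinates\<close>

lemma simplex_vertices_hull: "\<not> affine_dependent S \<Longrightarrow> simplex_vertices (convex hull S) = S"
  by (auto simp: simplex_vertices_def extreme_point_of_convex_hull_affine_independent)

lemma affine_independent_hull_inj:
  fixes S S' :: "(real ^ 'a::finite) set"
  assumes "\<not> affine_dependent S" "\<not> affine_dependent S'" "convex hull S = convex hull S'"
  shows "S = S'"
proof -
  have "S = simplex_vertices (convex hull S)" by (rule simplex_vertices_hull[OF assms(1), symmetric])
  also have "\<dots> = S'" unfolding assms(3) by (rule simplex_vertices_hull[OF assms(2)])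
  finally show ?thesis .
qed

lemma sum_coordinates:
  fixes c :: "real ^ 'a::finite \<Rightarrow> real"
  assumes "\<And>s. s \<in> S \<Longrightarrow> (\<Sum>v\<in>UNIV. s $ v) = 1"
  shows "(\<Sum>v\<in>UNIV. (\<Sum>s\<in>S. c s *\<^sub>R s) $ v) = (\<Sum>s\<in>S. c s)"
proof -
  have "(\<Sum>v\<in>UNIV. (\<Sum>s\<in>S. c s *\<^sub>R s) $ v) = (\<Sum>v\<in>UNIV. \<Sum>s\<in>S. c s * s $ v)" by simp
  also have "\<dots> = (\<Sum>s\<in>S. \<Sum>v\<in>UNIV. c s * s $ v)" by (rule sum.swap)
  also have "\<dots> = (\<Sum>s\<in>S. c s)" using assms by (intro sum.cong refl) (simp flip: sum_distrib_left)
  finally show ?thesis .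
qed

text \<open>The coordinates of points of a realization sum to one, so every linear relation between
  them is an affine one.\<close>

lemma affine_independent_in_simplex:
  assumes ind: "\<not> affine_dependent S" and sub: "S \<subseteq> realization \<sigma>"
    and c: "(\<Sum>s\<in>S. c s *\<^sub>R s) = 0" and "s \<in> S"
  shows "c s = 0"
proof -
  have fin: "finite S" using ind by (rule aff_independent_finite)
  have "(\<Sum>v\<in>UNIV. (\<Sum>s\<in>S. c s *\<^sub>R s) $ v) = (\<Sum>s\<in>S. c s)"
    using sub by (intro sum_coordinates) (auto simp: realization_iff)
  hence "sum c S = 0" using c by simp
  thus ?thesis using ind c \<open>s \<in> S\<close> unfolding affine_dependent_explicit_finite[OF fin] by blast
qed

lemma card_simplex_le:
  assumes ind: "\<not> affine_dependent S" and sub: "S \<subseteq> realization \<sigma>"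
  shows "card S \<le> card \<sigma>"
proof -
  have "int (card S) = aff_dim S + 1" using ind by (rule aff_dim_affine_independent)
  also have "aff_dim S \<le> aff_dim (realization \<sigma>)" using sub by (rule aff_dim_subset)
  also have "\<dots> = aff_dim ((\<lambda>v. axis v (1::real)) ` \<sigma>)" by (simp add: realization_def aff_dim_convex_hull)
  also have "\<dots> \<le> int (card ((\<lambda>v. axis v (1::real)) ` \<sigma>)) - 1" by (rule aff_dim_le_card) simp
  finally show ?thesis using card_image_le[of \<sigma> "\<lambda>v. axis v (1::real)"] by simp
qed

abbreviation bary_det :: "'a list \<Rightarrow> (real ^ 'a::finite) list \<Rightarrow> real" where
  "bary_det vs as \<equiv> col_det (length vs) (\<lambda>i a. a $ (vs ! i)) as"

lemma bary_det_transpose: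
  assumes "length as = length vs"
  shows "bary_det vs as = Determinant.det (Matrix.mat (length vs) (length vs) (\<lambda>(i, j). (as ! i) $ (vs ! j)))"
    and "bary_det vs as = col_det (length vs) (\<lambda>i v. (as ! i) $ v) vs"
proof -
  let ?n = "length vs"
  let ?A = "Matrix.mat ?n ?n (\<lambda>(i, j). (as ! i) $ (vs ! j))"
  have "transpose_mat ?A = Matrix.mat ?n ?n (\<lambda>(i, j). (as ! j) $ (vs ! i))" by (intro eq_matI) auto
  moreover have "Determinant.det (transpose_mat ?A) = Determinant.det ?A" by (rule det_transpose[of _ ?n]) simp
  ultimately show "bary_det vs as = Determinant.det ?A" by (simp add: col_det_def)
  thus "bary_det vs as = col_det ?n (\<lambda>i v. (as ! i) $ v) vs" by (simp add: col_det_def)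
qed

lemma bary_det_reorder_vertices:
  assumes "same_elems vs ws" "length as = length vs"
  shows "bary_det ws as = of_int (reorder_sign vs ws) * bary_det vs as"
proof -
  have l: "length ws = length vs" using assms(1) unfolding same_elems_def by (metis distinct_card)
  have "bary_det ws as = col_det (length ws) (\<lambda>i v. (as ! i) $ v) ws"
    using assms(2) l by (intro bary_det_transpose(2)) simp
  also have "\<dots> = of_int (reorder_sign vs ws) * col_det (length vs) (\<lambda>i v. (as ! i) $ v) vs"
    unfolding l by (rule col_det_reorder[OF assms(1) refl])
  also have "col_det (length vs) (\<lambda>i v. (as ! i) $ v) vs = bary_det vs as"
    using assms(2) by (rule bary_det_transpose(2)[symmetric])
  finally show ?thesis .
qed

lemma bary_det_nonzero:
  assumes ind: "\<not> affine_dependent S" and sub: "S \<subseteq> realization \<sigma>" and card: "card S = card \<sigma>"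
    and as: "distinct as" "set as = S" and vs: "distinct vs" "set vs = \<sigma>"
  shows "bary_det vs as \<noteq> 0"
proof
  assume "bary_det vs as = 0"
  moreover have "length as = length vs" using as vs card by (metis distinct_card)
  ultimately obtain c where c: "\<And>i. i < length vs \<Longrightarrow> (\<Sum>a\<in>set as. a $ (vs ! i) * c a) = 0" "\<exists>a\<in>set as. c a \<noteq> 0"
    using col_det_zero_imp_dependent[of as "length vs" "\<lambda>i a. a $ (vs ! i)"] as by metis
  have "(\<Sum>a\<in>S. c a *\<^sub>R a) = 0"
  proof (subst Finite_Cartesian_Product.vec_eq_iff, rule allI)
    fix v
    show "(\<Sum>a\<in>S. c a *\<^sub>R a) $ v = (0 :: real ^ 'a) $ v"
    proof (cases "v \<in> \<sigma>")
      case True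
      then obtain i where "i < length vs" "vs ! i = v" using vs by (metis in_set_conv_nth)
      thus ?thesis using c(1)[of i] as by (simp add: mult.commute)
    next
      case False
      hence "a $ v = 0" if "a \<in> S" for a using sub that by (auto simp: realization_iff)
      thus ?thesis by simp
    qed
  qed
  thus False using affine_independent_in_simplex[OF ind sub] c(2) as by blast
qed

lemma col_det_linear_first:
  "\<exists>k. \<forall>y. col_det (Suc n) G (y # xs) = (\<Sum>i<Suc n. G i y * k i)"
proof -
  define k where "k = (\<lambda>i. (- 1) ^ i * Determinant.det (Matrix.mat n n (\<lambda>(i', j). G (if i' < i then i' else Suc i') (xs ! j))))"
  have "col_det (Suc n) G (y # xs) = (\<Sum>i<Suc n. G i y * k i)" for y
  proof -
    let ?A = "Matrix.mat (Suc n) (Suc n) (\<lambda>(i, j). G i ((y # xs) ! j))"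
    have "mat_delete ?A i 0 = Matrix.mat n n (\<lambda>(i', j). G (if i' < i then i' else Suc i') (xs ! j))" if "i < Suc n" for i
      using that by (intro eq_matI) (auto simp: mat_delete_def)
    hence "Determinant.cofactor ?A i 0 = k i" if "i < Suc n" for i
      using that by (simp add: Determinant.cofactor_def k_def)
    moreover have "col_det (Suc n) G (y # xs) = (\<Sum>i<Suc n. ?A $$ (i, 0) * Determinant.cofactor ?A i 0)"
      unfolding col_det_def by (rule laplace_expansion_column) auto
    ultimately show ?thesis by simp
  qed
  thus ?thesis by blast
qed

lemma col_det_repeated:
  assumes "i < j" "j < length xs" "xs ! i = xs ! j"
  shows "col_det (length xs) G xs = 0"
  unfolding col_det_def by (rule det_identical_columns[of _ "length xs" i j]) (use assms in auto)

lemma col_det_zero_row: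
  assumes "i < n" "\<And>x. x \<in> set xs \<Longrightarrow> G i x = 0" "length xs = n"
  shows "col_det n G xs = 0"
proof -
  let ?A = "Matrix.mat n n (\<lambda>(i, j). G i (xs ! j))"
  have "col_det n G xs = (\<Sum>j<n. ?A $$ (i, j) * Determinant.cofactor ?A i j)"
    unfolding col_det_def by (rule laplace_expansion_row) (use assms in auto)
  also have "\<dots> = 0" using assms by (intro sum.neutral) auto
  finally show ?thesis .
qed

lemma bary_det_Cons:
  assumes "length as = length vs" "\<And>a. a \<in> set as \<Longrightarrow> a $ v = 0" "v \<notin> set vs"
  shows "bary_det (v # vs) (axis v 1 # as) = bary_det vs as"
proof -
  let ?n = "length vs"
  let ?A = "Matrix.mat (Suc ?n) (Suc ?n) (\<lambda>(i, j). ((axis v (1::real) # as) ! j) $ ((v # vs) ! i))"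
  have "bary_det (v # vs) (axis v 1 # as) = (\<Sum>j<Suc ?n. ?A $$ (0, j) * Determinant.cofactor ?A 0 j)"
    unfolding col_det_def by (simp only: list.size add_0_right add_Suc_right) (rule laplace_expansion_row, auto)
  also have "\<dots> = (\<Sum>j\<in>{0}. ?A $$ (0, j) * Determinant.cofactor ?A 0 j)"
  proof (rule sum.mono_neutral_right)
    show "\<forall>j\<in>{..<Suc ?n} - {0}. ?A $$ (0, j) * Determinant.cofactor ?A 0 j = 0"
    proof
      fix j assume j: "j \<in> {..<Suc ?n} - {0}"
      then obtain k where k: "j = Suc k" "k < length as" using assms(1) by (cases j) auto
      hence "as ! k \<in> set as" by simp
      hence "?A $$ (0, j) = 0" using k j assms by simp
      thus "?A $$ (0, j) * Determinant.cofactor ?A 0 j = 0" by simp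
    qed
  qed auto
  also have "\<dots> = Determinant.cofactor ?A 0 0" by simp
  also have "mat_delete ?A 0 0 = Matrix.mat ?n ?n (\<lambda>(i, j). (as ! j) $ (vs ! i))"
    by (intro eq_matI) (auto simp: mat_delete_def)
  hence "Determinant.cofactor ?A 0 0 = bary_det vs as" by (simp add: Determinant.cofactor_def col_det_def)
  finally show ?thesis .
qed

text \<open>An arbitrary orientation of each simplex of the subdivision. It enters every term twice,
  through \<open>piece_sign\<close> and through the count of solutions, so the choice
  cancels.\<close>

definition vertex_list :: "'p set \<Rightarrow> 'p list" where
  "vertex_list S = (SOME xs. distinct xs \<and> set xs = S)"

lemma vertex_list: "finite S \<Longrightarrow> distinct (vertex_list S) \<and> set (vertex_list S) = S"
  unfolding vertex_list_def by (rule someI_ex) (use finite_distinct_list in auto)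

lemma length_vertex_list: "finite S \<Longrightarrow> length (vertex_list S) = card S"
  using vertex_list by (metis distinct_card)

section \<open>Pieces of a subdivided simplex and the two sides of a facet\<close>

locale subdivided_complex = oriented_complex L ori
  for L :: "'a::finite set set" and ori +
  fixes T :: "(real ^ 'a) set set"
  assumes sub: "subdivision_of T L"
begin

lemma T_finite: "finite T" and T_face: "\<alpha> \<in> T \<Longrightarrow> \<beta> face_of \<alpha> \<Longrightarrow> \<beta> \<in> T"
  and T_Int: "\<alpha> \<in> T \<Longrightarrow> \<beta> \<in> T \<Longrightarrow> \<alpha> \<inter> \<beta> face_of \<alpha>"
  and T_Union: "\<Union> T = polyhedron_of L"
  and T_sub: "\<alpha> \<in> T \<Longrightarrow> \<exists>\<sigma>\<in>L. \<alpha> \<subseteq> realization \<sigma>"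
  using sub unfolding subdivision_of_def simplicial_complex_def by blast+

lemma T_simplex:
  assumes "\<alpha> \<in> T"
  obtains S where "\<not> affine_dependent S" "\<alpha> = convex hull S"
  using sub assms unfolding subdivision_of_def simplicial_complex_def simplex_def by metis

lemma T_convex: "\<alpha> \<in> T \<Longrightarrow> convex \<alpha>"
  by (metis T_simplex convex_convex_hull)

text \<open>A simplex of \<open>T\<close> through \<open>y\<close> may leave
  \<open>\<sigma>\<close>, but it lies in some \<open>\<sigma>'\<close>. The common face of
  \<open>\<sigma>\<close> and \<open>\<sigma>'\<close> cuts a face out of it, which belongs to
  \<open>T\<close> and still contains \<open>y\<close>.\<close>

lemma T_cover:
  assumes \<sigma>: "\<sigma> \<in> L" and y: "y \<in> realization \<sigma>"
  shows "\<exists>\<alpha>\<in>T. \<alpha> \<subseteq> realization \<sigma> \<and> y \<in> \<alpha>"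
proof -
  have "y \<in> \<Union> T" unfolding T_Union polyhedron_of_def using assms by blast
  then obtain \<alpha> where \<alpha>: "\<alpha> \<in> T" "y \<in> \<alpha>" by blast
  then obtain \<sigma>' where s': "\<sigma>' \<in> L" "\<alpha> \<subseteq> realization \<sigma>'" using T_sub by blast
  have "realization (\<sigma> \<inter> \<sigma>') face_of realization \<sigma>'" by (intro realization_face) auto
  hence "(realization (\<sigma> \<inter> \<sigma>') \<inter> \<alpha>) face_of (realization \<sigma>' \<inter> \<alpha>)"
    using T_convex[OF \<alpha>(1)] by (rule face_of_slice)
  moreover have "realization \<sigma>' \<inter> \<alpha> = \<alpha>" using s' by blast
  ultimately have "realization (\<sigma> \<inter> \<sigma>') \<inter> \<alpha> \<in> T" using T_face[OF \<alpha>(1)] by simp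
  moreover have "realization (\<sigma> \<inter> \<sigma>') = realization \<sigma> \<inter> realization \<sigma>'" by (simp add: realization_Int)
  ultimately show ?thesis using \<alpha> s' y by (intro bexI[of _ "realization (\<sigma> \<inter> \<sigma>') \<inter> \<alpha>"]) auto
qed

text \<open>Recorded by vertex sets instead of hulls, so that facets arise by removing a vertex and
  the columns of the determinants are at hand.\<close>

definition pieces :: "'a set \<Rightarrow> (real ^ 'a) set set" where
  "pieces \<sigma> = {S. \<not> affine_dependent S \<and> convex hull S \<in> T \<and> convex hull S \<subseteq> realization \<sigma> \<and> card S = card \<sigma>}"

lemma piece_finite: "S \<in> pieces \<sigma> \<Longrightarrow> finite S"
  by (auto simp: pieces_def intro: aff_independent_finite)

lemma piece_sub: "S \<in> pieces \<sigma> \<Longrightarrow> S \<subseteq> realization \<sigma>"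
  using hull_subset[of S convex] by (auto simp: pieces_def)

lemma finite_pieces: "finite (pieces \<sigma>)"
proof (rule finite_imageD)
  show "finite ((hull) convex ` pieces \<sigma>)"
    by (rule finite_subset[OF _ T_finite]) (auto simp: pieces_def)
  show "inj_on ((hull) convex) (pieces \<sigma>)"
    by (rule inj_onI, rule affine_independent_hull_inj) (auto simp: pieces_def)
qed

definition piece_sign :: "'a set \<Rightarrow> (real ^ 'a) set \<Rightarrow> int" where
  "piece_sign \<sigma> S = int_sgn (bary_det (ori \<sigma>) (vertex_list S))"

definition cofaces :: "'a set \<Rightarrow> (real ^ 'a) set \<Rightarrow> (real ^ 'a) set" where
  "cofaces \<sigma> \<gamma> = {a. a \<notin> \<gamma> \<and> insert a \<gamma> \<in> pieces \<sigma>}"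

text \<open>The signed volume of the cone from \<open>y\<close> over \<open>\<gamma>\<close>: a
  linear functional of \<open>y\<close> that vanishes on \<open>\<gamma>\<close> and whose sign
  tells the side on which \<open>y\<close> lies.\<close>

definition side :: "'a set \<Rightarrow> (real ^ 'a) set \<Rightarrow> real ^ 'a \<Rightarrow> real" where
  "side \<sigma> \<gamma> y = bary_det (ori \<sigma>) (y # vertex_list \<gamma>)"

end

locale subdivided_facet = subdivided_complex +
  fixes \<sigma> and \<gamma> :: "(real ^ 'a) set"
  assumes \<sigma>: "\<sigma> \<in> L" and \<gamma>_ind: "\<not> affine_dependent \<gamma>" and \<gamma>_T: "convex hull \<gamma> \<in> T"
    and \<gamma>_sub: "convex hull \<gamma> \<subseteq> realization \<sigma>" and \<gamma>_card: "card \<sigma> = Suc (card \<gamma>)" and \<gamma>_ne: "\<gamma> \<noteq> {}"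
begin

lemma \<gamma>_fin: "finite \<gamma>" using \<gamma>_ind by (rule aff_independent_finite)

lemma \<gamma>_real: "\<gamma> \<subseteq> realization \<sigma>" using \<gamma>_sub hull_subset[of \<gamma> convex] by blast

lemma \<gamma>_list: "distinct (vertex_list \<gamma>)" "set (vertex_list \<gamma>) = \<gamma>" "length (vertex_list \<gamma>) = card \<gamma>"
  using vertex_list[OF \<gamma>_fin] length_vertex_list[OF \<gamma>_fin] by auto

lemma len_ori: "length (ori \<sigma>) = Suc (card \<gamma>)"
  using length_ori[OF \<sigma>] \<gamma>_card by simp

lemma side_linear:
  obtains k where "\<And>y. side \<sigma> \<gamma> y = (\<Sum>i<Suc (card \<gamma>). y $ (ori \<sigma> ! i) * k i)"
  using col_det_linear_first[of "card \<gamma>" "\<lambda>i a. a $ (ori \<sigma> ! i)" "vertex_list \<gamma>"]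
  unfolding side_def len_ori by auto

lemma side_add: "side \<sigma> \<gamma> (x + y) = side \<sigma> \<gamma> x + side \<sigma> \<gamma> y"
  and side_scale: "side \<sigma> \<gamma> (t *\<^sub>R x) = t * side \<sigma> \<gamma> x"
  by (rule side_linear; simp add: algebra_simps sum.distrib sum_distrib_left)+

lemma side_0: "side \<sigma> \<gamma> 0 = 0" using side_scale[of 0 0] by simp

lemma side_sum: "side \<sigma> \<gamma> (\<Sum>s\<in>S. c s *\<^sub>R s) = (\<Sum>s\<in>S. c s * side \<sigma> \<gamma> s)"
  by (induction S rule: infinite_finite_induct) (auto simp: side_0 side_add side_scale)

lemma side_expand:
  assumes "\<And>v. v \<notin> \<sigma> \<Longrightarrow> y $ v = 0"
  shows "side \<sigma> \<gamma> y = (\<Sum>v\<in>\<sigma>. y $ v * side \<sigma> \<gamma> (axis v 1))"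
proof -
  have "y = (\<Sum>v\<in>\<sigma>. y $ v *\<^sub>R axis v (1::real))"
    using assms by (auto simp: Finite_Cartesian_Product.vec_eq_iff axis_def if_distrib[of "\<lambda>x. _ * x"] cong: if_cong)
  moreover have "side \<sigma> \<gamma> (\<Sum>v\<in>S. y $ v *\<^sub>R axis v 1) = (\<Sum>v\<in>S. y $ v * side \<sigma> \<gamma> (axis v 1))" for S
    by (induction S rule: infinite_finite_induct) (auto simp: side_0 side_add side_scale)
  ultimately show ?thesis by metis
qed

lemma side_vertex: "g \<in> \<gamma> \<Longrightarrow> side \<sigma> \<gamma> g = 0"
proof -
  assume "g \<in> \<gamma>"
  then obtain i where i: "i < length (vertex_list \<gamma>)" "vertex_list \<gamma> ! i = g"
    using \<gamma>_list by (metis in_set_conv_nth)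
  have "col_det (length (g # vertex_list \<gamma>)) (\<lambda>i a. a $ (ori \<sigma> ! i)) (g # vertex_list \<gamma>) = 0"
    by (rule col_det_repeated[of 0 "Suc i"]) (use i in auto)
  thus ?thesis by (simp add: side_def len_ori \<gamma>_list)
qed

lemma side_hull: "y \<in> convex hull \<gamma> \<Longrightarrow> side \<sigma> \<gamma> y = 0"
  unfolding convex_hull_finite[OF \<gamma>_fin] by (auto simp: side_sum side_vertex)

lemma side_coface:
  assumes "a \<in> cofaces \<sigma> \<gamma>"
  shows "side \<sigma> \<gamma> a \<noteq> 0"
proof -
  have p: "insert a \<gamma> \<in> pieces \<sigma>" "a \<notin> \<gamma>" using assms by (auto simp: cofaces_def)
  have "\<not> affine_dependent (insert a \<gamma>)" "card (insert a \<gamma>) = card \<sigma>" using p(1) by (auto simp: pieces_def)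
  moreover have "distinct (a # vertex_list \<gamma>)" "set (a # vertex_list \<gamma>) = insert a \<gamma>"
    using p(2) \<gamma>_list by auto
  ultimately show ?thesis
    unfolding side_def using piece_sub[OF p(1)] ori_simplex[OF \<sigma>] by (intro bary_det_nonzero)
qed

text \<open>In the linear relation between \<open>a\<close>, \<open>b\<close> and
  \<open>\<gamma>\<close> given by minors, the coefficients of \<open>a\<close> and \<open>b\<close>
  have opposite signs. Adding a multiple of the vertices of \<open>\<gamma>\<close> to both sides
  yields a common point of the two simplices away from \<open>\<gamma>\<close>. Since the simplices
  meet in a common face, \<open>b\<close> would be a vertex of the other simplex.\<close>

lemma coface_unique:
  assumes a: "a \<in> cofaces \<sigma> \<gamma>" and b: "b \<in> cofaces \<sigma> \<gamma>" and same: "side \<sigma> \<gamma> a * side \<sigma> \<gamma> b > 0"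
  shows "a = b"
proof (rule ccontr)
  assume ne: "a \<noteq> b"
  let ?m = "Suc (card \<gamma>)"
  let ?G = "\<lambda>i a. a $ (ori \<sigma> ! i)"
  have ab: "a \<notin> \<gamma>" "b \<notin> \<gamma>" "insert a \<gamma> \<in> pieces \<sigma>" "insert b \<gamma> \<in> pieces \<sigma>"
    using a b by (auto simp: cofaces_def)
  have real: "a \<in> realization \<sigma>" "b \<in> realization \<sigma>" using piece_sub[OF ab(3)] piece_sub[OF ab(4)] by auto
  let ?xs = "a # b # vertex_list \<gamma>"
  have dist: "distinct ?xs" "length ?xs = Suc ?m" using ab ne \<gamma>_list by auto
  define ys where "ys = (\<lambda>x. if x = a then b # vertex_list \<gamma> else if x = b then a # vertex_list \<gamma> else vertex_list (set ?xs - {x}))"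
  have ys: "distinct (ys x) \<and> set (ys x) = set ?xs - {x}" if "x \<in> set ?xs" for x
  proof -
    have "finite (set ?xs - {x})" by simp
    from vertex_list[OF this] show ?thesis using ab ne \<gamma>_list by (auto simp: ys_def)
  qed
  define K where "K = (\<lambda>x. of_int (reorder_sign (x # ys x) ?xs) * col_det ?m ?G (ys x))"
  have ker: "(\<Sum>x\<in>set ?xs. ?G r x * K x) = 0" if "r < ?m" for r
    unfolding K_def by (rule col_det_kernel[OF dist that ys])
  have Ka: "K a = side \<sigma> \<gamma> b"
    using dist by (simp add: K_def ys_def side_def len_ori)
  have Kb: "K b = - side \<sigma> \<gamma> a"
  proof -
    have "reorder_sign (b # a # vertex_list \<gamma>) ?xs = - 1" using dist by (intro reorder_sign_swap) auto
    thus ?thesis using ne by (simp add: K_def ys_def side_def len_ori)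
  qed
  have set: "(\<Sum>x\<in>set ?xs. f x) = f a + f b + (\<Sum>g\<in>\<gamma>. f g)" for f :: "_ \<Rightarrow> real"
    using dist \<gamma>_fin \<gamma>_list(2) by (simp add: ab)
  have comp: "side \<sigma> \<gamma> b * a $ v - side \<sigma> \<gamma> a * b $ v + (\<Sum>g\<in>\<gamma>. K g * g $ v) = 0" for v
  proof (cases "v \<in> \<sigma>")
    case True
    then obtain i where "i < ?m" "ori \<sigma> ! i = v" using ori_simplex[OF \<sigma>] len_ori by (metis in_set_conv_nth)
    thus ?thesis using ker[of i] unfolding set by (simp add: Ka Kb algebra_simps)
  next
    case False
    thus ?thesis using real \<gamma>_real by (auto simp: realization_iff intro!: sum.neutral)
  qed
  \<comment> \<open>Normalizes the relation so that \<open>a\<close> and \<open>b\<close> have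
    positive coefficients once \<open>b\<close> is moved to the other side.\<close>
  define t where "t = sgn (side \<sigma> \<gamma> b)"
  define p where "p = t * side \<sigma> \<gamma> b"
  define q where "q = t * side \<sigma> \<gamma> a"
  have pq: "p > 0" "q > 0" using same by (auto simp: p_def q_def t_def zero_less_mult_iff sgn_if)
  \<comment> \<open>Large enough to make the coefficients \<open>t * K g + M\<close> nonnegative for
    all \<open>g \<in> \<gamma>\<close>.\<close>
  define M where "M = (\<Sum>g\<in>\<gamma>. \<bar>K g\<bar>)"
  have M: "\<bar>K g\<bar> \<le> M" if "g \<in> \<gamma>" for g unfolding M_def using that \<gamma>_fin by (intro member_le_sum) auto
  have t: "\<bar>t\<bar> \<le> 1" by (simp add: t_def sgn_if)
  define w where "w = (\<lambda>x. if x = a then p else t * K x + M)"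
  define w' where "w' = (\<lambda>x. if x = b then q else M)"
  have wn: "0 \<le> w x" if "x \<in> insert a \<gamma>" for x
  proof (cases "x = a")
    case False
    have "\<bar>t * K x\<bar> \<le> 1 * \<bar>K x\<bar>" unfolding abs_mult using t by (intro mult_right_mono) auto
    also have "\<dots> \<le> M" using M False that by simp
    finally have "- M \<le> t * K x" by linarith
    thus ?thesis using False by (simp add: w_def)
  qed (use pq in \<open>simp add: w_def\<close>)
  have wn': "0 \<le> w' x" if "x \<in> insert b \<gamma>" for x
    using pq M by (auto simp: w'_def M_def intro: sum_nonneg)
  have eq: "(\<Sum>x\<in>insert a \<gamma>. w x *\<^sub>R x) = (\<Sum>x\<in>insert b \<gamma>. w' x *\<^sub>R x)"
  proof (subst Finite_Cartesian_Product.vec_eq_iff, rule allI)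
    fix v
    have wg: "(\<Sum>g\<in>\<gamma>. w g * g $ v) = (\<Sum>g\<in>\<gamma>. (t * K g + M) * g $ v)"
      using ab by (intro sum.cong) (auto simp: w_def)
    have wg': "(\<Sum>g\<in>\<gamma>. w' g * g $ v) = (\<Sum>g\<in>\<gamma>. M * g $ v)"
      using ab by (intro sum.cong) (auto simp: w'_def)
    have "t * (side \<sigma> \<gamma> b * a $ v - side \<sigma> \<gamma> a * b $ v + (\<Sum>g\<in>\<gamma>. K g * g $ v)) = 0" using comp by simp
    hence "p * a $ v + (\<Sum>g\<in>\<gamma>. (t * K g + M) * g $ v) = q * b $ v + (\<Sum>g\<in>\<gamma>. M * g $ v)"
      by (simp add: p_def q_def algebra_simps sum.distrib sum_distrib_left)
    thus "(\<Sum>x\<in>insert a \<gamma>. w x *\<^sub>R x) $ v = (\<Sum>x\<in>insert b \<gamma>. w' x *\<^sub>R x) $ v"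
      using ab \<gamma>_fin by (simp add: wg wg') (simp add: w_def w'_def)
  qed
  define W where "W = sum w' (insert b \<gamma>)"
  have coord: "(\<Sum>v\<in>UNIV. s $ v) = 1" if "s \<in> insert a \<gamma> \<or> s \<in> insert b \<gamma>" for s
    using that real \<gamma>_real by (auto simp: realization_iff)
  have W: "sum w (insert a \<gamma>) = W"
    using sum_coordinates[of "insert a \<gamma>" w] sum_coordinates[of "insert b \<gamma>" w'] coord eq by (simp add: W_def)
  have Wpos: "W > 0"
  proof -
    have "0 < w' b" using pq by (simp add: w'_def)
    also have "\<dots> \<le> W" unfolding W_def using \<gamma>_fin wn' by (intro member_le_sum) auto
    finally show ?thesis .
  qed
  define z where "z = (\<Sum>x\<in>insert b \<gamma>. (w' x / W) *\<^sub>R x)"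
  have z': "z = (\<Sum>x\<in>insert a \<gamma>. (w x / W) *\<^sub>R x)"
  proof -
    have "z = (1 / W) *\<^sub>R (\<Sum>x\<in>insert b \<gamma>. w' x *\<^sub>R x)" by (simp add: z_def scaleR_sum_right)
    thus ?thesis unfolding eq[symmetric] by (simp only: scaleR_sum_right scaleR_scaleR) simp
  qed
  have zb: "z \<in> convex hull (insert b \<gamma>)"
    unfolding convex_hull_finite[OF finite.insertI[OF \<gamma>_fin]]
    using wn' Wpos by (auto intro!: exI[of _ "\<lambda>x. w' x / W"] simp: z_def simp flip: sum_divide_distrib W_def simp del: sum.insert)
  have za: "z \<in> convex hull (insert a \<gamma>)"
    unfolding convex_hull_finite[OF finite.insertI[OF \<gamma>_fin]]
    using wn Wpos W by (auto intro!: exI[of _ "\<lambda>x. w x / W"] simp: z' simp flip: sum_divide_distrib simp del: sum.insert)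
  have sz: "side \<sigma> \<gamma> z \<noteq> 0"
  proof -
    have "side \<sigma> \<gamma> z = (\<Sum>x\<in>insert b \<gamma>. w' x / W * side \<sigma> \<gamma> x)" unfolding z_def by (rule side_sum)
    also have "\<dots> = w' b / W * side \<sigma> \<gamma> b" using ab \<gamma>_fin by (simp add: side_vertex)
    finally show ?thesis using pq Wpos side_coface[OF b] by (simp add: w'_def)
  qed
  let ?A = "convex hull (insert a \<gamma>)" and ?B = "convex hull (insert b \<gamma>)"
  have AB: "?A \<in> T" "?B \<in> T" "\<not> affine_dependent (insert a \<gamma>)" "\<not> affine_dependent (insert b \<gamma>)"
    using ab by (auto simp: pieces_def)
  \<comment> \<open>The point \<open>z\<close> lies in both simplices but off the hyperplane of
    \<open>\<gamma>\<close>, so the common face must contain \<open>b\<close>; as a vertex of that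
    face, \<open>b\<close> is a vertex of \<open>?A\<close> too.\<close>
  have FB: "?A \<inter> ?B face_of ?B" using T_Int[OF AB(2,1)] by (simp add: Int_commute)
  then obtain c where c: "c \<subseteq> insert b \<gamma>" "?A \<inter> ?B = convex hull c"
    using face_of_convex_hull_affine_independent[OF AB(4)] by blast
  have "b \<in> c"
  proof (rule ccontr)
    assume "b \<notin> c"
    hence "convex hull c \<subseteq> convex hull \<gamma>" using c(1) by (intro hull_mono) auto
    thus False using za zb c(2) side_hull sz by blast
  qed
  hence "b \<in> ?A \<inter> ?B" using c(2) hull_subset[of c convex] by blast
  moreover have "b extreme_point_of ?B" using AB(4) by (simp add: extreme_point_of_convex_hull_affine_independent)
  ultimately have "b extreme_point_of (?A \<inter> ?B)" using extreme_point_of_face[OF FB] by blast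
  hence "b extreme_point_of ?A" using extreme_point_of_face[OF T_Int[OF AB(1,2)]] by blast
  hence "b \<in> insert a \<gamma>" using AB(3) by (simp add: extreme_point_of_convex_hull_affine_independent)
  thus False using ab ne by auto
qed

end

section \<open>Existence of cofaces\<close>

context subdivided_facet
begin

definition centre :: "real ^ 'a" where
  "centre = (\<Sum>g\<in>\<gamma>. (1 / real (card \<gamma>)) *\<^sub>R g)"

lemma card_\<gamma>_pos: "card \<gamma> > 0"
  using \<gamma>_fin \<gamma>_ne by (simp add: card_gt_0_iff)

lemma centre_interior: "centre \<in> rel_interior (convex hull \<gamma>)"
  unfolding rel_interior_convex_hull_explicit[OF \<gamma>_ind]
  using card_\<gamma>_pos by (auto intro!: exI[of _ "\<lambda>_. 1 / real (card \<gamma>)"] simp: centre_def)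

lemma centre_hull: "centre \<in> convex hull \<gamma>"
  using centre_interior rel_interior_subset by blast

lemma side_centre: "side \<sigma> \<gamma> centre = 0"
  using centre_hull by (rule side_hull)

lemma centre_coordinate: "centre $ v = (\<Sum>g\<in>\<gamma>. g $ v) / real (card \<gamma>)"
  by (simp add: centre_def sum_divide_distrib)

text \<open>The intersection is a face of the hull of \<open>\<gamma>\<close> that contains a
  relative interior point of it, hence it is all of that hull.\<close>

lemma face_containing_centre:
  assumes \<alpha>: "\<alpha> \<in> T" "centre \<in> \<alpha>"
  shows "convex hull \<gamma> face_of \<alpha>"
proof -
  have F: "convex hull \<gamma> \<inter> \<alpha> face_of convex hull \<gamma>" by (rule T_Int[OF \<gamma>_T \<alpha>(1)])
  have "convex hull \<gamma> \<subseteq> convex hull \<gamma> \<inter> \<alpha>"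
    using subset_of_face_of[OF F subset_refl] centre_interior centre_hull \<alpha>(2) by blast
  hence "\<alpha> \<inter> convex hull \<gamma> = convex hull \<gamma>" by blast
  thus ?thesis using T_Int[OF \<alpha>(1) \<gamma>_T] by simp
qed

text \<open>Points near the centre of \<open>\<gamma>\<close> in direction \<open>u\<close> lie in finitely many simplices of the
  subdivision, hence one of these simplices contains points arbitrarily close to the centre.\<close>

lemma coface_exists:
  assumes e: "e > 0" and u: "\<And>t. 0 < t \<Longrightarrow> t \<le> e \<Longrightarrow> centre + t *\<^sub>R u \<in> realization \<sigma>"
    and side: "side \<sigma> \<gamma> u \<noteq> 0"
  shows "\<exists>a\<in>cofaces \<sigma> \<gamma>. side \<sigma> \<gamma> a * side \<sigma> \<gamma> u > 0"
proof -
  define t where "t = (\<lambda>n::nat. e / real (Suc n))"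
  have t: "0 < t n" "t n \<le> e" for n using e by (auto simp: t_def field_simps)
  have "\<exists>\<alpha>\<in>T. \<alpha> \<subseteq> realization \<sigma> \<and> centre + t n *\<^sub>R u \<in> \<alpha>" for n
    using T_cover[OF \<sigma> u[OF t]] .
  hence "\<forall>n\<in>UNIV. \<exists>\<alpha>\<in>T. \<alpha> \<subseteq> realization \<sigma> \<and> centre + t n *\<^sub>R u \<in> \<alpha>" by blast
  from pigeonhole_infinite_rel[OF infinite_UNIV_nat T_finite this]
  obtain \<alpha> where \<alpha>: "\<alpha> \<in> T" and inf: "infinite {n. \<alpha> \<subseteq> realization \<sigma> \<and> centre + t n *\<^sub>R u \<in> \<alpha>}" by auto
  hence "{n. \<alpha> \<subseteq> realization \<sigma> \<and> centre + t n *\<^sub>R u \<in> \<alpha>} \<noteq> {}" by (metis finite.emptyI)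
  then obtain n0 where n0: "\<alpha> \<subseteq> realization \<sigma>" "centre + t n0 *\<^sub>R u \<in> \<alpha>" by blast
  obtain S where S: "\<not> affine_dependent S" "\<alpha> = convex hull S" using T_simplex[OF \<alpha>] .
  have finS: "finite S" using S(1) by (rule aff_independent_finite)
  have "closed \<alpha>" unfolding S(2) using finS by (intro compact_imp_closed finite_imp_compact_convex_hull)
  have "centre \<in> \<alpha>"
  proof (rule ccontr)
    assume "centre \<notin> \<alpha>"
    then obtain \<epsilon> where \<epsilon>: "\<epsilon> > 0" "\<And>y. dist y centre < \<epsilon> \<Longrightarrow> y \<notin> \<alpha>"
      using \<open>closed \<alpha>\<close> unfolding closed_def open_dist by blast
    obtain N :: nat where N: "e * norm u / \<epsilon> < real N" using reals_Archimedean2 by blast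
    obtain n where n: "n > N" "centre + t n *\<^sub>R u \<in> \<alpha>"
      using inf unfolding infinite_nat_iff_unbounded by blast
    have "dist (centre + t n *\<^sub>R u) centre = t n * norm u" using t(1)[of n] by (simp add: dist_norm)
    also have "\<dots> < \<epsilon>"
    proof -
      have "e * norm u < \<epsilon> * real N" using N \<epsilon> by (simp add: field_simps)
      also have "\<dots> < \<epsilon> * real (Suc n)" using n \<epsilon> by simp
      finally show ?thesis by (simp add: t_def field_simps)
    qed
    finally show False using \<epsilon>(2) n(2) by blast
  qed
  hence "convex hull \<gamma> face_of convex hull S" using face_containing_centre[OF \<alpha>] S(2) by simp
  then obtain c where c: "c \<subseteq> S" "convex hull \<gamma> = convex hull c"
    using face_of_convex_hull_affine_independent[OF S(1)] by blast
  have "\<gamma> = c" using \<gamma>_ind affine_independent_subset[OF S(1) c(1)] c(2) by (rule affine_independent_hull_inj)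
  with c have sub: "\<gamma> \<subseteq> S" by simp
  obtain w where w: "\<forall>s\<in>S. 0 \<le> w s" "sum w S = 1" "(\<Sum>s\<in>S. w s *\<^sub>R s) = centre + t n0 *\<^sub>R u"
    using n0(2) unfolding S(2) convex_hull_finite[OF finS] by auto
  have "side \<sigma> \<gamma> (centre + t n0 *\<^sub>R u) = t n0 * side \<sigma> \<gamma> u"
    by (simp add: side_add side_scale side_centre)
  hence sum: "(\<Sum>s\<in>S. w s * side \<sigma> \<gamma> s) = t n0 * side \<sigma> \<gamma> u" using w(3) side_sum by metis
  have "S \<subseteq> realization \<sigma>" using n0(1) S(2) hull_subset[of S convex] by blast
  \<comment> \<open>By dimension at most one vertex of \<open>S\<close> lies outside
    \<open>\<gamma>\<close>; at least one does, because \<open>side\<close> is nonzero at the chosen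
    point of the simplex.\<close>
  hence cS: "card S \<le> Suc (card \<gamma>)" using card_simplex_le[OF S(1)] \<gamma>_card by metis
  have "S \<noteq> \<gamma>"
  proof
    assume "S = \<gamma>"
    hence "(\<Sum>s\<in>S. w s * side \<sigma> \<gamma> s) = 0" by (simp add: side_vertex)
    thus False using sum side t(1)[of n0] by simp
  qed
  then obtain a where a: "a \<in> S" "a \<notin> \<gamma>" using sub by blast
  have "insert a \<gamma> \<subseteq> S" "card (insert a \<gamma>) = Suc (card \<gamma>)" using a sub \<gamma>_fin by auto
  hence Sa: "S = insert a \<gamma>" using cS finS by (metis card_seteq)
  hence "insert a \<gamma> \<in> pieces \<sigma>" using S \<alpha> n0(1) \<gamma>_card a \<gamma>_fin by (simp add: pieces_def)
  hence cof: "a \<in> cofaces \<sigma> \<gamma>" using a by (simp add: cofaces_def)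
  have "w a * side \<sigma> \<gamma> a = t n0 * side \<sigma> \<gamma> u"
    using sum a(2) \<gamma>_fin by (simp add: Sa side_vertex)
  moreover have "t n0 * side \<sigma> \<gamma> u * side \<sigma> \<gamma> u > 0" using side t(1)[of n0] by (simp add: mult.assoc not_sum_squares_lt_zero zero_less_mult_iff) (metis linorder_neqE_linordered_idom)
  ultimately have "w a * (side \<sigma> \<gamma> a * side \<sigma> \<gamma> u) > 0" by (simp add: mult.assoc[symmetric])
  moreover have "w a \<ge> 0" using w(1) a by blast
  ultimately have "side \<sigma> \<gamma> a * side \<sigma> \<gamma> u > 0" by (simp add: zero_less_mult_iff)
  thus ?thesis using cof by blast
qed

text \<open>There are more vertices of \<open>\<sigma>\<close> than points of
  \<open>\<gamma>\<close>, so one of them is outside the span of \<open>\<gamma>\<close>; a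
  vanishing determinant would place it inside.\<close>

lemma exists_transversal_vertex: "\<exists>w\<in>\<sigma>. side \<sigma> \<gamma> (axis w 1) \<noteq> 0"
proof -
  have inj: "inj_on (\<lambda>v. axis v (1::real)) \<sigma>" by (auto simp: inj_on_def axis_eq_axis)
  have "\<not> (\<lambda>v. axis v (1::real)) ` \<sigma> \<subseteq> span \<gamma>"
  proof
    assume "(\<lambda>v. axis v (1::real)) ` \<sigma> \<subseteq> span \<gamma>"
    moreover have "independent ((\<lambda>v. axis v (1::real)) ` \<sigma>)"
      by (rule independent_mono[OF independent_Basis]) (auto simp: Basis_vec_def)
    ultimately have "card ((\<lambda>v. axis v (1::real)) ` \<sigma>) \<le> card \<gamma>"
      using independent_span_bound[OF \<gamma>_fin] by blast
    thus False using card_image[OF inj] \<gamma>_card by simp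
  qed
  then obtain w where w: "w \<in> \<sigma>" "axis w (1::real) \<notin> span \<gamma>" by blast
  hence notin: "axis w 1 \<notin> \<gamma>" using span_base by blast
  have "side \<sigma> \<gamma> (axis w 1) \<noteq> 0"
  proof
    assume z: "side \<sigma> \<gamma> (axis w 1) = 0"
    let ?xs = "axis w 1 # vertex_list \<gamma>"
    have xs: "length ?xs = Suc (card \<gamma>)" "distinct ?xs" "set ?xs = insert (axis w 1) \<gamma>" using \<gamma>_list notin by auto
    obtain c where c: "\<And>i. i < Suc (card \<gamma>) \<Longrightarrow> (\<Sum>x\<in>set ?xs. x $ (ori \<sigma> ! i) * c x) = 0" "\<exists>x\<in>set ?xs. c x \<noteq> 0"
    proof -
      have "col_det (Suc (card \<gamma>)) (\<lambda>i a. a $ (ori \<sigma> ! i)) ?xs = 0" using z by (simp add: side_def len_ori)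
      from col_det_zero_imp_dependent[OF xs(1,2) this] show ?thesis using that by blast
    qed
    have sum: "c (axis w 1) *\<^sub>R axis w 1 + (\<Sum>g\<in>\<gamma>. c g *\<^sub>R g) = 0"
    proof (subst Finite_Cartesian_Product.vec_eq_iff, rule allI)
      fix v
      show "(c (axis w 1) *\<^sub>R axis w 1 + (\<Sum>g\<in>\<gamma>. c g *\<^sub>R g)) $ v = (0 :: real ^ 'a) $ v"
      proof (cases "v \<in> \<sigma>")
        case True
        then obtain i where "i < Suc (card \<gamma>)" "ori \<sigma> ! i = v" using ori_simplex[OF \<sigma>] len_ori by (metis in_set_conv_nth)
        thus ?thesis using c(1)[of i] notin \<gamma>_fin unfolding xs(3) by (simp add: mult.commute)
      next
        case False
        hence "axis w (1::real) $ v = 0" using w(1) by (auto simp: axis_def)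
        moreover have "g $ v = 0" if "g \<in> \<gamma>" for g using \<gamma>_real that False by (auto simp: realization_iff)
        ultimately show ?thesis by simp
      qed
    qed
    show False
    proof (cases "c (axis w 1) = 0")
      case True
      hence "\<forall>g\<in>\<gamma>. c g = 0" using affine_independent_in_simplex[OF \<gamma>_ind \<gamma>_real] sum by auto
      thus False using c(2) True unfolding xs(3) by blast
    next
      case False
      have "c (axis w 1) *\<^sub>R axis w 1 = - (\<Sum>g\<in>\<gamma>. c g *\<^sub>R g)" using sum by (simp add: add_eq_0_iff2)
      hence "c (axis w 1) *\<^sub>R axis w 1 \<in> span \<gamma>" by (simp add: span_neg span_sum span_scale span_base)
      hence "(1 / c (axis w 1)) *\<^sub>R (c (axis w 1) *\<^sub>R axis w (1::real)) \<in> span \<gamma>" by (rule span_scale)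
      thus False using False w(2) by simp
    qed
  qed
  thus ?thesis using w(1) by blast
qed

lemma finite_cofaces: "finite (cofaces \<sigma> \<gamma>)"
proof (rule finite_imageD)
  show "finite ((\<lambda>a. insert a \<gamma>) ` cofaces \<sigma> \<gamma>)"
    by (rule finite_subset[OF _ finite_pieces[of \<sigma>]]) (auto simp: cofaces_def)
  show "inj_on (\<lambda>a. insert a \<gamma>) (cofaces \<sigma> \<gamma>)" by (auto simp: inj_on_def cofaces_def)
qed

text \<open>There is exactly one coface on each side of \<open>\<gamma>\<close>.\<close>

lemma sum_cofaces_interior:
  assumes int: "\<And>v. v \<in> \<sigma> \<Longrightarrow> \<exists>g\<in>\<gamma>. g $ v \<noteq> 0"
  shows "(\<Sum>a\<in>cofaces \<sigma> \<gamma>. int_sgn (side \<sigma> \<gamma> a)) = 0"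
proof -
  have nn: "0 \<le> g $ v" if "g \<in> \<gamma>" for g v using \<gamma>_real that by (auto simp: realization_iff)
  have pos: "centre $ v > 0" if "v \<in> \<sigma>" for v
  proof -
    obtain g where "g \<in> \<gamma>" "g $ v \<noteq> 0" using int[OF \<open>v \<in> \<sigma>\<close>] by blast
    hence "0 < g $ v" using nn[of g v] by simp
    also have "\<dots> \<le> (\<Sum>g\<in>\<gamma>. g $ v)" using nn \<gamma>_fin \<open>g \<in> \<gamma>\<close> by (intro member_le_sum) auto
    finally show ?thesis using card_\<gamma>_pos by (simp add: centre_coordinate)
  qed
  have cr: "centre \<in> realization \<sigma>" using centre_hull \<gamma>_sub by blast
  obtain w where w: "w \<in> \<sigma>" "side \<sigma> \<gamma> (axis w 1) \<noteq> 0" using exists_transversal_vertex by blast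
  define u where "u = axis w 1 - centre"
  have su: "side \<sigma> \<gamma> u = side \<sigma> \<gamma> (axis w 1)"
  proof -
    have "u = axis w 1 + (- 1) *\<^sub>R centre" by (simp add: u_def)
    thus ?thesis by (simp only: side_add side_scale side_centre)
  qed
  have u1: "centre + t *\<^sub>R u \<in> realization \<sigma>" if "0 < t" "t \<le> 1" for t
  proof -
    have "centre + t *\<^sub>R u = (1 - t) *\<^sub>R centre + t *\<^sub>R axis w 1" by (simp add: u_def algebra_simps)
    also have "\<dots> \<in> realization \<sigma>" using convex_realization cr axis_in_realization[OF w(1)] that
      by (intro convexD) auto
    finally show ?thesis .
  qed
  \<comment> \<open>All coordinates of the centre over \<open>\<sigma>\<close> are positive, so
    there is room to move away from the vertex \<open>w\<close>. Its coordinate becomes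
    \<open>(1 + t) * centre $ w - t\<close>, which is nonnegative for
    \<open>t \<le> centre $ w\<close>.\<close>
  have u2: "centre + t *\<^sub>R (- u) \<in> realization \<sigma>" if "0 < t" "t \<le> centre $ w" for t
    unfolding realization_iff
  proof (intro conjI allI impI)
    have coord: "(centre + t *\<^sub>R (- u)) $ v = (1 + t) * centre $ v - t * axis w 1 $ v" for v
      by (simp add: u_def algebra_simps)
    have one: "(\<Sum>v\<in>UNIV. axis w (1::real) $ v) = 1" by (simp add: axis_def)
    have c: "0 \<le> centre $ v" "v \<notin> \<sigma> \<Longrightarrow> centre $ v = 0" "(\<Sum>v\<in>UNIV. centre $ v) = 1" for v
      using cr by (auto simp: realization_iff)
    show "0 \<le> (centre + t *\<^sub>R (- u)) $ v" for v
    proof (cases "v = w")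
      case True
      have "t \<le> centre $ w + t * centre $ w" using that pos[OF w(1)] by (simp add: add_increasing2)
      thus ?thesis unfolding coord using True by (simp add: algebra_simps)
    next
      case False
      thus ?thesis unfolding coord using that c(1)[of v] by (simp add: axis_def)
    qed
    show "(\<Sum>v\<in>UNIV. (centre + t *\<^sub>R (- u)) $ v) = 1"
      unfolding coord sum_subtractf sum_distrib_left[symmetric] one c(3) by simp
    show "(centre + t *\<^sub>R (- u)) $ v = 0" if "v \<notin> \<sigma>" for v
      unfolding coord using that c(2)[of v] w(1) by (auto simp: axis_def)
  qed
  obtain a where a: "a \<in> cofaces \<sigma> \<gamma>" "side \<sigma> \<gamma> a * side \<sigma> \<gamma> u > 0"
    using coface_exists[of 1 u] u1 w(2) su by auto
  have "side \<sigma> \<gamma> (- u) = - side \<sigma> \<gamma> u" using side_scale[of "- 1" u] by simp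
  then obtain b where b: "b \<in> cofaces \<sigma> \<gamma>" "side \<sigma> \<gamma> b * side \<sigma> \<gamma> u < 0"
    using coface_exists[of "centre $ w" "- u"] u2 w su pos by auto
  have ab: "a \<noteq> b" using a b by auto
  have "cofaces \<sigma> \<gamma> = {a, b}"
  proof (intro equalityI subsetI)
    fix x assume x: "x \<in> cofaces \<sigma> \<gamma>"
    have "side \<sigma> \<gamma> x * side \<sigma> \<gamma> a > 0 \<or> side \<sigma> \<gamma> x * side \<sigma> \<gamma> b > 0"
      using a(2) b(2) side_coface[OF x] by (auto simp: zero_less_mult_iff mult_less_0_iff)
    thus "x \<in> {a, b}" using coface_unique[OF x a(1)] coface_unique[OF x b(1)] by blast
  qed (use a b in auto)
  thus ?thesis using ab a(2) b(2) by (auto simp: int_sgn_def zero_less_mult_iff mult_less_0_iff)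
qed

text \<open>Here \<open>\<gamma>\<close> has exactly one coface.\<close>

lemma sum_cofaces_boundary:
  assumes v: "v \<in> \<sigma>" and bd: "\<gamma> \<in> pieces (\<sigma> - {v})"
  shows "(\<Sum>a\<in>cofaces \<sigma> \<gamma>. int_sgn (side \<sigma> \<gamma> a)) = incidence ori \<sigma> v * piece_sign (\<sigma> - {v}) \<gamma>"
    and "cofaces \<sigma> \<gamma> \<noteq> {}"
proof -
  have ne: "\<sigma> \<noteq> {v}"
  proof
    assume "\<sigma> = {v}"
    hence "card \<gamma> = 0" using \<gamma>_card by simp
    thus False using card_\<gamma>_pos by simp
  qed
  have f: "\<sigma> - {v} \<in> L" using facet_in[OF \<sigma> ne] .
  have gv: "g $ v = 0" if "g \<in> \<gamma>" for g using piece_sub[OF bd] that by (auto simp: realization_iff)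
  have lf: "length (ori (\<sigma> - {v})) = card \<gamma>" using length_ori[OF f] \<gamma>_card v finite_simplex[OF \<sigma>] by simp
  let ?vs = "v # ori (\<sigma> - {v})"
  have se: "same_elems ?vs (ori \<sigma>)" using ori_simplex[OF f] ori_simplex[OF \<sigma>] v by (auto simp: same_elems_def)
  have "bary_det (ori (\<sigma> - {v})) (vertex_list \<gamma>) \<noteq> 0"
    using bd by (intro bary_det_nonzero[of \<gamma> "\<sigma> - {v}"] ori_simplex f \<gamma>_ind piece_sub \<gamma>_list) (auto simp: pieces_def)
  moreover have "bary_det ?vs (axis v 1 # vertex_list \<gamma>) = bary_det (ori (\<sigma> - {v})) (vertex_list \<gamma>)"
    using gv \<gamma>_list lf ori_simplex[OF f] by (intro bary_det_Cons) auto
  moreover have sv: "side \<sigma> \<gamma> (axis v 1) = of_int (incidence ori \<sigma> v) * bary_det ?vs (axis v 1 # vertex_list \<gamma>)"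
    unfolding side_def incidence_def using se lf \<gamma>_list by (intro bary_det_reorder_vertices) auto
  moreover have inc: "incidence ori \<sigma> v = 1 \<or> incidence ori \<sigma> v = - 1"
    unfolding incidence_def using se by (rule reorder_sign_cases)
  ultimately have sv0: "side \<sigma> \<gamma> (axis v 1) \<noteq> 0"
    and sgn: "int_sgn (side \<sigma> \<gamma> (axis v 1)) = incidence ori \<sigma> v * piece_sign (\<sigma> - {v}) \<gamma>"
    by (auto simp: int_sgn_minus piece_sign_def)
  \<comment> \<open>All other vertices of \<open>\<sigma>\<close> lie with \<open>\<gamma>\<close>
    in the hyperplane where the coordinate \<open>v\<close> vanishes. Hence on
    \<open>\<sigma>\<close> the functional \<open>side\<close> is a multiple of this
    coordinate.\<close>
  have sw: "side \<sigma> \<gamma> (axis w 1) = 0" if w: "w \<in> \<sigma>" "w \<noteq> v" for w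
  proof -
    obtain i where i: "i < length (ori \<sigma>)" "ori \<sigma> ! i = v" using v ori_simplex[OF \<sigma>] by (metis in_set_conv_nth)
    show ?thesis unfolding side_def
    proof (rule col_det_zero_row[OF i(1)])
      fix x assume "x \<in> set (axis w 1 # vertex_list \<gamma>)"
      thus "x $ (ori \<sigma> ! i) = 0" using i gv \<gamma>_list w by (auto simp: axis_def)
    qed (simp add: len_ori \<gamma>_list)
  qed
  have sy: "side \<sigma> \<gamma> y = y $ v * side \<sigma> \<gamma> (axis v 1)" if "y \<in> realization \<sigma>" for y
  proof -
    have "side \<sigma> \<gamma> y = (\<Sum>w\<in>\<sigma>. y $ w * side \<sigma> \<gamma> (axis w 1))"
      using that by (intro side_expand) (auto simp: realization_iff)
    also have "\<dots> = y $ v * side \<sigma> \<gamma> (axis v 1)"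
      using v finite_simplex[OF \<sigma>] sw by (subst sum.remove[of _ v]) auto
    finally show ?thesis .
  qed
  \<comment> \<open>The coordinate \<open>v\<close> is nonnegative on \<open>\<sigma>\<close>, so
    every coface lies on the same side as the vertex \<open>v\<close>.\<close>
  have sc: "side \<sigma> \<gamma> a * side \<sigma> \<gamma> (axis v 1) > 0" if a: "a \<in> cofaces \<sigma> \<gamma>" for a
  proof -
    have ar: "a \<in> realization \<sigma>" using a piece_sub[of "insert a \<gamma>" \<sigma>] by (auto simp: cofaces_def)
    have "a $ v \<noteq> 0" using side_coface[OF a] sy[OF ar] by auto
    moreover have "0 \<le> a $ v" using ar by (auto simp: realization_iff)
    moreover have "side \<sigma> \<gamma> (axis v 1) * side \<sigma> \<gamma> (axis v 1) > 0" using sv0 by (metis not_square_less_zero linorder_neqE_linordered_idom mult_eq_0_iff)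
    ultimately show ?thesis unfolding sy[OF ar] by (simp add: mult.assoc)
  qed
  have cr: "centre \<in> realization \<sigma>" using centre_hull \<gamma>_sub by blast
  define u where "u = axis v 1 - centre"
  have su: "side \<sigma> \<gamma> u = side \<sigma> \<gamma> (axis v 1)"
  proof -
    have "u = axis v 1 + (- 1) *\<^sub>R centre" by (simp add: u_def)
    thus ?thesis by (simp only: side_add side_scale side_centre)
  qed
  have u1: "centre + t *\<^sub>R u \<in> realization \<sigma>" if "0 < t" "t \<le> 1" for t
  proof -
    have "centre + t *\<^sub>R u = (1 - t) *\<^sub>R centre + t *\<^sub>R axis v 1" by (simp add: u_def algebra_simps)
    also have "\<dots> \<in> realization \<sigma>" using convex_realization cr axis_in_realization[OF v] that
      by (intro convexD) auto
    finally show ?thesis .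
  qed
  obtain a where a: "a \<in> cofaces \<sigma> \<gamma>"
    using coface_exists[of 1 u] u1 sv0 su by auto
  thus "cofaces \<sigma> \<gamma> \<noteq> {}" by blast
  have "x = a" if x: "x \<in> cofaces \<sigma> \<gamma>" for x
    using coface_unique[OF x a] sc[OF x] sc[OF a] by (auto simp: zero_less_mult_iff)
  hence "cofaces \<sigma> \<gamma> = {a}" using a by blast
  moreover have "int_sgn (side \<sigma> \<gamma> a) = int_sgn (side \<sigma> \<gamma> (axis v 1))"
    using sc[OF a] by (auto simp: int_sgn_def zero_less_mult_iff)
  ultimately show "(\<Sum>a\<in>cofaces \<sigma> \<gamma>. int_sgn (side \<sigma> \<gamma> a)) = incidence ori \<sigma> v * piece_sign (\<sigma> - {v}) \<gamma>"
    using sgn by simp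
qed

end

section \<open>The boundary of a subdivided simplex\<close>

context subdivided_complex
begin

text \<open>The sign with which a piece meets a facet is the side of the facet on which the piece
  lies. Cancellation at a facet thereby becomes a statement about its cofaces.\<close>

lemma piece_sign_incidence:
  assumes \<sigma>: "\<sigma> \<in> L" and S: "S \<in> pieces \<sigma>" and a: "a \<in> S"
  shows "piece_sign \<sigma> S * incidence vertex_list S a = int_sgn (side \<sigma> (S - {a}) a)"
proof -
  have fin: "finite S" "finite (S - {a})" using piece_finite[OF S] by auto
  have se: "same_elems (a # vertex_list (S - {a})) (vertex_list S)"
    using vertex_list[OF fin(1)] vertex_list[OF fin(2)] a by (auto simp: same_elems_def)
  have len: "length (a # vertex_list (S - {a})) = length (ori \<sigma>)"
  proof -
    have "card S = Suc (card (S - {a}))" using fin a by (metis card.remove)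
    thus ?thesis using length_ori[OF \<sigma>] length_vertex_list[OF fin(2)] S by (simp add: pieces_def del: card_Diff_insert card_Diff_singleton)
  qed
  let ?r = "reorder_sign (a # vertex_list (S - {a})) (vertex_list S)"
  have "bary_det (ori \<sigma>) (vertex_list S) = of_int ?r * side \<sigma> (S - {a}) a"
    unfolding side_def using se len by (rule col_det_reorder)
  hence "piece_sign \<sigma> S = ?r * int_sgn (side \<sigma> (S - {a}) a)"
    unfolding piece_sign_def using reorder_sign_cases[OF se] by (auto simp: int_sgn_minus)
  thus ?thesis using reorder_sign_square[OF se] by (simp add: incidence_def algebra_simps)
qed

text \<open>The subdivision operator is a chain map, tested against an arbitrary cochain \<open>F\<close>.\<close>

lemma pieces_boundary:
  fixes F :: "(real ^ 'a) set \<Rightarrow> int"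
  assumes \<sigma>: "\<sigma> \<in> L" and F0: "F {} = 0"
  shows "(\<Sum>S\<in>pieces \<sigma>. piece_sign \<sigma> S * (\<Sum>a\<in>S. incidence vertex_list S a * F (S - {a}))) =
    (\<Sum>v\<in>\<sigma>. incidence ori \<sigma> v * (\<Sum>\<gamma>\<in>pieces (\<sigma> - {v}). piece_sign (\<sigma> - {v}) \<gamma> * F \<gamma>))"
proof (cases "card \<sigma> = 1")
  case True
  then obtain v where v: "\<sigma> = {v}" by (auto simp: card_1_singleton_iff)
  have "F (S - {a}) = 0" if "S \<in> pieces \<sigma>" "a \<in> S" for S a
  proof -
    have "card S = 1" using that v by (simp add: pieces_def)
    hence e: "S - {a} = {}" using that by (auto simp: card_1_singleton_iff)
    show ?thesis unfolding e by (rule F0)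
  qed
  moreover have "F \<gamma> = 0" if "\<gamma> \<in> pieces {}" for \<gamma>
    using that F0 piece_finite[OF that] by (auto simp: pieces_def)
  ultimately show ?thesis using v by simp
next
  case False
  have fin\<sigma>: "finite \<sigma>" using finite_simplex[OF \<sigma>] .
  have c\<sigma>: "card \<sigma> > 1" using False fin\<sigma> nonempty_simplex[OF \<sigma>] by (metis card_gt_0_iff less_one nat_neq_iff)
  define Fc where "Fc = (\<Union>S\<in>pieces \<sigma>. (\<lambda>a. S - {a}) ` S)"
  have finFc: "finite Fc" unfolding Fc_def using finite_pieces piece_finite by auto
  define N where "N = (\<lambda>\<gamma>. \<Sum>a\<in>cofaces \<sigma> \<gamma>. int_sgn (side \<sigma> \<gamma> a))"
  have loc: "subdivided_facet L ori T \<sigma> \<gamma>" if g: "\<gamma> \<in> Fc" for \<gamma>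
  proof -
    obtain S a where S: "S \<in> pieces \<sigma>" "a \<in> S" "\<gamma> = S - {a}" using g by (auto simp: Fc_def)
    have ind: "\<not> affine_dependent S" using S by (simp add: pieces_def)
    have "convex hull \<gamma> face_of convex hull S"
      using face_of_convex_hull_affine_independent[OF ind] S(3) by blast
    hence T: "convex hull \<gamma> \<in> T" using T_face S(1) by (auto simp: pieces_def)
    have "card \<sigma> = Suc (card \<gamma>)"
      using card.remove[OF piece_finite[OF S(1)] S(2)] S(1,3) by (simp only: pieces_def mem_Collect_eq)
    moreover have "\<gamma> \<noteq> {}" using calculation c\<sigma> by auto
    moreover have "convex hull \<gamma> \<subseteq> realization \<sigma>"
      using S hull_mono[of \<gamma> S convex] by (auto simp: pieces_def)
    moreover have "\<not> affine_dependent \<gamma>" using affine_independent_subset[OF ind] S(3) by blast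
    ultimately show ?thesis using \<sigma> T by unfold_locales
  qed
  have "(\<Sum>S\<in>pieces \<sigma>. piece_sign \<sigma> S * (\<Sum>a\<in>S. incidence vertex_list S a * F (S - {a}))) =
    (\<Sum>S\<in>pieces \<sigma>. \<Sum>a\<in>S. int_sgn (side \<sigma> (S - {a}) a) * F (S - {a}))"
    using piece_sign_incidence[OF \<sigma>] by (simp add: sum_distrib_left mult.assoc[symmetric])
  also have "\<dots> = (\<Sum>(S, a)\<in>Sigma (pieces \<sigma>) (\<lambda>S. S). int_sgn (side \<sigma> (S - {a}) a) * F (S - {a}))"
    using finite_pieces piece_finite by (intro sum.Sigma) auto
  \<comment> \<open>Pairs of a piece and one of its vertices are regrouped by the facet opposite to
    the vertex.\<close>
  also have "\<dots> = (\<Sum>(\<gamma>, a)\<in>Sigma Fc (cofaces \<sigma>). int_sgn (side \<sigma> \<gamma> a) * F \<gamma>)"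
    by (rule sum.reindex_bij_witness[of _ "\<lambda>(\<gamma>, a). (insert a \<gamma>, a)" "\<lambda>(S, a). (S - {a}, a)"])
       (auto simp: Fc_def cofaces_def insert_absorb)
  also have "\<dots> = (\<Sum>\<gamma>\<in>Fc. \<Sum>a\<in>cofaces \<sigma> \<gamma>. int_sgn (side \<sigma> \<gamma> a) * F \<gamma>)"
    using finFc subdivided_facet.finite_cofaces[OF loc] by (intro sum.Sigma[symmetric]) auto
  also have "\<dots> = (\<Sum>\<gamma>\<in>Fc. N \<gamma> * F \<gamma>)" by (simp add: N_def sum_distrib_right)
  \<comment> \<open>Facets that lie in no proper face of \<open>\<sigma>\<close> cancel, having one
    coface on each side.\<close>
  also have "\<dots> = (\<Sum>\<gamma>\<in>(\<Union>v\<in>\<sigma>. pieces (\<sigma> - {v})). N \<gamma> * F \<gamma>)"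
  proof (rule sum.mono_neutral_right[OF finFc])
    show "(\<Union>v\<in>\<sigma>. pieces (\<sigma> - {v})) \<subseteq> Fc"
    proof clarify
      fix v \<gamma> assume v: "v \<in> \<sigma>" and g: "\<gamma> \<in> pieces (\<sigma> - {v})"
      have "subdivided_facet L ori T \<sigma> \<gamma>"
      proof unfold_locales
        have "card \<sigma> = Suc (card (\<sigma> - {v}))" using v fin\<sigma> by (metis card.remove)
        thus "card \<sigma> = Suc (card \<gamma>)" using g by (simp add: pieces_def)
        thus "\<gamma> \<noteq> {}" using c\<sigma> by auto
        have "realization (\<sigma> - {v}) \<subseteq> realization \<sigma>" by (intro face_of_imp_subset realization_face) auto
        thus "convex hull \<gamma> \<subseteq> realization \<sigma>" using g by (auto simp: pieces_def)
      qed (use \<sigma> g in \<open>auto simp: pieces_def\<close>)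
      then obtain a where "a \<in> cofaces \<sigma> \<gamma>" using subdivided_facet.sum_cofaces_boundary(2)[OF _ v g] by blast
      thus "\<gamma> \<in> Fc" unfolding Fc_def cofaces_def by (auto intro!: bexI[of _ "insert a \<gamma>"])
    qed
    show "\<forall>\<gamma>\<in>Fc - (\<Union>v\<in>\<sigma>. pieces (\<sigma> - {v})). N \<gamma> * F \<gamma> = 0"
    proof
      fix \<gamma> assume g: "\<gamma> \<in> Fc - (\<Union>v\<in>\<sigma>. pieces (\<sigma> - {v}))"
      interpret subdivided_facet L ori T \<sigma> \<gamma> using loc g by blast
      have "\<exists>x\<in>\<gamma>. x $ v \<noteq> 0" if v: "v \<in> \<sigma>" for v
      proof (rule ccontr)
        assume z: "\<not> (\<exists>x\<in>\<gamma>. x $ v \<noteq> 0)"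
        have "\<gamma> \<subseteq> realization (\<sigma> - {v})" using \<gamma>_real z by (fastforce simp: realization_iff)
        hence "convex hull \<gamma> \<subseteq> realization (\<sigma> - {v})" using convex_realization by (rule hull_minimal)
        moreover have "card \<sigma> = Suc (card (\<sigma> - {v}))" using v fin\<sigma> by (metis card.remove)
        ultimately have "\<gamma> \<in> pieces (\<sigma> - {v})" using \<gamma>_ind \<gamma>_T \<gamma>_card by (simp add: pieces_def)
        thus False using g v by blast
      qed
      thus "N \<gamma> * F \<gamma> = 0" using sum_cofaces_interior by (simp add: N_def)
    qed
  qed
  also have "\<dots> = (\<Sum>v\<in>\<sigma>. \<Sum>\<gamma>\<in>pieces (\<sigma> - {v}). N \<gamma> * F \<gamma>)"
  proof (rule sum.UNION_disjoint[OF fin\<sigma>])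
    show "\<forall>v\<in>\<sigma>. finite (pieces (\<sigma> - {v}))" using finite_pieces by blast
    \<comment> \<open>A facet lying in two faces \<open>\<sigma> - {v}\<close> and
      \<open>\<sigma> - {w}\<close> would lie in their intersection, which has too few vertices to
      contain it.\<close>
    show "\<forall>v\<in>\<sigma>. \<forall>w\<in>\<sigma>. v \<noteq> w \<longrightarrow> pieces (\<sigma> - {v}) \<inter> pieces (\<sigma> - {w}) = {}"
    proof (intro ballI impI, rule ccontr)
      fix v w assume vw: "v \<in> \<sigma>" "w \<in> \<sigma>" "v \<noteq> w" and "pieces (\<sigma> - {v}) \<inter> pieces (\<sigma> - {w}) \<noteq> {}"
      then obtain \<gamma> where g: "\<gamma> \<in> pieces (\<sigma> - {v})" "\<gamma> \<in> pieces (\<sigma> - {w})" by blast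
      have "\<gamma> \<subseteq> realization ((\<sigma> - {v}) \<inter> (\<sigma> - {w}))"
        using piece_sub[OF g(1)] piece_sub[OF g(2)] by (simp flip: realization_Int)
      hence "card \<gamma> \<le> card ((\<sigma> - {v}) \<inter> (\<sigma> - {w}))" using g by (intro card_simplex_le) (auto simp: pieces_def)
      also have "\<dots> < card (\<sigma> - {v})" using vw fin\<sigma> by (intro psubset_card_mono) auto
      finally show False using g by (simp add: pieces_def)
    qed
  qed
  also have "\<dots> = (\<Sum>v\<in>\<sigma>. \<Sum>\<gamma>\<in>pieces (\<sigma> - {v}). incidence ori \<sigma> v * piece_sign (\<sigma> - {v}) \<gamma> * F \<gamma>)"
  proof (intro sum.cong refl)
    fix v \<gamma> assume v: "v \<in> \<sigma>" and g: "\<gamma> \<in> pieces (\<sigma> - {v})"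
    interpret subdivided_facet L ori T \<sigma> \<gamma>
    proof unfold_locales
      have "card \<sigma> = Suc (card (\<sigma> - {v}))" using v fin\<sigma> by (metis card.remove)
      thus "card \<sigma> = Suc (card \<gamma>)" using g by (simp add: pieces_def)
      thus "\<gamma> \<noteq> {}" using c\<sigma> by auto
      have "realization (\<sigma> - {v}) \<subseteq> realization \<sigma>" by (intro face_of_imp_subset realization_face) auto
      thus "convex hull \<gamma> \<subseteq> realization \<sigma>" using g by (auto simp: pieces_def)
    qed (use \<sigma> g in \<open>auto simp: pieces_def\<close>)
    show "N \<gamma> * F \<gamma> = incidence ori \<sigma> v * piece_sign (\<sigma> - {v}) \<gamma> * F \<gamma>"
      using sum_cofaces_boundary(1)[OF v g] by (simp add: N_def)
  qed
  finally show ?thesis by (simp add: sum_distrib_left mult.assoc)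
qed

end

section \<open>The Smith sequence of a map in general position\<close>

context subdivided_complex
begin

definition vertices :: "(real ^ 'a) set" where
  "vertices = (\<Union>\<alpha>\<in>T. simplex_vertices \<alpha>)"

lemma piece_vertices: "S \<in> pieces \<sigma> \<Longrightarrow> S \<subseteq> vertices"
  using simplex_vertices_hull[of S] by (auto simp: pieces_def vertices_def)

lemma finite_vertices: "finite vertices"
  unfolding vertices_def
proof (rule finite_UN_I[OF T_finite])
  fix \<alpha> assume "\<alpha> \<in> T"
  then obtain S where "\<not> affine_dependent S" "\<alpha> = convex hull S" by (rule T_simplex)
  thus "finite (simplex_vertices \<alpha>)" using simplex_vertices_hull[of S] aff_independent_finite[of S] by simp
qed

lemma pieces_disjoint:
  assumes "\<sigma> \<inter> \<tau> = {}" "S \<in> pieces \<sigma>" "S' \<in> pieces \<tau>"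
  shows "S \<inter> S' = {}"
proof -
  have "S \<inter> S' \<subseteq> realization (\<sigma> \<inter> \<tau>)"
    using piece_sub[OF assms(2)] piece_sub[OF assms(3)] by (auto simp flip: realization_Int)
  thus ?thesis using assms(1) by (simp add: realization_empty)
qed

lemma piece_list: "S \<in> pieces \<sigma> \<Longrightarrow> distinct (vertex_list S) \<and> set (vertex_list S) = S"
  using vertex_list piece_finite by blast

lemma pieces_empty: "S \<in> pieces {} \<Longrightarrow> S = {}"
  using piece_sub[of S "{}"] by (simp add: realization_empty)

text \<open>The pullback of \<open>H\<close> along the product of two subdivision operators:
  \<open>H\<close> lives on pairs of simplices of \<open>T\<close>, the result on pairs of simplices
  of \<open>L\<close>.\<close>

definition piece_pairing :: "((real ^ 'a) set \<Rightarrow> (real ^ 'a) set \<Rightarrow> int) \<Rightarrow> 'a set \<Rightarrow> 'a set \<Rightarrow> int" where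
  "piece_pairing H \<sigma> \<tau> = (\<Sum>S\<in>pieces \<sigma>. \<Sum>S'\<in>pieces \<tau>. piece_sign \<sigma> S * piece_sign \<tau> S' * H S S')"

lemma piece_pairing_cong:
  assumes "\<And>S S'. S \<in> pieces \<sigma> \<Longrightarrow> S' \<in> pieces \<tau> \<Longrightarrow> H S S' = H' S S'"
  shows "piece_pairing H \<sigma> \<tau> = piece_pairing H' \<sigma> \<tau>"
  unfolding piece_pairing_def using assms by (intro sum.cong refl) auto

lemma piece_pairing_add:
  "piece_pairing (\<lambda>S S'. H S S' + k * H' S S') \<sigma> \<tau> = piece_pairing H \<sigma> \<tau> + k * piece_pairing H' \<sigma> \<tau>"
  by (simp add: piece_pairing_def sum.distrib sum_distrib_left algebra_simps)

lemma piece_pairing_swap: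
  "piece_pairing (\<lambda>S S'. H S' S) \<sigma> \<tau> = piece_pairing H \<tau> \<sigma>"
  unfolding piece_pairing_def by (subst sum.swap) (simp add: mult.commute)

lemma piece_pairing_boundary:
  assumes L: "\<sigma> \<in> L" "\<tau> \<in> L" and H: "\<And>S. H {} S = 0" "\<And>S. H S {} = 0"
  shows "(\<Sum>v\<in>\<sigma>. incidence ori \<sigma> v * piece_pairing H (\<sigma> - {v}) \<tau>) =
      piece_pairing (\<lambda>S S'. \<Sum>a\<in>S. incidence vertex_list S a * H (S - {a}) S') \<sigma> \<tau>"
    and "(\<Sum>w\<in>\<tau>. incidence ori \<tau> w * piece_pairing H \<sigma> (\<tau> - {w})) =
      piece_pairing (\<lambda>S S'. \<Sum>b\<in>S'. incidence vertex_list S' b * H S (S' - {b})) \<sigma> \<tau>"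
proof -
  have first: "(\<Sum>v\<in>\<sigma>. incidence ori \<sigma> v * piece_pairing H (\<sigma> - {v}) \<tau>) =
      piece_pairing (\<lambda>S S'. \<Sum>a\<in>S. incidence vertex_list S a * H (S - {a}) S') \<sigma> \<tau>"
    if L: "\<sigma> \<in> L" and H: "\<And>S. H {} S = 0" for \<sigma> \<tau> H
  proof -
    define F where "F = (\<lambda>S. \<Sum>S'\<in>pieces \<tau>. piece_sign \<tau> S' * H S S')"
    have pp: "piece_pairing H \<rho> \<tau> = (\<Sum>S\<in>pieces \<rho>. piece_sign \<rho> S * F S)" for \<rho>
      by (simp add: piece_pairing_def F_def sum_distrib_left algebra_simps)
    have F0: "F {} = 0" by (simp add: F_def H)
    note b = pieces_boundary[of \<sigma> F, OF L F0]
    have "(\<Sum>v\<in>\<sigma>. incidence ori \<sigma> v * piece_pairing H (\<sigma> - {v}) \<tau>) =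
      (\<Sum>S\<in>pieces \<sigma>. piece_sign \<sigma> S * (\<Sum>a\<in>S. incidence vertex_list S a * F (S - {a})))"
      unfolding pp b ..
    also have "\<dots> = (\<Sum>S\<in>pieces \<sigma>. \<Sum>S'\<in>pieces \<tau>. piece_sign \<sigma> S * piece_sign \<tau> S' *
       (\<Sum>a\<in>S. incidence vertex_list S a * H (S - {a}) S'))"
    proof (rule sum.cong[OF refl])
      fix S
      have "(\<Sum>a\<in>S. incidence vertex_list S a * F (S - {a})) =
        (\<Sum>a\<in>S. \<Sum>S'\<in>pieces \<tau>. piece_sign \<tau> S' * (incidence vertex_list S a * H (S - {a}) S'))"
        by (simp add: F_def sum_distrib_left algebra_simps)
      also have "\<dots> = (\<Sum>S'\<in>pieces \<tau>. \<Sum>a\<in>S. piece_sign \<tau> S' * (incidence vertex_list S a * H (S - {a}) S'))"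
        by (rule sum.swap)
      finally show "piece_sign \<sigma> S * (\<Sum>a\<in>S. incidence vertex_list S a * F (S - {a})) =
        (\<Sum>S'\<in>pieces \<tau>. piece_sign \<sigma> S * piece_sign \<tau> S' * (\<Sum>a\<in>S. incidence vertex_list S a * H (S - {a}) S'))"
        by (simp add: sum_distrib_left mult.assoc)
    qed
    finally show ?thesis by (simp add: piece_pairing_def)
  qed
  show "(\<Sum>v\<in>\<sigma>. incidence ori \<sigma> v * piece_pairing H (\<sigma> - {v}) \<tau>) =
      piece_pairing (\<lambda>S S'. \<Sum>a\<in>S. incidence vertex_list S a * H (S - {a}) S') \<sigma> \<tau>"
    using L(1) H(1) by (rule first)
  have "(\<Sum>w\<in>\<tau>. incidence ori \<tau> w * piece_pairing H \<sigma> (\<tau> - {w})) =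
     (\<Sum>w\<in>\<tau>. incidence ori \<tau> w * piece_pairing (\<lambda>S S'. H S' S) (\<tau> - {w}) \<sigma>)"
    by (simp only: piece_pairing_swap[of H])
  also have "\<dots> = piece_pairing (\<lambda>S S'. \<Sum>a\<in>S. incidence vertex_list S a * H S' (S - {a})) \<tau> \<sigma>"
    by (rule first[of \<tau> "\<lambda>S S'. H S' S", OF L(2) H(2)])
  also have "\<dots> = piece_pairing (\<lambda>S S'. \<Sum>b\<in>S'. incidence vertex_list S' b * H S (S' - {b})) \<sigma> \<tau>"
    by (rule piece_pairing_swap[of "\<lambda>S S'. \<Sum>b\<in>S'. incidence vertex_list S' b * H S (S' - {b})"])
  finally show "(\<Sum>w\<in>\<tau>. incidence ori \<tau> w * piece_pairing H \<sigma> (\<tau> - {w})) =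
      piece_pairing (\<lambda>S S'. \<Sum>b\<in>S'. incidence vertex_list S' b * H S (S' - {b})) \<sigma> \<tau>" .
qed

end

text \<open>With no points on one side, the corresponding normalization row reads
  \<open>0 = 1\<close>. This is the vanishing on empty simplices that \<open>pieces_boundary\<close>
  asks for.\<close>

lemma half_count_empty:
  assumes "n \<ge> 2"
  shows "half_count n (pair_row \<phi>) (pair_list [] bs) = 0" "half_count n (pair_row \<phi>) (pair_list as []) = 0"
proof -
  have "\<not> solves n (pair_row \<phi>) (set (pair_list [] bs)) z" for z
  proof
    assume "solves n (pair_row \<phi>) (set (pair_list [] bs)) z"
    hence "(\<Sum>x\<in>Inr ` set bs. pair_row \<phi> 0 x * z x) = 1" using assms by (auto simp: solves_def)
    moreover have "(\<Sum>x\<in>Inr ` set bs. pair_row \<phi> 0 x * z x) = 0" by (intro sum.neutral) (auto simp: pair_row_def)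
    ultimately show False by simp
  qed
  thus "half_count n (pair_row \<phi>) (pair_list [] bs) = 0" by (simp add: half_count_def)
  have "\<not> solves n (pair_row \<phi>) (set (pair_list as [])) z" for z
  proof
    assume "solves n (pair_row \<phi>) (set (pair_list as [])) z"
    hence "(\<Sum>x\<in>Inl ` set as. pair_row \<phi> 1 x * z x) = 1" using assms by (auto simp: solves_def)
    moreover have "(\<Sum>x\<in>Inl ` set as. pair_row \<phi> 1 x * z x) = 0" by (intro sum.neutral) (auto simp: pair_row_def)
    ultimately show False by simp
  qed
  thus "half_count n (pair_row \<phi>) (pair_list as []) = 0" by (simp add: half_count_def)
qed

section \<open>Cochains that count partial coincidences\<close>

locale generic_subdivision = subdivided_complex L ori T
  for L :: "'a::finite set set" and ori T +
  fixes \<phi> :: "nat \<Rightarrow> real ^ 'a \<Rightarrow> real" and N :: nat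
  assumes generic: "\<And>j. j \<le> N \<Longrightarrow> generic_rows j vertices \<phi>"
begin

definition pair_half :: "nat \<Rightarrow> (real ^ 'a) set \<Rightarrow> (real ^ 'a) set \<Rightarrow> int" where
  "pair_half j S S' = half_count (j + 2) (pair_row \<phi>) (pair_list (vertex_list S) (vertex_list S'))"

definition pair_zero :: "nat \<Rightarrow> (real ^ 'a) set \<Rightarrow> (real ^ 'a) set \<Rightarrow> int" where
  "pair_zero j S S' = zero_count (j + 2) (pair_row \<phi>) (pair_list (vertex_list S) (vertex_list S'))"

text \<open>The factor \<open>(- 1) ^ simplex_dim \<tau>\<close> reconciles two conventions: the
  second factor carries \<open>(- 1) ^ simplex_dim \<sigma>\<close> in the coboundary, but
  \<open>(- 1) ^ card S\<close> in \<open>half_count_pair_boundary\<close>, which is one sign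
  more.\<close>

definition geo_half :: "nat \<Rightarrow> 'a cochain" where
  "geo_half j = (\<lambda>(\<sigma>, \<tau>). if (\<sigma>, \<tau>) \<in> deleted_cells L j
     then (- 1) ^ simplex_dim \<tau> * piece_pairing (pair_half j) \<sigma> \<tau> else 0)"

definition geo_zero :: "nat \<Rightarrow> 'a cochain" where
  "geo_zero j = (\<lambda>(\<sigma>, \<tau>). if (\<sigma>, \<tau>) \<in> deleted_cells L j
     then (- 1) ^ simplex_dim \<tau> * piece_pairing (pair_zero j) \<sigma> \<tau> else 0)"

lemma pair_half_empty: "pair_half j {} S = 0" "pair_half j S {} = 0"
proof -
  have "vertex_list {} = ([] :: (real ^ 'a) list)" using vertex_list[of "{} :: (real ^ 'a) set"] by simp
  thus "pair_half j {} S = 0" "pair_half j S {} = 0" by (simp_all only: pair_half_def half_count_empty[of "j + 2"] le_add2)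
qed

lemma geo_half_in_cochains: "geo_half j \<in> cochains L j"
  by (auto simp: geo_half_def cochains_def)

lemma card_piece: "\<sigma> \<in> L \<Longrightarrow> S \<in> pieces \<sigma> \<Longrightarrow> card S = Suc (simplex_dim \<sigma>)"
  using card_pos by (simp add: pieces_def)

text \<open>The pairing turns the boundary of a cell of \<open>L\<close> into boundaries of pairs of
  pieces, and for each pair of pieces the claim is \<open>half_count_pair_boundary\<close>.\<close>

lemma geo_half_coboundary:
  assumes j: "Suc j \<le> N"
  shows "coboundary L ori j (geo_half j) = geo_zero (Suc j)"
proof (rule ext, clarify)
  fix \<sigma> \<tau>
  show "coboundary L ori j (geo_half j) (\<sigma>, \<tau>) = geo_zero (Suc j) (\<sigma>, \<tau>)"
  proof (cases "(\<sigma>, \<tau>) \<in> deleted_cells L (Suc j)")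
    case True
    hence st: "\<sigma> \<in> L" "\<tau> \<in> L" "\<sigma> \<inter> \<tau> = {}" "simplex_dim \<sigma> + simplex_dim \<tau> = Suc j" by (auto simp: deleted_cells_def)
    let ?p = "simplex_dim \<sigma>" and ?q = "simplex_dim \<tau>"
    have A: "geo_half j (\<sigma> - {v}, \<tau>) = (- 1) ^ ?q * piece_pairing (pair_half j) (\<sigma> - {v}) \<tau>" if v: "v \<in> \<sigma>" for v
    proof (cases "\<sigma> = {v}")
      case True
      have "pair_half j S S' = 0" if "S \<in> pieces {}" for S S'
        using pieces_empty[OF that] by (simp add: pair_half_empty)
      hence "piece_pairing (pair_half j) {} \<tau> = 0" by (simp add: piece_pairing_def)
      thus ?thesis using True by (simp add: geo_half_def)
    next
      case False
      hence "(\<sigma> - {v}, \<tau>) \<in> deleted_cells L j"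
        using st facet_in[OF st(1) False] simplex_dim_remove[OF finite_simplex[OF st(1)] v False]
        by (auto simp: deleted_cells_def)
      thus ?thesis by (simp add: geo_half_def)
    qed
    have B: "(- 1) ^ ?p * geo_half j (\<sigma>, \<tau> - {w}) = (- 1) ^ ?q * ((- 1) ^ Suc ?p * piece_pairing (pair_half j) \<sigma> (\<tau> - {w}))" if w: "w \<in> \<tau>" for w
    proof (cases "\<tau> = {w}")
      case True
      have "pair_half j S S' = 0" if "S' \<in> pieces {}" for S S'
        using pieces_empty[OF that] by (simp add: pair_half_empty)
      hence "piece_pairing (pair_half j) \<sigma> {} = 0" by (simp add: piece_pairing_def)
      thus ?thesis using True by (simp add: geo_half_def)
    next
      case False
      note q = simplex_dim_remove[OF finite_simplex[OF st(2)] w False]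
      have "(\<sigma>, \<tau> - {w}) \<in> deleted_cells L j"
        using st facet_in[OF st(2) False] q by (auto simp: deleted_cells_def)
      thus ?thesis by (simp add: geo_half_def q)
    qed
    have "coboundary L ori j (geo_half j) (\<sigma>, \<tau>) = raw_coboundary ori (geo_half j) \<sigma> \<tau>"
      using True by (simp add: coboundary_apply)
    also have "\<dots> = (\<Sum>v\<in>\<sigma>. incidence ori \<sigma> v * geo_half j (\<sigma> - {v}, \<tau>)) +
       (\<Sum>w\<in>\<tau>. incidence ori \<tau> w * ((- 1) ^ ?p * geo_half j (\<sigma>, \<tau> - {w})))"
      by (simp add: raw_coboundary_def sum_distrib_left algebra_simps)
    also have "\<dots> = (- 1) ^ ?q * ((\<Sum>v\<in>\<sigma>. incidence ori \<sigma> v * piece_pairing (pair_half j) (\<sigma> - {v}) \<tau>) +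
       (- 1) ^ Suc ?p * (\<Sum>w\<in>\<tau>. incidence ori \<tau> w * piece_pairing (pair_half j) \<sigma> (\<tau> - {w})))"
    proof -
      have "(\<Sum>v\<in>\<sigma>. incidence ori \<sigma> v * geo_half j (\<sigma> - {v}, \<tau>)) =
        (- 1) ^ ?q * (\<Sum>v\<in>\<sigma>. incidence ori \<sigma> v * piece_pairing (pair_half j) (\<sigma> - {v}) \<tau>)"
        unfolding sum_distrib_left by (intro sum.cong refl) (simp add: A)
      moreover have "(\<Sum>w\<in>\<tau>. incidence ori \<tau> w * ((- 1) ^ ?p * geo_half j (\<sigma>, \<tau> - {w}))) =
        (- 1) ^ ?q * ((- 1) ^ Suc ?p * (\<Sum>w\<in>\<tau>. incidence ori \<tau> w * piece_pairing (pair_half j) \<sigma> (\<tau> - {w})))"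
        unfolding sum_distrib_left by (intro sum.cong refl) (simp only: B mult.left_commute)
      ultimately show ?thesis by (simp only: distrib_left)
    qed
    also have "\<dots> = (- 1) ^ ?q * piece_pairing (\<lambda>S S'. (\<Sum>a\<in>S. incidence vertex_list S a * pair_half j (S - {a}) S')
       + (- 1) ^ Suc ?p * (\<Sum>b\<in>S'. incidence vertex_list S' b * pair_half j S (S' - {b}))) \<sigma> \<tau>"
      unfolding piece_pairing_add piece_pairing_boundary[of \<sigma> \<tau> "pair_half j", OF st(1,2) pair_half_empty] ..
    also have "\<dots> = (- 1) ^ ?q * piece_pairing (pair_zero (Suc j)) \<sigma> \<tau>"
    proof (intro arg_cong[of _ _ "(*) _"] piece_pairing_cong)
      fix S S' assume S: "S \<in> pieces \<sigma>" "S' \<in> pieces \<tau>"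
      have c: "card S = Suc ?p" "card S' = Suc ?q" using card_piece[OF st(1) S(1)] card_piece[OF st(2) S(2)] by auto
      have "(\<Sum>a\<in>S. incidence vertex_list S a * half_count (j + 2) (pair_row \<phi>) (pair_list (vertex_list (S - {a})) (vertex_list S')))
    + (- 1) ^ card S * (\<Sum>b\<in>S'. incidence vertex_list S' b * half_count (j + 2) (pair_row \<phi>) (pair_list (vertex_list S) (vertex_list (S' - {b}))))
    = zero_count (j + 3) (pair_row \<phi>) (pair_list (vertex_list S) (vertex_list S'))"
      proof (rule half_count_pair_boundary)
        show "generic_rows j vertices \<phi>" "generic_rows (Suc j) vertices \<phi>" using generic j by auto
        show "S \<subseteq> vertices" "S' \<subseteq> vertices" using piece_vertices S by blast+
        show "S \<inter> S' = {}" using pieces_disjoint[OF st(3) S] .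
        show "finite S" "finite S'" using piece_finite S by blast+
        thus "distinct (vertex_list R) \<and> set (vertex_list R) = R" if "R \<subseteq> S \<or> R \<subseteq> S'" for R
          using that by (intro vertex_list) (auto intro: finite_subset)
        show "card S + card S' = j + 3" using c st(4) by simp
      qed
      thus "(\<Sum>a\<in>S. incidence vertex_list S a * pair_half j (S - {a}) S')
       + (- 1) ^ Suc ?p * (\<Sum>b\<in>S'. incidence vertex_list S' b * pair_half j S (S' - {b})) = pair_zero (Suc j) S S'"
        unfolding pair_half_def pair_zero_def c(1) by (simp add: numeral_3_eq_3)
    qed
    also have "\<dots> = geo_zero (Suc j) (\<sigma>, \<tau>)" using True by (simp add: geo_zero_def)
    finally show ?thesis .
  qed (simp add: coboundary_apply geo_zero_def)
qed

lemma geo_zero_decompose: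
  assumes j: "Suc j \<le> N"
  shows "geo_zero j = (\<lambda>e. geo_half j e + (- 1) ^ j * swap_cochain (geo_half j) e)"
proof (rule ext, clarify)
  fix \<sigma> \<tau>
  show "geo_zero j (\<sigma>, \<tau>) = geo_half j (\<sigma>, \<tau>) + (- 1) ^ j * swap_cochain (geo_half j) (\<sigma>, \<tau>)"
  proof (cases "(\<sigma>, \<tau>) \<in> deleted_cells L j")
    case True
    hence st: "\<sigma> \<in> L" "\<tau> \<in> L" "\<sigma> \<inter> \<tau> = {}" "simplex_dim \<sigma> + simplex_dim \<tau> = j" by (auto simp: deleted_cells_def)
    let ?p = "simplex_dim \<sigma>" and ?q = "simplex_dim \<tau>"
    have T': "(\<tau>, \<sigma>) \<in> deleted_cells L j" using True deleted_cells_swap by blast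
    let ?e = "1 + j + Suc ?p * Suc ?q"
    have "piece_pairing (pair_zero j) \<sigma> \<tau> = piece_pairing (\<lambda>S S'. pair_half j S S' + (- 1) ^ ?e * pair_half j S' S) \<sigma> \<tau>"
    proof (rule piece_pairing_cong)
      fix S S' assume S: "S \<in> pieces \<sigma>" "S' \<in> pieces \<tau>"
      have c: "card S = Suc ?p" "card S' = Suc ?q" using card_piece[OF st(1) S(1)] card_piece[OF st(2) S(2)] by auto
      show "pair_zero j S S' = pair_half j S S' + (- 1) ^ ?e * pair_half j S' S"
        unfolding pair_zero_def pair_half_def c[symmetric]
        using generic[OF j] piece_vertices[OF S(1)] piece_vertices[OF S(2)] pieces_disjoint[OF st(3) S] c st(4) piece_list S
        by (intro zero_count_decompose) auto
    qed
    also have "\<dots> = piece_pairing (pair_half j) \<sigma> \<tau> + (- 1) ^ ?e * piece_pairing (pair_half j) \<tau> \<sigma>"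
      by (simp only: piece_pairing_add piece_pairing_swap[of "pair_half j"])
    finally have *: "piece_pairing (pair_zero j) \<sigma> \<tau> = piece_pairing (pair_half j) \<sigma> \<tau> + (- 1) ^ ?e * piece_pairing (pair_half j) \<tau> \<sigma>" .
    \<comment> \<open>As \<open>j = ?p + ?q\<close>, the exponent \<open>?e\<close> has the parity
      of \<open>?p * ?q\<close>.\<close>
    have sgn: "(- 1::int) ^ ?q * (- 1) ^ ?e = (- 1) ^ j * ((- 1) ^ (?p * ?q) * (- 1) ^ ?p)"
      unfolding st(4)[symmetric] by (cases "even ?p"; cases "even ?q") auto
    have "geo_zero j (\<sigma>, \<tau>) = (- 1) ^ ?q * piece_pairing (pair_half j) \<sigma> \<tau> + ((- 1) ^ ?q * (- 1) ^ ?e) * piece_pairing (pair_half j) \<tau> \<sigma>"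
      using True * by (simp only: geo_zero_def prod.case if_True distrib_left mult.assoc)
    also have "\<dots> = geo_half j (\<sigma>, \<tau>) + (- 1) ^ j * swap_cochain (geo_half j) (\<sigma>, \<tau>)"
      unfolding sgn using True T' by (simp only: geo_half_def swap_cochain_apply prod.case if_True mult.assoc)
    finally show ?thesis .
  next
    case False
    hence "(\<tau>, \<sigma>) \<notin> deleted_cells L j" using deleted_cells_swap by blast
    thus ?thesis using False by (simp add: geo_zero_def geo_half_def swap_cochain_apply)
  qed
qed

lemma pieces_vertex:
  assumes v: "{v} \<in> L"
  shows "pieces {v} = {{axis v 1}}" and "piece_sign {v} {axis v 1} = 1"
proof -
  have r: "realization {v} = {axis v (1::real)}" by (simp add: realization_def)
  obtain \<alpha> where "\<alpha> \<in> T" "\<alpha> \<subseteq> realization {v}" "axis v 1 \<in> \<alpha>"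
    using T_cover[OF v axis_in_realization[of v "{v}"]] by auto
  hence "{axis v (1::real)} \<in> T" using r by (metis insert_absorb insert_not_empty subset_singletonD)
  hence "{axis v 1} \<in> pieces {v}" by (simp add: pieces_def r)
  moreover have "S = {axis v 1}" if "S \<in> pieces {v}" for S
  proof -
    have "S \<subseteq> {axis v 1}" "S \<noteq> {}" using piece_sub[OF that] that r by (auto simp: pieces_def)
    thus ?thesis by blast
  qed
  ultimately show "pieces {v} = {{axis v 1}}" by blast
  have vl: "vertex_list {axis v (1::real)} = [axis v 1]"
  proof -
    have "length (vertex_list {axis v (1::real)}) = 1" by (simp add: length_vertex_list)
    then obtain z where "vertex_list {axis v (1::real)} = [z]" by (metis One_nat_def length_0_conv length_Suc_conv)
    thus ?thesis using vertex_list[of "{axis v (1::real)}"] by simp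
  qed
  have "bary_det [v] [axis v 1] = bary_det ([] :: 'a list) []" by (rule bary_det_Cons) auto
  also have "\<dots> = 1" by (simp add: col_det_def)
  finally show "piece_sign {v} {axis v 1} = 1" by (simp add: piece_sign_def vl ori_singleton[OF v] int_sgn_def)
qed

text \<open>For two vertices only the normalization rows are left: the matrix is the identity and
  the constant one is a solution. So the geometric sequence starts at the constant cocycle
  too.\<close>

lemma geo_zero_0: "geo_zero 0 = smith_cochain r 0"
proof (rule ext, clarify)
  fix \<sigma> \<tau>
  show "geo_zero 0 (\<sigma>, \<tau>) = smith_cochain r 0 (\<sigma>, \<tau>)"
  proof (cases "(\<sigma>, \<tau>) \<in> deleted_cells L 0")
    case True
    hence st: "\<sigma> \<in> L" "\<tau> \<in> L" "simplex_dim \<sigma> = 0" "simplex_dim \<tau> = 0" by (auto simp: deleted_cells_def)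
    then obtain v w where vw: "\<sigma> = {v}" "\<tau> = {w}"
      using card_pos[of \<sigma>] card_pos[of \<tau>] by (auto simp: card_1_singleton_iff)
    let ?a = "axis v (1::real)" and ?b = "axis w (1::real)"
    have vl: "vertex_list {x} = [x]" for x :: "real ^ 'a"
    proof -
      have "length (vertex_list {x}) = 1" by (simp add: length_vertex_list)
      then obtain z where "vertex_list {x} = [z]" by (metis One_nat_def length_0_conv length_Suc_conv)
      thus ?thesis using vertex_list[of "{x}"] by simp
    qed
    have "pair_zero 0 {?a} {?b} = 1"
    proof -
      have "Matrix.mat 2 2 (\<lambda>(i, j). pair_row \<phi> i ([Inl ?a, Inr ?b] ! j)) = 1\<^sub>m 2"
        by (intro eq_matI) (auto simp: pair_row_def less_2_cases_iff)
      hence "col_det 2 (pair_row \<phi>) [Inl ?a, Inr ?b] = 1" by (simp add: col_det_def)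
      moreover have "solves 2 (pair_row \<phi>) {Inl ?a, Inr ?b} (\<lambda>_. 1)"
        by (auto simp: solves_def pair_row_def less_2_cases_iff)
      hence "\<exists>z. solves 2 (pair_row \<phi>) {Inl ?a, Inr ?b} z" by blast
      ultimately show ?thesis by (simp add: pair_zero_def zero_count_def vl int_sgn_def numeral_2_eq_2)
    qed
    thus ?thesis using True st vw pieces_vertex by (simp add: geo_zero_def piece_pairing_def)
  qed (simp add: geo_zero_def)
qed

text \<open>Wu's theorem.\<close>

lemma geo_zero_cohomologous:
  assumes r: "inj_on r L"
    and i: "i < N"
  shows "\<exists>c\<in>cochains L i. swap_cochain c = (\<lambda>e. (- 1) ^ Suc i * c e) \<and>
     (\<lambda>e. geo_zero (Suc i) e - smith_cochain r (Suc i) e) = coboundary L ori i c"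
proof -
  have "smith_sequence N geo_zero geo_half"
    unfolding smith_sequence_def
    using geo_half_in_cochains geo_zero_decompose geo_half_coboundary by (metis Suc_leI)
  thus ?thesis
    using smith_sequence_smith_cochain[OF r] geo_zero_0 r i by (rule smith_sequence_unique)
qed

end

section \<open>Generic flags of projections\<close>

text \<open>The rows form a unitriangular combination of the coordinates, so that they can be made generic
  one after the other without changing any determinant.\<close>

definition flag_row :: "nat \<Rightarrow> (nat \<Rightarrow> real) \<Rightarrow> (nat \<Rightarrow> 'p \<Rightarrow> real) \<Rightarrow> nat \<Rightarrow> 'p \<Rightarrow> real" where
  "flag_row n t g r x = (\<Sum>i\<in>{r..<n}. t r ^ (i - r) * g i x)"

lemma flag_row_sum:
  "(\<Sum>x\<in>S. c x * flag_row n t g r x) = (\<Sum>i\<in>{r..<n}. t r ^ (i - r) * (\<Sum>x\<in>S. c x * g i x))"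
proof -
  have "(\<Sum>x\<in>S. c x * flag_row n t g r x) = (\<Sum>x\<in>S. \<Sum>i\<in>{r..<n}. t r ^ (i - r) * (c x * g i x))"
    by (simp add: flag_row_def sum_distrib_left algebra_simps)
  also have "\<dots> = (\<Sum>i\<in>{r..<n}. \<Sum>x\<in>S. t r ^ (i - r) * (c x * g i x))" by (rule sum.swap)
  finally show ?thesis by (simp add: sum_distrib_left)
qed

lemma unitriangular_zero:
  fixes w :: "nat \<Rightarrow> real"
  assumes hi: "\<And>i. m \<le> i \<Longrightarrow> i < n \<Longrightarrow> w i = 0"
    and lo: "\<And>r. r < m \<Longrightarrow> r < n \<Longrightarrow> (\<Sum>i\<in>{r..<n}. t r ^ (i - r) * w i) = 0" and "i < n"
  shows "w i = 0"
  using \<open>i < n\<close>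
proof (induction "n - i" arbitrary: i rule: less_induct)
  case less
  show ?case
  proof (cases "m \<le> i")
    case False
    have "(\<Sum>j\<in>{i..<n}. t i ^ (j - i) * w j) = w i + (\<Sum>j\<in>{Suc i..<n}. t i ^ (j - i) * w j)"
      using less.prems by (subst sum.atLeast_Suc_lessThan) auto
    also have "(\<Sum>j\<in>{Suc i..<n}. t i ^ (j - i) * w j) = 0"
    proof (intro sum.neutral ballI)
      fix j assume "j \<in> {Suc i..<n}"
      hence "w j = 0" using less.prems by (intro less.hyps) auto
      thus "t i ^ (j - i) * w j = 0" by simp
    qed
    finally show ?thesis using lo[of i] less.prems False by simp
  qed (use hi less.prems in auto)
qed

text \<open>Since \<open>j\<close> rows are already generic, the dependences of at most
  \<open>j + 2\<close> points with respect to them form at most a line. A bad parameter is a root of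
  a polynomial attached to this line, which is nonzero by the general position of all
  \<open>n\<close> coordinates. Finitely many sets of points exclude finitely many
  parameters.\<close>

lemma generic_flag_step:
  fixes g :: "nat \<Rightarrow> 'p \<Rightarrow> real"
  assumes V: "finite V" and gp: "generic_rows n V g" and j: "j < n"
    and gen: "generic_rows j V (flag_row n t g)"
  shows "\<exists>s. generic_rows (Suc j) V (flag_row n (t(j := s)) g)"
proof -
  define dep where "dep = (\<lambda>S c. (\<Sum>v\<in>S. c v) = 0 \<and> (\<forall>r<j. (\<Sum>v\<in>S. c v * flag_row n t g r v) = 0) \<and> (\<exists>v\<in>S. c v \<noteq> (0::real)))"
  define bad where "bad = (\<lambda>S. {s. \<exists>c. dep S c \<and> (\<Sum>i\<in>{j..<n}. s ^ (i - j) * (\<Sum>v\<in>S. c v * g i v)) = 0})"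
  have fin_bad: "finite (bad S)" if S: "S \<subseteq> V" "card S \<le> Suc j + 1" for S
  proof (cases "\<exists>c. dep S c")
    case False
    hence "bad S = {}" by (auto simp: bad_def)
    thus ?thesis by simp
  next
    case True
    then obtain c0 where c0: "dep S c0" by blast
    then obtain v0 where v0: "v0 \<in> S" "c0 v0 \<noteq> 0" by (auto simp: dep_def)
    have finS: "finite S" using S(1) V by (rule finite_subset)
    define w where "w = (\<lambda>i. \<Sum>v\<in>S. c0 v * g i v)"
    \<comment> \<open>Otherwise the rows below \<open>j\<close>, being unitriangular, would force
      all \<open>n\<close> coordinates to vanish on the dependence \<open>c0\<close>, against
      general position.\<close>
    have nz: "\<exists>i. j \<le> i \<and> i < n \<and> w i \<noteq> 0"
    proof (rule ccontr)
      assume "\<not> ?thesis"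
      hence hi: "\<And>i. j \<le> i \<Longrightarrow> i < n \<Longrightarrow> w i = 0" by blast
      have lo: "(\<Sum>i\<in>{r..<n}. t r ^ (i - r) * w i) = 0" if "r < j" for r
        using c0 that unfolding dep_def w_def flag_row_sum by blast
      have "w i = 0" if "i < n" for i using hi lo that by (rule unitriangular_zero[where m = j and t = t])
      hence "\<forall>v\<in>S. c0 v = 0"
        using gp c0 S finS j unfolding generic_rows_def dep_def w_def by (metis Suc_leI add_le_mono1 order.trans)
      thus False using v0 by blast
    qed
    then obtain i0 where i0: "j \<le> i0" "i0 < n" "w i0 \<noteq> 0" by blast
    define p where "p = (\<Sum>i\<in>{j..<n}. monom (w i) (i - j))"
    have "coeff p (i0 - j) = (\<Sum>i\<in>{j..<n}. if i - j = i0 - j then w i else 0)"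
      by (simp add: p_def coeff_sum)
    also have "\<dots> = (\<Sum>i\<in>{i0}. if i - j = i0 - j then w i else 0)"
      using i0 by (intro sum.mono_neutral_right) auto
    finally have "p \<noteq> 0" using i0(3) by auto
    hence "finite {s. poly p s = 0}" by (rule poly_roots_finite)
    moreover have "bad S \<subseteq> {s. poly p s = 0}"
    proof
      fix s assume "s \<in> bad S"
      then obtain c where c: "dep S c" "(\<Sum>i\<in>{j..<n}. s ^ (i - j) * (\<Sum>v\<in>S. c v * g i v)) = 0" by (auto simp: bad_def)
      define k where "k = c v0 / c0 v0"
      \<comment> \<open>Removing the coefficient at \<open>v0\<close> leaves a dependence of at most
        \<open>j + 1\<close> points, which is trivial. So every dependence of \<open>S\<close> is a
        multiple of \<open>c0\<close>, and the single polynomial \<open>p\<close> decides about all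
        of them.\<close>
      define d where "d = (\<lambda>v. c v - k * c0 v)"
      have dv0: "d v0 = 0" using v0 by (simp add: d_def k_def)
      have s1: "(\<Sum>v\<in>S - {v0}. d v * f v) = (\<Sum>v\<in>S. c v * f v) - k * (\<Sum>v\<in>S. c0 v * f v)" for f
      proof -
        have "(\<Sum>v\<in>S. d v * f v) = d v0 * f v0 + (\<Sum>v\<in>S - {v0}. d v * f v)" using finS v0(1) by (rule sum.remove)
        thus ?thesis using dv0 by (simp add: d_def algebra_simps sum_subtractf sum_distrib_left)
      qed
      have "\<forall>v\<in>S - {v0}. d v = 0"
      proof -
        have "card (S - {v0}) \<le> j + 1" using S(2) v0(1) finS by simp
        moreover have "(\<Sum>v\<in>S - {v0}. d v) = 0" using s1[of "\<lambda>_. 1"] c(1) c0 by (simp add: dep_def)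
        moreover have "\<forall>r<j. (\<Sum>v\<in>S - {v0}. d v * flag_row n t g r v) = 0" using s1 c(1) c0 by (simp add: dep_def)
        moreover have "finite (S - {v0})" "S - {v0} \<subseteq> V" using finS S(1) by auto
        ultimately show ?thesis using gen unfolding generic_rows_def by blast
      qed
      hence cv: "c v = k * c0 v" if "v \<in> S" for v
        using dv0 that by (cases "v = v0") (auto simp: d_def)
      have "k \<noteq> 0" using c(1) cv by (auto simp: dep_def)
      have "(\<Sum>v\<in>S. c v * g i v) = k * w i" for i
        by (simp add: w_def sum_distrib_left cv mult.assoc)
      hence "k * (\<Sum>i\<in>{j..<n}. s ^ (i - j) * w i) = 0" using c(2) by (simp add: sum_distrib_left algebra_simps)
      hence "(\<Sum>i\<in>{j..<n}. s ^ (i - j) * w i) = 0" using \<open>k \<noteq> 0\<close> by simp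
      thus "s \<in> {s. poly p s = 0}" by (simp add: p_def poly_sum poly_monom mult.commute)
    qed
    ultimately show ?thesis by (rule finite_subset[rotated])
  qed
  have "finite (\<Union>S\<in>{S. S \<subseteq> V \<and> card S \<le> Suc j + 1}. bad S)"
    using V fin_bad by (intro finite_UN_I) auto
  then obtain s where s: "s \<notin> (\<Union>S\<in>{S. S \<subseteq> V \<and> card S \<le> Suc j + 1}. bad S)"
    using ex_new_if_finite[OF infinite_UNIV_char_0[where 'a = real]] by blast
  have row: "flag_row n (t(j := s)) g r = flag_row n t g r" if "r < j" for r
    using that by (auto simp: flag_row_def)
  have "generic_rows (Suc j) V (flag_row n (t(j := s)) g)"
    unfolding generic_rows_def
  proof (intro allI impI, rule ccontr)
    fix S c assume *: "finite S \<and> S \<subseteq> V \<and> card S \<le> Suc j + 1 \<and> (\<Sum>v\<in>S. c v) = 0 \<and>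
        (\<forall>r<Suc j. (\<Sum>v\<in>S. c v * flag_row n (t(j := s)) g r v) = 0)" and nz: "\<not> (\<forall>v\<in>S. c v = 0)"
    have "dep S c" using * nz row unfolding dep_def by (metis less_Suc_eq)
    moreover have "(\<Sum>i\<in>{j..<n}. s ^ (i - j) * (\<Sum>v\<in>S. c v * g i v)) = 0"
    proof -
      have "(\<Sum>v\<in>S. c v * flag_row n (t(j := s)) g j v) = 0" using * by blast
      thus ?thesis unfolding flag_row_sum by simp
    qed
    ultimately have "s \<in> bad S" by (auto simp: bad_def)
    thus False using s * by blast
  qed
  thus ?thesis by blast
qed

lemma generic_flag_exists:
  fixes g :: "nat \<Rightarrow> 'p \<Rightarrow> real"
  assumes V: "finite V" and gp: "generic_rows n V g"
  shows "\<exists>t. \<forall>j\<le>n. generic_rows j V (flag_row n t g)"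
proof -
  have "\<exists>t. \<forall>j\<le>m. generic_rows j V (flag_row n t g)" if "m \<le> n" for m
    using that
  proof (induction m)
    case 0
    have "c v = 0" if "finite S" "card S \<le> 1" "(\<Sum>v\<in>S. c v) = (0::real)" "v \<in> S" for S c and v :: 'p
    proof -
      have "card S = 1" using that by (metis One_nat_def card_gt_0_iff empty_iff le_antisym Suc_leI)
      then obtain x where "S = {x}" by (auto simp: card_1_singleton_iff)
      thus ?thesis using that by simp
    qed
    thus ?case by (auto simp: generic_rows_def)
  next
    case (Suc m)
    then obtain t where t: "\<forall>j\<le>m. generic_rows j V (flag_row n t g)" by auto
    obtain s where s: "generic_rows (Suc m) V (flag_row n (t(m := s)) g)"
      using generic_flag_step[OF V gp _ spec[OF t, THEN mp, OF order_refl]] Suc.prems by auto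
    have "generic_rows j V (flag_row n (t(m := s)) g)" if "j \<le> m" for j
    proof -
      have "flag_row n (t(m := s)) g r = flag_row n t g r" if "r < j" for r
        using that \<open>j \<le> m\<close> by (auto simp: flag_row_def)
      thus ?thesis using t that unfolding generic_rows_def by simp
    qed
    with s show ?case by (metis le_Suc_eq)
  qed
  thus ?thesis by blast
qed

lemma pair_row_flag:
  "r \<ge> 2 \<Longrightarrow> pair_row (flag_row n t g) r x = (\<Sum>i\<in>{r..<n + 2}. t (r - 2) ^ (i - r) * pair_row g i x)"
proof -
  assume r: "r \<ge> 2"
  have "(\<Sum>i\<in>{r..<n + 2}. t (r - 2) ^ (i - r) * pair_row g i x) = (\<Sum>i\<in>{r - 2..<n}. t (r - 2) ^ (i + 2 - r) * pair_row g (i + 2) x)"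
    using sum.shift_bounds_nat_ivl[of "\<lambda>i. t (r - 2) ^ (i - r) * pair_row g i x" "r - 2" 2 n] r
    by (simp only: le_add_diff_inverse2)
  also have "\<dots> = (\<Sum>i\<in>{r - 2..<n}. t (r - 2) ^ (i - (r - 2)) * pair_row g (i + 2) x)"
    using r by (intro sum.cong refl) auto
  also have "\<dots> = pair_row (flag_row n t g) r x"
    using r by (cases x) (auto simp: pair_row_def flag_row_def sum_negf)
  finally show ?thesis ..
qed

text \<open>The change of coordinates is multiplication by a unipotent matrix that leaves the
  normalization rows alone. With \<open>solves_flag\<close> it follows that the counts with all
  \<open>n\<close> rows are unchanged, although the truncations to fewer rows become
  generic.\<close>

lemma col_det_flag:
  "col_det (n + 2) (pair_row (flag_row n t g)) xs = col_det (n + 2) (pair_row g) xs"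
proof -
  let ?m = "n + 2"
  define P where "P = Matrix.mat ?m ?m (\<lambda>(i, j). if i = j then 1 else if i < j \<and> 2 \<le> i then t (i - 2) ^ (j - i) else 0 :: real)"
  let ?A = "Matrix.mat ?m ?m (\<lambda>(i, j). pair_row g i (xs ! j))"
  have P: "P \<in> carrier_mat ?m ?m" by (simp add: P_def)
  have "Matrix.mat ?m ?m (\<lambda>(i, j). pair_row (flag_row n t g) i (xs ! j)) = P * ?A"
  proof (rule eq_matI)
    fix i j assume "i < dim_row (P * ?A)" "j < dim_col (P * ?A)"
    hence ij: "i < ?m" "j < ?m" by (auto simp: P_def)
    have "(P * ?A) $$ (i, j) = (\<Sum>k<?m. P $$ (i, k) * pair_row g k (xs ! j))"
      using ij P by (auto simp: scalar_prod_def lessThan_atLeast0 intro!: sum.cong)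
    also have "\<dots> = pair_row (flag_row n t g) i (xs ! j)"
    proof (cases "2 \<le> i")
      case True
      have "(\<Sum>k<?m. P $$ (i, k) * pair_row g k (xs ! j)) = (\<Sum>k\<in>{i..<?m}. P $$ (i, k) * pair_row g k (xs ! j))"
        using ij by (intro sum.mono_neutral_right) (auto simp: P_def)
      also have "\<dots> = (\<Sum>k\<in>{i..<?m}. t (i - 2) ^ (k - i) * pair_row g k (xs ! j))"
        using ij True by (intro sum.cong) (auto simp: P_def)
      finally show ?thesis using True by (simp add: pair_row_flag)
    next
      case False
      have "(\<Sum>k<?m. P $$ (i, k) * pair_row g k (xs ! j)) = (\<Sum>k\<in>{i}. P $$ (i, k) * pair_row g k (xs ! j))"
        using ij False by (intro sum.mono_neutral_right) (auto simp: P_def)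
      also have "\<dots> = pair_row (flag_row n t g) i (xs ! j)"
        using ij False by (auto simp: P_def pair_row_def split: sum.splits)
      finally show ?thesis .
    qed
    finally show "Matrix.mat ?m ?m (\<lambda>(i, j). pair_row (flag_row n t g) i (xs ! j)) $$ (i, j) = (P * ?A) $$ (i, j)"
      using ij by simp
  qed (auto simp: P_def)
  moreover have "Determinant.det (P * ?A) = Determinant.det P * Determinant.det ?A"
    using P by (intro det_mult[of _ ?m]) auto
  moreover have "Determinant.det P = 1"
  proof -
    have "upper_triangular P" unfolding upper_triangular_def by (auto simp: P_def)
    hence "Determinant.det P = prod_list (diag_mat P)" using P by (rule det_upper_triangular)
    also have "diag_mat P = replicate ?m 1"
      by (rule nth_equalityI) (auto simp: diag_mat_def P_def simp del: upt_Suc replicate.simps)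
    finally show ?thesis by simp
  qed
  ultimately show ?thesis by (simp add: col_det_def)
qed

lemma solves_flag:
  assumes "finite Z"
  shows "solves (n + 2) (pair_row (flag_row n t g)) Z z \<longleftrightarrow> solves (n + 2) (pair_row g) Z z"
proof -
  define w where "w = (\<lambda>i. \<Sum>x\<in>Z. pair_row g (i + 2) x * z x)"
  have low: "pair_row (flag_row n t g) r x = pair_row g r x" if "r < 2" for r x
    using that by (auto simp: pair_row_def split: sum.splits)
  have high: "(\<Sum>x\<in>Z. pair_row (flag_row n t g) (r + 2) x * z x) = (\<Sum>i\<in>{r..<n}. t r ^ (i - r) * w i)" for r
  proof -
    have "(\<Sum>x\<in>Z. pair_row (flag_row n t g) (r + 2) x * z x) =
      (\<Sum>x\<in>Z. \<Sum>i\<in>{r..<n}. t r ^ (i - r) * (pair_row g (i + 2) x * z x))"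
    proof (rule sum.cong[OF refl])
      fix x
      have "pair_row (flag_row n t g) (r + 2) x = (\<Sum>i\<in>{r + 2..<n + 2}. t r ^ (i - (r + 2)) * pair_row g i x)"
        by (subst pair_row_flag) auto
      also have "\<dots> = (\<Sum>i\<in>{r..<n}. t r ^ (i - r) * pair_row g (i + 2) x)"
        by (subst sum.shift_bounds_nat_ivl) simp
      finally show "pair_row (flag_row n t g) (r + 2) x * z x = (\<Sum>i\<in>{r..<n}. t r ^ (i - r) * (pair_row g (i + 2) x * z x))"
        by (simp add: sum_distrib_right mult.assoc)
    qed
    also have "\<dots> = (\<Sum>i\<in>{r..<n}. \<Sum>x\<in>Z. t r ^ (i - r) * (pair_row g (i + 2) x * z x))" by (rule sum.swap)
    finally show ?thesis by (simp add: w_def sum_distrib_left)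
  qed
  have split: "(\<forall>r<n + 2. Q r) \<longleftrightarrow> (\<forall>r<2. Q r) \<and> (\<forall>r<n. Q (r + 2))" for Q :: "nat \<Rightarrow> bool"
  proof (intro iffI conjI allI impI)
    fix r assume Q: "(\<forall>r<2. Q r) \<and> (\<forall>r<n. Q (r + 2))" and r: "r < n + 2"
    show "Q r"
    proof (cases "r < 2")
      case False
      hence e: "r - 2 + 2 = r" "r - 2 < n" using r by auto
      hence "Q (r - 2 + 2)" using Q by blast
      thus ?thesis unfolding e .
    qed (use Q in blast)
  qed auto
  have "(\<forall>r<n. (\<Sum>i\<in>{r..<n}. t r ^ (i - r) * w i) = 0) \<longleftrightarrow> (\<forall>r<n. w r = 0)"
  proof
    assume a: "\<forall>r<n. (\<Sum>i\<in>{r..<n}. t r ^ (i - r) * w i) = 0"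
    show "\<forall>r<n. w r = 0"
    proof (intro allI impI)
      fix i assume "i < n"
      thus "w i = 0" by (rule unitriangular_zero[of n n w t i, rotated 2]) (use a in auto)
    qed
  qed (auto intro!: sum.neutral)
  thus ?thesis unfolding solves_def split high low w_def by (auto simp: low)
qed

section \<open>Comparison with the van Kampen cochain\<close>

lemma col_det_scale_columns:
  "Determinant.det (Matrix.mat n n (\<lambda>(i, j). c j * M i j)) = (\<Prod>j<n. c j) * Determinant.det (Matrix.mat n n (\<lambda>(i, j). M i j :: real))"
proof -
  have tr: "Determinant.det (Matrix.mat n n (\<lambda>(i, j). A i j :: real)) = col_det n (\<lambda>j i. A i j) [0..<n]" for A
  proof -
    have "transpose_mat (Matrix.mat n n (\<lambda>(i, j). A i j)) = Matrix.mat n n (\<lambda>(j, i). A ([0..<n] ! i) j)"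
      by (intro eq_matI) auto
    thus ?thesis unfolding col_det_def by (metis det_transpose mat_carrier)
  qed
  show ?thesis unfolding tr by (rule col_det_scale_rows)
qed

text \<open>Subtracting the first column of each block from the rest of the block leaves a single
  one in each normalization row. Expanding along these rows costs \<open>(- 1) ^ k\<close>, which
  comes from the second one; it cancels against the \<open>k\<close> negated columns of the second
  simplex.\<close>

lemma det_edge_vectors:
  fixes f :: "real ^ 'a::finite \<Rightarrow> real vec"
  assumes len: "length as = Suc k" "length bs = Suc k"
    and f: "\<And>x. x \<in> set as \<union> set bs \<Longrightarrow> f x \<in> carrier_vec (2 * k)"
  shows "Determinant.det (mat_of_cols (2 * k) (edge_vectors f as @ edge_vectors f bs)) =
     col_det (2 * k + 2) (pair_row (\<lambda>r x. vec_index (f x) r)) (pair_list as bs)"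
proof -
  let ?n = "2 * k + 2"
  let ?G = "pair_row (\<lambda>r x. vec_index (f x) r)"
  let ?xs = "pair_list as bs"
  define A where "A = (\<lambda>i j. ?G i (?xs ! j))"
  have xa: "?xs ! j = Inl (as ! j)" if "j \<le> k" for j using that len by (simp add: nth_append)
  have xb: "?xs ! Suc (j + k) = Inr (bs ! j)" if "j \<le> k" for j using that len by (simp add: nth_append)
  have A0: "A 0 j = (if j \<le> k then 1 else 0)" if "j < ?n" for j
  proof (cases "j \<le> k")
    case False
    define j' where "j' = j - Suc k"
    have "j = Suc (j' + k)" "j' \<le> k" using that False by (auto simp: j'_def)
    thus ?thesis using False by (simp add: A_def xb pair_row_def)
  qed (simp add: A_def xa pair_row_def)
  have A1: "A (Suc 0) j = (if j \<le> k then 0 else 1)" if "j < ?n" for j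
  proof (cases "j \<le> k")
    case False
    define j' where "j' = j - Suc k"
    have "j = Suc (j' + k)" "j' \<le> k" using that False by (auto simp: j'_def)
    thus ?thesis using False by (simp add: A_def xb pair_row_def)
  qed (simp add: A_def xa pair_row_def)
  define E where "E = Matrix.mat ?n ?n (\<lambda>(i, j). of_bool (i = j) - of_bool (i = 0 \<and> 1 \<le> j \<and> j \<le> k) - of_bool (i = Suc k \<and> Suc k < j) :: real)"
  define B where "B = (\<lambda>i j. A i j - of_bool (1 \<le> j \<and> j \<le> k) * A i 0 - of_bool (Suc k < j) * A i (Suc k))"
  have E: "E \<in> carrier_mat ?n ?n" by (simp add: E_def)
  let ?A = "Matrix.mat ?n ?n (\<lambda>(i, j). A i j)" and ?B = "Matrix.mat ?n ?n (\<lambda>(i, j). B i j)"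
  have "?A * E = ?B"
  proof (rule eq_matI)
    fix i j assume "i < dim_row ?B" "j < dim_col ?B"
    hence ij: "i < ?n" "j < ?n" by auto
    have "(?A * E) $$ (i, j) = (\<Sum>l<?n. A i l * E $$ (l, j))"
      using ij E by (auto simp: scalar_prod_def lessThan_atLeast0 intro!: sum.cong)
    also have "\<dots> = (\<Sum>l<?n. (if l = j then A i l else 0) - (if l = 0 then of_bool (1 \<le> j \<and> j \<le> k) * A i l else 0)
         - (if l = Suc k then of_bool (Suc k < j) * A i l else 0))"
      using ij by (intro sum.cong) (auto simp: E_def)
    also have "\<dots> = B i j"
    proof -
      have key: "(\<Sum>l<m. (if l = j then A i l else 0) - (if l = 0 then of_bool (1 \<le> j \<and> j \<le> k) * A i l else 0)
         - (if l = Suc k then of_bool (Suc k < j) * A i l else 0)) = B i j" if "j < m" "Suc k < m" for m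
        using that by (simp add: sum_subtractf B_def)
      show ?thesis by (rule key) (use ij in auto)
    qed
    finally show "(?A * E) $$ (i, j) = ?B $$ (i, j)" using ij by simp
  qed (use E in auto)
  moreover have "Determinant.det (?A * E) = Determinant.det ?A * Determinant.det E"
    using E by (intro det_mult[of _ ?n]) auto
  moreover have "Determinant.det E = 1"
  proof -
    have "upper_triangular E" unfolding upper_triangular_def by (auto simp: E_def)
    hence "Determinant.det E = prod_list (diag_mat E)" using E by (rule det_upper_triangular)
    also have "diag_mat E = replicate ?n 1"
      by (rule nth_equalityI) (auto simp: diag_mat_def E_def simp del: upt_Suc replicate.simps)
    finally show ?thesis by simp
  qed
  ultimately have detA: "Determinant.det ?A = Determinant.det ?B" by simp
  have B0: "B 0 j = of_bool (j = 0)" if "j < ?n" for j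
    using A0[OF that] A0[of 0] A0[of "Suc k"] by (auto simp: B_def)
  have B1: "B (Suc 0) j = of_bool (j = Suc k)" if "j < ?n" for j
    using A1[OF that] A1[of 0] A1[of "Suc k"] by (auto simp: B_def)
  let ?C = "Matrix.mat (2 * k + 1) (2 * k + 1) (\<lambda>(i, j). B (Suc i) (Suc j))"
  have "Determinant.det ?B = (\<Sum>j<?n. ?B $$ (0, j) * Determinant.cofactor ?B 0 j)"
    by (rule laplace_expansion_row) auto
  also have "\<dots> = (\<Sum>j\<in>{0}. ?B $$ (0, j) * Determinant.cofactor ?B 0 j)"
    using B0 by (intro sum.mono_neutral_right) auto
  also have "\<dots> = Determinant.cofactor ?B 0 0" using B0[of 0] by simp
  also have "mat_delete ?B 0 0 = ?C" by (intro eq_matI) (auto simp: mat_delete_def)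
  hence "Determinant.cofactor ?B 0 0 = Determinant.det ?C" by (simp add: Determinant.cofactor_def)
  finally have detB: "Determinant.det ?B = Determinant.det ?C" .
  let ?D = "Matrix.mat (2 * k) (2 * k) (\<lambda>(i, j). B (Suc (Suc i)) (if j < k then Suc j else Suc (Suc j)))"
  have "Determinant.det ?C = (\<Sum>j<2 * k + 1. ?C $$ (0, j) * Determinant.cofactor ?C 0 j)"
    by (rule laplace_expansion_row) auto
  also have "\<dots> = (\<Sum>j\<in>{k}. ?C $$ (0, j) * Determinant.cofactor ?C 0 j)"
    using B1 by (intro sum.mono_neutral_right) auto
  also have "\<dots> = Determinant.cofactor ?C 0 k" using B1[of "Suc k"] by simp
  also have "mat_delete ?C 0 k = ?D" by (intro eq_matI) (auto simp: mat_delete_def)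
  hence "Determinant.cofactor ?C 0 k = (- 1) ^ k * Determinant.det ?D" by (simp add: Determinant.cofactor_def)
  finally have detC: "Determinant.det ?C = (- 1) ^ k * Determinant.det ?D" .
  let ?M = "mat_of_cols (2 * k) (edge_vectors f as @ edge_vectors f bs)"
  have le: "length (edge_vectors f as) = k" "length (edge_vectors f bs) = k" using len by (auto simp: edge_vectors_def)
  obtain a as' where as: "as = a # as'" "length as' = k" using len by (cases as) auto
  obtain b bs' where bs: "bs = b # bs'" "length bs' = k" using len by (cases bs) auto
  have D: "?D = Matrix.mat (2 * k) (2 * k) (\<lambda>(i, j). (if j < k then 1 else - 1) * ?M $$ (i, j))"
  proof (rule eq_matI)
    fix i j assume "i < dim_row (Matrix.mat (2 * k) (2 * k) (\<lambda>(i, j). (if j < k then 1 else - 1) * ?M $$ (i, j)))"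
       "j < dim_col (Matrix.mat (2 * k) (2 * k) (\<lambda>(i, j). (if j < k then 1 else - 1) * ?M $$ (i, j)))"
    hence ij: "i < 2 * k" "j < 2 * k" by auto
    show "?D $$ (i, j) = Matrix.mat (2 * k) (2 * k) (\<lambda>(i, j). (if j < k then 1 else - 1) * ?M $$ (i, j)) $$ (i, j)"
    proof (cases "j < k")
      case True
      have M: "?M $$ (i, j) = vec_index (f (as' ! j)) i - vec_index (f a) i"
      proof -
        have "f (as' ! j) \<in> carrier_vec (2 * k)" "f a \<in> carrier_vec (2 * k)" using f True as by auto
        thus ?thesis using ij True as le by (simp add: mat_of_cols_index nth_append) (simp add: edge_vectors_def)
      qed
      have "B (Suc (Suc i)) (Suc j) = A (Suc (Suc i)) (Suc j) - A (Suc (Suc i)) 0" using True by (simp add: B_def)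
      also have "\<dots> = vec_index (f (as' ! j)) i - vec_index (f a) i"
        using xa[of "Suc j"] xa[of 0] True as by (simp add: A_def pair_row_def)
      finally show ?thesis using ij True M by simp
    next
      case False
      define j' where "j' = j - k"
      have j': "j = j' + k" "j' < k" using False ij by (auto simp: j'_def)
      have M: "?M $$ (i, j) = vec_index (f (bs' ! j')) i - vec_index (f b) i"
      proof -
        have "f (bs' ! j') \<in> carrier_vec (2 * k)" "f b \<in> carrier_vec (2 * k)" using f j' bs by auto
        thus ?thesis using ij False bs le j' by (simp add: mat_of_cols_index nth_append) (simp add: edge_vectors_def)
      qed
      have "B (Suc (Suc i)) (Suc (Suc j)) = A (Suc (Suc i)) (Suc (Suc j)) - A (Suc (Suc i)) (Suc k)" using False by (simp add: B_def)
      also have "\<dots> = - (vec_index (f (bs' ! j')) i - vec_index (f b) i)"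
        using xb[of "Suc j'"] xb[of 0] j' bs by (simp add: A_def pair_row_def)
      finally show ?thesis using ij False M by simp
    qed
  qed auto
  have "?M = Matrix.mat (2 * k) (2 * k) (\<lambda>(i, j). ?M $$ (i, j))" using le by (intro eq_matI) auto
  hence "Determinant.det ?D = (\<Prod>j<2 * k. if j < k then 1 else - 1) * Determinant.det ?M"
    unfolding D by (subst col_det_scale_columns) simp
  also have "(\<Prod>j<2 * k. if j < k then 1 else - 1 :: real) = (- 1) ^ k"
  proof -
    have "(\<Prod>j<k + m. if j < k then 1 else - 1 :: real) = (- 1) ^ m" for m by (induction m) auto
    from this[of k] show ?thesis by (simp add: mult_2)
  qed
  finally have "Determinant.det ?A = ((- 1) ^ k * (- 1) ^ k) * Determinant.det ?M"
    unfolding detA detB detC by simp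
  hence "Determinant.det ?A = Determinant.det ?M" by (simp flip: power_mult_distrib)
  thus ?thesis by (simp add: col_det_def A_def)
qed

lemma sgn_eq_int_sgn: "sgn x = of_int (int_sgn x)" for x :: real
  by (auto simp: int_sgn_def sgn_if)

text \<open>\<open>affine_map_on\<close> speaks of two points only. A coordinate of \<open>f\<close>
  and its negative are both convex, and Jensen's inequality for the two of them gives equality for
  longer combinations.\<close>

lemma affine_map_sum:
  fixes f :: "real ^ 'a::finite \<Rightarrow> real vec"
  assumes aff: "affine_map_on (convex hull S) f" and car: "f ` (convex hull S) \<subseteq> carrier_vec n" and i: "i < n"
    and S: "finite S" and w: "\<And>s. s \<in> S \<Longrightarrow> 0 \<le> w s" "sum w S = 1"
  shows "vec_index (f (\<Sum>s\<in>S. w s *\<^sub>R s)) i = (\<Sum>s\<in>S. w s * vec_index (f s) i)"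
proof -
  let ?C = "convex hull S"
  define g where "g = (\<lambda>x. vec_index (f x) i)"
  have comb: "g (u *\<^sub>R x + v *\<^sub>R y) = u * g x + v * g y"
    if "x \<in> ?C" "y \<in> ?C" "0 \<le> u" "0 \<le> v" "u + v = 1" for x y u v
  proof -
    have u: "u = 1 - v" "v \<in> {0..1}" using that by auto
    have "f ((1 - v) *\<^sub>R x + v *\<^sub>R y) = (1 - v) \<cdot>\<^sub>v f x + v \<cdot>\<^sub>v f y"
      using aff that u(2) unfolding affine_map_on_def by blast
    moreover have "f x \<in> carrier_vec n" "f y \<in> carrier_vec n" using car that by auto
    ultimately show ?thesis using i unfolding u g_def by simp
  qed
  have cv: "convex_on ?C g" "convex_on ?C (\<lambda>x. - g x)"
    unfolding convex_on_def using comb by auto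
  have mem: "s \<in> ?C" if "s \<in> S" for s using that by (rule hull_inc)
  have "S \<noteq> {}" using w(2) by auto
  have "g (\<Sum>s\<in>S. w s *\<^sub>R s) \<le> (\<Sum>s\<in>S. w s * g s)"
    by (rule convex_on_sum[OF S \<open>S \<noteq> {}\<close> cv(1) w(2)]) (use w mem in auto)
  moreover have "- g (\<Sum>s\<in>S. w s *\<^sub>R s) \<le> (\<Sum>s\<in>S. w s * - g s)"
    by (rule convex_on_sum[OF S \<open>S \<noteq> {}\<close> cv(2) w(2)]) (use w mem in auto)
  ultimately show ?thesis by (simp add: g_def sum_negf)
qed

section \<open>Crossing signs and intersection numbers\<close>

context subdivided_complex
begin

lemma piece_sign_cases:
  assumes "\<sigma> \<in> L" "S \<in> pieces \<sigma>"
  shows "piece_sign \<sigma> S = 1 \<or> piece_sign \<sigma> S = - 1"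
proof -
  have "bary_det (ori \<sigma>) (vertex_list S) \<noteq> 0"
    using piece_list[OF assms(2)] piece_sub[OF assms(2)] ori_simplex[OF assms(1)] assms(2)
    by (intro bary_det_nonzero[of S \<sigma>]) (auto simp: pieces_def)
  thus ?thesis by (auto simp: piece_sign_def int_sgn_def)
qed

lemma positive_ordering_iff:
  assumes "\<sigma> \<in> L" "S \<in> pieces \<sigma>"
  shows "positive_ordering (ori \<sigma>) (convex hull S) as \<longleftrightarrow>
    same_elems (vertex_list S) as \<and> reorder_sign (vertex_list S) as = piece_sign \<sigma> S"
proof -
  have vl: "distinct (vertex_list S)" "set (vertex_list S) = S" using piece_list[OF assms(2)] by auto
  have sv: "simplex_vertices (convex hull S) = S" using assms(2) by (intro simplex_vertices_hull) (simp add: pieces_def)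
  have len: "length (ori \<sigma>) = card S" using length_ori[OF assms(1)] assms(2) by (simp add: pieces_def)
  have "positive_ordering (ori \<sigma>) (convex hull S) as \<longleftrightarrow> same_elems (vertex_list S) as \<and> bary_det (ori \<sigma>) as > 0"
  proof -
    have se: "same_elems (vertex_list S) as \<longleftrightarrow> distinct as \<and> set as = S" using vl by (auto simp: same_elems_def)
    have l: "length as = length (ori \<sigma>)" if "distinct as" "set as = S" using len distinct_card[OF that(1)] that(2) by simp
    show ?thesis
    proof (cases "distinct as \<and> set as = S")
      case True
      hence le: "length as = length (ori \<sigma>)" using l by blast
      show ?thesis unfolding positive_ordering_def sv se bary_det_transpose(1)[OF le] using True le by blast
    next
      case False
      thus ?thesis unfolding positive_ordering_def sv se by blast
    qed
  qed
  moreover have "bary_det (ori \<sigma>) as > 0 \<longleftrightarrow> reorder_sign (vertex_list S) as = piece_sign \<sigma> S" if se: "same_elems (vertex_list S) as"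
  proof -
    have "bary_det (ori \<sigma>) as = of_int (reorder_sign (vertex_list S) as) * bary_det (ori \<sigma>) (vertex_list S)"
      using se len length_vertex_list[OF piece_finite[OF assms(2)]] by (intro col_det_reorder) auto
    hence "int_sgn (bary_det (ori \<sigma>) as) = reorder_sign (vertex_list S) as * piece_sign \<sigma> S"
      using int_sgn_of_int[OF reorder_sign_cases[OF se]] by (simp add: int_sgn_mult piece_sign_def)
    moreover have "bary_det (ori \<sigma>) as > 0 \<longleftrightarrow> int_sgn (bary_det (ori \<sigma>) as) = 1" by (auto simp: int_sgn_def)
    ultimately show ?thesis using reorder_sign_cases[OF se] piece_sign_cases[OF assms] by auto
  qed
  ultimately show ?thesis by blast
qed

text \<open>If the reference list has the wrong orientation, exchange its first two entries;
  positive dimension guarantees that there are two.\<close>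

lemma positive_ordering_exists:
  assumes "\<sigma> \<in> L" "S \<in> pieces \<sigma>" "simplex_dim \<sigma> \<ge> 1"
  shows "\<exists>as. positive_ordering (ori \<sigma>) (convex hull S) as"
proof -
  have vl: "distinct (vertex_list S)" using piece_list[OF assms(2)] by auto
  have "length (vertex_list S) = card S" using length_vertex_list[OF piece_finite[OF assms(2)]] .
  also have "\<dots> \<ge> 2" using assms card_pos[OF assms(1)] by (simp add: pieces_def)
  finally obtain a b xs where ab: "vertex_list S = a # b # xs"
    by (metis One_nat_def Suc_1 Suc_le_length_iff)
  have "reorder_sign (a # b # xs) (b # a # xs) = - 1" using vl ab by (intro reorder_sign_swap) simp
  moreover have "same_elems (vertex_list S) (b # a # xs)" using vl ab by (auto simp: same_elems_def)
  moreover have "same_elems (vertex_list S) (vertex_list S)" using vl by (simp add: same_elems_def)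
  ultimately show ?thesis
    unfolding positive_ordering_iff[OF assms(1,2)] using piece_sign_cases[OF assms(1,2)] vl ab
    by (metis reorder_sign_refl)
qed

end

locale pl_map = subdivided_complex L ori T
  for L :: "'a::finite set set" and ori T +
  fixes f :: "real ^ 'a \<Rightarrow> real vec" and k :: nat
  assumes pl: "pl_general_position (2 * k) L T f" and dim: "has_dimension L k" and k: "k \<ge> 1"
begin

definition coords :: "nat \<Rightarrow> real ^ 'a \<Rightarrow> real" where
  "coords r x = vec_index (f x) r"

lemma f_carrier: "\<alpha> \<in> T \<Longrightarrow> f ` \<alpha> \<subseteq> carrier_vec (2 * k)"
  using pl T_Union unfolding pl_general_position_def by blast

lemma f_affine: "\<alpha> \<in> T \<Longrightarrow> affine_map_on \<alpha> f"
  using pl unfolding pl_general_position_def by blast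

lemma coords_generic: "generic_rows (2 * k) vertices coords"
  using pl unfolding pl_general_position_def general_position_def generic_rows_def vertices_def coords_def
  by blast

lemma images_meet_iff:
  assumes S: "S \<in> pieces \<sigma>" "S' \<in> pieces \<tau>"
  shows "f ` (convex hull S) \<inter> f ` (convex hull S') \<noteq> {} \<longleftrightarrow>
    (\<exists>z. solves (2 * k + 2) (pair_row coords) (S <+> S') z)"
proof -
  have fin: "finite S" "finite S'" using piece_finite S by auto
  have T: "convex hull S \<in> T" "convex hull S' \<in> T" using S by (auto simp: pieces_def)
  have sum: "vec_index (f (\<Sum>s\<in>R. w s *\<^sub>R s)) i = (\<Sum>s\<in>R. w s * coords i s)"
    if "R = S \<or> R = S'" "i < 2 * k" "\<And>s. s \<in> R \<Longrightarrow> 0 \<le> w s" "sum w R = 1" for R w i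
    unfolding coords_def using that T fin
    by (intro affine_map_sum[where n = "2 * k"] f_affine f_carrier) auto
  have split: "(\<forall>r<2 * k + 2. Q r) \<longleftrightarrow> Q 0 \<and> Q (Suc 0) \<and> (\<forall>r<2 * k. Q (Suc (Suc r)))" for Q :: "nat \<Rightarrow> bool"
    by (auto simp: All_less_Suc2)
  have sol: "solves (2 * k + 2) (pair_row coords) (S <+> S') z \<longleftrightarrow>
     (\<forall>x\<in>S <+> S'. 0 \<le> z x) \<and> (\<Sum>a\<in>S. z (Inl a)) = 1 \<and> (\<Sum>b\<in>S'. z (Inr b)) = 1 \<and>
     (\<forall>r<2 * k. (\<Sum>a\<in>S. coords r a * z (Inl a)) = (\<Sum>b\<in>S'. coords r b * z (Inr b)))" for z
    unfolding solves_def split sum_pair_row[OF fin] by auto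
  show ?thesis
  proof
    assume "f ` (convex hull S) \<inter> f ` (convex hull S') \<noteq> {}"
    then obtain x y where xy: "x \<in> convex hull S" "y \<in> convex hull S'" "f x = f y" by blast
    obtain w where w: "\<forall>s\<in>S. 0 \<le> w s" "sum w S = 1" "(\<Sum>s\<in>S. w s *\<^sub>R s) = x"
      using xy(1) unfolding convex_hull_finite[OF fin(1)] by blast
    obtain w' where w': "\<forall>s\<in>S'. 0 \<le> w' s" "sum w' S' = 1" "(\<Sum>s\<in>S'. w' s *\<^sub>R s) = y"
      using xy(2) unfolding convex_hull_finite[OF fin(2)] by blast
    have eq: "(\<Sum>a\<in>S. w a * coords r a) = (\<Sum>b\<in>S'. w' b * coords r b)" if "r < 2 * k" for r
      using sum[of S r w] sum[of S' r w'] w w' xy(3) that by simp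
    show "\<exists>z. solves (2 * k + 2) (pair_row coords) (S <+> S') z"
      unfolding sol using w w' eq
      by (intro exI[of _ "case_sum w w'"]) (auto simp: mult.commute)
  next
    assume "\<exists>z. solves (2 * k + 2) (pair_row coords) (S <+> S') z"
    then obtain z where z: "\<forall>x\<in>S <+> S'. 0 \<le> z x" "(\<Sum>a\<in>S. z (Inl a)) = 1" "(\<Sum>b\<in>S'. z (Inr b)) = 1"
      "\<And>r. r < 2 * k \<Longrightarrow> (\<Sum>a\<in>S. coords r a * z (Inl a)) = (\<Sum>b\<in>S'. coords r b * z (Inr b))"
      unfolding sol by blast
    define x where "x = (\<Sum>a\<in>S. z (Inl a) *\<^sub>R a)"
    define y where "y = (\<Sum>b\<in>S'. z (Inr b) *\<^sub>R b)"
    have x: "x \<in> convex hull S" unfolding convex_hull_finite[OF fin(1)] x_def using z by (intro CollectI exI[of _ "\<lambda>a. z (Inl a)"]) auto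
    have y: "y \<in> convex hull S'" unfolding convex_hull_finite[OF fin(2)] y_def using z by (intro CollectI exI[of _ "\<lambda>b. z (Inr b)"]) auto
    have car: "f x \<in> carrier_vec (2 * k)" "f y \<in> carrier_vec (2 * k)"
      using f_carrier[OF T(1)] f_carrier[OF T(2)] x y by auto
    have "f x = f y"
    proof (rule eq_vecI)
      fix i assume "i < dim_vec (f y)"
      hence i: "i < 2 * k" using car by simp
      have "vec_index (f x) i = (\<Sum>a\<in>S. z (Inl a) * coords i a)"
        unfolding x_def using z i by (intro sum) auto
      moreover have "vec_index (f y) i = (\<Sum>b\<in>S'. z (Inr b) * coords i b)"
        unfolding y_def using z i by (intro sum) auto
      ultimately show "vec_index (f x) i = vec_index (f y) i"
        using z(4)[OF i] by (simp add: mult.commute)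
    qed (use car in simp)
    thus "f ` (convex hull S) \<inter> f ` (convex hull S') \<noteq> {}" using x y by blast
  qed
qed

text \<open>\<open>crossing_sign\<close> asks for some positive orderings. Passing from the
  reference lists to any positive orderings changes the determinant by the product of the two piece
  signs, so the sign does not depend on the choice; a choice exists because
  \<open>k \<ge> 1\<close>.\<close>

lemma crossing_sign_iff:
  assumes L: "\<sigma> \<in> L" "\<tau> \<in> L" "simplex_dim \<sigma> = k" "simplex_dim \<tau> = k"
    and S: "S \<in> pieces \<sigma>" "S' \<in> pieces \<tau>"
  shows "crossing_sign k ori f \<sigma> \<tau> (convex hull S) (convex hull S') (of_int s) \<longleftrightarrow>
    piece_sign \<sigma> S * piece_sign \<tau> S' *
      int_sgn (col_det (2 * k + 2) (pair_row coords) (pair_list (vertex_list S) (vertex_list S'))) = s"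
proof -
  let ?v = "vertex_list S" and ?v' = "vertex_list S'"
  have len: "length ?v = Suc k" "length ?v' = Suc k"
    using length_vertex_list[OF piece_finite[OF S(1)]] length_vertex_list[OF piece_finite[OF S(2)]]
      S card_pos[OF L(1)] card_pos[OF L(2)] L(3,4) by (auto simp: pieces_def)
  have T: "convex hull S \<in> T" "convex hull S' \<in> T" using S by (auto simp: pieces_def)
  have "sgn (Determinant.det (mat_of_cols (2 * k) (edge_vectors f as @ edge_vectors f bs))) =
     of_int (piece_sign \<sigma> S * piece_sign \<tau> S' * int_sgn (col_det (2 * k + 2) (pair_row coords) (pair_list ?v ?v')))"
    if as: "same_elems ?v as" "reorder_sign ?v as = piece_sign \<sigma> S"
      and bs: "same_elems ?v' bs" "reorder_sign ?v' bs = piece_sign \<tau> S'" for as bs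
  proof -
    have l: "length as = Suc k" "length bs = Suc k"
      using as bs len unfolding same_elems_def by (metis distinct_card)+
    have sets: "set as = S" "set bs = S'" using as bs piece_list S by (auto simp: same_elems_def)
    have "f x \<in> carrier_vec (2 * k)" if "x \<in> set as \<union> set bs" for x
      using that sets f_carrier[OF T(1)] f_carrier[OF T(2)] by (auto simp: hull_inc)
    hence "Determinant.det (mat_of_cols (2 * k) (edge_vectors f as @ edge_vectors f bs)) =
       col_det (2 * k + 2) (pair_row coords) (pair_list as bs)"
      using det_edge_vectors[OF l] unfolding coords_def by blast
    also have "\<dots> = of_int (reorder_sign (pair_list ?v ?v') (pair_list as bs)) *
       col_det (2 * k + 2) (pair_row coords) (pair_list ?v ?v')"
      using as(1) bs(1) len by (intro col_det_reorder same_elems_pair_list) auto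
    also have "reorder_sign (pair_list ?v ?v') (pair_list as bs) = piece_sign \<sigma> S * piece_sign \<tau> S'"
      using reorder_sign_pair_list[OF as(1) bs(1)] as(2) bs(2) by simp
    finally show ?thesis
      using int_sgn_of_int[of "piece_sign \<sigma> S * piece_sign \<tau> S'"] piece_sign_cases[OF L(1) S(1)] piece_sign_cases[OF L(2) S(2)]
      unfolding sgn_eq_int_sgn int_sgn_mult by (auto simp: int_sgn_minus)
  qed
  moreover obtain as bs where "positive_ordering (ori \<sigma>) (convex hull S) as" "positive_ordering (ori \<tau>) (convex hull S') bs"
    using positive_ordering_exists[OF L(1) S(1)] positive_ordering_exists[OF L(2) S(2)] L k by auto
  ultimately show ?thesis
    unfolding crossing_sign_def positive_ordering_iff[OF L(1) S(1)] positive_ordering_iff[OF L(2) S(2)]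
    by (metis of_int_eq_iff)
qed

text \<open>Pieces are determined by their hulls, so crossing pairs correspond to the pairs of
  pieces whose system is solvable. Each pair contributes \<open>1\<close>, \<open>0\<close> or
  \<open>- 1\<close> to both sides; one with vanishing determinant is counted on neither.\<close>

lemma intersection_number_eq:
  assumes L: "\<sigma> \<in> L" "\<tau> \<in> L" "simplex_dim \<sigma> = k" "simplex_dim \<tau> = k"
  shows "intersection_number k ori T f \<sigma> \<tau> =
    piece_pairing (\<lambda>S S'. zero_count (2 * k + 2) (pair_row coords) (pair_list (vertex_list S) (vertex_list S'))) \<sigma> \<tau>"
proof -
  define P where "P = pieces \<sigma> \<times> pieces \<tau>"
  define val where "val = (\<lambda>(S, S'). piece_sign \<sigma> S * piece_sign \<tau> S' *
     zero_count (2 * k + 2) (pair_row coords) (pair_list (vertex_list S) (vertex_list S')))"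
  define h where "h = (\<lambda>(S, S'). (convex hull S :: (real ^ 'a) set, convex hull S' :: (real ^ 'a) set))"
  have finP: "finite P" by (simp add: P_def finite_pieces)
  have inj: "inj_on h P"
  proof -
    have "S = R" if "S \<in> pieces \<rho>" "R \<in> pieces \<rho>" "convex hull S = convex hull R" for S R \<rho>
      by (rule affine_independent_hull_inj) (use that in \<open>auto simp: pieces_def\<close>)
    thus ?thesis unfolding inj_on_def h_def P_def by fast
  qed
  have card\<sigma>: "card \<sigma> = Suc k" "card \<tau> = Suc k" using card_pos L by auto
  have cross: "crossings k T f \<sigma> \<tau> = h ` {(S, S') \<in> P. f ` (convex hull S) \<inter> f ` (convex hull S') \<noteq> {}}"
  proof -
    have simp: "int k simplex \<alpha> \<and> \<alpha> \<in> T \<and> \<alpha> \<subseteq> realization \<rho> \<longleftrightarrow> (\<exists>S\<in>pieces \<rho>. \<alpha> = convex hull S)"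
      if "card \<rho> = Suc k" for \<alpha> \<rho>
      unfolding simplex_def pieces_def using that by auto
    show ?thesis
    proof (intro equalityI subsetI)
      fix p assume p: "p \<in> crossings k T f \<sigma> \<tau>"
      obtain \<alpha> \<beta> where ab: "p = (\<alpha>, \<beta>)" by (cases p)
      hence m: "f ` \<alpha> \<inter> f ` \<beta> \<noteq> {}" using p by (simp add: crossings_def)
      obtain S where S: "S \<in> pieces \<sigma>" "\<alpha> = convex hull S"
        using simp[OF card\<sigma>(1), of \<alpha>] p ab by (auto simp: crossings_def)
      obtain S' where S': "S' \<in> pieces \<tau>" "\<beta> = convex hull S'"
        using simp[OF card\<sigma>(2), of \<beta>] p ab by (auto simp: crossings_def)
      have "p = h (S, S')" by (simp add: ab S S' h_def)
      moreover have "(S, S') \<in> {(S, S') \<in> P. f ` (convex hull S) \<inter> f ` (convex hull S') \<noteq> {}}"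
        using S S' m by (simp add: P_def)
      ultimately show "p \<in> h ` {(S, S') \<in> P. f ` (convex hull S) \<inter> f ` (convex hull S') \<noteq> {}}" by blast
    next
      fix p assume "p \<in> h ` {(S, S') \<in> P. f ` (convex hull S) \<inter> f ` (convex hull S') \<noteq> {}}"
      then obtain S S' where S: "S \<in> pieces \<sigma>" "S' \<in> pieces \<tau>" "p = (convex hull S, convex hull S')"
        "f ` (convex hull S) \<inter> f ` (convex hull S') \<noteq> {}" by (auto simp: P_def h_def)
      have "int k simplex (convex hull S) \<and> convex hull S \<in> T \<and> convex hull S \<subseteq> realization \<sigma>"
        unfolding simp[OF card\<sigma>(1)] using S(1) by blast
      moreover have "int k simplex (convex hull S') \<and> convex hull S' \<in> T \<and> convex hull S' \<subseteq> realization \<tau>"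
        unfolding simp[OF card\<sigma>(2)] using S(2) by blast
      ultimately show "p \<in> crossings k T f \<sigma> \<tau>"
        unfolding crossings_def S(3) using S(4) by blast
    qed
  qed
  have val: "(f ` (convex hull S) \<inter> f ` (convex hull S') \<noteq> {} \<and>
      crossing_sign k ori f \<sigma> \<tau> (convex hull S) (convex hull S') (of_int s)) \<longleftrightarrow> val (S, S') = s"
    if "(S, S') \<in> P" "s \<noteq> 0" for S S' s
  proof -
    have S: "S \<in> pieces \<sigma>" "S' \<in> pieces \<tau>" using that by (auto simp: P_def)
    have "set (pair_list (vertex_list S) (vertex_list S')) = S <+> S'"
      using piece_list[OF S(1)] piece_list[OF S(2)] by (simp only: set_pair_list)
    thus ?thesis
      unfolding images_meet_iff[OF S] crossing_sign_iff[OF L S] val_def prod.case zero_count_def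
      using that(2) by auto
  qed
  have card: "int (card {(\<alpha>, \<beta>) \<in> crossings k T f \<sigma> \<tau>. crossing_sign k ori f \<sigma> \<tau> \<alpha> \<beta> (of_int s)}) = (\<Sum>p\<in>P. of_bool (val p = s))"
    if "s \<noteq> 0" for s
  proof -
    have "{(\<alpha>, \<beta>) \<in> crossings k T f \<sigma> \<tau>. crossing_sign k ori f \<sigma> \<tau> \<alpha> \<beta> (of_int s)} = h ` {p \<in> P. val p = s}"
    proof -
      have "{(\<alpha>, \<beta>) \<in> crossings k T f \<sigma> \<tau>. crossing_sign k ori f \<sigma> \<tau> \<alpha> \<beta> (of_int s)} =
        h ` {(S, S') \<in> P. f ` (convex hull S) \<inter> f ` (convex hull S') \<noteq> {} \<and>
          crossing_sign k ori f \<sigma> \<tau> (convex hull S) (convex hull S') (of_int s)}"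
        unfolding cross h_def by fast
      also have "{(S, S') \<in> P. f ` (convex hull S) \<inter> f ` (convex hull S') \<noteq> {} \<and>
          crossing_sign k ori f \<sigma> \<tau> (convex hull S) (convex hull S') (of_int s)} = {p \<in> P. val p = s}"
      proof (rule Set.set_eqI)
        fix p :: "(real ^ 'a) set \<times> (real ^ 'a) set"
        obtain S S' where p: "p = (S, S')" by (cases p)
        show "p \<in> {(S, S') \<in> P. f ` (convex hull S) \<inter> f ` (convex hull S') \<noteq> {} \<and>
          crossing_sign k ori f \<sigma> \<tau> (convex hull S) (convex hull S') (of_int s)} \<longleftrightarrow> p \<in> {p \<in> P. val p = s}"
          unfolding p mem_Collect_eq prod.case using val[of S S' s] that by blast
      qed
      finally show ?thesis .
    qed
    moreover have "card (h ` {p \<in> P. val p = s}) = card {p \<in> P. val p = s}"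
      by (intro card_image inj_on_subset[OF inj]) auto
    moreover have "(\<Sum>p\<in>P. of_bool (val p = s)) = int (card {p \<in> P. val p = s})"
      using finP by (simp add: of_bool_def sum.If_cases Int_def)
    ultimately show ?thesis by simp
  qed
  have "val p = of_bool (val p = 1) - of_bool (val p = - 1)" if pP: "p \<in> P" for p
  proof -
    obtain S S' where p: "p = (S, S')" "S \<in> pieces \<sigma>" "S' \<in> pieces \<tau>" using pP by (auto simp: P_def)
    show ?thesis using piece_sign_cases[OF L(1) p(2)] piece_sign_cases[OF L(2) p(3)]
      by (auto simp: p(1) val_def zero_count_def int_sgn_def)
  qed
  hence "(\<Sum>p\<in>P. val p) = (\<Sum>p\<in>P. of_bool (val p = 1) - of_bool (val p = - 1))" by (rule sum.cong[OF refl])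
  also have "\<dots> = intersection_number k ori T f \<sigma> \<tau>"
    using card[of 1] card[of "- 1"] by (simp add: intersection_number_def sum_subtractf)
  finally show ?thesis
    unfolding piece_pairing_def P_def val_def by (simp add: sum.cartesian_product)
qed

lemma top_cell_dim:
  assumes "(\<sigma>, \<tau>) \<in> deleted_cells L (2 * k)"
  shows "\<sigma> \<in> L" "\<tau> \<in> L" "simplex_dim \<sigma> = k" "simplex_dim \<tau> = k"
proof -
  have *: "\<sigma> \<in> L" "\<tau> \<in> L" "simplex_dim \<sigma> + simplex_dim \<tau> = 2 * k" using assms by (auto simp: deleted_cells_def)
  moreover have "simplex_dim \<sigma> \<le> k" "simplex_dim \<tau> \<le> k" using * dim by (auto simp: has_dimension_def)
  ultimately show "\<sigma> \<in> L" "\<tau> \<in> L" "simplex_dim \<sigma> = k" "simplex_dim \<tau> = k" by auto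
qed

text \<open>The flag serves the truncations to fewer coordinates; in degree \<open>2 * k\<close> its
  counts are those of \<open>f\<close> itself. On a top cell both factors have dimension
  \<open>k\<close>, so the sign \<open>(- 1) ^ k\<close> of the van Kampen cochain is the factor
  \<open>(- 1) ^ simplex_dim \<tau>\<close> in \<open>geo_zero\<close>.\<close>

lemma van_kampen_cochain_cohomologous:
  assumes r: "inj_on r L"
  shows "\<exists>c\<in>invariant_cochains L (2 * k - 1).
     (\<lambda>e. van_kampen_cochain k L ori T f e - smith_cochain r (2 * k) e) = coboundary L ori (2 * k - 1) c"
proof -
  obtain t where t: "\<forall>j\<le>2 * k. generic_rows j vertices (flag_row (2 * k) t coords)"
    using generic_flag_exists[OF finite_vertices coords_generic] by blast
  interpret generic_subdivision L ori T "flag_row (2 * k) t coords" "2 * k"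
    using t by unfold_locales blast
  have zc: "pair_zero (2 * k) S S' = zero_count (2 * k + 2) (pair_row coords) (pair_list (vertex_list S) (vertex_list S'))" for S S'
    unfolding pair_zero_def zero_count_def col_det_flag solves_flag[OF finite_set] ..
  have "van_kampen_cochain k L ori T f (\<sigma>, \<tau>) = geo_zero (2 * k) (\<sigma>, \<tau>)" for \<sigma> \<tau>
  proof (cases "(\<sigma>, \<tau>) \<in> deleted_cells L (2 * k)")
    case True
    note d = top_cell_dim[OF True]
    have "pair_zero (2 * k) = (\<lambda>S S'. zero_count (2 * k + 2) (pair_row coords) (pair_list (vertex_list S) (vertex_list S')))"
      by (intro ext zc)
    thus ?thesis using True d(4) unfolding van_kampen_cochain_def geo_zero_def
      by (simp only: prod.case if_True intersection_number_eq[OF d])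
  qed (simp add: van_kampen_cochain_def geo_zero_def)
  hence vk: "van_kampen_cochain k L ori T f = geo_zero (2 * k)" by auto
  have Suc: "Suc (2 * k - 1) = 2 * k" using k by simp
  have lt: "2 * k - 1 < 2 * k" using k by simp
  have "(- 1::int) ^ (2 * k) = 1" by simp
  with geo_zero_cohomologous[OF r lt] show ?thesis
    unfolding Suc vk invariant_cochains_def by (simp del: smith_cochain.simps) blast
qed

end

section \<open>Existence of maps in general position\<close>

lemma affine_independent_axes: "\<not> affine_dependent ((\<lambda>v. axis v (1::real)) ` (\<sigma> :: 'a::finite set))"
proof -
  have "independent ((\<lambda>v. axis v (1::real)) ` \<sigma>)"
    by (rule independent_mono[OF independent_Basis]) (auto simp: Basis_vec_def)
  thus ?thesis using affine_dependent_imp_dependent by blast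
qed

text \<open>The empty set has to be added because \<open>simplicial_complex\<close> demands closure
  under all faces, including the empty one. The other faces come from subsets of the vertices, as
  the axes are affinely independent.\<close>

lemma trivial_subdivision:
  fixes L :: "'a::finite set set"
  assumes L: "abstract_complex L" "L \<noteq> {}"
  shows "subdivision_of (insert {} (realization ` L)) L"
  unfolding subdivision_of_def simplicial_complex_def
proof (intro conjI ballI allI impI)
  let ?T = "insert {} (realization ` L)"
  show "finite ?T" using L by (simp add: abstract_complex_def)
  show "\<exists>n. n simplex \<alpha>" if mem: "\<alpha> \<in> ?T" for \<alpha>
  proof (cases "\<alpha> = {}")
    case False
    then obtain \<sigma> where "\<alpha> = convex hull ((\<lambda>v. axis v (1::real)) ` \<sigma>)" using mem by (auto simp: realization_def)
    thus ?thesis unfolding simplex_def using affine_independent_axes[of \<sigma>]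
      by (intro exI[of _ "int (card ((\<lambda>v. axis v (1::real)) ` \<sigma>)) - 1"]) auto
  qed auto
  show "F \<in> ?T" if *: "\<alpha> \<in> ?T \<and> F face_of \<alpha>" for F \<alpha>
  proof (cases "\<alpha> = {} \<or> F = {}")
    case True
    thus ?thesis using * face_of_imp_subset[of F \<alpha>] by blast
  next
    case False
    then obtain \<sigma> where s: "\<sigma> \<in> L" "\<alpha> = convex hull ((\<lambda>v. axis v (1::real)) ` \<sigma>)" using * by (auto simp: realization_def)
    then obtain c where c: "c \<subseteq> (\<lambda>v. axis v (1::real)) ` \<sigma>" "F = convex hull c"
      using * face_of_convex_hull_affine_independent[OF affine_independent_axes] by blast
    then obtain \<rho> where \<rho>: "\<rho> \<subseteq> \<sigma>" "c = (\<lambda>v. axis v 1) ` \<rho>" by (meson subset_imageE)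
    hence "F = realization \<rho>" "\<rho> \<noteq> {}" using c False by (auto simp: realization_def)
    moreover have "\<rho> \<in> L" using L(1) s(1) \<rho>(1) \<open>\<rho> \<noteq> {}\<close> unfolding abstract_complex_def by blast
    ultimately show ?thesis by blast
  qed
  show "\<alpha> \<inter> \<beta> face_of \<alpha>" if mem: "\<alpha> \<in> ?T \<and> \<beta> \<in> ?T" for \<alpha> \<beta>
  proof (cases "\<alpha> = {} \<or> \<beta> = {}")
    case True
    thus ?thesis by auto
  next
    case False
    then obtain \<sigma> \<tau> where "\<alpha> = realization \<sigma>" "\<beta> = realization \<tau>" using mem by auto
    thus ?thesis by (auto simp: realization_Int intro: realization_face)
  qed
  show "\<Union> ?T = polyhedron_of L" by (auto simp: polyhedron_of_def)
  show "\<exists>\<sigma>\<in>L. \<alpha> \<subseteq> realization \<sigma>" if "\<alpha> \<in> ?T" for \<alpha> using that L(2) by auto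
qed

text \<open>Combine the relations with the coefficients of the polynomial whose roots are the other
  nodes: its degree is at most \<open>n\<close>, and it singles out the coefficient at
  \<open>s0\<close>.\<close>

lemma vandermonde_independent:
  fixes \<rho> :: "'p \<Rightarrow> real"
  assumes S: "finite S" "card S \<le> n + 1" and inj: "inj_on \<rho> S"
    and c: "\<And>i. i \<le> n \<Longrightarrow> (\<Sum>s\<in>S. c s * \<rho> s ^ i) = 0" and s0: "s0 \<in> S"
  shows "c s0 = 0"
proof -
  define p where "p = (\<Prod>s\<in>S - {s0}. [:- \<rho> s, 1:])"
  have "degree p \<le> (\<Sum>s\<in>S - {s0}. degree [:- \<rho> s, 1:])"
    unfolding p_def using degree_prod_sum_le[of "S - {s0}" "\<lambda>s. [:- \<rho> s, 1:]"] S by (simp add: o_def)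
  also have "\<dots> = card (S - {s0})" by simp
  also have "\<dots> \<le> n" using S s0 by simp
  finally have deg: "degree p \<le> n" .
  have "(\<Sum>s\<in>S. c s * poly p (\<rho> s)) = (\<Sum>s\<in>S. \<Sum>i\<le>degree p. coeff p i * (c s * \<rho> s ^ i))"
    by (simp add: poly_altdef sum_distrib_left algebra_simps)
  also have "\<dots> = (\<Sum>i\<le>degree p. \<Sum>s\<in>S. coeff p i * (c s * \<rho> s ^ i))" by (rule sum.swap)
  also have "\<dots> = 0"
  proof (rule sum.neutral, rule ballI)
    fix i assume "i \<in> {..degree p}"
    hence "(\<Sum>s\<in>S. c s * \<rho> s ^ i) = 0" using c deg by simp
    thus "(\<Sum>s\<in>S. coeff p i * (c s * \<rho> s ^ i)) = 0" by (simp flip: sum_distrib_left)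
  qed
  finally have "(\<Sum>s\<in>S. c s * poly p (\<rho> s)) = 0" .
  moreover have "(\<Sum>s\<in>S. c s * poly p (\<rho> s)) = c s0 * poly p (\<rho> s0) + (\<Sum>s\<in>S - {s0}. c s * poly p (\<rho> s))"
    using S(1) s0 by (rule sum.remove)
  moreover have "(\<Sum>s\<in>S - {s0}. c s * poly p (\<rho> s)) = 0"
  proof (intro sum.neutral ballI)
    fix s assume "s \<in> S - {s0}"
    hence "poly p (\<rho> s) = 0" using S(1) by (auto simp: p_def poly_prod)
    thus "c s * poly p (\<rho> s) = 0" by simp
  qed
  moreover have "poly p (\<rho> s0) \<noteq> 0"
    using S(1) s0 inj by (auto simp: p_def poly_prod inj_on_def)
  ultimately show ?thesis by simp
qed

text \<open>The vertices go to points of the moment curve with distinct parameters, and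
  \<open>f\<close> is linear on the whole space. The exponents start at \<open>Suc 0\<close> because
  the power zero is supplied by the vanishing sum of the coefficients.\<close>

lemma pl_general_position_exists:
  fixes L :: "'a::finite set set"
  assumes L: "abstract_complex L" "L \<noteq> {}"
  shows "\<exists>T f. pl_general_position n L T f"
proof -
  define T where "T = insert {} (realization ` L)"
  define m where "m = (\<lambda>v::'a. real (to_nat v))"
  define f where "f = (\<lambda>x :: real ^ 'a. Matrix.vec n (\<lambda>i. \<Sum>v\<in>UNIV. x $ v * m v ^ Suc i))"
  have vert: "\<exists>v. x = axis v 1" if mem: "(x :: real ^ 'a) \<in> (\<Union>\<alpha>\<in>T. simplex_vertices \<alpha>)" for x
  proof -
    obtain \<alpha> where "\<alpha> \<in> T" "x \<in> simplex_vertices \<alpha>" using mem by blast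
    then obtain \<sigma> where "x \<in> simplex_vertices (realization \<sigma>)" by (auto simp: T_def simplex_vertices_def)
    hence "x \<in> (\<lambda>v. axis v 1) ` \<sigma>"
      unfolding realization_def simplex_vertices_hull[OF affine_independent_axes] .
    thus ?thesis by blast
  qed
  have fx: "vec_index (f (axis v 1)) i = m v ^ Suc i" if "i < n" for v i
  proof -
    have "vec_index (f (axis v 1)) i = (\<Sum>w\<in>UNIV. axis v 1 $ w * m w ^ Suc i)" using that by (simp add: f_def)
    also have "\<dots> = (\<Sum>w\<in>UNIV. if w = v then m w ^ Suc i else 0)" by (intro sum.cong) (auto simp: axis_def)
    finally show ?thesis by simp
  qed
  have "general_position n (\<Union>\<alpha>\<in>T. simplex_vertices \<alpha>) f"
    unfolding general_position_def
  proof (intro allI impI)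
    fix S c assume S: "finite S \<and> S \<subseteq> (\<Union>\<alpha>\<in>T. simplex_vertices \<alpha>) \<and> card S \<le> n + 1"
      and c: "(\<Sum>v\<in>S. c v) = 0 \<and> (\<forall>i<n. (\<Sum>v\<in>S. c v * vec_index (f v) i) = 0)"
    define \<rho> where "\<rho> = (\<lambda>x :: real ^ 'a. m (SOME v. x = axis v 1))"
    have \<rho>: "\<rho> (axis v 1) = m v" for v :: 'a
    proof -
      have "axis v (1::real) = axis (SOME w. axis v (1::real) = axis w 1) 1" by (rule someI[of _ v]) simp
      thus ?thesis by (simp add: \<rho>_def axis_eq_axis)
    qed
    have ax: "\<exists>v. x = axis v 1" if "x \<in> S" for x using vert S that by blast
    have "c s = 0" if "s \<in> S" for s
    proof (rule vandermonde_independent[of S n \<rho> c s])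
      show "inj_on \<rho> S"
      proof (rule inj_onI)
        fix x y assume xy: "x \<in> S" "y \<in> S" "\<rho> x = \<rho> y"
        then obtain v w where "x = axis v 1" "y = axis w 1" using ax by blast
        thus "x = y" using xy(3) \<rho> by (simp add: m_def)
      qed
      fix i assume i: "i \<le> n"
      show "(\<Sum>s\<in>S. c s * \<rho> s ^ i) = 0"
      proof (cases i)
        case 0
        thus ?thesis using c by simp
      next
        case (Suc j)
        have "(\<Sum>s\<in>S. c s * \<rho> s ^ i) = (\<Sum>s\<in>S. c s * vec_index (f s) j)"
        proof (rule sum.cong[OF refl])
          fix s assume "s \<in> S"
          then obtain v where v: "s = axis v 1" using ax by blast
          have "j < n" using i Suc by simp
          thus "c s * \<rho> s ^ i = c s * vec_index (f s) j" unfolding v \<rho> fx[OF \<open>j < n\<close>] Suc by simp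
        qed
        thus ?thesis using c i Suc by simp
      qed
    qed (use S that in auto)
    thus "\<forall>v\<in>S. c v = 0" by blast
  qed
  moreover have "affine_map_on \<alpha> f" for \<alpha>
    unfolding affine_map_on_def
  proof (intro ballI)
    fix x y :: "real ^ 'a" and t :: real
    show "f ((1 - t) *\<^sub>R x + t *\<^sub>R y) = (1 - t) \<cdot>\<^sub>v f x + t \<cdot>\<^sub>v f y"
      by (rule eq_vecI) (auto simp: f_def sum_distrib_left sum.distrib algebra_simps sum_subtractf)
  qed
  moreover have "f ` polyhedron_of L \<subseteq> carrier_vec n" by (auto simp: f_def)
  ultimately have "pl_general_position n L T f"
    unfolding pl_general_position_def T_def using trivial_subdivision[OF L] by blast
  thus ?thesis by blast
qed

section \<open>The van Kampen obstruction\<close>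

lemma cohomology_class_eq:
  "cohomology_class L ori i c = {(\<lambda>e. h e + c e) | h. h \<in> invariant_coboundaries L ori i}"
  by (auto simp: cohomology_class_def r_coset_def invariant_cocycle_group_def)

context oriented_complex
begin

lemma invariant_coboundaries_closed:
  assumes "a \<in> invariant_coboundaries L ori i" "b \<in> invariant_coboundaries L ori i"
  shows "(\<lambda>e. a e + b e) \<in> invariant_coboundaries L ori i" "(\<lambda>e. a e - b e) \<in> invariant_coboundaries L ori i"
proof -
  have "(\<lambda>e. a e + b e) \<in> invariant_coboundaries L ori i \<and> (\<lambda>e. a e - b e) \<in> invariant_coboundaries L ori i"
  proof (cases "i = 0")
    case False
    then obtain x y where xy: "x \<in> invariant_cochains L (i - 1)" "y \<in> invariant_cochains L (i - 1)"
      "a = coboundary L ori (i - 1) x" "b = coboundary L ori (i - 1) y"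
      using assms by (auto simp: invariant_coboundaries_def)
    have "(\<lambda>e. x e + y e) \<in> invariant_cochains L (i - 1)" "(\<lambda>e. x e - y e) \<in> invariant_cochains L (i - 1)"
      using xy by (auto simp: invariant_cochains_def swap_cochain_add swap_cochain_diff intro: cochains_add cochains_diff)
    moreover have "(\<lambda>e. a e + b e) = coboundary L ori (i - 1) (\<lambda>e. x e + y e)"
      "(\<lambda>e. a e - b e) = coboundary L ori (i - 1) (\<lambda>e. x e - y e)"
      by (simp_all add: xy coboundary_add coboundary_diff)
    ultimately show ?thesis using False by (auto simp: invariant_coboundaries_def)
  qed (use assms in \<open>auto simp: invariant_coboundaries_def\<close>)
  thus "(\<lambda>e. a e + b e) \<in> invariant_coboundaries L ori i" "(\<lambda>e. a e - b e) \<in> invariant_coboundaries L ori i"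
    by auto
qed

lemma zero_coboundary: "(\<lambda>e. 0) \<in> invariant_coboundaries L ori i"
proof (cases "i = 0")
  case False
  have "(\<lambda>e. 0) \<in> invariant_cochains L (i - 1)"
    by (auto simp: invariant_cochains_def cochains_def fun_eq_iff swap_cochain_apply)
  moreover have "coboundary L ori (i - 1) (\<lambda>e. 0) = (\<lambda>e. 0)"
    by (auto simp: fun_eq_iff coboundary_apply raw_coboundary_def)
  ultimately show ?thesis using False by (force simp: invariant_coboundaries_def)
qed (simp add: invariant_coboundaries_def)

lemma cohomology_class_cong:
  assumes "(\<lambda>e. a e - b e) \<in> invariant_coboundaries L ori i"
  shows "cohomology_class L ori i a = cohomology_class L ori i b"
proof -
  have "cohomology_class L ori i a \<subseteq> cohomology_class L ori i b"
    if d: "(\<lambda>e. a e - b e) \<in> invariant_coboundaries L ori i" for a b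
  proof
    fix x assume "x \<in> cohomology_class L ori i a"
    then obtain h where h: "h \<in> invariant_coboundaries L ori i" "x = (\<lambda>e. h e + a e)" by (auto simp: cohomology_class_eq)
    have "x = (\<lambda>e. (h e + (a e - b e)) + b e)" by (simp add: h)
    thus "x \<in> cohomology_class L ori i b"
      using invariant_coboundaries_closed(1)[OF h(1) d] unfolding cohomology_class_eq
      by (intro CollectI exI[of _ "\<lambda>e. h e + (a e - b e)"] conjI)
  qed
  moreover have "(\<lambda>e. b e - a e) \<in> invariant_coboundaries L ori i"
    using invariant_coboundaries_closed(2)[OF zero_coboundary assms] by simp
  ultimately show ?thesis using assms by (intro subset_antisym)
qed

lemma cohomology_class_trivial_iff:
  "cohomology_class L ori i a = \<one>\<^bsub>invariant_cohomology L ori i\<^esub> \<longleftrightarrow> a \<in> invariant_coboundaries L ori i"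
proof -
  have one: "\<one>\<^bsub>invariant_cohomology L ori i\<^esub> = invariant_coboundaries L ori i"
    by (simp add: invariant_cohomology_def FactGroup_def)
  have "cohomology_class L ori i (\<lambda>e. 0) = invariant_coboundaries L ori i" by (simp add: cohomology_class_eq)
  moreover have "a \<in> cohomology_class L ori i a" using zero_coboundary unfolding cohomology_class_eq by force
  ultimately show ?thesis unfolding one using cohomology_class_cong[of a "\<lambda>e. 0" i] by auto
qed

end

text \<open>Each map gives a cochain cohomologous to one and the same Smith cochain, which involves
  no map. So the definite description has at most one candidate, and
  \<open>pl_general_position_exists\<close> supplies it.\<close>

lemma van_kampen_obstruction_trivial_iff:
  fixes L :: "'a::finite set set"
  assumes "oriented_complex L ori" and dim: "has_dimension L k" "k \<ge> 1" and r: "inj_on r L"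
  shows "van_kampen_obstruction k L ori = \<one>\<^bsub>invariant_cohomology L ori (2 * k)\<^esub> \<longleftrightarrow>
    (\<exists>c\<in>invariant_cochains L (2 * k - 1). coboundary L ori (2 * k - 1) c = oriented_complex.smith_cochain L ori r (2 * k))"
proof -
  interpret oriented_complex L ori by fact
  let ?A = "smith_cochain r (2 * k)"
  have H: "invariant_coboundaries L ori (2 * k) = coboundary L ori (2 * k - 1) ` invariant_cochains L (2 * k - 1)"
    using dim(2) by (simp add: invariant_coboundaries_def)
  have cls: "cohomology_class L ori (2 * k) (van_kampen_cochain k L ori T f) = cohomology_class L ori (2 * k) ?A"
    if pl: "pl_general_position (2 * k) L T f" for T f
  proof -
    interpret pl_map L ori T f k
      using pl dim by unfold_locales (auto simp: pl_general_position_def)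
    show ?thesis using van_kampen_cochain_cohomologous[OF r] unfolding H[symmetric]
      by (intro cohomology_class_cong) (auto simp: H)
  qed
  have "L \<noteq> {}" using dim(1) by (auto simp: has_dimension_def)
  then obtain T f where pl: "pl_general_position (2 * k) L T f" using pl_general_position_exists[OF cpx] by blast
  have "van_kampen_obstruction k L ori = cohomology_class L ori (2 * k) ?A"
    unfolding van_kampen_obstruction_def
  proof (rule the_equality)
    show "\<exists>T f. pl_general_position (2 * k) L T f \<and>
      cohomology_class L ori (2 * k) ?A = cohomology_class L ori (2 * k) (van_kampen_cochain k L ori T f)"
      using pl cls[OF pl, symmetric] by blast
  qed (elim exE conjE, simp only: cls)
  thus ?thesis by (simp only: cohomology_class_trivial_iff H image_iff Bex_def eq_commute[of ?A])
qed

text \<open>The binary encoding is injective on finite sets, as the halving needs, and it orders the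
  singletons as \<open>h\<close> orders the vertices, as the evaluation in degree two needs.\<close>

definition vertex_rank :: "('a \<Rightarrow> nat) \<Rightarrow> 'a set \<Rightarrow> nat" where
  "vertex_rank h \<sigma> = set_encode (h ` \<sigma>)"

lemma vertex_rank_inj:
  fixes h :: "'a::finite \<Rightarrow> nat"
  assumes "inj h"
  shows "inj_on (vertex_rank h) L"
proof (rule inj_onI)
  fix \<sigma> \<tau> assume "vertex_rank h \<sigma> = vertex_rank h \<tau>"
  hence "h ` \<sigma> = h ` \<tau>" by (simp add: vertex_rank_def set_encode_eq)
  thus "\<sigma> = \<tau>" using assms by (simp add: inj_image_eq_iff)
qed

lemma vertex_rank_singleton_less: "vertex_rank h {u} < vertex_rank h {v} \<longleftrightarrow> h u < h v"
  by (simp add: vertex_rank_def set_encode_def)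

text \<open>Places the three points before the vertices of \<open>K\<close>, in the order 1, 2, 3:
  the order assumed in \<open>smith_cochain_join\<close>.\<close>

definition join_order :: "3 + 'a::finite \<Rightarrow> nat" where
  "join_order = case_sum (\<lambda>i. if i = 1 then 0 else if i = 2 then 1 else 2) (\<lambda>a. 3 + to_nat a)"

lemma inj_join_order: "inj (join_order :: 3 + 'a::finite \<Rightarrow> nat)"
proof (rule injI)
  fix x y :: "3 + 'a"
  assume eq: "join_order x = join_order y"
  show "x = y"
  proof (cases x; cases y)
    fix i j assume "x = Inl i" "y = Inl j"
    thus ?thesis using eq exhaust_3[of i] exhaust_3[of j] by (auto simp: join_order_def)
  qed (use eq in \<open>auto simp: join_order_def split: if_splits\<close>)
qed

theorem theorem3:
  fixes K :: "'a::finite set set" and d :: nat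
    and oriK :: "'a set \<Rightarrow> 'a list" and oriJ :: "(3 + 'a) set \<Rightarrow> (3 + 'a) list"
  assumes "abstract_complex K" and "has_dimension K d" and "d \<ge> 1"
    and "orientation K oriK"
    and "orientation (simplicial_join three_points K) oriJ"
  shows "van_kampen_obstruction d K oriK \<noteq> \<one>\<^bsub>invariant_cohomology K oriK (2 * d)\<^esub> \<longleftrightarrow>
    van_kampen_obstruction (d + 1) (simplicial_join three_points K) oriJ
      \<noteq> \<one>\<^bsub>invariant_cohomology (simplicial_join three_points K) oriJ (2 * d + 2)\<^esub>"
proof -
  let ?J = "simplicial_join three_points K"
  interpret three_join K oriK oriJ
    using assms abstract_complex_join by unfold_locales auto
  define rK :: "'a set \<Rightarrow> nat" where "rK = vertex_rank to_nat"
  define rJ :: "(3 + 'a) set \<Rightarrow> nat" where "rJ = vertex_rank join_order"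
  have rK: "inj_on rK K" unfolding rK_def by (intro vertex_rank_inj) simp
  have rJ: "inj_on rJ ?J" unfolding rJ_def by (intro vertex_rank_inj inj_join_order)
  have "(\<exists>c\<in>invariant_cochains K (2 * d - 1). coboundary K oriK (2 * d - 1) c = K.smith_cochain rK (2 * d)) \<longleftrightarrow>
    (\<exists>c\<in>invariant_cochains ?J (2 * d + 1). coboundary ?J oriJ (2 * d + 1) c = J.smith_cochain rJ (2 * d + 2))"
    using assms(2,3) rK rJ
    by (rule smith_cochain_join_coboundary)
       (auto simp: rJ_def vertex_rank_singleton_less join_order_def)
  moreover have "van_kampen_obstruction d K oriK = \<one>\<^bsub>invariant_cohomology K oriK (2 * d)\<^esub> \<longleftrightarrow>
    (\<exists>c\<in>invariant_cochains K (2 * d - 1). coboundary K oriK (2 * d - 1) c = K.smith_cochain rK (2 * d))"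
    using K.oriented_complex_axioms assms(2,3) rK by (rule van_kampen_obstruction_trivial_iff)
  moreover have "van_kampen_obstruction (d + 1) ?J oriJ = \<one>\<^bsub>invariant_cohomology ?J oriJ (2 * (d + 1))\<^esub> \<longleftrightarrow>
    (\<exists>c\<in>invariant_cochains ?J (2 * (d + 1) - 1). coboundary ?J oriJ (2 * (d + 1) - 1) c = J.smith_cochain rJ (2 * (d + 1)))"
    using J.oriented_complex_axioms has_dimension_join[OF assms(1,2)] _ rJ
    by (rule van_kampen_obstruction_trivial_iff) simp
  moreover have "2 * (d + 1) = 2 * d + 2" "2 * (d + 1) - 1 = 2 * d + 1" by simp_all
  ultimately show ?thesis by (simp only:)
qed

end
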